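(* Let $\varphi_1,\varphi_2$ be linear fractional self-maps of the unit disc $\mathbb D$ without fixed point in $\mathbb D$, with $\varphi_1\neq\varphi_2$, and denote by $\alpha_1,\alpha_2\in\mathbb T$ their respective attractive fixed points. Then the composition operators $C_{\varphi_1}$ and $C_{\varphi_2}$ are disjointly frequently hypercyclic on $H^2(\mathbb D)$ if and only if both of the following hold: (a) each symbol $\varphi_i$ ($i=1,2$) is either a parabolic automorphism or a hyperbolic linear fractional map; (b) $\alpha_1\neq\alpha_2$, or $\alpha_1=\alpha_2=\alpha$ and (i) either $\varphi_1$ and $\varphi_2$ are hyperbolic with $\varphi_1'(\alpha)\neq\varphi_2'(\alpha)$; (ii) or $\varphi_1$ and $\varphi_2$ are parabolic; (iii) or $\varphi_1$ is parabolic and $\varphi_2$ is hyperbolic and is not an automorphism; (iv) or $\varphi_2$ is parabolic and $\varphi_1$ is hyperbolic and is not an automorphism.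
   Context: $\mathbb D$ is the open unit disc of $\mathbb C$, $\mathbb T$ the unit circle, $H^2(\mathbb D)$ the Hardy space, and $C_\varphi f=f\circ\varphi$. A linear fractional map of $\mathbb D$ is a (nonconstant) linear fractional transformation $\varphi$ with $\varphi(\mathbb D)\subset\mathbb D$; it is an automorphism if $\varphi(\mathbb D)=\mathbb D$. If $\varphi$ has no fixed point in $\mathbb D$, its attractive fixed point is the point $\alpha\in\mathbb T$ such that the iterates $\varphi^n$ converge to $\alpha$ uniformly on compact subsets of $\mathbb D$. Such a $\varphi$ is parabolic if $\alpha$ is its only fixed point in the Riemann sphere, and hyperbolic if it has a second (repulsive) fixed point, which then lies outside $\mathbb D$ (and lies on $\mathbb T$ if and only if $\varphi$ is an automorphism). Continuous linear operators $T_1,\dots,T_N$ on a separable infinite-dimensional $F$-space $X$ are disjointly frequently hypercyclic if there is a vector $x\in X$ such that, for any nonempty open set $U\subset X^N$, the set $\{n\in\mathbb N:\ (T_1^n x,\dots,T_N^n x)\in U\}$ has positive lower density. The lower density of $A\subset\mathbb N$ is $\liminf_{n\to\infty}\frac{1}{n}\#(A\cap[1,n])$. *)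

theory Defs
  imports "HOL-Analysis.Analysis"
begin

section \<open>The Hardy space of the unit disc\<close>

abbreviation unit_disc :: "complex set" where
  "unit_disc \<equiv> ball 0 1"

definition integral_mean :: "(complex \<Rightarrow> complex) \<Rightarrow> real \<Rightarrow> real" where
  "integral_mean f r =
     1 / (2 * pi) * integral {0..2 * pi} (\<lambda>t. (cmod (f (of_real r * cis t)))\<^sup>2)"

text \<open>A function on the disc is represented by its extension by zero to the whole plane, so
  that equality in \<open>hardy2\<close> is equality on the disc.\<close>

definition hardy2 :: "(complex \<Rightarrow> complex) set" where
  "hardy2 = {f. f holomorphic_on unit_disc \<and> (\<forall>z. z \<notin> unit_disc \<longrightarrow> f z = 0) \<and>
                bdd_above (integral_mean f ` {0..<1})}"

text \<open>The value outside \<open>hardy2\<close>, where the supremum may be infinite, is a dummy; it makes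
  the distance below nonnegative for all arguments, as \<open>Metric_space\<close> demands.\<close>

definition hardy2_norm :: "(complex \<Rightarrow> complex) \<Rightarrow> real" where
  "hardy2_norm f = (if f \<in> hardy2 then sqrt (SUP r\<in>{0..<1}. integral_mean f r) else 0)"

definition hardy2_dist :: "(complex \<Rightarrow> complex) \<Rightarrow> (complex \<Rightarrow> complex) \<Rightarrow> real" where
  "hardy2_dist f g = hardy2_norm (\<lambda>z. f z - g z)"

definition hardy2_topology :: "(complex \<Rightarrow> complex) topology" where
  "hardy2_topology = Metric_space.mtopology hardy2 hardy2_dist"

lemma integral_Cauchy_Schwarz:
  fixes u v :: "real \<Rightarrow> real"
  assumes u: "continuous_on {a..b} u" and v: "continuous_on {a..b} v"
  shows "(integral {a..b} (\<lambda>t. u t * v t))\<^sup>2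
         \<le> integral {a..b} (\<lambda>t. (u t)\<^sup>2) * integral {a..b} (\<lambda>t. (v t)\<^sup>2)"
proof -
  define A where "A = integral {a..b} (\<lambda>t. (u t)\<^sup>2)"
  define B where "B = integral {a..b} (\<lambda>t. (v t)\<^sup>2)"
  define C where "C = integral {a..b} (\<lambda>t. u t * v t)"
  have iu: "((\<lambda>t. (u t)\<^sup>2) has_integral A) {a..b}"
    unfolding A_def by (intro integrable_integral integrable_continuous_real continuous_intros u)
  have iv: "((\<lambda>t. (v t)\<^sup>2) has_integral B) {a..b}"
    unfolding B_def by (intro integrable_integral integrable_continuous_real continuous_intros v)
  have iuv: "((\<lambda>t. u t * v t) has_integral C) {a..b}"
    unfolding C_def by (intro integrable_integral integrable_continuous_real continuous_intros u v)
  have quad: "0 \<le> s\<^sup>2 * A - 2 * s * C + B" for s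
  proof -
    have "((\<lambda>t. s\<^sup>2 * (u t)\<^sup>2 - (2 * s) * (u t * v t) + (v t)\<^sup>2)
            has_integral (s\<^sup>2 * A - 2 * s * C + B)) {a..b}"
      by (intro has_integral_add has_integral_diff has_integral_mult_right iu iv iuv)
    moreover have "0 \<le> s\<^sup>2 * (u t)\<^sup>2 - (2 * s) * (u t * v t) + (v t)\<^sup>2" for t
    proof -
      have "s\<^sup>2 * (u t)\<^sup>2 - (2 * s) * (u t * v t) + (v t)\<^sup>2 = (s * u t - v t)\<^sup>2"
        by (simp add: power2_eq_square algebra_simps)
      then show ?thesis by simp
    qed
    ultimately show ?thesis
      by (meson has_integral_nonneg)
  qed
  have A0: "0 \<le> A"
    using iu by (rule has_integral_nonneg) auto
  have "C\<^sup>2 \<le> A * B"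
  proof (cases "A = 0")
    case True
    have "C = 0"
    proof (rule ccontr)
      assume "C \<noteq> 0"
      then show False
        using quad[of "(B + 1) / (2 * C)"] True by (simp add: field_simps)
    qed
    then show ?thesis using True by simp
  next
    case False
    then have "A > 0" using A0 by simp
    moreover have "0 \<le> (C / A)\<^sup>2 * A - 2 * (C / A) * C + B"
      by (rule quad)
    ultimately show ?thesis
      by (simp add: field_simps power2_eq_square)
  qed
  then show ?thesis by (simp add: A_def B_def C_def)
qed

lemma integral_Minkowski:
  fixes u v :: "real \<Rightarrow> real"
  assumes u: "continuous_on {a..b} u" and v: "continuous_on {a..b} v"
  shows "sqrt (integral {a..b} (\<lambda>t. (u t + v t)\<^sup>2))
         \<le> sqrt (integral {a..b} (\<lambda>t. (u t)\<^sup>2)) + sqrt (integral {a..b} (\<lambda>t. (v t)\<^sup>2))"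
proof -
  define A where "A = integral {a..b} (\<lambda>t. (u t)\<^sup>2)"
  define B where "B = integral {a..b} (\<lambda>t. (v t)\<^sup>2)"
  define C where "C = integral {a..b} (\<lambda>t. u t * v t)"
  have iu: "((\<lambda>t. (u t)\<^sup>2) has_integral A) {a..b}"
    unfolding A_def by (intro integrable_integral integrable_continuous_real continuous_intros u)
  have iv: "((\<lambda>t. (v t)\<^sup>2) has_integral B) {a..b}"
    unfolding B_def by (intro integrable_integral integrable_continuous_real continuous_intros v)
  have iuv: "((\<lambda>t. u t * v t) has_integral C) {a..b}"
    unfolding C_def by (intro integrable_integral integrable_continuous_real continuous_intros u v)
  have "((\<lambda>t. (u t)\<^sup>2 + 2 * (u t * v t) + (v t)\<^sup>2) has_integral (A + 2 * C + B)) {a..b}"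
    by (intro has_integral_add has_integral_mult_right iu iv iuv)
  then have "((\<lambda>t. (u t + v t)\<^sup>2) has_integral (A + 2 * C + B)) {a..b}"
    by (rule has_integral_eq[rotated]) (simp add: power2_sum)
  then have S: "integral {a..b} (\<lambda>t. (u t + v t)\<^sup>2) = A + 2 * C + B"
    by (rule integral_unique)
  have A0: "0 \<le> A" and B0: "0 \<le> B"
    using iu iv by (auto intro: has_integral_nonneg)
  have "C\<^sup>2 \<le> A * B"
    unfolding A_def B_def C_def by (rule integral_Cauchy_Schwarz[OF u v])
  then have "C \<le> sqrt A * sqrt B"
    by (metis real_le_rsqrt real_sqrt_mult)
  then have "A + 2 * C + B \<le> (sqrt A + sqrt B)\<^sup>2"
    using A0 B0 by (simp add: power2_sum)
  then show ?thesis
    unfolding S using A0 B0 by (simp add: A_def[symmetric] B_def[symmetric] real_le_lsqrt)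
qed

lemma continuous_on_circle:
  assumes "f holomorphic_on unit_disc" "0 \<le> r" "r < 1"
  shows "continuous_on {0..2 * pi} (\<lambda>t. cmod (f (of_real r * cis t)))"
proof -
  have "continuous_on {0..2 * pi} (\<lambda>t. f (of_real r * cis t))"
    by (rule continuous_on_compose2[OF holomorphic_on_imp_continuous_on[OF assms(1)]])
       (use assms in \<open>auto intro!: continuous_intros simp: norm_mult\<close>)
  then show ?thesis by (intro continuous_intros)
qed

lemma integral_mean_nonneg: "0 \<le> integral_mean f r"
proof -
  have "0 \<le> integral {0..2 * pi} (\<lambda>t. (cmod (f (of_real r * cis t)))\<^sup>2)"
    by (cases "(\<lambda>t. (cmod (f (of_real r * cis t)))\<^sup>2) integrable_on {0..2 * pi}")
       (auto intro: integral_nonneg simp: not_integrable_integral)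
  then show ?thesis by (simp add: integral_mean_def)
qed

lemma hardy2_norm_nonneg: "0 \<le> hardy2_norm f"
proof (cases "f \<in> hardy2")
  case True
  then have "integral_mean f 0 \<le> (SUP r\<in>{0..<1}. integral_mean f r)"
    by (intro cSUP_upper) (auto simp: hardy2_def)
  then show ?thesis
    using integral_mean_nonneg[of f 0] by (simp add: hardy2_norm_def)
qed (simp add: hardy2_norm_def)

lemma integral_mean_le_norm:
  assumes "f \<in> hardy2" "0 \<le> r" "r < 1"
  shows "sqrt (integral_mean f r) \<le> hardy2_norm f"
proof -
  have "integral_mean f r \<le> (SUP r\<in>{0..<1}. integral_mean f r)"
    using assms by (intro cSUP_upper) (auto simp: hardy2_def)
  then show ?thesis using assms by (simp add: hardy2_norm_def)
qed

lemma integral_mean_add: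
  assumes f: "f holomorphic_on unit_disc" and g: "g holomorphic_on unit_disc"
    and r: "0 \<le> r" "r < 1"
  shows "sqrt (integral_mean (\<lambda>z. f z + g z) r) \<le> sqrt (integral_mean f r) + sqrt (integral_mean g r)"
proof -
  let ?I = "integral {0..2 * pi}"
  let ?u = "\<lambda>t. cmod (f (of_real r * cis t))" and ?v = "\<lambda>t. cmod (g (of_real r * cis t))"
  have cu: "continuous_on {0..2 * pi} ?u" and cv: "continuous_on {0..2 * pi} ?v"
    using f g r by (simp_all add: continuous_on_circle)
  have "continuous_on {0..2 * pi} (\<lambda>t. cmod (f (of_real r * cis t) + g (of_real r * cis t)))"
    by (rule continuous_on_circle[where f = "\<lambda>z. f z + g z"]) (use f g r in \<open>auto intro: holomorphic_intros\<close>)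
  then have "?I (\<lambda>t. (cmod (f (of_real r * cis t) + g (of_real r * cis t)))\<^sup>2) \<le> ?I (\<lambda>t. (?u t + ?v t)\<^sup>2)"
    by (intro integral_le integrable_continuous_real continuous_on_power continuous_on_add cu cv)
       (auto intro!: power_mono norm_triangle_ineq)
  then have "sqrt (?I (\<lambda>t. (cmod (f (of_real r * cis t) + g (of_real r * cis t)))\<^sup>2))
             \<le> sqrt (?I (\<lambda>t. (?u t)\<^sup>2)) + sqrt (?I (\<lambda>t. (?v t)\<^sup>2))"
    using integral_Minkowski[OF cu cv] by (meson order_trans real_sqrt_le_mono)
  then have "sqrt (1 / (2 * pi)) * sqrt (?I (\<lambda>t. (cmod (f (of_real r * cis t) + g (of_real r * cis t)))\<^sup>2))
             \<le> sqrt (1 / (2 * pi)) * (sqrt (?I (\<lambda>t. (?u t)\<^sup>2)) + sqrt (?I (\<lambda>t. (?v t)\<^sup>2)))"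
    by (intro mult_left_mono) auto
  then show ?thesis
    by (simp only: integral_mean_def real_sqrt_mult distrib_left)
qed

lemma hardy2_add:
  assumes f: "f \<in> hardy2" and g: "g \<in> hardy2"
  shows "(\<lambda>z. f z + g z) \<in> hardy2"
    and "hardy2_norm (\<lambda>z. f z + g z) \<le> hardy2_norm f + hardy2_norm g"
proof -
  have hol: "f holomorphic_on unit_disc" "g holomorphic_on unit_disc"
    using f g by (auto simp: hardy2_def)
  have le: "integral_mean (\<lambda>z. f z + g z) r \<le> (hardy2_norm f + hardy2_norm g)\<^sup>2"
    if "0 \<le> r" "r < 1" for r
  proof -
    have "sqrt (integral_mean (\<lambda>z. f z + g z) r) \<le> hardy2_norm f + hardy2_norm g"
      using integral_mean_add[OF hol that] integral_mean_le_norm[OF f that]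
        integral_mean_le_norm[OF g that] by linarith
    then show ?thesis
      by (rule sqrt_le_D)
  qed
  show mem: "(\<lambda>z. f z + g z) \<in> hardy2"
    unfolding hardy2_def
  proof (intro CollectI conjI allI impI)
    show "(\<lambda>z. f z + g z) holomorphic_on unit_disc"
      by (intro holomorphic_intros hol)
    show "f z + g z = 0" if "z \<notin> unit_disc" for z
      using f g that by (simp add: hardy2_def)
    show "bdd_above (integral_mean (\<lambda>z. f z + g z) ` {0..<1})"
      using le by (auto intro!: bdd_aboveI2)
  qed
  have "(SUP r\<in>{0..<1}. integral_mean (\<lambda>z. f z + g z) r) \<le> (hardy2_norm f + hardy2_norm g)\<^sup>2"
    using le by (intro cSUP_least) auto
  then show "hardy2_norm (\<lambda>z. f z + g z) \<le> hardy2_norm f + hardy2_norm g"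
    using mem hardy2_norm_nonneg[of f] hardy2_norm_nonneg[of g]
    by (simp add: hardy2_norm_def[of "\<lambda>z. f z + g z"] real_le_lsqrt)
qed

lemma integral_mean_minus: "integral_mean (\<lambda>z. - f z) = integral_mean f"
  by (simp add: integral_mean_def fun_eq_iff)

lemma hardy2_minus_iff: "(\<lambda>z. - f z) \<in> hardy2 \<longleftrightarrow> f \<in> hardy2"
proof -
  have "(\<lambda>z. - g z) \<in> hardy2" if "g \<in> hardy2" for g
    using that by (auto simp: hardy2_def integral_mean_minus intro: holomorphic_intros)
  from this[of f] this[of "\<lambda>z. - f z"] show ?thesis by auto
qed

lemma hardy2_diff:
  assumes "f \<in> hardy2" "g \<in> hardy2"
  shows "(\<lambda>z. f z - g z) \<in> hardy2"
  using hardy2_add(1)[OF assms(1) iffD2[OF hardy2_minus_iff assms(2)]] by simp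

lemma hardy2_norm_eq_0:
  assumes f: "f \<in> hardy2" and 0: "hardy2_norm f = 0"
  shows "f z = 0"
proof (cases "z \<in> unit_disc")
  case False
  then show ?thesis using f by (simp add: hardy2_def)
next
  case True
  define r where "r = cmod z"
  have r: "0 \<le> r" "r < 1" using True by (auto simp: r_def)
  have hol: "f holomorphic_on unit_disc" using f by (simp add: hardy2_def)
  have "integral_mean f r = 0"
    using integral_mean_le_norm[OF f r] 0 integral_mean_nonneg[of f r] by simp
  then have I0: "integral {0..2 * pi} (\<lambda>t. (cmod (f (of_real r * cis t)))\<^sup>2) = 0"
    by (simp add: integral_mean_def)
  have "continuous_on {0..2 * pi} (\<lambda>t. (cmod (f (of_real r * cis t)))\<^sup>2)"
    by (intro continuous_intros continuous_on_circle hol r)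
  then have "\<forall>t\<in>{0..2 * pi}. (cmod (f (of_real r * cis t)))\<^sup>2 = 0"
    using I0 integral_eq_0_iff[of 0 "2 * pi" "\<lambda>t. (cmod (f (of_real r * cis t)))\<^sup>2"] by simp
  moreover have "Arg2pi z \<in> {0..2 * pi}"
    using Arg2pi[of z] by auto
  moreover have "z = of_real r * cis (Arg2pi z)"
    using Arg2pi_eq[of z] by (simp add: r_def cis_conv_exp)
  ultimately show ?thesis by (metis norm_eq_zero power_eq_0_iff)
qed

lemma hardy2_norm_0: "hardy2_norm (\<lambda>z. 0) = 0"
  by (simp add: hardy2_norm_def integral_mean_def)

lemma Metric_space_hardy2: "Metric_space hardy2 hardy2_dist"
proof
  show "0 \<le> hardy2_dist f g" for f g
    by (simp add: hardy2_dist_def hardy2_norm_nonneg)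
  show "hardy2_dist f g = hardy2_dist g f" for f g
    using hardy2_minus_iff[of "\<lambda>z. f z - g z"] integral_mean_minus[of "\<lambda>z. f z - g z"]
    by (simp add: hardy2_dist_def hardy2_norm_def)
  show "hardy2_dist f g = 0 \<longleftrightarrow> f = g" if "f \<in> hardy2" "g \<in> hardy2" for f g
    using hardy2_norm_eq_0[OF hardy2_diff[OF that]] by (auto simp: hardy2_dist_def hardy2_norm_0)
  show "hardy2_dist f h \<le> hardy2_dist f g + hardy2_dist g h"
    if "f \<in> hardy2" "g \<in> hardy2" "h \<in> hardy2" for f g h
    using hardy2_add(2)[OF hardy2_diff[OF that(1,2)] hardy2_diff[OF that(2,3)]]
    by (simp add: hardy2_dist_def)
qed

lemma topspace_hardy2: "topspace hardy2_topology = hardy2"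
  by (simp add: hardy2_topology_def Metric_space.topspace_mtopology[OF Metric_space_hardy2])


section \<open>Linear fractional maps of the disc\<close>

text \<open>The Riemann sphere is \<open>complex option\<close>, with \<open>None\<close> as the point at infinity.\<close>

definition moebius ::
  "complex \<Rightarrow> complex \<Rightarrow> complex \<Rightarrow> complex \<Rightarrow> complex option \<Rightarrow> complex option" where
  "moebius a b c d w =
     (case w of
        None \<Rightarrow> (if c = 0 then None else Some (a / c))
      | Some z \<Rightarrow> (if c * z + d = 0 then None else Some ((a * z + b) / (c * z + d))))"

definition linear_fractional :: "(complex option \<Rightarrow> complex option) \<Rightarrow> bool" where
  "linear_fractional \<phi> \<longleftrightarrow> (\<exists>a b c d. a * d - b * c \<noteq> 0 \<and> \<phi> = moebius a b c d)"

definition disc_lft :: "(complex option \<Rightarrow> complex option) \<Rightarrow> bool" where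
  "disc_lft \<phi> \<longleftrightarrow> linear_fractional \<phi> \<and> \<phi> ` (Some ` unit_disc) \<subseteq> Some ` unit_disc"

definition disc_automorphism :: "(complex option \<Rightarrow> complex option) \<Rightarrow> bool" where
  "disc_automorphism \<phi> \<longleftrightarrow> linear_fractional \<phi> \<and> \<phi> ` (Some ` unit_disc) = Some ` unit_disc"

text \<open>The map as a function of a complex variable; it is meaningless at the pole of \<open>\<phi>\<close>.\<close>

definition on_plane :: "(complex option \<Rightarrow> complex option) \<Rightarrow> complex \<Rightarrow> complex" where
  "on_plane \<phi> z = the (\<phi> (Some z))"

definition attractive_fixed_point :: "(complex option \<Rightarrow> complex option) \<Rightarrow> complex" where
  "attractive_fixed_point \<phi> =
     (THE \<alpha>. \<alpha> \<in> sphere 0 1 \<and>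
        (\<forall>K. compact K \<and> K \<subseteq> unit_disc \<longrightarrow>
           uniform_limit K (\<lambda>n. on_plane \<phi> ^^ n) (\<lambda>_. \<alpha>) sequentially))"

text \<open>The next two notions are meant for \<open>disc_lft\<close> maps without fixed point in the disc.\<close>

definition parabolic :: "(complex option \<Rightarrow> complex option) \<Rightarrow> bool" where
  "parabolic \<phi> \<longleftrightarrow> {w. \<phi> w = w} = {Some (attractive_fixed_point \<phi>)}"

definition hyperbolic :: "(complex option \<Rightarrow> complex option) \<Rightarrow> bool" where
  "hyperbolic \<phi> \<longleftrightarrow> \<phi> (Some (attractive_fixed_point \<phi>)) = Some (attractive_fixed_point \<phi>) \<and>
     (\<exists>w. w \<noteq> Some (attractive_fixed_point \<phi>) \<and> \<phi> w = w)"

definition composition_operator ::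
  "(complex option \<Rightarrow> complex option) \<Rightarrow> (complex \<Rightarrow> complex) \<Rightarrow> (complex \<Rightarrow> complex)" where
  "composition_operator \<phi> f = (\<lambda>z. if z \<in> unit_disc then f (on_plane \<phi> z) else 0)"


section \<open>Disjoint frequent hypercyclicity\<close>

definition lower_density :: "nat set \<Rightarrow> ereal" where
  "lower_density A = liminf (\<lambda>n. ereal (real (card (A \<inter> {1..n})) / real n))"

text \<open>The operators \<open>T\<^sub>1, \<dots>, T\<^sub>N\<close> on the space with topology \<open>X\<close> are given as a list, and
  \<open>X\<^sup>N\<close> is the product topology on functions with domain \<open>{..<N}\<close>.\<close>

definition disjointly_frequently_hypercyclic ::
  "'a topology \<Rightarrow> ('a \<Rightarrow> 'a) list \<Rightarrow> bool" where
  "disjointly_frequently_hypercyclic X Ts \<longleftrightarrow>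
     (\<exists>x\<in>topspace X. \<forall>U. openin (product_topology (\<lambda>_. X) {..<length Ts}) U \<and> U \<noteq> {} \<longrightarrow>
        lower_density {n. (\<lambda>i\<in>{..<length Ts}. ((Ts ! i) ^^ n) x) \<in> U} > 0)"

end

theory Submission
  imports Defs "HOL-Complex_Analysis.Complex_Analysis"
begin

text \<open>The Cayley transform \<open>half_plane \<alpha>\<close> turns a symbol with attractive fixed point \<open>\<alpha>\<close> into the map
  \<open>w \<mapsto> \<mu> w + b\<close> of the right half-plane, where \<open>\<mu> = 1\<close> in the parabolic case.

  Sufficiency: every target \<open>u\<close> in a dense set is transported backwards to functions \<open>y n\<close> with \<open>y n \<circ> g^n \<approx> u\<close>
  whose sums are small along all other times of the orbit of \<open>g\<close> and along the orbit of the other symbol. Summing such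
  functions over well separated sets of times of positive lower density gives the hypercyclic vector. With
  distinct attractive fixed points a factor vanishing at the other point makes the cross terms small. With a common one
  and maps of the same type, the times are taken from lacunary blocks, on which the two orbits run at
  different speeds and never meet. For a hyperbolic non-automorphism against a parabolic automorphism
  \<open>w \<mapsto> w + i a\<close>, the transported functions are multiplied by functions of \<open>exp (- 2 \<pi> w / (\<bar>a\<bar> D))\<close> that are close to 1 far
  to the right and small near the points \<open>i a m\<close>, for times \<open>m\<close> with \<open>m / D\<close> not close to \<open>1 / 2\<close> modulo 1.

  Necessity: the difference of the values of an \<open>H\<^sup>2\<close> function at two points of bounded hyperbolic distance tends to 0
  along the orbits in question, which excludes parabolic non-automorphisms and equal multipliers. For a parabolic and a
  hyperbolic automorphism one evaluates a small function \<open>f \<circ> g2^m\<close> at the preimages under \<open>g2^m\<close> of a parabolic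
  orbit. Weighted differences of these evaluations are almost orthogonal, so \<open>f\<close> cannot be close to a nonzero target at a
  positive proportion of the times of that orbit.\<close>

section \<open>Quadratic means on circles\<close>

text \<open>The obstacle of the mixed case: along the parabolic orbit at time m, a transported
  function of the hyperbolic map for time n is small when m is much smaller or much larger than
  \<mu>^n, but not when the two are comparable. Times of positive lower density contain an m
  comparable to \<mu>^n for every large n, so no choice of times avoids the collision, and for two
  automorphisms it is fatal. A hyperbolic non-automorphism moves every point to the right at least
  linearly in time, while a parabolic automorphism keeps the real part; a multiplier can tell the
  two orbits apart. In the variable q = exp (- k w) it has to be close to 1 at q = 0 and small near
  the roots of unity visited by the parabolic orbit. By the mean value property it cannot be small
  on the whole circle, so an arc around -1 is left free and the times landing there are discarded.
  This is repeated on infinitely many scales with geometrically shrinking arcs, which keeps the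
  lower density positive. The price is the order of choices: the arcs first, then the bounds of the
  multipliers, which depend on them, and only then the scales.\<close>

definition circle_norm :: "(complex \<Rightarrow> real) \<Rightarrow> real \<Rightarrow> real" where
  "circle_norm u r = sqrt (1 / (2 * pi) * integral {0..2 * pi} (\<lambda>t. (u (of_real r * cis t))\<^sup>2))"

text \<open>A bound for arbitrary real functions instead of a norm of holomorphic ones: the
  majorants used later are sums of moduli, constants and kernels, which need not be moduli of
  holomorphic functions. Continuity is included to make the circle integrals exist.\<close>

definition L2_bounded :: "(complex \<Rightarrow> real) \<Rightarrow> real \<Rightarrow> bool" where
  "L2_bounded u C \<longleftrightarrow> continuous_on unit_disc u \<and> (\<forall>r\<in>{0..<1}. circle_norm u r \<le> C)"

lemma continuous_on_circle_real:
  fixes u :: "complex \<Rightarrow> real"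
  assumes "continuous_on unit_disc u" "0 \<le> r" "r < 1"
  shows "continuous_on {0..2 * pi} (\<lambda>t. u (of_real r * cis t))"
  by (rule continuous_on_compose2[OF assms(1)])
     (use assms in \<open>auto intro!: continuous_intros simp: norm_mult\<close>)

lemma circle_norm_nonneg: "0 \<le> circle_norm u r"
proof -
  have "0 \<le> integral {0..2 * pi} (\<lambda>t. (u (of_real r * cis t))\<^sup>2)"
    by (cases "(\<lambda>t. (u (of_real r * cis t))\<^sup>2) integrable_on {0..2 * pi}")
       (auto intro: integral_nonneg simp: not_integrable_integral)
  then show ?thesis by (simp add: circle_norm_def)
qed

lemma circle_norm_mono:
  assumes u: "continuous_on unit_disc u" and v: "continuous_on unit_disc v"
    and r: "0 \<le> r" "r < 1" and le: "\<And>z. z \<in> unit_disc \<Longrightarrow> \<bar>u z\<bar> \<le> v z"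
  shows "circle_norm u r \<le> circle_norm v r"
proof -
  have "integral {0..2 * pi} (\<lambda>t. (u (of_real r * cis t))\<^sup>2)
        \<le> integral {0..2 * pi} (\<lambda>t. (v (of_real r * cis t))\<^sup>2)"
  proof (intro integral_le integrable_continuous_real continuous_on_power
      continuous_on_circle_real u v r)
    fix t
    have "of_real r * cis t \<in> unit_disc" using r by (simp add: norm_mult)
    from le[OF this] show "(u (of_real r * cis t))\<^sup>2 \<le> (v (of_real r * cis t))\<^sup>2"
      by (metis abs_ge_zero power2_abs power_mono)
  qed
  then show ?thesis by (simp add: circle_norm_def divide_right_mono)
qed

lemma circle_norm_add:
  assumes u: "continuous_on unit_disc u" and v: "continuous_on unit_disc v"
    and r: "0 \<le> r" "r < 1"
  shows "circle_norm (\<lambda>z. u z + v z) r \<le> circle_norm u r + circle_norm v r"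
proof -
  have "sqrt (1 / (2 * pi)) * sqrt (integral {0..2 * pi} (\<lambda>t. (u (of_real r * cis t) + v (of_real r * cis t))\<^sup>2))
     \<le> sqrt (1 / (2 * pi)) * (sqrt (integral {0..2 * pi} (\<lambda>t. (u (of_real r * cis t))\<^sup>2))
         + sqrt (integral {0..2 * pi} (\<lambda>t. (v (of_real r * cis t))\<^sup>2)))"
    by (intro mult_left_mono integral_Minkowski continuous_on_circle_real u v r) auto
  then show ?thesis
    by (simp only: circle_norm_def real_sqrt_mult distrib_left)
qed

lemma circle_norm_const: "circle_norm (\<lambda>_. c) r = \<bar>c\<bar>"
  by (simp add: circle_norm_def)

lemma circle_norm_cmult: "circle_norm (\<lambda>z. c * u z) r = \<bar>c\<bar> * circle_norm u r"
  by (simp add: circle_norm_def power_mult_distrib real_sqrt_mult real_sqrt_divide)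

lemma L2_bounded_nonneg: "L2_bounded u C \<Longrightarrow> 0 \<le> C"
  using circle_norm_nonneg[of u 0] unfolding L2_bounded_def
  by (metis atLeastLessThan_iff order.trans order_refl zero_less_one)

lemma L2_bounded_mono:
  assumes "L2_bounded v C" "continuous_on unit_disc u"
    and "\<And>z. z \<in> unit_disc \<Longrightarrow> \<bar>u z\<bar> \<le> v z" and "C \<le> C'"
  shows "L2_bounded u C'"
  using assms circle_norm_mono[of u v] unfolding L2_bounded_def
  by (meson atLeastLessThan_iff order.trans)

lemma L2_bounded_add:
  assumes "L2_bounded u C" "L2_bounded v D"
  shows "L2_bounded (\<lambda>z. u z + v z) (C + D)"
  unfolding L2_bounded_def
proof (intro conjI ballI)
  show "continuous_on unit_disc (\<lambda>z. u z + v z)"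
    using assms by (auto simp: L2_bounded_def intro: continuous_intros)
  fix r :: real assume r: "r \<in> {0..<1}"
  have "circle_norm u r \<le> C" "circle_norm v r \<le> D"
    using assms r by (auto simp: L2_bounded_def)
  then show "circle_norm (\<lambda>z. u z + v z) r \<le> C + D"
    using circle_norm_add[of u v r] assms r by (auto simp: L2_bounded_def intro: order.trans[OF _ add_mono])
qed

lemma L2_bounded_const: "0 \<le> c \<Longrightarrow> L2_bounded (\<lambda>_. c) c"
  by (simp add: L2_bounded_def circle_norm_const)

lemma L2_bounded_cmult:
  assumes "L2_bounded u C" "0 \<le> c"
  shows "L2_bounded (\<lambda>z. c * u z) (c * C)"
  using assms by (auto simp: L2_bounded_def circle_norm_cmult intro!: mult_left_mono continuous_intros)

lemma L2_bounded_sum: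
  assumes "finite I" "\<And>i. i \<in> I \<Longrightarrow> L2_bounded (u i) (C i)"
  shows "L2_bounded (\<lambda>z. \<Sum>i\<in>I. u i z) (\<Sum>i\<in>I. C i)"
  using assms
proof (induction I rule: finite_induct)
  case empty
  then show ?case using L2_bounded_const[of 0] by simp
next
  case (insert i I)
  then show ?case using L2_bounded_add[of "u i" "C i"] by simp
qed

text \<open>Each mean involves a single compact circle, on which the convergence is uniform, so the
  bound survives without any domination near the unit circle.\<close>

lemma L2_bounded_limit:
  assumes b: "\<And>n. L2_bounded (u n) C" and v: "continuous_on unit_disc v"
    and lim: "\<And>K. compact K \<Longrightarrow> K \<subseteq> unit_disc \<Longrightarrow> uniform_limit K u v sequentially"
  shows "L2_bounded v C"
  unfolding L2_bounded_def
proof (intro conjI ballI v)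
  fix r :: real assume r: "r \<in> {0..<1}"
  show "circle_norm v r \<le> C"
  proof (rule field_le_epsilon)
    fix e :: real assume e: "e > 0"
    have "uniform_limit (cball 0 r) u v sequentially"
      using r by (intro lim) auto
    then obtain n where n: "\<forall>z\<in>cball 0 r. dist (u n z) (v z) < e"
      using e by (metis (mono_tags, lifting) eventually_at_top_linorder order_refl uniform_limitD)
    have un: "continuous_on unit_disc (u n)" using b by (auto simp: L2_bounded_def)
    have "circle_norm v r \<le> circle_norm (\<lambda>z. \<bar>u n z\<bar> + e) r"
    proof -
      have "integral {0..2 * pi} (\<lambda>t. (v (of_real r * cis t))\<^sup>2)
            \<le> integral {0..2 * pi} (\<lambda>t. (\<bar>u n (of_real r * cis t)\<bar> + e)\<^sup>2)"
      proof (intro integral_le integrable_continuous_real continuous_intros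
          continuous_on_circle_real v un)
        fix t
        have "of_real r * cis t \<in> cball 0 r" using r by (simp add: norm_mult)
        then have "\<bar>v (of_real r * cis t)\<bar> \<le> \<bar>u n (of_real r * cis t)\<bar> + e"
          using n by (fastforce simp: dist_real_def)
        then show "(v (of_real r * cis t))\<^sup>2 \<le> (\<bar>u n (of_real r * cis t)\<bar> + e)\<^sup>2"
          by (metis abs_ge_zero power2_abs power_mono)
      qed (use r in auto)
      then show ?thesis by (simp add: circle_norm_def divide_right_mono)
    qed
    also have "\<dots> \<le> circle_norm (\<lambda>z. \<bar>u n z\<bar>) r + circle_norm (\<lambda>_. e) r"
      using r by (intro circle_norm_add continuous_intros un) auto
    also have "\<dots> = circle_norm (u n) r + e"
      using e by (simp add: circle_norm_const) (simp add: circle_norm_def)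
    also have "\<dots> \<le> C + e" using b r by (auto simp: L2_bounded_def)
    finally show "circle_norm v r \<le> C + e" .
  qed
qed

lemma circle_norm_cmod: "circle_norm (\<lambda>z. cmod (f z)) r = sqrt (integral_mean f r)"
  by (simp add: circle_norm_def integral_mean_def)

lemma circle_norm_cong:
  assumes "\<And>z. z \<in> unit_disc \<Longrightarrow> u z = v z" "0 \<le> r" "r < 1"
  shows "circle_norm u r = circle_norm v r"
proof -
  have "u (of_real r * cis t) = v (of_real r * cis t)" for t
    using assms by (intro assms) (auto simp: norm_mult)
  then show ?thesis by (simp add: circle_norm_def)
qed

lemma L2_bounded_hardy2:
  assumes "f \<in> hardy2" shows "L2_bounded (\<lambda>z. cmod (f z)) (hardy2_norm f)"
  using assms integral_mean_le_norm[OF assms] unfolding L2_bounded_def circle_norm_cmod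
  by (auto simp: hardy2_def intro!: continuous_intros holomorphic_on_imp_continuous_on)

lemma hardy2I:
  assumes hol: "f holomorphic_on unit_disc" and 0: "\<And>z. z \<notin> unit_disc \<Longrightarrow> f z = 0"
    and b: "L2_bounded (\<lambda>z. cmod (f z)) C"
  shows "f \<in> hardy2" "hardy2_norm f \<le> C"
proof -
  have C: "0 \<le> C" using b by (rule L2_bounded_nonneg)
  have le: "integral_mean f r \<le> C\<^sup>2" if "r \<in> {0..<1}" for r
    using b that unfolding L2_bounded_def circle_norm_cmod by (auto intro: sqrt_le_D)
  show mem: "f \<in> hardy2"
    using hol 0 le by (auto simp: hardy2_def intro!: bdd_aboveI2[where M = "C\<^sup>2"])
  have "(SUP r\<in>{0..<1}. integral_mean f r) \<le> C\<^sup>2"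
    using le by (intro cSUP_least) auto
  then show "hardy2_norm f \<le> C" using mem C by (simp add: hardy2_norm_def real_le_lsqrt)
qed

section \<open>Fourier orthogonality and Parseval's identity\<close>

lemma integral_cis_int:
  fixes k :: int
  shows "((\<lambda>t. cis (of_int k * t)) has_integral (if k = 0 then of_real (2 * pi) else 0)) {0..2 * pi}"
proof (cases "k = 0")
  case True
  then show ?thesis
    using has_integral_const_real[of "1::complex" 0 "2 * pi"] by (simp add: scaleR_conv_of_real)
next
  case False
  define F where "F t = cis (of_int k * t) / (\<i> * of_int k)" for t :: real
  have "((\<lambda>t. cis (of_int k * t)) has_integral (F (2 * pi) - F 0)) {0..2 * pi}"
  proof (rule fundamental_theorem_of_calculus)
    fix t assume "t \<in> {0..2*pi}"
    have "((\<lambda>t. exp (\<i> * of_int k * of_real t) / (\<i> * of_int k)) has_vector_derivative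
        exp (\<i> * of_int k * of_real t)) (at t within {0..2 * pi})"
      by (rule has_vector_derivative_real_field) (use False in \<open>auto intro!: derivative_eq_intros\<close>)
    then show "(F has_vector_derivative cis (of_int k * t)) (at t within {0..2 * pi})"
      by (simp add: F_def[abs_def] cis_conv_exp mult.assoc)
  qed simp
  moreover have "cis (of_int k * (2 * pi)) = 1"
    by (metis cis_multiple_2pi mult.commute Ints_of_int)
  ultimately show ?thesis using False by (simp add: F_def)
qed

lemma integral_trig_poly:
  fixes a :: "nat \<Rightarrow> complex"
  shows "((\<lambda>t. (cmod (\<Sum>n<N. a n * cis (real n * t)))\<^sup>2) has_integral (2 * pi * (\<Sum>n<N. (cmod (a n))\<^sup>2))) {0..2 * pi}"
proof -
  have "((\<lambda>t. \<Sum>n<N. \<Sum>m<N. a n * cnj (a m) * cis (of_int (int n - int m) * t)) has_integral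
      (\<Sum>n<N. \<Sum>m<N. a n * cnj (a m) * (if int n - int m = 0 then of_real (2 * pi) else 0))) {0..2 * pi}"
    by (intro has_integral_sum has_integral_mult_right integral_cis_int) auto
  also have "(\<lambda>t. \<Sum>n<N. \<Sum>m<N. a n * cnj (a m) * cis (of_int (int n - int m) * t)) =
     (\<lambda>t. of_real ((cmod (\<Sum>n<N. a n * cis (real n * t)))\<^sup>2))"
  proof
    fix t
    have "cis (of_int (int n - int m) * t) = cis (real n * t) * cnj (cis (real m * t))" for n m
      by (simp add: cis_cnj cis_mult algebra_simps)
    then show "(\<Sum>n<N. \<Sum>m<N. a n * cnj (a m) * cis (of_int (int n - int m) * t)) =
       of_real ((cmod (\<Sum>n<N. a n * cis (real n * t)))\<^sup>2)"
      unfolding complex_norm_square by (simp add: sum_product cnj_sum mult_ac)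
  qed
  also have "(\<Sum>n<N. \<Sum>m<N. a n * cnj (a m) * (if int n - int m = 0 then of_real (2 * pi) else 0))
     = of_real (2 * pi * (\<Sum>n<N. (cmod (a n))\<^sup>2))"
  proof -
    have "(\<Sum>m<N. a n * cnj (a m) * (if int n - int m = 0 then of_real (2 * pi) else 0)) = of_real (2 * pi * (cmod (a n))\<^sup>2)"
      if "n < N" for n
    proof -
      have "(\<Sum>m<N. a n * cnj (a m) * (if int n - int m = 0 then of_real (2 * pi) else 0))
         = (\<Sum>m<N. if m = n then a n * cnj (a n) * of_real (2 * pi) else 0)"
        by (rule sum.cong) auto
      also have "\<dots> = a n * cnj (a n) * of_real (2 * pi)" using that by simp
      finally show ?thesis by (simp only: of_real_mult complex_norm_square mult_ac)
    qed
    then show ?thesis by (simp add: sum_distrib_left)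
  qed
  finally have "((\<lambda>t. of_real ((cmod (\<Sum>n<N. a n * cis (real n * t)))\<^sup>2)) has_integral
     complex_of_real (2 * pi * (\<Sum>n<N. (cmod (a n))\<^sup>2))) {0..2 * pi}" .
  from has_integral_linear[OF this bounded_linear_Re] show ?thesis by (simp add: o_def)
qed

lemma power_series_cis:
  "a n * (of_real r * cis t) ^ n = (a n * of_real r ^ n) * cis (real n * t)"
  by (simp add: power_mult_distrib Complex.DeMoivre mult_ac)

text \<open>The series converges absolutely on the circle of radius \<open>r\<close> because it
  converges at the larger radius \<open>s\<close>; the resulting constant \<open>M\<close> dominates
  all partial sums, which are trigonometric polynomials, and dominated convergence gives the
  identity.\<close>

lemma Parseval:
  assumes F: "\<And>z. z \<in> unit_disc \<Longrightarrow> (\<lambda>n. a n * z ^ n) sums F z" and r: "0 \<le> r" "r < 1"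
  shows "(\<lambda>n. (cmod (a n) * r ^ n)\<^sup>2) sums integral_mean F r"
proof -
  define s where "s = (1 + r) / 2"
  have s: "r < s" "s < 1" "0 < s" using r by (auto simp: s_def)
  have "summable (\<lambda>n. a n * of_real s ^ n)"
    using F[of "of_real s"] s by (auto simp: sums_iff)
  then have abs: "summable (\<lambda>n. cmod (a n * of_real r ^ n))"
    by (rule powser_insidea) (use s r in auto)
  define M where "M = (\<Sum>n. cmod (a n * of_real r ^ n))"
  define S where "S N t = (\<Sum>n<N. (a n * of_real r ^ n) * cis (real n * t))" for N t
  have S: "(\<lambda>N. S N t) \<longlonglongrightarrow> F (of_real r * cis t)" for t
    using F[of "of_real r * cis t"] r unfolding sums_def S_def power_series_cis
    by (simp add: norm_mult)
  have bound: "cmod (S N t) \<le> M" for N t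
  proof -
    have "cmod (S N t) \<le> (\<Sum>n<N. cmod (a n * of_real r ^ n))"
      unfolding S_def by (rule sum_norm_le) (simp add: norm_mult)
    also have "\<dots> \<le> M" unfolding M_def by (rule sum_le_suminf[OF abs]) auto
    finally show ?thesis .
  qed
  have "(\<lambda>N. integral {0..2 * pi} (\<lambda>t. (cmod (S N t))\<^sup>2)) \<longlonglongrightarrow>
     integral {0..2 * pi} (\<lambda>t. (cmod (F (of_real r * cis t)))\<^sup>2)"
  proof (rule dominated_convergence(2))
    show "(\<lambda>t. (cmod (S N t))\<^sup>2) integrable_on {0..2 * pi}" for N
      unfolding S_def using integral_trig_poly by (rule has_integral_integrable)
    show "(\<lambda>_. M\<^sup>2) integrable_on {0..2 * pi}" by (rule integrable_const_ivl)
    show "norm ((cmod (S N t))\<^sup>2) \<le> M\<^sup>2" for N t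
      using bound[of N t] by (simp add: power_mono)
    show "(\<lambda>N. (cmod (S N t))\<^sup>2) \<longlonglongrightarrow> (cmod (F (of_real r * cis t)))\<^sup>2" for t
      by (intro tendsto_intros S)
  qed
  moreover have "integral {0..2 * pi} (\<lambda>t. (cmod (S N t))\<^sup>2) = 2 * pi * (\<Sum>n<N. (cmod (a n) * r ^ n)\<^sup>2)" for N
    unfolding S_def using integral_unique[OF integral_trig_poly, of "\<lambda>n. a n * of_real r ^ n" N] r
    by (simp add: norm_mult norm_power)
  ultimately have "(\<lambda>N. 1 / (2 * pi) * (2 * pi * (\<Sum>n<N. (cmod (a n) * r ^ n)\<^sup>2))) \<longlonglongrightarrow> integral_mean F r"
    unfolding integral_mean_def by (intro tendsto_mult_left) simp
  then show ?thesis by (simp add: sums_def)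
qed

lemma holomorphic_disc_power_series:
  assumes "F holomorphic_on unit_disc"
  shows "\<exists>a. \<forall>z\<in>unit_disc. (\<lambda>n. a n * z ^ n) sums F z"
  using holomorphic_power_series[of F 0 1] assms
  by (intro exI[of _ "\<lambda>n. (deriv ^^ n) F 0 / fact n"]) simp

text \<open>For finitely many coefficients the limit \<open>r\<close> to 1 can be taken in
  Parseval's identity.\<close>

lemma L2_bounded_coeffs:
  assumes F: "\<And>z. z \<in> unit_disc \<Longrightarrow> (\<lambda>n. a n * z ^ n) sums F z" and b: "L2_bounded (\<lambda>z. cmod (F z)) C"
  shows "(\<Sum>n<N. (cmod (a n))\<^sup>2) \<le> C\<^sup>2"
proof -
  have C: "0 \<le> C" using b by (rule L2_bounded_nonneg)
  have le: "(\<Sum>n<N. (cmod (a n) * r ^ n)\<^sup>2) \<le> C\<^sup>2" if r: "0 < r" "r < 1" for r :: real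
  proof -
    have "(\<Sum>n<N. (cmod (a n) * r ^ n)\<^sup>2) \<le> integral_mean F r"
      using sum_le_suminf[of "\<lambda>n. (cmod (a n) * r ^ n)\<^sup>2" "{..<N}"] Parseval[OF F, of r] r
      by (auto simp: sums_iff)
    also have "sqrt \<dots> \<le> C"
      using b r unfolding L2_bounded_def circle_norm_cmod by auto
    then have "integral_mean F r \<le> C\<^sup>2" by (rule sqrt_le_D)
    finally show ?thesis .
  qed
  have "((\<lambda>r. \<Sum>n<N. (cmod (a n) * r ^ n)\<^sup>2) \<longlongrightarrow> (\<Sum>n<N. (cmod (a n) * 1 ^ n)\<^sup>2)) (at_left (1::real))"
    by (intro tendsto_intros)
  moreover have "eventually (\<lambda>r. (\<Sum>n<N. (cmod (a n) * r ^ n)\<^sup>2) \<le> C\<^sup>2) (at_left (1::real))"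
    using eventually_at_left_real[of 0 1] by (rule eventually_mono) (auto intro: le)
  ultimately show ?thesis
    using tendsto_upperbound[of _ _ "at_left (1::real)"] by fastforce
qed

lemma coeffs_L2_bounded:
  assumes F: "\<And>z. z \<in> unit_disc \<Longrightarrow> (\<lambda>n. a n * z ^ n) sums F z" and hol: "F holomorphic_on unit_disc"
    and C: "0 \<le> C" and le: "\<And>N. (\<Sum>n<N. (cmod (a n))\<^sup>2) \<le> C\<^sup>2"
  shows "L2_bounded (\<lambda>z. cmod (F z)) C"
  unfolding L2_bounded_def circle_norm_cmod
proof (intro conjI ballI)
  show "continuous_on unit_disc (\<lambda>z. cmod (F z))"
    by (intro continuous_intros holomorphic_on_imp_continuous_on hol)
  fix r :: real assume "r \<in> {0..<1}"
  then have r: "0 \<le> r" "r < 1" by auto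
  have "(\<Sum>n<N. (cmod (a n) * r ^ n)\<^sup>2) \<le> C\<^sup>2" for N
  proof -
    have "(\<Sum>n<N. (cmod (a n) * r ^ n)\<^sup>2) \<le> (\<Sum>n<N. (cmod (a n))\<^sup>2)"
      using r by (intro sum_mono power_mono mult_right_le_one_le) (auto simp: power_le_one)
    with le[of N] show ?thesis by simp
  qed
  moreover have "(\<lambda>N. \<Sum>n<N. (cmod (a n) * r ^ n)\<^sup>2) \<longlonglongrightarrow> integral_mean F r"
    using Parseval[OF F r] by (simp add: sums_def)
  ultimately have "integral_mean F r \<le> C\<^sup>2" by (meson LIMSEQ_le_const2)
  then show "sqrt (integral_mean F r) \<le> C" using C by (simp add: real_le_lsqrt)
qed

text \<open>The coefficients \<open>q ^ n\<close> have square sum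
  \<open>1 / (1 - (cmod q)\<^sup>2)\<close>. These are the reproducing kernels of the Hardy space,
  and nearly every norm estimate below is reduced to them.\<close>

lemma L2_bounded_geometric:
  assumes q: "cmod q < 1"
  shows "L2_bounded (\<lambda>z. cmod (1 / (1 - q * z))) (1 / sqrt (1 - (cmod q)\<^sup>2))"
proof (rule coeffs_L2_bounded)
  have ne: "q * z \<noteq> 1" and lt: "cmod (q * z) < 1" if "z \<in> unit_disc" for z
  proof -
    have "cmod q * cmod z < 1" using that q
      by (metis dist_0_norm mem_ball mult.commute mult_1 norm_ge_zero mult_strict_mono' )
    then show "q * z \<noteq> 1" "cmod (q * z) < 1" by (auto simp flip: norm_mult)
  qed
  show "(\<lambda>n. q ^ n * z ^ n) sums (1 / (1 - q * z))" if "z \<in> unit_disc" for z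
    using geometric_sums[OF lt[OF that]] by (simp add: power_mult_distrib)
  show "(\<lambda>z. 1 / (1 - q * z)) holomorphic_on unit_disc"
    using ne by (intro holomorphic_intros) auto
  have q2: "(cmod q)\<^sup>2 < 1" using q by (simp add: power_less_one_iff abs_square_less_1)
  then show "0 \<le> 1 / sqrt (1 - (cmod q)\<^sup>2)" by simp
  show "(\<Sum>n<N. (cmod (q ^ n))\<^sup>2) \<le> (1 / sqrt (1 - (cmod q)\<^sup>2))\<^sup>2" for N
  proof -
    have "(\<lambda>n. ((cmod q)\<^sup>2) ^ n) sums (1 / (1 - (cmod q)\<^sup>2))"
      using q2 by (intro geometric_sums) auto
    then have "(\<Sum>n<N. ((cmod q)\<^sup>2) ^ n) \<le> 1 / (1 - (cmod q)\<^sup>2)"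
      using sum_le_suminf[of "\<lambda>n. ((cmod q)\<^sup>2) ^ n" "{..<N}"] by (auto simp: sums_iff)
    then show ?thesis using q2
      by (simp add: norm_power power_divide flip: power_mult) (simp add: mult.commute power_mult)
  qed
qed

text \<open>Duality in coordinates: the functional \<open>L n\<close> is given by the sequence
  \<open>e n\<close>, \<open>G\<close> is the Gram matrix of these sequences, and Cauchy-Schwarz
  bounds a combination of functionals by the Gram form. It is applied to one point evaluation, to
  the difference of two, and to a long stretch of a parabolic orbit.\<close>

lemma functional_bound:
  fixes e :: "'i \<Rightarrow> nat \<Rightarrow> complex"
  assumes F: "\<And>z. z \<in> unit_disc \<Longrightarrow> (\<lambda>n. a n * z ^ n) sums F z" and b: "L2_bounded (\<lambda>z. cmod (F z)) C"
    and B: "finite B" and G: "\<And>n m. n \<in> B \<Longrightarrow> m \<in> B \<Longrightarrow> (\<lambda>i. e n i * cnj (e m i)) sums G n m"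
    and L: "\<And>n. n \<in> B \<Longrightarrow> (\<lambda>i. a i * e n i) sums L n"
  shows "(cmod (\<Sum>n\<in>B. c n * L n))\<^sup>2 \<le> C\<^sup>2 * cmod (\<Sum>n\<in>B. \<Sum>m\<in>B. c n * cnj (c m) * G n m)"
proof -
  define E where "E i = (\<Sum>n\<in>B. c n * e n i)" for i
  let ?G = "\<Sum>n\<in>B. \<Sum>m\<in>B. c n * cnj (c m) * G n m"
  have "(\<lambda>i. \<Sum>n\<in>B. \<Sum>m\<in>B. c n * cnj (c m) * (e n i * cnj (e m i))) sums ?G"
    by (intro sums_sum sums_mult G)
  also have "(\<lambda>i. \<Sum>n\<in>B. \<Sum>m\<in>B. c n * cnj (c m) * (e n i * cnj (e m i))) = (\<lambda>i. of_real ((cmod (E i))\<^sup>2))"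
    unfolding complex_norm_square E_def by (simp add: sum_product cnj_sum mult_ac)
  finally have "(\<lambda>i. Re (of_real ((cmod (E i))\<^sup>2))) sums Re ?G" by (rule sums_Re)
  then have Es: "(\<lambda>i. (cmod (E i))\<^sup>2) sums Re ?G" by simp
  have EN: "(\<Sum>i<N. (cmod (E i))\<^sup>2) \<le> cmod ?G" for N
    using sum_le_suminf[of "\<lambda>i. (cmod (E i))\<^sup>2" "{..<N}"] Es complex_Re_le_cmod[of ?G] by (auto simp: sums_iff)
  have "(\<lambda>i. \<Sum>n\<in>B. c n * (a i * e n i)) sums (\<Sum>n\<in>B. c n * L n)"
    by (intro sums_sum sums_mult L)
  moreover have "(\<lambda>i. \<Sum>n\<in>B. c n * (a i * e n i)) = (\<lambda>i. a i * E i)"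
    by (simp add: E_def sum_distrib_left mult_ac)
  ultimately have "(\<lambda>N. \<Sum>i<N. a i * E i) \<longlonglongrightarrow> (\<Sum>n\<in>B. c n * L n)"
    by (simp add: sums_def)
  then have lim: "(\<lambda>N. (cmod (\<Sum>i<N. a i * E i))\<^sup>2) \<longlonglongrightarrow> (cmod (\<Sum>n\<in>B. c n * L n))\<^sup>2"
    by (intro tendsto_intros)
  have "(cmod (\<Sum>i<N. a i * E i))\<^sup>2 \<le> C\<^sup>2 * cmod ?G" for N
  proof -
    have "cmod (\<Sum>i<N. a i * E i) \<le> (\<Sum>i<N. cmod (a i) * cmod (E i))"
      by (rule sum_norm_le) (simp add: norm_mult)
    then have "(cmod (\<Sum>i<N. a i * E i))\<^sup>2 \<le> (\<Sum>i<N. cmod (a i) * cmod (E i))\<^sup>2"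
      by (intro power_mono) auto
    also have "\<dots> \<le> (\<Sum>i<N. (cmod (a i))\<^sup>2) * (\<Sum>i<N. (cmod (E i))\<^sup>2)"
      by (rule Cauchy_Schwarz_ineq_sum)
    also have "\<dots> \<le> C\<^sup>2 * cmod ?G"
      using L2_bounded_coeffs[OF F b] EN by (intro mult_mono) (auto intro: sum_nonneg)
    finally show ?thesis .
  qed
  then show ?thesis using lim by (meson LIMSEQ_le_const2)
qed

section \<open>Reproducing kernels and the right half-plane\<close>

lemma norm_square_less_one: "z \<in> unit_disc \<Longrightarrow> (cmod z)\<^sup>2 < 1"
  by (simp add: abs_square_less_1)

lemma mult_norm_less_one:
  assumes "z \<in> unit_disc" "w \<in> unit_disc" shows "cmod (z * cnj w) < 1"
  using mult_strict_mono'[of "cmod z" 1 "cmod w" 1] assms by (simp add: norm_mult)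

lemma geometric_kernel:
  assumes "z \<in> unit_disc" "w \<in> unit_disc"
  shows "(\<lambda>i. z ^ i * cnj (w ^ i)) sums (1 / (1 - z * cnj w))"
  using geometric_sums[OF mult_norm_less_one[OF assms]] by (simp add: power_mult_distrib)

lemma point_evaluation_bound:
  assumes hol: "F holomorphic_on unit_disc" and b: "L2_bounded (\<lambda>z. cmod (F z)) C" and z: "z \<in> unit_disc"
  shows "cmod (F z) \<le> C / sqrt (1 - (cmod z)\<^sup>2)"
proof -
  obtain a where a: "\<And>z. z \<in> unit_disc \<Longrightarrow> (\<lambda>n. a n * z ^ n) sums F z"
    using holomorphic_disc_power_series[OF hol] by blast
  have C: "0 \<le> C" using b by (rule L2_bounded_nonneg)
  \<comment> \<open>A single functional: the index set is \<open>{()}\<close> and the Gram matrix is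
    one number, the reproducing kernel on the diagonal.\<close>
  have "(cmod (\<Sum>n\<in>{()}. 1 * F z))\<^sup>2 \<le> C\<^sup>2 * cmod (\<Sum>n\<in>{()}. \<Sum>m\<in>{()}. 1 * cnj 1 * (1 / (1 - z * cnj z)))"
    by (rule functional_bound[OF a b, where e = "\<lambda>_ i. z ^ i"]) (use geometric_kernel[OF z z] a[OF z] in auto)
  then have "(cmod (F z))\<^sup>2 \<le> C\<^sup>2 * cmod (1 / (1 - z * cnj z))" by simp
  also have eq: "1 / (1 - z * cnj z) = of_real (1 / (1 - (cmod z)\<^sup>2))"
    unfolding complex_norm_square[symmetric] by simp
  finally have "(cmod (F z))\<^sup>2 \<le> C\<^sup>2 * (1 / (1 - (cmod z)\<^sup>2))"
    unfolding norm_of_real using norm_square_less_one[OF z] by (simp add: abs_of_pos)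
  then have "(cmod (F z))\<^sup>2 \<le> (C / sqrt (1 - (cmod z)\<^sup>2))\<^sup>2"
    using norm_square_less_one[OF z] by (simp add: power_divide)
  then show ?thesis
  proof (rule power2_le_imp_le)
    show "0 \<le> C / sqrt (1 - (cmod z)\<^sup>2)" using C norm_square_less_one[OF z] by simp
  qed
qed

text \<open>The last factor is the squared pseudohyperbolic distance of the two points; it has to
  compete with the size of the kernels, the factor before it.\<close>

lemma point_difference_bound:
  assumes hol: "F holomorphic_on unit_disc" and b: "L2_bounded (\<lambda>z. cmod (F z)) C"
    and z: "z \<in> unit_disc" and w: "w \<in> unit_disc"
  shows "(cmod (F z - F w))\<^sup>2 \<le> C\<^sup>2 * ((1 / (1 - (cmod z)\<^sup>2) + 1 / (1 - (cmod w)\<^sup>2)) *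
           ((cmod (z - w))\<^sup>2 / (cmod (1 - z * cnj w))\<^sup>2))"
proof -
  obtain a where a: "\<And>z. z \<in> unit_disc \<Longrightarrow> (\<lambda>n. a n * z ^ n) sums F z"
    using holomorphic_disc_power_series[OF hol] by blast
  define G where "G = 1 / (1 - z * cnj z) - 1 / (1 - z * cnj w) - (1 / (1 - w * cnj z) - 1 / (1 - w * cnj w))"
  define A B x where "A = (cmod z)\<^sup>2" and "B = (cmod w)\<^sup>2" and "x = 1 - z * cnj w"
  define P d Q where "P = (1 - A) * (1 - B)" and "d = (cmod (z - w))\<^sup>2" and "Q = (cmod x)\<^sup>2"
  have AB: "A < 1" "B < 1" using z w norm_square_less_one by (auto simp: A_def B_def)
  have x0: "x \<noteq> 0" using mult_norm_less_one[OF z w] by (auto simp: x_def)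
  have P: "P > 0" and Q: "Q > 0" and d: "d \<ge> 0" using AB x0 by (auto simp: P_def Q_def d_def)
  \<comment> \<open>The identity behind the pseudohyperbolic metric. It collapses the four terms of
    \<open>G\<close> to one quotient with the factor \<open>d\<close>.\<close>
  have QP: "Q = P + d"
    unfolding Q_def x_def P_def d_def A_def B_def cmod_power2 by (simp add: power2_eq_square algebra_simps)
  have rex: "2 * Re x = 2 - A - B + d"
    unfolding x_def d_def A_def B_def cmod_power2 by (simp add: power2_eq_square algebra_simps)
  have "(\<lambda>i. (z ^ i - w ^ i) * cnj (z ^ i - w ^ i)) sums G"
    unfolding G_def using sums_diff[OF sums_diff[OF geometric_kernel[OF z z] geometric_kernel[OF z w]]
        sums_diff[OF geometric_kernel[OF w z] geometric_kernel[OF w w]]]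
    by (simp add: algebra_simps)
  then have "(cmod (\<Sum>n\<in>{()}. 1 * (F z - F w)))\<^sup>2 \<le> C\<^sup>2 * cmod (\<Sum>n\<in>{()}. \<Sum>m\<in>{()}. 1 * cnj 1 * G)"
    by (intro functional_bound[OF a b, where e = "\<lambda>_ i. z ^ i - w ^ i"])
       (use sums_diff[OF a[OF z] a[OF w]] in \<open>auto simp: algebra_simps\<close>)
  then have main: "(cmod (F z - F w))\<^sup>2 \<le> C\<^sup>2 * cmod G" by simp
  have "G = of_real (1 / (1 - A)) + of_real (1 / (1 - B)) - (1 / x + cnj (1 / x))"
    unfolding G_def A_def B_def x_def complex_norm_square[symmetric] by (simp add: mult.commute)
  also have "1 / x + cnj (1 / x) = of_real (2 * Re x / Q)"
    unfolding complex_add_cnj Q_def by (simp add: Re_divide cmod_power2)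
  finally have G: "G = of_real (1 / (1 - A) + 1 / (1 - B) - (2 - A - B + d) / Q)"
    by (simp add: rex)
  have eq: "1 / (1 - A) + 1 / (1 - B) = (2 - A - B) / P"
    using AB by (simp add: P_def field_simps)
  have "(2 - A - B) / P - (2 - A - B + d) / Q = ((2 - A - B) * Q - (2 - A - B + d) * P) / (P * Q)"
    using P Q by (subst diff_frac_eq) auto
  also have "(2 - A - B) * Q - (2 - A - B + d) * P = d * (2 - A - B - P)"
    unfolding QP by (simp add: algebra_simps)
  also have "2 - A - B - P = 1 - A * B" by (simp add: P_def algebra_simps)
  finally have G2: "G = of_real (d * (1 - A * B) / (P * Q))" by (simp add: G eq)
  have ABs: "A * B \<le> 1" using AB by (metis A_def B_def less_eq_real_def mult_left_le_one_le order.trans zero_le_power2)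
  have "cmod G = d * (1 - A * B) / (P * Q)"
    unfolding G2 norm_of_real using d ABs P Q by simp
  also have "\<dots> \<le> d * (2 - A - B) / (P * Q)"
    using P Q d \<open>2 - A - B - P = 1 - A * B\<close> by (intro divide_right_mono mult_left_mono) auto
  also have "\<dots> = (1 / (1 - A) + 1 / (1 - B)) * (d / Q)" by (simp add: eq)
  finally have "cmod G \<le> (1 / (1 - A) + 1 / (1 - B)) * (d / Q)" .
  then show ?thesis
    using order.trans[OF main mult_left_mono[OF _ zero_le_power2]] by (auto simp only: A_def B_def d_def Q_def x_def)
qed

section \<open>The Cayley transform and kernels in the half-plane\<close>

definition half_plane :: "complex \<Rightarrow> complex \<Rightarrow> complex" where
  "half_plane \<alpha> z = (\<alpha> + z) / (\<alpha> - z)"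

text \<open>The inverse of \<open>half_plane\<close>: it maps 1 to the centre of the disc and
  infinity to the boundary point \<alpha>.\<close>

definition disc_point :: "complex \<Rightarrow> complex \<Rightarrow> complex" where
  "disc_point \<alpha> w = \<alpha> * (w - 1) / (w + 1)"

lemma unit_disc_neq: "cmod \<alpha> = 1 \<Longrightarrow> z \<in> unit_disc \<Longrightarrow> \<alpha> - z \<noteq> 0"
  by auto

lemma half_plane_plus_one: "\<alpha> - z \<noteq> 0 \<Longrightarrow> half_plane \<alpha> z + 1 = 2 * \<alpha> / (\<alpha> - z)"
  by (simp add: half_plane_def field_simps)

lemma Re_half_plane: "cmod \<alpha> = 1 \<Longrightarrow> \<alpha> \<noteq> z \<Longrightarrow> Re (half_plane \<alpha> z) = (1 - (cmod z)\<^sup>2) / (cmod (\<alpha> - z))\<^sup>2"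
proof -
  assume a: "cmod \<alpha> = 1" "\<alpha> \<noteq> z"
  have "(Re \<alpha>)\<^sup>2 + (Im \<alpha>)\<^sup>2 = 1" using a by (metis cmod_power2 one_power2)
  then show ?thesis
    unfolding half_plane_def Re_divide cmod_power2 by (simp add: power2_eq_square algebra_simps)
qed

lemma Re_half_plane_pos:
  assumes "cmod \<alpha> = 1" "z \<in> unit_disc" shows "0 < Re (half_plane \<alpha> z)"
proof -
  have "\<alpha> \<noteq> z" using assms by auto
  then show ?thesis
    using assms norm_square_less_one[OF assms(2)] by (simp add: Re_half_plane)
qed

lemma disc_point_half_plane:
  assumes "\<alpha> \<noteq> 0" "\<alpha> \<noteq> z" shows "disc_point \<alpha> (half_plane \<alpha> z) = z"
proof -
  have "half_plane \<alpha> z + 1 = 2 * \<alpha> / (\<alpha> - z)" using assms by (intro half_plane_plus_one) auto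
  moreover have "half_plane \<alpha> z - 1 = 2 * z / (\<alpha> - z)" using assms by (simp add: half_plane_def field_simps)
  ultimately show ?thesis using assms by (simp add: disc_point_def)
qed

lemma half_plane_disc_point:
  assumes "\<alpha> \<noteq> 0" "w \<noteq> - 1" shows "half_plane \<alpha> (disc_point \<alpha> w) = w"
proof -
  have w: "w + 1 \<noteq> 0" using assms by (metis add_eq_0_iff2)
  have "\<alpha> + disc_point \<alpha> w = 2 * \<alpha> * w / (w + 1)" "\<alpha> - disc_point \<alpha> w = 2 * \<alpha> / (w + 1)"
    using w by (simp_all add: disc_point_def field_simps)
  then show ?thesis using w assms by (simp add: half_plane_def)
qed

lemma norm_disc_point:
  assumes "cmod \<alpha> = 1" "w \<noteq> - 1"
  shows "1 - (cmod (disc_point \<alpha> w))\<^sup>2 = 4 * Re w / (cmod (w + 1))\<^sup>2"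
proof -
  have w: "cmod (w + 1) \<noteq> 0" using assms by (metis add_eq_0_iff2 norm_eq_zero)
  have "(cmod (disc_point \<alpha> w))\<^sup>2 = (cmod (w - 1))\<^sup>2 / (cmod (w + 1))\<^sup>2"
    using assms by (simp add: disc_point_def norm_divide norm_mult power_divide)
  moreover have "(cmod (w + 1))\<^sup>2 - (cmod (w - 1))\<^sup>2 = 4 * Re w"
    unfolding cmod_power2 by (simp add: power2_eq_square algebra_simps)
  ultimately show ?thesis using w by (simp add: divide_simps) (simp add: algebra_simps)
qed

lemma Re_pos_neq: "0 < Re w \<Longrightarrow> w \<noteq> - 1"
  by auto

lemma disc_point_in_disc:
  assumes "cmod \<alpha> = 1" "0 < Re w" shows "disc_point \<alpha> w \<in> unit_disc"
proof -
  have w: "w \<noteq> - 1" using assms(2) by (rule Re_pos_neq)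
  then have "cmod (w + 1) \<noteq> 0" by (metis add_eq_0_iff2 norm_eq_zero)
  then have "1 - (cmod (disc_point \<alpha> w))\<^sup>2 > 0"
    unfolding norm_disc_point[OF assms(1) w] using assms by simp
  then show ?thesis by (simp add: abs_square_less_1)
qed

text \<open>In half-plane coordinates the kernel becomes \<open>1 / (p + cnj q)\<close> up to one
  factor for each variable; these factors can be divided out when whole families of evaluations are
  compared.\<close>

lemma disc_point_kernel:
  assumes a: "cmod \<alpha> = 1" and p: "p \<noteq> - 1" and q: "q \<noteq> - 1"
  shows "1 - disc_point \<alpha> p * cnj (disc_point \<alpha> q) = 2 * (p + cnj q) / ((p + 1) * (cnj q + 1))"
proof -
  have "cnj (q + 1) \<noteq> 0" unfolding complex_cnj_zero_iff using q by (metis add_eq_0_iff2)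
  moreover have "p + 1 \<noteq> 0" using p by (metis add_eq_0_iff2)
  ultimately have w: "p + 1 \<noteq> 0" "cnj q + 1 \<noteq> 0" by auto
  have "\<alpha> * cnj \<alpha> = 1" using a by (metis complex_norm_square of_real_1 one_power2)
  then have "(\<alpha> * cnj \<alpha>) * ((p - 1) * (cnj q - 1)) / ((p + 1) * (cnj q + 1)) = (p - 1) * (cnj q - 1) / ((p + 1) * (cnj q + 1))"
    by simp
  then have "disc_point \<alpha> p * cnj (disc_point \<alpha> q) = (p - 1) * (cnj q - 1) / ((p + 1) * (cnj q + 1))"
    by (simp add: disc_point_def mult_ac)
  then show ?thesis using w by (simp add: divide_simps) (simp add: algebra_simps)
qed

lemma holomorphic_half_plane: "cmod \<alpha> = 1 \<Longrightarrow> half_plane \<alpha> holomorphic_on unit_disc"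
  unfolding half_plane_def using unit_disc_neq by (intro holomorphic_intros) auto

lemma continuous_half_plane: "cmod \<alpha> = 1 \<Longrightarrow> continuous_on unit_disc (half_plane \<alpha>)"
  by (intro holomorphic_on_imp_continuous_on holomorphic_half_plane)

text \<open>In the disc variable the quotient is a constant multiple of a geometric kernel
  \<open>1 / (1 - q * z)\<close>, and its bound simplifies to \<open>1 / sqrt (Re p)\<close>.
  Smallness therefore comes from a pole \<open>- p\<close> far to the left.\<close>

lemma L2_bounded_kernel:
  assumes a: "cmod \<alpha> = 1" and p: "0 < Re p"
  shows "L2_bounded (\<lambda>z. cmod ((half_plane \<alpha> z + 1) / (half_plane \<alpha> z + p))) (1 / sqrt (Re p))"
proof -
  define q where "q = (p - 1) / (p + 1) / \<alpha>"
  have p1: "p + 1 \<noteq> 0" using Re_pos_neq[OF p] by (metis add_eq_0_iff2)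
  have a0: "\<alpha> \<noteq> 0" using a by auto
  have "cmod q = cmod (disc_point 1 p)" using a by (simp add: q_def disc_point_def norm_divide norm_mult)
  moreover have "disc_point 1 p \<in> unit_disc" using p by (intro disc_point_in_disc) auto
  ultimately have q1: "cmod q < 1" by simp
  have "1 - (cmod q)\<^sup>2 = 4 * Re p / (cmod (p + 1))\<^sup>2"
    using \<open>cmod q = _\<close> norm_disc_point[of 1 p] Re_pos_neq[OF p] by simp
  then have sq: "sqrt (1 - (cmod q)\<^sup>2) = 2 * sqrt (Re p) / cmod (p + 1)"
    by (simp add: real_sqrt_divide real_sqrt_mult)
  have "L2_bounded (\<lambda>z. cmod (2 / (p + 1)) * cmod (1 / (1 - q * z))) (cmod (2 / (p + 1)) * (1 / sqrt (1 - (cmod q)\<^sup>2)))"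
    by (intro L2_bounded_cmult L2_bounded_geometric q1) auto
  also have "cmod (2 / (p + 1)) * (1 / sqrt (1 - (cmod q)\<^sup>2)) = 1 / sqrt (Re p)"
    unfolding sq using p1 by (simp add: norm_divide)
  finally have *: "L2_bounded (\<lambda>z. cmod (2 / (p + 1)) * cmod (1 / (1 - q * z))) (1 / sqrt (Re p))" .
  have eq: "(half_plane \<alpha> z + 1) / (half_plane \<alpha> z + p) = 2 / (p + 1) * (1 / (1 - q * z))"
    if z: "z \<in> unit_disc" for z
  proof -
    have az: "\<alpha> - z \<noteq> 0" using unit_disc_neq[OF a z] .
    have "half_plane \<alpha> z + p = ((\<alpha> + z) + p * (\<alpha> - z)) / (\<alpha> - z)"
      using az by (simp add: half_plane_def field_simps)
    moreover have "(p + 1) * \<alpha> * q = p - 1" using p1 a0 by (simp add: q_def)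
    then have "(p + 1) * \<alpha> * q * z = (p - 1) * z" by simp
    then have "(\<alpha> + z) + p * (\<alpha> - z) = (p + 1) * \<alpha> * (1 - q * z)"
      unfolding right_diff_distrib by (simp add: algebra_simps)
    ultimately have "half_plane \<alpha> z + p = (p + 1) * \<alpha> * (1 - q * z) / (\<alpha> - z)" by simp
    then show ?thesis
      using az a0 p1 by (simp add: half_plane_plus_one)
  qed
  have ne: "half_plane \<alpha> z + p \<noteq> 0" if "z \<in> unit_disc" for z
  proof -
    have "0 < Re (half_plane \<alpha> z + p)" using Re_half_plane_pos[OF a that] p by simp
    then show ?thesis by (metis less_irrefl zero_complex.sel(1))
  qed
  show ?thesis
  proof (rule L2_bounded_mono[OF *])
    show "continuous_on unit_disc (\<lambda>z. cmod ((half_plane \<alpha> z + 1) / (half_plane \<alpha> z + p)))"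
      using ne by (intro continuous_intros continuous_half_plane a) auto
  qed (auto simp: eq norm_mult norm_divide)
qed

lemma half_plane_add_neq_0:
  assumes "cmod \<alpha> = 1" "0 < Re p" "z \<in> unit_disc" shows "half_plane \<alpha> z + p \<noteq> 0"
proof -
  have "0 < Re (half_plane \<alpha> z + p)" using Re_half_plane_pos[OF assms(1,3)] assms(2) by simp
  then show ?thesis by (metis less_irrefl zero_complex.sel(1))
qed

lemma continuous_half_plane_inverse:
  assumes "cmod \<alpha> = 1" "0 < Re p"
  shows "continuous_on unit_disc (\<lambda>z. cmod (1 / (half_plane \<alpha> z + p)))"
  using half_plane_add_neq_0[OF assms] by (intro continuous_intros continuous_half_plane assms) auto

lemma cmod_plus_one_ge: "0 \<le> Re w \<Longrightarrow> 1 \<le> cmod (w + 1)"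
  using complex_Re_le_cmod[of "w + 1"] by simp

lemma L2_bounded_inverse:
  assumes a: "cmod \<alpha> = 1" and p: "0 < Re p"
  shows "L2_bounded (\<lambda>z. cmod (1 / (half_plane \<alpha> z + p))) (1 / sqrt (Re p))"
proof (rule L2_bounded_mono[OF L2_bounded_kernel[OF a p] continuous_half_plane_inverse[OF a p]])
  fix z assume z: "z \<in> unit_disc"
  have "1 \<le> cmod (half_plane \<alpha> z + 1)" using Re_half_plane_pos[OF a z] by (intro cmod_plus_one_ge) auto
  then show "\<bar>cmod (1 / (half_plane \<alpha> z + p))\<bar> \<le> cmod ((half_plane \<alpha> z + 1) / (half_plane \<alpha> z + p))"
    by (simp add: norm_divide divide_right_mono)
qed simp

text \<open>The bound \<open>1 / sqrt (Re p)\<close> does not improve when \<open>p\<close> escapes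
  in the imaginary direction. Here \<open>cmod p\<close> is estimated by \<open>cmod (half_plane
  \<alpha> z + p) + cmod (half_plane \<alpha> z + 1)\<close>, which gains a factor
  \<open>1 / cmod p\<close> as soon as \<open>Re p\<close> stays away from 0.\<close>

lemma L2_bounded_inverse_far:
  assumes a: "cmod \<alpha> = 1" and p: "0 < Re p"
  shows "L2_bounded (\<lambda>z. cmod (1 / (half_plane \<alpha> z + p))) ((1 + 1 / sqrt (Re p)) / cmod p)"
proof -
  have p0: "cmod p > 0" using p by auto
  have "L2_bounded (\<lambda>z. 1 / cmod p * (1 + cmod ((half_plane \<alpha> z + 1) / (half_plane \<alpha> z + p)))) (1 / cmod p * (1 + 1 / sqrt (Re p)))"
    by (intro L2_bounded_cmult L2_bounded_add L2_bounded_const L2_bounded_kernel a p) auto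
  then show ?thesis
  proof (rule L2_bounded_mono[OF _ continuous_half_plane_inverse[OF a p]])
    fix z assume z: "z \<in> unit_disc"
    let ?w = "half_plane \<alpha> z"
    have ne: "cmod (?w + p) > 0" using half_plane_add_neq_0[OF a p z] by simp
    have re: "0 < Re ?w" using Re_half_plane_pos[OF a z] .
    have "(cmod ?w)\<^sup>2 \<le> (cmod (?w + 1))\<^sup>2"
      unfolding cmod_power2 using re by (simp add: power_mono)
    then have "cmod ?w \<le> cmod (?w + 1)" by (rule power2_le_imp_le) simp
    then have "cmod p \<le> cmod (?w + p) + cmod (?w + 1)"
      using norm_triangle_ineq4[of "?w + p" ?w] by simp
    then have "cmod p / (cmod p * cmod (?w + p)) \<le> (cmod (?w + p) + cmod (?w + 1)) / (cmod p * cmod (?w + p))"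
      using p0 ne by (intro divide_right_mono) auto
    also have "\<dots> = 1 / cmod p * (1 + cmod ((?w + 1) / (?w + p)))"
      unfolding norm_divide using p0 ne by (simp add: add_divide_distrib)
    finally show "\<bar>cmod (1 / (?w + p))\<bar> \<le> 1 / cmod p * (1 + cmod ((?w + 1) / (?w + p)))"
      unfolding norm_divide using p0 by simp
  qed simp
qed

lemma poly_sums: "(\<lambda>n. coeff p n * z ^ n) sums poly p (z :: complex)"
  unfolding poly_altdef by (rule sums_finite) (auto simp: coeff_eq_0)

text \<open>Truncated power series with coefficients moved into a countable dense subset of the
  plane. One sequence serves all \<open>f\<close>, so that the targets can be enumerated.\<close>

lemma hardy2_polynomials_dense:
  "\<exists>q :: nat \<Rightarrow> complex poly. \<forall>f\<in>hardy2. \<forall>e>0. \<exists>k. L2_bounded (\<lambda>z. cmod (f z - poly (q k) z)) e"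
proof -
  obtain D :: "complex set" where D: "countable D" and dense: "\<And>X. open X \<Longrightarrow> X \<noteq> {} \<Longrightarrow> \<exists>d\<in>D. d \<in> X"
    using countable_dense_exists by metis
  define L where "L = Poly ` lists D"
  have "countable L" "L \<noteq> {}" using D by (auto simp: L_def)
  show ?thesis
  proof (intro exI[of _ "from_nat_into L"] ballI allI impI)
    fix f and e :: real assume f: "f \<in> hardy2" and e: "e > 0"
    have hol: "f holomorphic_on unit_disc" using f by (simp add: hardy2_def)
    obtain a where a: "\<And>z. z \<in> unit_disc \<Longrightarrow> (\<lambda>n. a n * z ^ n) sums f z"
      using holomorphic_disc_power_series[OF hol] by blast
    have "summable (\<lambda>n. (cmod (a n))\<^sup>2)"
      using L2_bounded_coeffs[OF a L2_bounded_hardy2[OF f]] by (intro summableI_nonneg_bounded) auto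
    then obtain N where N: "norm (\<Sum>n\<in>{m..<k}. (cmod (a n))\<^sup>2) < e\<^sup>2 / 2" if "m \<ge> N" for m k
      using e unfolding summable_Cauchy by (metis half_gt_zero zero_less_power)
    \<comment> \<open>Chosen so that \<open>N\<close> coefficient errors contribute at most half of
      \<open>e\<^sup>2\<close>; the tail beyond \<open>N\<close> takes the other half.\<close>
    define \<delta> where "\<delta> = e / sqrt (2 * (real N + 1))"
    have \<delta>: "\<delta> > 0" using e by (simp add: \<delta>_def)
    have "\<exists>d\<in>D. d \<in> ball (a n) \<delta>" for n using dense[of "ball (a n) \<delta>"] \<delta> by auto
    then obtain d where d: "\<And>n. d n \<in> D" "\<And>n. cmod (a n - d n) < \<delta>"
      unfolding mem_ball dist_norm by metis
    define p where "p = Poly (map d [0..<N])"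
    have "p \<in> L" using d by (auto simp: L_def p_def intro!: imageI)
    then obtain k where k: "from_nat_into L k = p"
      using \<open>countable L\<close> from_nat_into_surj by metis
    have cp: "coeff p n = (if n < N then d n else 0)" for n
      by (simp add: p_def coeff_Poly_eq nth_default_def)
    have sq: "(cmod (a n - coeff p n))\<^sup>2 \<le> \<delta>\<^sup>2" if "n < N" for n
      using that d(2)[of n] by (simp add: cp power_mono)
    have "L2_bounded (\<lambda>z. cmod (f z - poly p z)) e"
    proof (rule coeffs_L2_bounded)
      show "(\<lambda>n. (a n - coeff p n) * z ^ n) sums (f z - poly p z)" if "z \<in> unit_disc" for z
        using sums_diff[OF a[OF that] poly_sums[of p z]] by (simp add: algebra_simps)
      show "(\<lambda>z. f z - poly p z) holomorphic_on unit_disc"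
        by (intro holomorphic_intros hol)
      fix M
      have "(\<Sum>n<M. (cmod (a n - coeff p n))\<^sup>2) \<le> (\<Sum>n\<in>{..<N} \<union> {N..<M}. (cmod (a n - coeff p n))\<^sup>2)"
        by (rule sum_mono2) auto
      also have "\<dots> = (\<Sum>n<N. (cmod (a n - coeff p n))\<^sup>2) + (\<Sum>n\<in>{N..<M}. (cmod (a n))\<^sup>2)"
        by (subst sum.union_disjoint) (auto simp: cp)
      also have "(\<Sum>n<N. (cmod (a n - coeff p n))\<^sup>2) \<le> (\<Sum>n<N. \<delta>\<^sup>2)"
        by (rule sum_mono) (use sq in auto)
      also have "\<dots> \<le> e\<^sup>2 / 2" using e by (simp add: \<delta>_def power_divide field_simps)
      also have "(\<Sum>n\<in>{N..<M}. (cmod (a n))\<^sup>2) \<le> e\<^sup>2 / 2" using N[of N M] by simp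
      finally show "(\<Sum>n<M. (cmod (a n - coeff p n))\<^sup>2) \<le> e\<^sup>2" by simp
    qed (use e in auto)
    then show "\<exists>k. L2_bounded (\<lambda>z. cmod (f z - poly (from_nat_into L k) z)) e"
      using k by metis
  qed
qed

section \<open>Block times with positive lower density\<close>

text \<open>Two elements of one block have a quotient of at most \<open>1 + 1 / H\<close>, elements
  of different blocks one of at least about \<open>H\<close>, so a prescribed ratio above 1 is
  missed when \<open>H\<close> is large. The blocks still fill a fixed proportion of every long
  initial segment.\<close>

definition blocks :: "nat \<Rightarrow> nat set" where
  "blocks H = {n. \<exists>p. H ^ Suc p \<le> n \<and> n \<le> H ^ Suc p + H ^ p}"

text \<open>The sets \<open>A k\<close> serve as the times at which the \<open>k\<close>-th pair of targets is approximated.\<close>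

definition rich :: "nat set \<Rightarrow> bool" where
  "rich E \<longleftrightarrow> (\<forall>N :: nat \<Rightarrow> nat. \<exists>A :: nat \<Rightarrow> nat set.
     (\<forall>k. A k \<subseteq> E \<and> lower_density (A k) > 0 \<and> (\<forall>n\<in>A k. N k \<le> n)) \<and>
     (\<forall>k l. \<forall>n\<in>A k. \<forall>m\<in>A l. (k, n) \<noteq> (l, m) \<longrightarrow>
        n \<noteq> m \<and> int (N k) \<le> \<bar>int n - int m\<bar> \<and> int (N l) \<le> \<bar>int n - int m\<bar>))"

lemma lower_density_mono: "A \<subseteq> B \<Longrightarrow> lower_density A \<le> lower_density B"
  unfolding lower_density_def
  by (intro Liminf_mono always_eventually allI) (auto intro!: divide_right_mono card_mono)

lemma card_residue_class_ge:
  fixes D :: nat assumes c: "c < D"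
  shows "L div D \<le> card {n \<in> {X..X + L}. n mod D = c}"
proof -
  \<comment> \<open>The first number from \<open>X\<close> on in the residue class; the others
    follow in steps of \<open>D\<close>.\<close>
  define Y where "Y = X + (c + D - X mod D) mod D"
  have Y: "Y mod D = c"
  proof -
    have "X mod D < D" using c by simp
    then have "X mod D + (c + D - X mod D) = c + D" by simp
    then have "(X mod D + (c + D - X mod D)) mod D = c" using c by simp
    then show ?thesis by (simp add: Y_def mod_simps)
  qed
  have "(\<lambda>k. Y + k * D) ` {..<L div D} \<subseteq> {n \<in> {X..X + L}. n mod D = c}"
  proof clarsimp
    fix k assume k: "k < L div D"
    then have "Suc k * D \<le> L div D * D" by (intro mult_right_mono) auto
    also have "\<dots> \<le> L" by simp
    finally have "k * D + D \<le> L" by simp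
    moreover have "Y < X + D" using c by (simp add: Y_def)
    ultimately show "X \<le> Y + k * D \<and> Y + k * D \<le> X + L \<and> Y mod D = c" using Y by (simp add: Y_def)
  qed
  then have "card ((\<lambda>k. Y + k * D) ` {..<L div D}) \<le> card {n \<in> {X..X + L}. n mod D = c}"
    by (intro card_mono) auto
  moreover have "inj_on (\<lambda>k. Y + k * D) {..<L div D}" using c by (auto simp: inj_on_def)
  ultimately show ?thesis by (simp add: card_image)
qed

text \<open>A member is determined by its period \<open>n div D\<close> and by the position
  \<open>(n mod D - b) div d\<close> in the window, because its residue modulo \<open>d\<close> is
  prescribed.\<close>

lemma card_two_residues_le:
  fixes D d :: nat
  assumes d: "d dvd w" "d dvd b" "0 < d" "0 < D" "d dvd D"
  shows "card {n \<in> {X..X + L}. n mod d = c \<and> b \<le> n mod D \<and> n mod D \<le> b + w}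
         \<le> ((X + L) div D - X div D + 1) * (w div d + 1)"
proof -
  let ?S = "{n \<in> {X..X + L}. n mod d = c \<and> b \<le> n mod D \<and> n mod D \<le> b + w}"
  let ?h = "\<lambda>n. (n div D, (n mod D - b) div d)"
  have "inj_on ?h ?S"
  proof (rule inj_onI)
    fix x y assume x: "x \<in> ?S" and y: "y \<in> ?S" and eq: "?h x = ?h y"
    have mod: "(z mod D - b) mod d = c" if "z \<in> ?S" for z
    proof -
      have "z mod D = (z mod D - b) + b" using that by auto
      moreover have "z mod D mod d = c" using \<open>d dvd D\<close> that by (simp add: mod_mod_cancel)
      ultimately show ?thesis using d(2) by (metis dvd_imp_mod_0 mod_add_right_eq add_0_right)
    qed
    have "x mod D - b = y mod D - b"
      using eq mod[OF x] mod[OF y] by (metis Pair_inject div_mult_mod_eq)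
    then have "x mod D = y mod D" using x y by auto
    then show "x = y" using eq by (metis Pair_inject div_mult_mod_eq)
  qed
  moreover have "?h ` ?S \<subseteq> {X div D..(X + L) div D} \<times> {0..w div d}"
    by (auto intro!: div_le_mono)
  ultimately have "card ?S \<le> card ({X div D..(X + L) div D} \<times> {0..w div d})"
    by (intro card_inj_on_le[of ?h]) auto
  moreover have "card {X div D..(X + L) div D} = (X + L) div D - X div D + 1"
    using div_le_mono[of X "X + L" D] by simp
  ultimately show ?thesis by (simp add: card_cartesian_product)
qed

lemma real_div_minus_one_le:
  fixes L D :: nat assumes "0 < D"
  shows "real L / real D - 1 \<le> real (L div D)"
proof -
  have "real L \<le> real (D + D * (L div D))"
    using dividend_less_times_div[OF assms, of L] by (intro of_nat_mono) simp
  then show ?thesis using assms by (simp add: field_simps)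
qed

lemma div_diff_le:
  fixes X L D :: nat assumes "0 < D"
  shows "real ((X + L) div D - X div D + 1) \<le> real L / real D + 2"
proof -
  have "real ((X + L) div D) \<le> real (X + L) / real D" by (rule of_nat_div_le_of_nat)
  moreover have "real X / real D - 1 \<le> real (X div D)" using assms by (rule real_div_minus_one_le)
  moreover have "X div D \<le> (X + L) div D" by (simp add: div_le_mono)
  ultimately show ?thesis by (simp add: of_nat_diff add_divide_distrib)
qed

text \<open>Every scale divides the next one, so residue conditions at different scales are
  compatible. The half-width \<open>W j\<close> is the fraction \<open>1 / 2 ^ (j + s)\<close> of
  the period \<open>D j\<close>: the proportions lost to the windows around \<open>D j / 2\<close>
  are summable, and \<open>s\<close> makes their sum small even when the loss is measured in a
  single block. \<open>F\<close> forces the scales to grow as fast as desired.\<close>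

locale sparse_windows =
  fixes H s :: nat and F W D :: "nat \<Rightarrow> nat"
  assumes H: "2 \<le> H" and s: "28 * (8 * H + 9) \<le> s"
    and D: "\<And>j. D j = 2 ^ (j + s) * W j" and W0: "W 0 = 2 ^ F 0"
    and WS: "\<And>j. W (Suc j) = D j * 2 ^ F (Suc j)"
begin

lemma W_pos: "0 < W j" by (induction j) (simp_all add: W0 WS D)
lemma D_pos: "0 < D j" by (simp add: D W_pos)

lemma D_dvd_W: "i < j \<Longrightarrow> D i dvd W j"
proof (induction j)
  case (Suc j)
  show ?case
  proof (cases "i = j")
    case False
    then have "D i dvd W j" using Suc by simp
    then show ?thesis by (simp add: WS D)
  qed (simp add: WS)
qed simp

lemma W_ge: "j \<le> W j"
proof (cases j)
  case (Suc i)
  have "i < 2 ^ i" by simp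
  also have "(2::nat) ^ i \<le> D i" using W_pos[of i] by (simp add: D power_add)
  also have "\<dots> \<le> W j" by (simp add: Suc WS)
  finally show ?thesis using Suc by simp
qed simp

lemma F_le_D: "F j \<le> D j"
proof -
  have "F j < 2 ^ F j" by simp
  also have "(2::nat) ^ F j \<le> W j" using D_pos by (cases j) (simp_all add: W0 WS Suc_leI)
  also have "\<dots> \<le> D j" by (simp add: D)
  finally show ?thesis by simp
qed

lemma W_mono: "i \<le> j \<Longrightarrow> W i \<le> W j"
proof (cases "i = j")
  case False
  assume "i \<le> j"
  then have "D i \<le> W j" using False by (intro dvd_imp_le D_dvd_W W_pos) auto
  moreover have "W i \<le> D i" by (simp add: D)
  ultimately show ?thesis by simp
qed simp

definition half :: "nat \<Rightarrow> nat" where "half j = 2 ^ (j + s - 1) * W j"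

lemma half: "D j = 2 * half j"
proof -
  have "j + s = Suc (j + s - 1)" using s by simp
  then have "(2::nat) ^ (j + s) = 2 * 2 ^ (j + s - 1)" by (metis power_Suc)
  then show ?thesis by (simp add: D half_def)
qed

lemma half_ge: "16 * W j \<le> half j"
proof -
  have "(2::nat) ^ 4 \<le> 2 ^ (j + s - 1)" using s by (intro power_increasing) auto
  then show ?thesis by (simp add: half_def)
qed

text \<open>Level \<open>i\<close> occupies one residue class modulo \<open>D i\<close>, at
  \<open>2 * W i\<close> above the middle \<open>half i\<close>, and stays more than
  \<open>3 * W j\<close> away from the middle of every longer period. So it avoids the window of
  half-width \<open>W j\<close> at each scale, and keeps the distance \<open>W j\<close> from the
  times of each higher level \<open>j\<close>.\<close>

definition A :: "nat \<Rightarrow> nat set" where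
  "A i = {n \<in> blocks H. n mod D i = half i + 2 * W i \<and>
            (\<forall>j>i. \<not> (half j - 3 * W j \<le> n mod D j \<and> n mod D j \<le> half j + 3 * W j))}"

lemma residue_lt: "half j + 5 * W j < D j"
  using half_ge[of j] W_pos[of j] by (simp add: half)

lemma A_ge: "n \<in> A i \<Longrightarrow> W i \<le> n"
proof -
  assume "n \<in> A i"
  then have "half i + 2 * W i \<le> n" by (auto simp: A_def) (metis mod_less_eq_dividend)
  then show ?thesis by simp
qed

lemma A_separated_same:
  assumes "n \<in> A i" "m \<in> A i" "n \<noteq> m" shows "int (W i) \<le> \<bar>int n - int m\<bar>"
proof -
  have "n mod D i = m mod D i" using assms by (simp add: A_def)
  then have "int n mod int (D i) = int m mod int (D i)" by (simp flip: zmod_int)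
  then have "int (D i) dvd int n - int m" by (simp add: mod_eq_dvd_iff)
  then have "int (D i) \<le> \<bar>int n - int m\<bar>" using assms(3) by (metis dvd_imp_le_int abs_of_nat eq_iff_diff_eq_0 of_nat_eq_iff)
  moreover have "W i \<le> D i" by (simp add: D)
  ultimately show ?thesis by simp
qed

lemma A_separated_less:
  assumes n: "n \<in> A i" and m: "m \<in> A j" and ij: "i < j" shows "int (W j) \<le> \<bar>int n - int m\<bar>"
proof (rule ccontr)
  assume neg: "\<not> ?thesis"
  define q where "q = m div D j"
  have mq: "m = q * D j + (half j + 2 * W j)" using m by (simp add: A_def q_def) (metis div_mult_mod_eq)
  define r where "r = n - q * D j"
  have "m < n + W j" "n < m + W j" using neg by linarith+
  then have "q * D j + half j + W j < n" "n < q * D j + half j + 3 * W j" using mq by linarith+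
  then have r: "n = q * D j + r" "half j + W j < r" "r < half j + 3 * W j" by (auto simp: r_def)
  then have "n mod D j = r" using residue_lt[of j] by simp
  then show False using n ij r by (auto simp: A_def)
qed

text \<open>Shorter periods divide the residue of level \<open>i\<close>, so \<open>n\<close> is a
  multiple of \<open>D j\<close>; at its own scale the offset \<open>2 * W i\<close> exceeds the
  half-width; at longer scales the window was removed.\<close>

lemma A_avoids_middle:
  assumes "n \<in> A i" shows "n mod D j + W j \<le> half j \<or> half j + W j \<le> n mod D j"
proof -
  consider "j < i" | "j = i" | "i < j" by linarith
  then show ?thesis
  proof cases
    case 1
    then have dvd: "D j dvd W i" by (rule D_dvd_W)
    then have "D j dvd half i + 2 * W i" by (simp add: half_def)
    moreover have "D j dvd D i" using dvd by (simp add: D)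
    moreover have "n mod D i = half i + 2 * W i" using assms by (simp add: A_def)
    ultimately have "n mod D j = 0" by (metis mod_mod_cancel dvd_imp_mod_0)
    then show ?thesis using half_ge[of j] by simp
  next
    case 2
    then show ?thesis using assms by (simp add: A_def)
  next
    case 3
    then show ?thesis using assms by (auto simp: A_def)
  qed
qed

text \<open>A window holds at most \<open>6 * W j div D i + 1\<close> members of the class, which is
  at most \<open>7 * W j / D i\<close> since \<open>D i\<close> divides \<open>W j\<close>; the
  interval meets at most \<open>L / D j + 2\<close> periods.\<close>

lemma card_removed:
  assumes ij: "i < j"
  shows "real (card {n \<in> {X..X + L}. n mod D i = c \<and> half j - 3 * W j \<le> n mod D j \<and> n mod D j \<le> half j + 3 * W j})
         \<le> 7 / 2 ^ (j + s) * (real L + 2 * real (D j)) / real (D i)"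
proof -
  have dvd: "D i dvd W j" using D_dvd_W[OF ij] .
  then have dvd': "D i dvd 6 * W j" "D i dvd half j - 3 * W j" "D i dvd D j"
    by (auto simp: half_def D intro: dvd_diff_nat)
  have eq: "half j - 3 * W j + 6 * W j = half j + 3 * W j" using half_ge[of j] by simp
  have W1: "D i \<le> W j" using dvd W_pos by (intro dvd_imp_le) auto
  have "real (6 * W j div D i + 1) = 6 * real (W j) / real (D i) + 1"
    using dvd' by (simp add: real_of_nat_div)
  also have "\<dots> \<le> 7 * real (W j) / real (D i)"
    using W1 D_pos[of i] by (simp add: field_simps)
  finally have w: "real (6 * W j div D i + 1) \<le> 7 * real (W j) / real (D i)" .
  have "real (card {n \<in> {X..X + L}. n mod D i = c \<and> half j - 3 * W j \<le> n mod D j \<and> n mod D j \<le> half j - 3 * W j + 6 * W j})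
     \<le> real (((X + L) div D j - X div D j + 1) * (6 * W j div D i + 1))"
    using card_two_residues_le[OF dvd'(1,2) D_pos D_pos dvd'(3)] of_nat_mono by blast
  also have "\<dots> = real ((X + L) div D j - X div D j + 1) * real (6 * W j div D i + 1)" by (rule of_nat_mult)
  also have "\<dots> \<le> (real L / real (D j) + 2) * (7 * real (W j) / real (D i))"
    by (intro mult_mono div_diff_le w D_pos) auto
  also have "\<dots> = 7 * (real (W j) / real (D j)) * (real L + 2 * real (D j)) / real (D i)"
    using D_pos[of j] D_pos[of i] by (simp add: field_simps)
  also have "real (W j) / real (D j) = 1 / 2 ^ (j + s)"
    using W_pos[of j] by (simp add: D)
  finally show ?thesis unfolding eq by simp
qed

text \<open>At least \<open>L / D i - 1\<close> members of the class lie in a block of length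
  \<open>L\<close>. The windows remove at most a quarter of \<open>L / D i\<close>, and the missing
  1 is at most another quarter by \<open>4 * D i \<le> H ^ p\<close>, so half remains.\<close>

lemma card_A_block:
  assumes L: "4 * D i \<le> H ^ p"
  shows "real (H ^ p) / (2 * real (D i)) \<le> real (card (A i \<inter> {H ^ Suc p..H ^ Suc p + H ^ p}))"
proof -
  define L X c where "L = H ^ p" and "X = H ^ Suc p" and "c = half i + 2 * W i"
  define S where "S = {n \<in> {X..X + L}. n mod D i = c}"
  define R where "R j = {n \<in> {X..X + L}. n mod D i = c \<and> half j - 3 * W j \<le> n mod D j \<and> n mod D j \<le> half j + 3 * W j}" for j
  \<comment> \<open>Only these scales matter: when \<open>D j\<close> exceeds
    \<open>4 * (X + L)\<close>, its first window lies beyond the block.\<close>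
  define J where "J = {j \<in> {i<..4 * (X + L)}. D j \<le> 4 * (X + L)}"
  have c: "c < D i" using residue_lt[of i] by (simp add: c_def)
  have fin: "finite J" "finite S" "finite (R j)" for j by (auto simp: J_def S_def R_def)
  have sub: "S - (\<Union>j\<in>J. R j) \<subseteq> A i \<inter> {X..X + L}"
  proof
    fix n assume n: "n \<in> S - (\<Union>j\<in>J. R j)"
    have "\<not> (half j - 3 * W j \<le> n mod D j \<and> n mod D j \<le> half j + 3 * W j)" if "i < j" for j
    proof (cases "j \<in> J")
      case True
      then show ?thesis using n by (auto simp: S_def R_def)
    next
      case False
      have "j \<le> D j" using W_ge[of j] by (simp add: D) (metis le_trans mult_le_mono1 nat_mult_1 one_le_numeral one_le_power)
      then have "4 * (X + L) < D j" using False that by (auto simp: J_def)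
      moreover have "n \<le> X + L" using n by (auto simp: S_def)
      ultimately show ?thesis using half_ge[of j] W_pos[of j] by (simp add: half)
    qed
    moreover have "n \<in> blocks H" using n by (auto simp: blocks_def S_def X_def L_def)
    ultimately show "n \<in> A i \<inter> {X..X + L}" using n by (auto simp: A_def S_def c_def)
  qed
  have XL: "X = H * L" by (simp add: X_def L_def)
  have RB: "real (card (R j)) \<le> real L / (4 * real (D i)) * (1 / 2) ^ j" if "j \<in> J" for j
  proof -
    have ij: "i < j" and Dj: "D j \<le> 4 * (X + L)" using that by (auto simp: J_def)
    have "real (D j) \<le> real (4 * (H * L + L))" using Dj unfolding XL by (rule of_nat_mono)
    then have "real (D j) \<le> 4 * (real H + 1) * real L" by (simp add: algebra_simps)
    then have "real L + 2 * real (D j) \<le> (8 * real H + 9) * real L" by (simp add: algebra_simps)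
    \<comment> \<open>Here \<open>s\<close> is spent: \<open>8 * H + 9\<close> comes from
      \<open>D j \<le> 4 * (X + L)\<close> with \<open>X = H * L\<close>, and 28 is 7 times 4, which
      leaves a quarter of \<open>L / D i\<close>, weighted by the summable
      \<open>(1 / 2) ^ j\<close>.\<close>
    then have "7 / 2 ^ (j + s) * (real L + 2 * real (D j)) / real (D i)
       \<le> 7 / 2 ^ (j + s) * ((8 * real H + 9) * real L) / real (D i)"
      by (intro divide_right_mono mult_left_mono) auto
    also have "\<dots> = 28 * (8 * real H + 9) / 2 ^ s * (real L / (4 * real (D i)) * (1 / 2) ^ j)"
      using D_pos[of i] by (simp add: power_add power_one_over field_simps)
    also have "\<dots> \<le> 1 * (real L / (4 * real (D i)) * (1 / 2) ^ j)"
    proof (intro mult_right_mono)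
      have "28 * (8 * H + 9) < 2 ^ s" using s less_exp[of s] by linarith
      then have "real (28 * (8 * H + 9)) \<le> real (2 ^ s)" by linarith
      then show "28 * (8 * real H + 9) / 2 ^ s \<le> 1" by simp
    qed auto
    finally show ?thesis using card_removed[OF ij, of X L c] by (simp add: R_def)
  qed
  have "real (card (\<Union>j\<in>J. R j)) \<le> real (\<Sum>j\<in>J. card (R j))"
    by (intro of_nat_mono card_UN_le fin)
  also have "\<dots> \<le> (\<Sum>j\<in>J. real L / (4 * real (D i)) * (1 / 2) ^ j)"
    using RB by (simp add: sum_mono)
  also have "\<dots> = real L / (4 * real (D i)) * (\<Sum>j\<in>J. (1 / 2) ^ j)" by (simp add: sum_distrib_left)
  also have "\<dots> \<le> real L / (4 * real (D i)) * 1"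
  proof (intro mult_left_mono)
    have "(\<Sum>j\<in>J. (1 / 2 :: real) ^ j) = (\<Sum>j\<in>(\<lambda>j. j - 1) ` J. (1 / 2) ^ Suc j)"
      by (subst sum.reindex) (auto simp: inj_on_def J_def intro!: sum.cong simp flip: power_Suc)
    also have "\<dots> \<le> (\<Sum>j. (1 / 2) ^ Suc j)"
      by (rule sum_le_suminf) (use fin power_half_series in \<open>auto simp: sums_iff\<close>)
    also have "\<dots> = 1" using power_half_series by (simp add: sums_iff)
    finally show "(\<Sum>j\<in>J. (1 / 2 :: real) ^ j) \<le> 1" .
  qed auto
  finally have removed: "real (card (\<Union>j\<in>J. R j)) \<le> real L / (4 * real (D i))" by simp
  have "real L / real (D i) - 1 \<le> real (L div D i)"
    using D_pos by (rule real_div_minus_one_le)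
  also have "\<dots> \<le> real (card S)"
    unfolding S_def by (intro of_nat_mono card_residue_class_ge c)
  finally have "real L / real (D i) - 1 - real L / (4 * real (D i)) \<le> real (card S) - real (card (\<Union>j\<in>J. R j))"
    using removed by linarith
  also have "\<dots> \<le> real (card (S - (\<Union>j\<in>J. R j)))"
    using diff_card_le_card_Diff[of "\<Union>j\<in>J. R j" S] fin by (auto simp: le_diff_conv)
  also have "\<dots> \<le> real (card (A i \<inter> {X..X + L}))"
    by (intro of_nat_mono card_mono sub) auto
  finally have "real L / real (D i) - 1 - real L / (4 * real (D i)) \<le> real (card (A i \<inter> {X..X + L}))" .
  moreover have "real (4 * D i) \<le> real L" using L by (intro of_nat_mono) (simp add: L_def)
  then have "1 \<le> real L / (4 * real (D i))" using D_pos[of i] by (simp add: pos_le_divide_eq)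
  moreover have "real L / (2 * real (D i)) = real L / real (D i) - 2 * (real L / (4 * real (D i)))"
    by (simp add: field_simps)
  ultimately show ?thesis unfolding X_def[symmetric] L_def[symmetric] by linarith
qed

lemma lower_density_A: "0 < lower_density (A i)"
proof -
  define C where "C = 1 / (2 * real (D i) * (real H ^ 2 + real H))"
  have C: "C > 0" using D_pos[of i] H by (simp add: C_def add_pos_pos)
  have "C \<le> real (card (A i \<inter> {1..n})) / real n" if n: "H ^ (4 * D i + 1) + H ^ (4 * D i) \<le> n" for n
  proof -
    \<comment> \<open>With \<open>q\<close> the least exponent for which \<open>n\<close> lies below
      the end of the block of \<open>q\<close>, the preceding block \<open>p\<close> lies entirely
      in \<open>{1..n}\<close>, while \<open>n\<close> is at most
      \<open>(H\<^sup>2 + H) * H ^ p\<close>; this gives \<open>C\<close>.\<close>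
    define P where "P q \<longleftrightarrow> n < H ^ Suc q + H ^ q" for q
    have "n < H ^ n" using H by (simp add: less_exp power_gt_expt)
    then have "P n" by (simp add: P_def)
    define q where "q = (LEAST q. P q)"
    have q: "P q" unfolding q_def using \<open>P n\<close> by (rule LeastI)
    have "4 * D i < q"
    proof (rule ccontr)
      assume "\<not> 4 * D i < q"
      then have "H ^ Suc q + H ^ q \<le> H ^ (4 * D i + 1) + H ^ (4 * D i)"
        using H by (intro add_mono power_increasing) auto
      then show False using q n by (simp add: P_def)
    qed
    then obtain p where p: "q = Suc p" "4 * D i \<le> p" by (cases q) auto
    have notP: "\<not> P p" using not_less_Least[of p P] p by (simp add: q_def)
    have "4 * D i \<le> H ^ p"
      using p(2) less_exp[of p] power_mono[OF H, of p] by linarith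
    from card_A_block[OF this]
    have "real (H ^ p) / (2 * real (D i)) \<le> real (card (A i \<inter> {H ^ Suc p..H ^ Suc p + H ^ p}))" .
    also have "\<dots> \<le> real (card (A i \<inter> {1..n}))"
    proof (intro of_nat_mono card_mono)
      have "1 \<le> H * H ^ p" using H by (simp add: Suc_leI)
      then have "1 \<le> x" if "H ^ Suc p \<le> x" for x using that by (metis order.trans power_Suc)
      then show "A i \<inter> {H ^ Suc p..H ^ Suc p + H ^ p} \<subseteq> A i \<inter> {1..n}"
        using notP unfolding P_def by (meson IntD1 IntD2 IntI atLeastAtMost_iff le_trans not_less subsetI)
    qed auto
    finally have card: "real (H ^ p) / (2 * real (D i)) \<le> real (card (A i \<inter> {1..n}))" .
    have n0: "0 < n" using notP H by (auto simp: P_def intro: gr0I)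
    have "real n \<le> real (H ^ Suc q + H ^ q)" using q unfolding P_def by (intro of_nat_mono) (rule less_imp_le)
    also have "\<dots> = real (H ^ p) * (real H ^ 2 + real H)" by (simp add: p power2_eq_square algebra_simps)
    finally have "C * real n \<le> C * (real (H ^ p) * (real H ^ 2 + real H))"
      using C by (intro mult_left_mono) auto
    also have "\<dots> = real (H ^ p) / (2 * real (D i))"
    proof -
      have "real H ^ 2 + real H \<noteq> 0" using H by (simp add: add_pos_pos pos_add_strict less_imp_neq[symmetric])
      then show ?thesis using D_pos[of i] by (simp add: C_def)
    qed
    finally show ?thesis using card n0 by (simp add: pos_le_divide_eq)
  qed
  then have "eventually (\<lambda>n. ereal C \<le> ereal (real (card (A i \<inter> {1..n})) / real n)) sequentially"
    by (auto simp: eventually_at_top_linorder)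
  then have "ereal C \<le> lower_density (A i)"
    unfolding lower_density_def by (rule Liminf_bounded)
  then show ?thesis using C by (metis ereal_less(2) less_le_trans)
qed

lemma rich_windows: "rich (blocks H \<inter> {m. \<forall>j. m mod D j + W j \<le> half j \<or> half j + W j \<le> m mod D j})"
  unfolding rich_def
proof
  fix N :: "nat \<Rightarrow> nat"
  \<comment> \<open>The \<open>k\<close>-th set is taken from level \<open>t k\<close>, high enough
    for the separation \<open>W (t k)\<close> to be at least \<open>N k\<close>.\<close>
  define t where "t k = (\<Sum>i\<le>k. N i + 1)" for k
  have tN: "N k \<le> t k" for k
    using member_le_sum[of k "{..k}" "\<lambda>i. N i + 1"] by (simp add: t_def)
  have "strict_mono t" by (rule strict_mono_Suc_iff[THEN iffD2]) (simp add: t_def)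
  have WN: "N k \<le> W (t k)" for k using tN W_ge order.trans by blast
  show "\<exists>A. (\<forall>k. A k \<subseteq> blocks H \<inter> {m. \<forall>j. m mod D j + W j \<le> half j \<or> half j + W j \<le> m mod D j} \<and>
             0 < lower_density (A k) \<and> (\<forall>n\<in>A k. N k \<le> n)) \<and>
        (\<forall>k l. \<forall>n\<in>A k. \<forall>m\<in>A l. (k, n) \<noteq> (l, m) \<longrightarrow>
             n \<noteq> m \<and> int (N k) \<le> \<bar>int n - int m\<bar> \<and> int (N l) \<le> \<bar>int n - int m\<bar>)"
  proof (intro exI[of _ "\<lambda>k. A (t k)"] conjI allI ballI impI subsetI)
    fix k n assume n: "n \<in> A (t k)"
    show "n \<in> blocks H \<inter> {m. \<forall>j. m mod D j + W j \<le> half j \<or> half j + W j \<le> m mod D j}"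
      using n A_avoids_middle[OF n] by (simp add: A_def)
    show "N k \<le> n" using WN[of k] A_ge[OF n] by simp
  next
    fix k show "0 < lower_density (A (t k))" by (rule lower_density_A)
  next
    fix k l n m assume nm: "n \<in> A (t k)" "m \<in> A (t l)" "(k, n) \<noteq> (l, m)"
    have "int (max (W (t k)) (W (t l))) \<le> \<bar>int n - int m\<bar>"
    proof -
      consider "k = l" | "t k < t l" | "t l < t k"
        using \<open>strict_mono t\<close> by (metis less_linear strict_mono_less)
      then show ?thesis
      proof cases
        case 1
        then show ?thesis using nm A_separated_same[of n "t k" m] by simp
      next
        case 2
        then show ?thesis using A_separated_less[OF nm(1,2) 2] W_mono[of "t k" "t l"] by simp
      next
        case 3
        then show ?thesis using A_separated_less[OF nm(2,1) 3] W_mono[of "t l" "t k"] by simp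
      qed
    qed
    moreover have "0 < W (t k)" by (rule W_pos)
    ultimately show "n \<noteq> m" "int (N k) \<le> \<bar>int n - int m\<bar>" "int (N l) \<le> \<bar>int n - int m\<bar>"
      using WN[of k] WN[of l] by auto
  qed
qed

text \<open>Only residues near \<open>D j / 2\<close> bring the root of unity near -1. Outside the
  window its angle differs from \<open>pi\<close> by at least the angle of the half-width
  \<open>W j\<close>, which depends on \<open>j\<close> and \<open>s\<close> alone.\<close>

lemma window_cis:
  assumes "m mod D j + W j \<le> half j \<or> half j + W j \<le> m mod D j"
  shows "1 - cos (2 * pi / 2 ^ (j + s)) \<le> cmod (1 + cis (2 * pi * real m / real (D j)))"
proof -
  define x where "x = 2 * pi * real (m mod D j) / real (D j)"
  define \<eta> where "\<eta> = 2 * pi / 2 ^ (j + s)"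
  have D0: "real (D j) > 0" using D_pos by simp
  have \<eta>W: "\<eta> = 2 * pi * real (W j) / real (D j)" using W_pos[of j] by (simp add: \<eta>_def D)
  have pih: "pi = 2 * pi * real (half j) / real (D j)" using D0 by (simp add: half)
  have "real m = real (m div D j) * real (D j) + real (m mod D j)"
    by (metis div_mult_mod_eq of_nat_add of_nat_mult)
  then have "2 * pi * real m / real (D j) = x + 2 * pi * real (m div D j)"
    using D0 by (simp add: x_def field_simps)
  then have "Re (cis (2 * pi * real m / real (D j))) = cos x"
    by (simp add: cos_add) (metis cos_int_2pin sin_int_2pin mult.commute of_int_of_nat_eq mult.right_neutral mult_zero_right diff_zero)
  moreover have "- cos x \<le> cos \<eta>"
  proof -
    have x0: "0 \<le> x" by (simp add: x_def)
    have "x \<le> 2 * pi * real (D j) / real (D j)" unfolding x_def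
      using D_pos[of j] by (intro divide_right_mono mult_left_mono) (auto intro: less_imp_le)
    then have x2: "x \<le> 2 * pi" using D0 by simp
    have "\<eta> \<le> \<bar>x - pi\<bar>"
    proof -
      have mono: "a \<le> b \<Longrightarrow> 2 * pi * real a / real (D j) \<le> 2 * pi * real b / real (D j)" for a b
        by (intro divide_right_mono mult_left_mono) auto
      from assms show ?thesis
      proof
        assume "m mod D j + W j \<le> half j"
        from mono[OF this] have "x + \<eta> \<le> pi"
          unfolding x_def \<eta>W by (subst pih) (simp add: add_divide_distrib distrib_left)
        then show ?thesis by simp
      next
        assume "half j + W j \<le> m mod D j"
        from mono[OF this] have "pi + \<eta> \<le> x"
          unfolding x_def \<eta>W by (subst pih) (simp add: add_divide_distrib distrib_left)
        then show ?thesis by simp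
      qed
    qed
    then have "cos \<bar>x - pi\<bar> \<le> cos \<eta>"
      using x0 x2 by (intro cos_monotone_0_pi_le) (auto simp: \<eta>_def)
    then show ?thesis by (simp add: cos_diff)
  qed
  ultimately show ?thesis
    using complex_Re_le_cmod[of "1 + cis (2 * pi * real m / real (D j))"] by (simp add: \<eta>_def)
qed

end

lemma rich_subset:
  assumes "rich E" "E \<subseteq> E'" shows "rich E'"
  unfolding rich_def
proof
  fix N :: "nat \<Rightarrow> nat"
  from assms(1)[unfolded rich_def, rule_format, of N] obtain A
    where "(\<forall>k. A k \<subseteq> E \<and> lower_density (A k) > 0 \<and> (\<forall>n\<in>A k. N k \<le> n)) \<and>
     (\<forall>k l. \<forall>n\<in>A k. \<forall>m\<in>A l. (k, n) \<noteq> (l, m) \<longrightarrow>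
        n \<noteq> m \<and> int (N k) \<le> \<bar>int n - int m\<bar> \<and> int (N l) \<le> \<bar>int n - int m\<bar>)" ..
  then show "\<exists>A. (\<forall>k. A k \<subseteq> E' \<and> lower_density (A k) > 0 \<and> (\<forall>n\<in>A k. N k \<le> n)) \<and>
     (\<forall>k l. \<forall>n\<in>A k. \<forall>m\<in>A l. (k, n) \<noteq> (l, m) \<longrightarrow>
        n \<noteq> m \<and> int (N k) \<le> \<bar>int n - int m\<bar> \<and> int (N l) \<le> \<bar>int n - int m\<bar>)"
    using assms(2) by (intro exI[of _ A]) (simp, blast)
qed

text \<open>The order of the quantifiers matters: \<delta> is known before the growth
  \<open>F\<close> of the scales is prescribed. The multipliers depend on \<delta>, and the scales
  are chosen in terms of their bounds.\<close>

lemma rich_blocks_windows: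
  assumes H: "2 \<le> H"
  shows "\<exists>\<delta> :: nat \<Rightarrow> real. (\<forall>j. 0 < \<delta> j) \<and> (\<forall>F. \<exists>D :: nat \<Rightarrow> nat. (\<forall>j. F j \<le> D j \<and> 0 < D j) \<and>
           rich {m \<in> blocks H. \<forall>j. \<delta> j \<le> cmod (1 + cis (2 * pi * real m / real (D j)))})"
proof -
  define s where "s = 28 * (8 * H + 9)"
  show ?thesis
  proof (intro exI[of _ "\<lambda>j. 1 - cos (2 * pi / 2 ^ (j + s))"] conjI allI)
    fix j
    have "1 \<le> j + s" by (simp add: s_def)
    then have "(2::real) ^ 1 \<le> 2 ^ (j + s)" by (intro power_increasing) auto
    then have "cos (2 * pi / 2 ^ (j + s)) < cos 0"
      by (intro cos_monotone_0_pi) (simp_all add: divide_le_eq)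
    then show "0 < 1 - cos (2 * pi / 2 ^ (j + s))" by simp
  next
    fix F :: "nat \<Rightarrow> nat"
    define W :: "nat \<Rightarrow> nat" where "W = rec_nat (2 ^ F 0) (\<lambda>j w. 2 ^ (j + s) * w * 2 ^ F (Suc j))"
    define D where "D j = 2 ^ (j + s) * W j" for j
    interpret sparse_windows H s F W D
      by standard (use H in \<open>auto simp: s_def D_def W_def\<close>)
    show "\<exists>D :: nat \<Rightarrow> nat. (\<forall>j. F j \<le> D j \<and> 0 < D j) \<and>
       rich {m \<in> blocks H. \<forall>j. 1 - cos (2 * pi / 2 ^ (j + s)) \<le> cmod (1 + cis (2 * pi * real m / real (D j)))}"
    proof (intro exI[of _ D] conjI allI F_le_D D_pos)
      show "rich {m \<in> blocks H. \<forall>j. 1 - cos (2 * pi / 2 ^ (j + s)) \<le> cmod (1 + cis (2 * pi * real m / real (D j)))}"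
        by (rule rich_subset[OF rich_windows]) (use window_cis in auto)
    qed
  qed
qed

lemma rich_blocks:
  assumes H: "2 \<le> H" shows "rich (blocks H)"
proof -
  obtain \<delta> :: "nat \<Rightarrow> real" where "\<forall>F. \<exists>D :: nat \<Rightarrow> nat. (\<forall>j. F j \<le> D j \<and> 0 < D j) \<and>
      rich {m \<in> blocks H. \<forall>j. \<delta> j \<le> cmod (1 + cis (2 * pi * real m / real (D j)))}"
    using rich_blocks_windows[OF H] by (elim exE conjE)
  from this[THEN spec, of "\<lambda>_. 0"] show ?thesis by (elim exE conjE rich_subset) auto
qed

section \<open>A criterion for disjoint frequent hypercyclicity\<close>

text \<open>Majorants are applied in this form: holomorphy supplies the continuity that
  \<open>L2_bounded\<close> asks for.\<close>

lemma L2_bounded_holomorphic: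
  assumes "F holomorphic_on unit_disc" "L2_bounded v C" "\<And>z. z \<in> unit_disc \<Longrightarrow> cmod (F z) \<le> v z" "C \<le> C'"
  shows "L2_bounded (\<lambda>z. cmod (F z)) C'"
  using assms by (intro L2_bounded_mono[OF assms(2)]) (auto intro!: continuous_intros holomorphic_on_imp_continuous_on)

lemma L2_bounded_weaken: "L2_bounded v C \<Longrightarrow> C \<le> C' \<Longrightarrow> L2_bounded v C'"
  by (force simp: L2_bounded_def)

lemma iterate_in_disc:
  assumes "g ` unit_disc \<subseteq> unit_disc" shows "z \<in> unit_disc \<Longrightarrow> (g ^^ n) z \<in> unit_disc"
  using assms by (induction n) (simp_all only: image_subset_iff funpow.simps id_apply o_apply)

lemma holomorphic_iterate:
  assumes g: "g ` unit_disc \<subseteq> unit_disc" "g holomorphic_on unit_disc"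
  shows "(g ^^ n) holomorphic_on unit_disc"
proof (induction n)
  case 0
  then show ?case by (simp add: id_def)
next
  case (Suc n)
  have "(g \<circ> (g ^^ n)) holomorphic_on unit_disc"
    by (rule holomorphic_on_compose_gen[OF Suc g(2)]) (use iterate_in_disc[OF g(1)] in blast)
  then show ?case by (simp add: o_def)
qed

lemma holomorphic_iterate_compose:
  assumes g: "g ` unit_disc \<subseteq> unit_disc" "g holomorphic_on unit_disc" and F: "F holomorphic_on unit_disc"
  shows "(\<lambda>z. F ((g ^^ n) z)) holomorphic_on unit_disc"
proof -
  have "(F \<circ> (g ^^ n)) holomorphic_on unit_disc"
    by (rule holomorphic_on_compose_gen[OF holomorphic_iterate[OF g] F]) (use iterate_in_disc[OF g(1)] in blast)
  then show ?thesis by (simp add: o_def)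
qed

text \<open>\<open>y n\<close> is meant to produce \<open>u\<close> at time \<open>n\<close> and to
  disturb little at times far from \<open>n\<close>. Arbitrary finite \<open>J\<close> take the
  place of unconditional convergence. Time 0 is added because it stands for the vector itself, whose
  series has to converge.\<close>

definition tracks :: "(complex \<Rightarrow> complex) \<Rightarrow> nat set \<Rightarrow> (complex \<Rightarrow> complex) \<Rightarrow> (nat \<Rightarrow> complex \<Rightarrow> complex) \<Rightarrow> bool" where
  "tracks g E u y \<longleftrightarrow> (\<forall>e>0. \<exists>N.
     (\<forall>m\<in>E. N \<le> m \<longrightarrow> L2_bounded (\<lambda>z. cmod (y m ((g ^^ m) z) - u z)) e) \<and>
     (\<forall>m\<in>insert 0 E. \<forall>J. finite J \<longrightarrow> J \<subseteq> E \<longrightarrow> (\<forall>n\<in>J. int N \<le> \<bar>int n - int m\<bar>) \<longrightarrow>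
        L2_bounded (\<lambda>z. cmod (\<Sum>n\<in>J. y n ((g ^^ m) z))) e))"

text \<open>Along the orbit of the other symbol even the term \<open>n = m\<close> has to be small,
  so the threshold concerns \<open>max m n\<close> instead of
  \<open>\<bar>n - m\<bar>\<close>.\<close>

definition vanishes :: "(complex \<Rightarrow> complex) \<Rightarrow> nat set \<Rightarrow> (nat \<Rightarrow> complex \<Rightarrow> complex) \<Rightarrow> bool" where
  "vanishes g E y \<longleftrightarrow> (\<forall>e>0. \<exists>N. \<forall>m\<in>insert 0 E. \<forall>J. finite J \<longrightarrow> J \<subseteq> E \<longrightarrow> (\<forall>n\<in>J. N \<le> max m n) \<longrightarrow>
        L2_bounded (\<lambda>z. cmod (\<Sum>n\<in>J. y n ((g ^^ m) z))) e)"

definition steers :: "(complex \<Rightarrow> complex) \<Rightarrow> (complex \<Rightarrow> complex) \<Rightarrow> nat set \<Rightarrow> bool" where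
  "steers g g' E \<longleftrightarrow> (\<forall>p e. 0 < e \<longrightarrow> (\<exists>u y. u holomorphic_on unit_disc \<and>
     L2_bounded (\<lambda>z. cmod (poly p z - u z)) e \<and> (\<forall>n. y n holomorphic_on unit_disc) \<and>
     tracks g E u y \<and> vanishes g' E y))"

text \<open>The targets are pairs of balls of equal radius;
  \<open>disjointly_frequently_hypercyclic_iff\<close> passes to open sets of the product.\<close>

definition hypercyclic_pair :: "(complex \<Rightarrow> complex) \<Rightarrow> (complex \<Rightarrow> complex) \<Rightarrow> bool" where
  "hypercyclic_pair g1 g2 \<longleftrightarrow> (\<exists>f\<in>hardy2. \<forall>h1\<in>hardy2. \<forall>h2\<in>hardy2. \<forall>e>0.
     0 < lower_density {n. L2_bounded (\<lambda>z. cmod (f ((g1 ^^ n) z) - h1 z)) e \<and>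
                           L2_bounded (\<lambda>z. cmod (f ((g2 ^^ n) z) - h2 z)) e})"

lemma tracks_vanishes_add:
  assumes t: "tracks g E u y" and v: "vanishes g E y'" and e: "0 < e"
    and y: "\<And>n. y n holomorphic_on unit_disc" "\<And>n. y' n holomorphic_on unit_disc" and u: "u holomorphic_on unit_disc"
    and g: "g ` unit_disc \<subseteq> unit_disc" "g holomorphic_on unit_disc"
  shows "\<exists>N. \<forall>M\<ge>N. (\<forall>m\<in>E. M \<le> m \<longrightarrow> L2_bounded (\<lambda>z. cmod (y m ((g ^^ m) z) + y' m ((g ^^ m) z) - u z)) e) \<and>
     (\<forall>m\<in>insert 0 E. \<forall>J. finite J \<longrightarrow> J \<subseteq> E \<longrightarrow> (\<forall>n\<in>J. int M \<le> \<bar>int n - int m\<bar>) \<longrightarrow>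
        L2_bounded (\<lambda>z. cmod (\<Sum>n\<in>J. y n ((g ^^ m) z) + y' n ((g ^^ m) z))) e)"
proof -
  have e2: "0 < e / 2" using e by simp
  from t e2 obtain N1 where N1: "\<And>m. m \<in> E \<Longrightarrow> N1 \<le> m \<Longrightarrow> L2_bounded (\<lambda>z. cmod (y m ((g ^^ m) z) - u z)) (e / 2)"
    "\<And>m J. m \<in> insert 0 E \<Longrightarrow> finite J \<Longrightarrow> J \<subseteq> E \<Longrightarrow> (\<forall>n\<in>J. int N1 \<le> \<bar>int n - int m\<bar>) \<Longrightarrow>
        L2_bounded (\<lambda>z. cmod (\<Sum>n\<in>J. y n ((g ^^ m) z))) (e / 2)"
    unfolding tracks_def by meson
  from v e2 obtain N2 where N2: "\<And>m J. m \<in> insert 0 E \<Longrightarrow> finite J \<Longrightarrow> J \<subseteq> E \<Longrightarrow> (\<forall>n\<in>J. N2 \<le> max m n) \<Longrightarrow>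
        L2_bounded (\<lambda>z. cmod (\<Sum>n\<in>J. y' n ((g ^^ m) z))) (e / 2)"
    unfolding vanishes_def by meson
  have hol: "(\<lambda>z. y n ((g ^^ m) z)) holomorphic_on unit_disc" "(\<lambda>z. y' n ((g ^^ m) z)) holomorphic_on unit_disc" for n m
    using holomorphic_iterate_compose[OF g] y by auto
  show ?thesis
  proof (intro exI[of _ "max N1 N2"] allI impI conjI ballI)
    fix M m assume M: "max N1 N2 \<le> M" and m: "m \<in> E" "M \<le> m"
    have "L2_bounded (\<lambda>z. cmod (y m ((g ^^ m) z) - u z) + cmod (\<Sum>n\<in>{m}. y' n ((g ^^ m) z))) (e / 2 + e / 2)"
      using M m by (intro L2_bounded_add N1(1) N2) auto
    then show "L2_bounded (\<lambda>z. cmod (y m ((g ^^ m) z) + y' m ((g ^^ m) z) - u z)) e"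
    proof (rule L2_bounded_holomorphic[rotated])
      show "cmod (y m ((g ^^ m) z) + y' m ((g ^^ m) z) - u z) \<le> cmod (y m ((g ^^ m) z) - u z) + cmod (\<Sum>n\<in>{m}. y' n ((g ^^ m) z))" for z
        using norm_triangle_ineq[of "y m ((g ^^ m) z) - u z" "y' m ((g ^^ m) z)"] by (simp add: algebra_simps)
    qed (auto intro!: holomorphic_intros hol u)
  next
    fix M m J assume M: "max N1 N2 \<le> M" and m: "m \<in> insert 0 E" and J: "finite J" "J \<subseteq> E" "\<forall>n\<in>J. int M \<le> \<bar>int n - int m\<bar>"
    have "L2_bounded (\<lambda>z. cmod (\<Sum>n\<in>J. y n ((g ^^ m) z)) + cmod (\<Sum>n\<in>J. y' n ((g ^^ m) z))) (e / 2 + e / 2)"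
      using M m J by (intro L2_bounded_add N1(2) N2) force+
    then show "L2_bounded (\<lambda>z. cmod (\<Sum>n\<in>J. y n ((g ^^ m) z) + y' n ((g ^^ m) z))) e"
    proof (rule L2_bounded_holomorphic[rotated])
      show "cmod (\<Sum>n\<in>J. y n ((g ^^ m) z) + y' n ((g ^^ m) z)) \<le> cmod (\<Sum>n\<in>J. y n ((g ^^ m) z)) + cmod (\<Sum>n\<in>J. y' n ((g ^^ m) z))" for z
        by (simp add: sum.distrib norm_triangle_ineq)
    qed (auto intro!: holomorphic_intros hol)
  qed
qed

lemma sum_half_powers: "(\<Sum>k\<le>j. (1 / 2 :: real) ^ k) \<le> 2"
proof -
  have "(\<Sum>k\<le>j. (1 / 2 :: real) ^ k) = 2 - (1 / 2) ^ j"
    by (induction j) auto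
  then show ?thesis by simp
qed

text \<open>The vector is the sum of \<open>x k n\<close> over all \<open>k\<close> and all
  \<open>n\<close> in \<open>A k\<close>. At a time of the group \<open>l\<close>, the group
  \<open>k\<close> contributes at most \<open>(1 / 2) ^ (k + l)\<close> apart from the intended
  term, so the error there is of order \<open>(1 / 2) ^ l\<close>.\<close>

theorem hypercyclic_pair_criterion:
  assumes g1: "g1 ` unit_disc \<subseteq> unit_disc" "g1 holomorphic_on unit_disc"
    and g2: "g2 ` unit_disc \<subseteq> unit_disc" "g2 holomorphic_on unit_disc"
    and E: "rich E" and s1: "steers g1 g2 E" and s2: "steers g2 g1 E"
  shows "hypercyclic_pair g1 g2"
proof -
  obtain q :: "nat \<Rightarrow> complex poly" where q: "\<And>f e. f \<in> hardy2 \<Longrightarrow> 0 < e \<Longrightarrow> \<exists>k. L2_bounded (\<lambda>z. cmod (f z - poly (q k) z)) e"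
    using hardy2_polynomials_dense by blast
  \<comment> \<open>The second component of the decoded \<open>k\<close> carries no target: it makes
    every pair of polynomials occur for arbitrarily large \<open>k\<close>, hence with arbitrary
    accuracy.\<close>
  define p1 where "p1 k = q (fst (prod_decode (fst (prod_decode k))))" for k
  define p2 where "p2 k = q (snd (prod_decode (fst (prod_decode k))))" for k
  have "\<forall>k. \<exists>u y. u holomorphic_on unit_disc \<and> L2_bounded (\<lambda>z. cmod (poly (p1 k) z - u z)) ((1 / 2) ^ k) \<and>
      (\<forall>n. y n holomorphic_on unit_disc) \<and> tracks g1 E u y \<and> vanishes g2 E y"
    using s1 unfolding steers_def by (meson zero_less_power half_gt_zero zero_less_one)
  then obtain u1 y1 where u1: "\<And>k. u1 k holomorphic_on unit_disc"
      "\<And>k. L2_bounded (\<lambda>z. cmod (poly (p1 k) z - u1 k z)) ((1 / 2) ^ k)"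
      "\<And>k n. y1 k n holomorphic_on unit_disc" "\<And>k. tracks g1 E (u1 k) (y1 k)" "\<And>k. vanishes g2 E (y1 k)"
    by metis
  have "\<forall>k. \<exists>u y. u holomorphic_on unit_disc \<and> L2_bounded (\<lambda>z. cmod (poly (p2 k) z - u z)) ((1 / 2) ^ k) \<and>
      (\<forall>n. y n holomorphic_on unit_disc) \<and> tracks g2 E u y \<and> vanishes g1 E y"
    using s2 unfolding steers_def by (meson zero_less_power half_gt_zero zero_less_one)
  then obtain u2 y2 where u2: "\<And>k. u2 k holomorphic_on unit_disc"
      "\<And>k. L2_bounded (\<lambda>z. cmod (poly (p2 k) z - u2 k z)) ((1 / 2) ^ k)"
      "\<And>k n. y2 k n holomorphic_on unit_disc" "\<And>k. tracks g2 E (u2 k) (y2 k)" "\<And>k. vanishes g1 E (y2 k)"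
    by metis
  define x where "x k n z = y1 k n z + y2 k n z" for k n z
  define G where "G i = (if i then g1 else g2)" for i :: bool
  define u where "u i = (if i then u1 else u2)" for i :: bool
  define p where "p i = (if i then p1 else p2)" for i :: bool
  have G: "G i ` unit_disc \<subseteq> unit_disc" "G i holomorphic_on unit_disc" for i
    using g1 g2 by (auto simp: G_def)
  have u: "u i k holomorphic_on unit_disc" "L2_bounded (\<lambda>z. cmod (poly (p i k) z - u i k z)) ((1 / 2) ^ k)" for i k
    using u1 u2 by (auto simp: u_def p_def)
  have x: "x k n holomorphic_on unit_disc" for k n
    unfolding x_def by (intro holomorphic_intros u1 u2)
  have xG: "(\<lambda>z. x k n ((G i ^^ m) z)) holomorphic_on unit_disc" for k n i m
    by (intro holomorphic_iterate_compose G x)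
  define good where "good i k e M \<longleftrightarrow> (\<forall>m\<in>E. M \<le> m \<longrightarrow> L2_bounded (\<lambda>z. cmod (x k m ((G i ^^ m) z) - u i k z)) e) \<and>
     (\<forall>m\<in>insert 0 E. \<forall>J. finite J \<longrightarrow> J \<subseteq> E \<longrightarrow> (\<forall>n\<in>J. int M \<le> \<bar>int n - int m\<bar>) \<longrightarrow>
        L2_bounded (\<lambda>z. cmod (\<Sum>n\<in>J. x k n ((G i ^^ m) z))) e)" for i k e M
  have ex: "\<exists>N. \<forall>M\<ge>N. good i k e M" if "0 < e" for i k e
  proof (cases i)
    case True
    then show ?thesis
      using tracks_vanishes_add[OF u1(4)[of k] u2(5)[of k] that u1(3) u2(3) u1(1) g1]
      by (simp add: good_def x_def G_def u_def)
  next
    case False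
    then show ?thesis
      using tracks_vanishes_add[OF u2(4)[of k] u1(5)[of k] that u2(3) u1(3) u2(1) g2]
      by (simp add: good_def x_def G_def u_def add.commute)
  qed
  define N0 where "N0 i k e = (SOME N. \<forall>M\<ge>N. good i k e M)" for i k e
  have N0: "good i k e M" if "0 < e" "N0 i k e \<le> M" for i k e M
    using someI_ex[OF ex[OF that(1)], of i k] that(2) unfolding N0_def by blast
  \<comment> \<open>Dominates the thresholds of all pairs \<open>k\<close>, \<open>l\<close> up to
    \<open>j\<close>, so a separation by \<open>max (N k) (N l)\<close> suffices for the accuracy
    \<open>(1 / 2) ^ (k + l)\<close>.\<close>
  define N where "N j = (\<Sum>k\<le>j. \<Sum>l\<le>j. N0 True k ((1 / 2) ^ (k + l)) + N0 False k ((1 / 2) ^ (k + l)))" for j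
  have NN0: "N0 i k ((1 / 2) ^ (k + l)) \<le> N j" if "k \<le> j" "l \<le> j" for i k l j
  proof -
    have "N0 i k ((1 / 2) ^ (k + l)) \<le> N0 True k ((1 / 2) ^ (k + l)) + N0 False k ((1 / 2) ^ (k + l))"
      by (cases i) auto
    also have "\<dots> \<le> (\<Sum>l\<le>j. N0 True k ((1 / 2) ^ (k + l)) + N0 False k ((1 / 2) ^ (k + l)))"
      using that by (intro member_le_sum) auto
    also have "\<dots> \<le> N j" unfolding N_def
      using that by (intro member_le_sum[of k "{..j}" "\<lambda>k. \<Sum>l\<le>j. N0 True k ((1 / 2) ^ (k + l)) + N0 False k ((1 / 2) ^ (k + l))"]) auto
    finally show ?thesis .
  qed
  from E[unfolded rich_def, THEN spec, of N] obtain A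
    where A': "(\<forall>k. A k \<subseteq> E \<and> 0 < lower_density (A k) \<and> (\<forall>n\<in>A k. N k \<le> n)) \<and>
      (\<forall>k l. \<forall>n\<in>A k. \<forall>m\<in>A l. (k, n) \<noteq> (l, m) \<longrightarrow>
        n \<noteq> m \<and> int (N k) \<le> \<bar>int n - int m\<bar> \<and> int (N l) \<le> \<bar>int n - int m\<bar>)" ..
  have A: "A k \<subseteq> E" "0 < lower_density (A k)" "n \<in> A k \<Longrightarrow> N k \<le> n" for k n
    using A'[THEN conjunct1] by auto
  have sep: "int (N k) \<le> \<bar>int n - int m\<bar> \<and> int (N l) \<le> \<bar>int n - int m\<bar>"
    if "n \<in> A k" "m \<in> A l" "(k, n) \<noteq> (l, m)" for k l n m
    using A'[THEN conjunct2, rule_format, OF that] by simp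
  have group: "L2_bounded (\<lambda>z. cmod (\<Sum>n\<in>J. x k n ((G i ^^ m) z))) ((1 / 2) ^ (k + l))"
    if "m \<in> A l" "finite J" "J \<subseteq> A k" "\<And>n. n \<in> J \<Longrightarrow> (k, n) \<noteq> (l, m)" for i k l m J
  proof -
    have "good i k ((1 / 2) ^ (k + l)) (max (N k) (N l))"
    proof (rule N0)
      show "N0 i k ((1 / 2) ^ (k + l)) \<le> max (N k) (N l)"
        using NN0[of k l l i] NN0[of k k l i] by (cases "k \<le> l") (auto simp: le_max_iff_disj)
    qed simp
    moreover have "\<forall>n\<in>J. int (max (N k) (N l)) \<le> \<bar>int n - int m\<bar>"
      using sep that by fastforce
    moreover have "m \<in> insert 0 E" "J \<subseteq> E" using A(1) that by auto
    ultimately show ?thesis using that unfolding good_def by blast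
  qed
  have group0: "L2_bounded (\<lambda>z. cmod (\<Sum>n\<in>J. x k n z)) e"
    if "0 < e" "finite J" "J \<subseteq> A k" "\<And>n. n \<in> J \<Longrightarrow> N0 True k e \<le> n" for k J e
  proof -
    have "good True k e (N0 True k e)" using that by (intro N0) auto
    moreover have "\<forall>n\<in>J. int (N0 True k e) \<le> \<bar>int n - int 0\<bar>" using that by auto
    moreover have "J \<subseteq> E" using A(1) that by auto
    ultimately have "L2_bounded (\<lambda>z. cmod (\<Sum>n\<in>J. x k n ((G True ^^ 0) z))) e"
      using that unfolding good_def by blast
    then show ?thesis by simp
  qed
  \<comment> \<open>Diagonal partial sums: groups and times up to \<open>j\<close> enter
    simultaneously, which keeps every sum finite.\<close>
  define S where "S j z = (\<Sum>k\<le>j. \<Sum>n\<in>A k \<inter> {..j}. x k n z)" for j z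
  have S: "S j holomorphic_on unit_disc" for j
    unfolding S_def by (intro holomorphic_intros x)
  have Cauchy: "\<exists>M. \<forall>i\<ge>M. \<forall>j\<ge>i. L2_bounded (\<lambda>z. cmod (S j z - S i z)) e" if e: "0 < e" for e
  proof -
    \<comment> \<open>Groups with \<open>k > K\<close> are summably small whatever the times are;
      the finitely many others are handled by taking \<open>i\<close> beyond their thresholds for
      the accuracy \<delta>, so that together they give \<open>e / 2\<close>.\<close>
    obtain K where K: "(1 / 2 :: real) ^ K < e / 4" using e real_arch_pow_inv[of "e / 4" "1 / 2"] by auto
    define \<delta> where "\<delta> = e / (2 * (real K + 1))"
    have \<delta>: "0 < \<delta>" using e by (simp add: \<delta>_def)
    define M where "M = K + (\<Sum>k\<le>K. N0 True k \<delta>)"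
    show ?thesis
    proof (intro exI[of _ M] allI impI)
      fix i j assume i: "M \<le> i" and j: "i \<le> j"
      define B where "B k = {n \<in> A k. n \<le> j \<and> (i < k \<or> i < n)}" for k
      define c where "c k = (if k \<le> K then \<delta> else (1 / 2) ^ K * (1 / 2) ^ k)" for k
      have Bk: "finite (B k)" "B k \<subseteq> A k" for k by (auto simp: B_def)
      have "L2_bounded (\<lambda>z. cmod (\<Sum>n\<in>B k. x k n z)) (c k)" if "k \<le> j" for k
      proof (cases "k \<le> K")
        case True
        have "N0 True k \<delta> \<le> (\<Sum>k\<le>K. N0 True k \<delta>)"
          using True by (intro member_le_sum[of k "{..K}" "\<lambda>k. N0 True k \<delta>"]) auto
        then have "N0 True k \<delta> \<le> i" "k \<le> i" using True i by (auto simp: M_def)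
        then have "L2_bounded (\<lambda>z. cmod (\<Sum>n\<in>B k. x k n z)) \<delta>"
          by (intro group0 \<delta> Bk) (auto simp: B_def)
        then show ?thesis using True by (simp add: c_def)
      next
        case False
        have "L2_bounded (\<lambda>z. cmod (\<Sum>n\<in>B k. x k n z)) ((1 / 2) ^ (k + k))"
          using A(3)[of _ k] NN0[of k k k True] Bk by (intro group0) (auto intro: order.trans simp: B_def)
        moreover have "(1 / 2 :: real) ^ (k + k) \<le> (1 / 2) ^ K * (1 / 2) ^ k"
          using False by (simp add: power_add power_decreasing)
        ultimately show ?thesis
          using False by (auto simp: c_def intro: L2_bounded_weaken)
      qed
      then have bound: "L2_bounded (\<lambda>z. \<Sum>k\<le>j. cmod (\<Sum>n\<in>B k. x k n z)) (\<Sum>k\<le>j. c k)"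
        by (intro L2_bounded_sum) auto
      have "(\<Sum>k\<le>j. c k) \<le> (\<Sum>k\<le>j. (if k \<le> K then \<delta> else 0) + (1 / 2) ^ K * (1 / 2) ^ k)"
        by (intro sum_mono) (auto simp: c_def)
      also have "\<dots> = (\<Sum>k\<le>j. if k \<le> K then \<delta> else 0) + (1 / 2) ^ K * (\<Sum>k\<le>j. (1 / 2) ^ k)"
        by (simp add: sum.distrib sum_distrib_left)
      also have "(\<Sum>k\<le>j. if k \<le> K then \<delta> else 0) = (\<Sum>k\<in>{..j} \<inter> {..K}. \<delta>)"
        by (subst sum.inter_restrict) (auto intro!: sum.cong)
      also have "\<dots> \<le> (\<Sum>k\<le>K. \<delta>)" using \<delta> by (intro sum_mono2) auto
      also have "\<dots> = e / 2" by (simp add: \<delta>_def field_simps)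
      also have "(1 / 2 :: real) ^ K * (\<Sum>k\<le>j. (1 / 2) ^ k) \<le> (e / 4) * 2"
        using K sum_half_powers e by (intro mult_mono) (auto intro: sum_nonneg)
      finally have le: "(\<Sum>k\<le>j. c k) \<le> e" by simp
      have "S j z - S i z = (\<Sum>k\<le>j. \<Sum>n\<in>B k. x k n z)" for z
      proof -
        have "S i z = (\<Sum>k\<le>j. \<Sum>n\<in>(if k \<le> i then A k \<inter> {..i} else {}). x k n z)"
        proof -
          have "S i z = (\<Sum>k\<in>{..j} \<inter> {..i}. \<Sum>n\<in>A k \<inter> {..i}. x k n z)"
            using j by (simp add: S_def Int_absorb1)
          also have "\<dots> = (\<Sum>k\<le>j. if k \<in> {..i} then \<Sum>n\<in>A k \<inter> {..i}. x k n z else 0)"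
            by (rule sum.inter_restrict) simp
          also have "\<dots> = (\<Sum>k\<le>j. \<Sum>n\<in>(if k \<le> i then A k \<inter> {..i} else {}). x k n z)"
            by (rule sum.cong) auto
          finally show ?thesis .
        qed
        moreover have "(\<Sum>n\<in>A k \<inter> {..j}. x k n z) - (\<Sum>n\<in>(if k \<le> i then A k \<inter> {..i} else {}). x k n z) = (\<Sum>n\<in>B k. x k n z)" for k
        proof -
          have *: "B k = A k \<inter> {..j} - (if k \<le> i then A k \<inter> {..i} else {})" using j by (auto simp: B_def)
          show ?thesis unfolding * by (rule sum_diff[symmetric]) (use j in auto)
        qed
        ultimately show ?thesis by (simp add: S_def flip: sum_subtractf)
      qed
      then have "cmod (S j z - S i z) \<le> (\<Sum>k\<le>j. cmod (\<Sum>n\<in>B k. x k n z))" for z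
        by (simp add: norm_sum)
      then show "L2_bounded (\<lambda>z. cmod (S j z - S i z)) e"
        using bound le by (intro L2_bounded_holomorphic[OF _ bound]) (auto intro!: holomorphic_intros S)
    qed
  qed
  \<comment> \<open>Instead of completeness of the Hardy space: point evaluations turn the Cauchy
    property into locally uniform convergence, and \<open>L2_bounded_limit\<close> carries the
    bounds over to the limit.\<close>
  have unif: "uniformly_convergent_on K S" if K: "compact K" "K \<subseteq> unit_disc" for K
  proof (rule Cauchy_uniformly_convergent)
    obtain r where r: "r < 1" "\<And>z. z \<in> K \<Longrightarrow> cmod z \<le> r" "0 \<le> r"
    proof (cases "K = {}")
      case True
      then show ?thesis using that[of 0] by simp
    next
      case False
      have "continuous_on K cmod" by (intro continuous_intros)
      with K False obtain w where "w \<in> K" "\<And>z. z \<in> K \<Longrightarrow> cmod z \<le> cmod w"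
        using continuous_attains_sup[of K cmod] by blast
      then show ?thesis using that[of "cmod w"] K by auto
    qed
    have r2: "0 < sqrt (1 - r\<^sup>2)" using r by (simp add: abs_square_less_1)
    show "uniformly_Cauchy_on K S"
    proof (rule uniformly_Cauchy_onI')
      fix e :: real assume e: "0 < e"
      obtain M where M: "\<And>i j. M \<le> i \<Longrightarrow> i \<le> j \<Longrightarrow> L2_bounded (\<lambda>z. cmod (S j z - S i z)) (e / 2 * sqrt (1 - r\<^sup>2))"
        using Cauchy[of "e / 2 * sqrt (1 - r\<^sup>2)"] e r2 by auto
      show "\<exists>M. \<forall>z\<in>K. \<forall>m\<ge>M. \<forall>n>m. dist (S m z) (S n z) < e"
      proof (intro exI[of _ M] ballI allI impI)
        fix z m n assume z: "z \<in> K" and mn: "M \<le> m" "m < n"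
        have zD: "z \<in> unit_disc" using z K by auto
        have "cmod (S n z - S m z) \<le> e / 2 * sqrt (1 - r\<^sup>2) / sqrt (1 - (cmod z)\<^sup>2)"
          using mn by (intro point_evaluation_bound[OF _ M zD]) (auto intro!: holomorphic_intros S)
        also have "\<dots> \<le> e / 2 * sqrt (1 - r\<^sup>2) / sqrt (1 - r\<^sup>2)"
          using r r2 z e norm_square_less_one[OF zD] by (intro divide_left_mono) (auto intro!: power_mono mult_pos_pos)
        also have "\<dots> = e / 2" using r2 by simp
        also have "\<dots> < e" using e by simp
        finally show "dist (S m z) (S n z) < e" by (simp add: dist_norm norm_minus_commute)
      qed
    qed
  qed
  define f where "f z = (if z \<in> unit_disc then lim (\<lambda>j. S j z) else 0)" for z
  have lim: "uniform_limit K S f sequentially" if K: "compact K" "K \<subseteq> unit_disc" for K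
  proof -
    have "uniform_limit K S (\<lambda>z. lim (\<lambda>j. S j z)) sequentially"
      using unif[OF K] by (simp add: uniformly_convergent_uniform_limit_iff)
    then show ?thesis
      using uniform_limit_cong'[of K S S "\<lambda>z. lim (\<lambda>j. S j z)" f sequentially] subsetD[OF K(2)]
      by (simp add: f_def)
  qed
  have f: "f holomorphic_on unit_disc"
  proof (rule holomorphic_uniform_sequence[OF open_ball S])
    fix z :: complex assume "z \<in> unit_disc"
    then obtain d where "d > 0" "cball z d \<subseteq> unit_disc" using open_contains_cball by blast
    then show "\<exists>d>0. cball z d \<subseteq> unit_disc \<and> uniform_limit (cball z d) S f sequentially"
      using lim by auto
  qed
  have limit_bound: "L2_bounded (\<lambda>z. cmod (f ((G i ^^ m) z) - v z)) C"
    if "\<And>j. J \<le> j \<Longrightarrow> L2_bounded (\<lambda>z. cmod (S j ((G i ^^ m) z) - v z)) C" and v: "v holomorphic_on unit_disc" for i m v C J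
  proof (rule L2_bounded_limit[where u = "\<lambda>j z. cmod (S (j + J) ((G i ^^ m) z) - v z)"])
    show "continuous_on unit_disc (\<lambda>z. cmod (f ((G i ^^ m) z) - v z))"
      by (intro continuous_intros holomorphic_on_imp_continuous_on holomorphic_iterate_compose G f v)
    fix K :: "complex set" assume K: "compact K" "K \<subseteq> unit_disc"
    have "compact ((G i ^^ m) ` K)" "(G i ^^ m) ` K \<subseteq> unit_disc"
      using K iterate_in_disc[OF G(1)[of i]]
      by (auto intro!: compact_continuous_image holomorphic_on_imp_continuous_on
          intro: holomorphic_on_subset[OF holomorphic_iterate[OF G]])
    then have "uniform_limit ((G i ^^ m) ` K) S f sequentially" by (rule lim)
    then have "uniform_limit ((G i ^^ m) ` K) (\<lambda>j. S (j + J)) f sequentially"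
      unfolding uniform_limit_sequentially_iff by (meson trans_le_add1)
    then show "uniform_limit K (\<lambda>j z. cmod (S (j + J) ((G i ^^ m) z) - v z)) (\<lambda>z. cmod (f ((G i ^^ m) z) - v z)) sequentially"
      unfolding uniform_limit_iff
    proof (intro allI impI)
      fix e :: real assume "0 < e" and *: "\<forall>e>0. \<forall>\<^sub>F j in sequentially. \<forall>z\<in>(G i ^^ m) ` K. dist (S (j + J) z) (f z) < e"
      then have "\<forall>\<^sub>F j in sequentially. \<forall>z\<in>(G i ^^ m) ` K. dist (S (j + J) z) (f z) < e" by blast
      then show "\<forall>\<^sub>F j in sequentially. \<forall>z\<in>K. dist (cmod (S (j + J) ((G i ^^ m) z) - v z)) (cmod (f ((G i ^^ m) z) - v z)) < e"
      proof (rule eventually_mono, intro ballI)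
        fix j z assume "\<forall>z\<in>(G i ^^ m) ` K. dist (S (j + J) z) (f z) < e" "z \<in> K"
        then have "dist (S (j + J) ((G i ^^ m) z)) (f ((G i ^^ m) z)) < e" by blast
        then show "dist (cmod (S (j + J) ((G i ^^ m) z) - v z)) (cmod (f ((G i ^^ m) z) - v z)) < e"
          using norm_triangle_ineq3[of "S (j + J) ((G i ^^ m) z) - v z" "f ((G i ^^ m) z) - v z"]
          by (simp add: dist_norm)
      qed
    qed
  qed (use that in auto)
  have "f \<in> hardy2"
  proof -
    have "L2_bounded (\<lambda>z. cmod (S j z)) 2" for j
    proof -
      have "L2_bounded (\<lambda>z. cmod (\<Sum>n\<in>A k \<inter> {..j}. x k n z)) ((1 / 2) ^ k)" for k
      proof (rule L2_bounded_weaken)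
        show "L2_bounded (\<lambda>z. cmod (\<Sum>n\<in>A k \<inter> {..j}. x k n z)) ((1 / 2) ^ (k + k))"
          using A(3)[of _ k] NN0[of k k k True] by (intro group0) (auto intro: order.trans)
      qed (auto intro!: power_decreasing)
      then have "L2_bounded (\<lambda>z. \<Sum>k\<le>j. cmod (\<Sum>n\<in>A k \<inter> {..j}. x k n z)) (\<Sum>k\<le>j. (1 / 2) ^ k)"
        by (intro L2_bounded_sum) auto
      then show ?thesis
        by (rule L2_bounded_holomorphic[OF S _ _ sum_half_powers]) (simp add: S_def norm_sum)
    qed
    then have "L2_bounded (\<lambda>z. cmod (f ((G True ^^ 0) z) - 0)) 2"
      by (intro limit_bound[where J = 0]) auto
    then show ?thesis
      using f by (intro hardy2I(1)) (auto simp: f_def)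
  qed
  \<comment> \<open>The constant 3: one part for the term meant for the time \<open>m\<close>, two
    for the sum over all groups.\<close>
  have main: "L2_bounded (\<lambda>z. cmod (f ((G i ^^ m) z) - u i l z)) (3 * (1 / 2) ^ l)" if m: "m \<in> A l" for i l m
  proof (rule limit_bound[where J = "max l m"])
    fix j assume j: "max l m \<le> j"
    define B where "B k = A k \<inter> {..j} - (if k = l then {m} else {})" for k
    have "L2_bounded (\<lambda>z. cmod (\<Sum>n\<in>B k. x k n ((G i ^^ m) z))) ((1 / 2) ^ (k + l))" for k
      by (rule group[OF m]) (auto simp: B_def split: if_splits)
    then have b1: "L2_bounded (\<lambda>z. \<Sum>k\<le>j. cmod (\<Sum>n\<in>B k. x k n ((G i ^^ m) z))) (\<Sum>k\<le>j. (1 / 2) ^ (k + l))"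
      by (intro L2_bounded_sum) auto
    have "good i l ((1 / 2) ^ (l + l)) (N l)"
      using NN0[of l l l i] by (intro N0) auto
    then have b2: "L2_bounded (\<lambda>z. cmod (x l m ((G i ^^ m) z) - u i l z)) ((1 / 2) ^ (l + l))"
      using m A(1)[of l] A(3)[OF m] unfolding good_def by auto
    have le: "(1 / 2) ^ (l + l) + (\<Sum>k\<le>j. (1 / 2) ^ (k + l)) \<le> 3 * (1 / 2 :: real) ^ l"
    proof -
      have "(\<Sum>k\<le>j. (1 / 2 :: real) ^ (k + l)) = (1 / 2) ^ l * (\<Sum>k\<le>j. (1 / 2) ^ k)"
        by (simp add: power_add sum_distrib_left mult.commute)
      also have "\<dots> \<le> (1 / 2) ^ l * 2" by (intro mult_left_mono sum_half_powers) auto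
      finally have "(\<Sum>k\<le>j. (1 / 2 :: real) ^ (k + l)) \<le> (1 / 2) ^ l * 2" .
      moreover have "(1 / 2 :: real) ^ (l + l) \<le> (1 / 2) ^ l" by (intro power_decreasing) auto
      ultimately show ?thesis by linarith
    qed
    have eq: "S j z = x l m z + (\<Sum>k\<le>j. \<Sum>n\<in>B k. x k n z)" for z
    proof -
      have "(\<Sum>n\<in>A k \<inter> {..j}. x k n z) = (if k = l then x l m z else 0) + (\<Sum>n\<in>B k. x k n z)" for k
        using m j by (auto simp: B_def sum.remove)
      then show ?thesis using j by (simp add: S_def sum.distrib)
    qed
    show "L2_bounded (\<lambda>z. cmod (S j ((G i ^^ m) z) - u i l z)) (3 * (1 / 2) ^ l)"
    proof (rule L2_bounded_holomorphic[OF _ L2_bounded_add[OF b2 b1] _ le])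
      show "(\<lambda>z. S j ((G i ^^ m) z) - u i l z) holomorphic_on unit_disc"
        by (intro holomorphic_intros holomorphic_iterate_compose G S u)
      fix z
      have "S j ((G i ^^ m) z) - u i l z = (x l m ((G i ^^ m) z) - u i l z) + (\<Sum>k\<le>j. \<Sum>n\<in>B k. x k n ((G i ^^ m) z))"
        unfolding eq by simp
      then have "cmod (S j ((G i ^^ m) z) - u i l z) \<le> cmod (x l m ((G i ^^ m) z) - u i l z) +
          cmod (\<Sum>k\<le>j. \<Sum>n\<in>B k. x k n ((G i ^^ m) z))"
        by (simp only: norm_triangle_ineq)
      also have "cmod (\<Sum>k\<le>j. \<Sum>n\<in>B k. x k n ((G i ^^ m) z)) \<le> (\<Sum>k\<le>j. cmod (\<Sum>n\<in>B k. x k n ((G i ^^ m) z)))"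
        by (rule norm_sum)
      finally show "cmod (S j ((G i ^^ m) z) - u i l z) \<le> cmod (x l m ((G i ^^ m) z) - u i l z) +
          (\<Sum>k\<le>j. cmod (\<Sum>n\<in>B k. x k n ((G i ^^ m) z)))" by simp
    qed
  qed (rule u)
  show ?thesis
    unfolding hypercyclic_pair_def
  proof (intro bexI[OF _ \<open>f \<in> hardy2\<close>] ballI allI impI)
    fix h1 h2 and e :: real assume h: "h1 \<in> hardy2" "h2 \<in> hardy2" and e: "0 < e"
    have e2: "0 < e / 2" using e by simp
    obtain i1 i2 where i1: "L2_bounded (\<lambda>z. cmod (h1 z - poly (q i1) z)) (e / 2)"
      and i2: "L2_bounded (\<lambda>z. cmod (h2 z - poly (q i2) z)) (e / 2)"
      using q[OF h(1) e2] q[OF h(2) e2] by auto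
    obtain b where b: "(1 / 2 :: real) ^ b < e / 8" using e real_arch_pow_inv[of "e / 8" "1 / 2"] by auto
    define k where "k = prod_encode (prod_encode (i1, i2), b)"
    have "b \<le> k" unfolding k_def by (rule le_prod_encode_2)
    then have "(1 / 2 :: real) ^ k \<le> (1 / 2) ^ b" by (intro power_decreasing) auto
    with b have k: "(1 / 2 :: real) ^ k \<le> e / 8" by linarith
    define h where "h i = (if i then h1 else h2)" for i :: bool
    have hq: "L2_bounded (\<lambda>z. cmod (h i z - poly (p i k) z)) (e / 2)" for i
      using i1 i2 by (simp add: h_def p_def p1_def p2_def k_def)
    have hol: "h i holomorphic_on unit_disc" for i
      using \<open>h1 \<in> hardy2\<close> \<open>h2 \<in> hardy2\<close> by (simp add: h_def hardy2_def)
    have "L2_bounded (\<lambda>z. cmod (f ((G i ^^ m) z) - h i z)) e" if m: "m \<in> A k" for i m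
    proof (rule L2_bounded_holomorphic[OF _ L2_bounded_add[OF main[OF m, of i] L2_bounded_add[OF u(2)[where k = k and i = i] hq[of i]]]])
      show "(\<lambda>z. f ((G i ^^ m) z) - h i z) holomorphic_on unit_disc"
        by (intro holomorphic_intros holomorphic_iterate_compose G f hol)
      show "3 * (1 / 2) ^ k + ((1 / 2) ^ k + e / 2) \<le> e" using k by simp
      show "cmod (f ((G i ^^ m) z) - h i z) \<le> cmod (f ((G i ^^ m) z) - u i k z) +
          (cmod (poly (p i k) z - u i k z) + cmod (h i z - poly (p i k) z))" for z
      proof -
        have "f ((G i ^^ m) z) - h i z = (f ((G i ^^ m) z) - u i k z) - ((poly (p i k) z - u i k z) + (h i z - poly (p i k) z))"
          by simp
        also have "cmod \<dots> \<le> cmod (f ((G i ^^ m) z) - u i k z) + cmod ((poly (p i k) z - u i k z) + (h i z - poly (p i k) z))"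
          by (rule norm_triangle_ineq4)
        also have "cmod ((poly (p i k) z - u i k z) + (h i z - poly (p i k) z)) \<le> cmod (poly (p i k) z - u i k z) + cmod (h i z - poly (p i k) z)"
          by (rule norm_triangle_ineq)
        finally show ?thesis by simp
      qed
    qed
    from this[of _ True] this[of _ False]
    have "A k \<subseteq> {n. L2_bounded (\<lambda>z. cmod (f ((g1 ^^ n) z) - h1 z)) e \<and> L2_bounded (\<lambda>z. cmod (f ((g2 ^^ n) z) - h2 z)) e}"
      by (auto simp: G_def h_def)
    then show "0 < lower_density {n. L2_bounded (\<lambda>z. cmod (f ((g1 ^^ n) z) - h1 z)) e \<and> L2_bounded (\<lambda>z. cmod (f ((g2 ^^ n) z) - h2 z)) e}"
      by (rule less_le_trans[OF A(2) lower_density_mono])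
  qed
qed

section \<open>From open sets of the product space to pairs of balls\<close>

lemma composition_operator_power:
  assumes "on_plane \<phi> ` unit_disc \<subseteq> unit_disc" and "\<And>z. z \<notin> unit_disc \<Longrightarrow> f z = 0"
  shows "(composition_operator \<phi> ^^ n) f = (\<lambda>z. if z \<in> unit_disc then f ((on_plane \<phi> ^^ n) z) else 0)"
proof (induction n)
  case 0
  then show ?case using assms(2) by auto
next
  case (Suc n)
  have "on_plane \<phi> z \<in> unit_disc" if "z \<in> unit_disc" for z using assms(1) that by blast
  then show ?case
    unfolding funpow.simps o_apply Suc by (auto simp: composition_operator_def fun_eq_iff funpow_swap1)
qed

lemma hardy2_dist_less:
  assumes "f \<in> hardy2" "g \<in> hardy2" "L2_bounded (\<lambda>z. cmod (f z - g z)) C"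
  shows "hardy2_dist f g \<le> C"
proof -
  have "(\<lambda>z. f z - g z) \<in> hardy2" using assms by (intro hardy2_diff)
  then show ?thesis unfolding hardy2_dist_def
    by (intro hardy2I(2) assms) (auto simp: hardy2_def)
qed

lemma disjointly_frequently_hypercyclic_iff:
  assumes g1: "on_plane \<phi>1 ` unit_disc \<subseteq> unit_disc" "on_plane \<phi>1 holomorphic_on unit_disc"
    and g2: "on_plane \<phi>2 ` unit_disc \<subseteq> unit_disc" "on_plane \<phi>2 holomorphic_on unit_disc"
  shows "disjointly_frequently_hypercyclic hardy2_topology [composition_operator \<phi>1, composition_operator \<phi>2]
     \<longleftrightarrow> hypercyclic_pair (on_plane \<phi>1) (on_plane \<phi>2)"
proof -
  interpret Metric_space hardy2 hardy2_dist by (rule Metric_space_hardy2)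
  define G where "G i = (if i = 0 then on_plane \<phi>1 else on_plane \<phi>2)" for i :: nat
  define T where "T i = [composition_operator \<phi>1, composition_operator \<phi>2] ! i" for i
  let ?U = "product_topology (\<lambda>_. hardy2_topology) {..<2::nat}"
  have G: "G i ` unit_disc \<subseteq> unit_disc" "G i holomorphic_on unit_disc" for i
    using g1 g2 by (auto simp: G_def)
  have T: "(T i ^^ n) f = (\<lambda>z. if z \<in> unit_disc then f ((G i ^^ n) z) else 0)" if "f \<in> hardy2" "i < 2" for i n f
    using composition_operator_power[OF g1(1), of f n] composition_operator_power[OF g2(1), of f n] that
    by (auto simp: T_def G_def less_2_cases_iff hardy2_def)
  have L2T: "L2_bounded (\<lambda>z. cmod ((T i ^^ n) f z - h z)) C \<longleftrightarrow> L2_bounded (\<lambda>z. cmod (f ((G i ^^ n) z) - h z)) C"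
    if "f \<in> hardy2" "i < 2" for i n f h C
  proof -
    have "continuous_on unit_disc (\<lambda>z. cmod ((T i ^^ n) f z - h z)) = continuous_on unit_disc (\<lambda>z. cmod (f ((G i ^^ n) z) - h z))"
      by (rule continuous_on_cong) (simp_all add: T[OF that])
    moreover have "circle_norm (\<lambda>z. cmod ((T i ^^ n) f z - h z)) r = circle_norm (\<lambda>z. cmod (f ((G i ^^ n) z) - h z)) r" if "r \<in> {0..<1}" for r
      using that by (intro circle_norm_cong) (simp_all add: T[OF \<open>f \<in> hardy2\<close> \<open>i < 2\<close>])
    ultimately show ?thesis by (simp add: L2_bounded_def)
  qed
  have top: "topspace hardy2_topology = hardy2" by (rule topspace_hardy2)
  have two: "(\<forall>i<2. P i) \<longleftrightarrow> P 0 \<and> P (1::nat)" for P by (auto simp: less_2_cases_iff)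
  have dfh: "disjointly_frequently_hypercyclic hardy2_topology [composition_operator \<phi>1, composition_operator \<phi>2] \<longleftrightarrow>
     (\<exists>f\<in>hardy2. \<forall>U. openin ?U U \<and> U \<noteq> {} \<longrightarrow> 0 < lower_density {n. (\<lambda>i\<in>{..<2}. (T i ^^ n) f) \<in> U})"
    by (simp add: disjointly_frequently_hypercyclic_def top T_def numeral_2_eq_2)
  show ?thesis
  proof
    assume "disjointly_frequently_hypercyclic hardy2_topology [composition_operator \<phi>1, composition_operator \<phi>2]"
    then obtain f where f: "f \<in> hardy2" and dens: "\<And>U. openin ?U U \<Longrightarrow> U \<noteq> {} \<Longrightarrow>
        0 < lower_density {n. (\<lambda>i\<in>{..<2}. (T i ^^ n) f) \<in> U}"
      unfolding dfh by blast
    show "hypercyclic_pair (on_plane \<phi>1) (on_plane \<phi>2)"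
      unfolding hypercyclic_pair_def
    proof (intro bexI[OF _ f] ballI allI impI)
      fix h1 h2 and e :: real assume h: "h1 \<in> hardy2" "h2 \<in> hardy2" and e: "0 < e"
      define h where "h i = (if i = 0 then h1 else h2)" for i :: nat
      define U where "U = PiE {..<2::nat} (\<lambda>i. mball (h i) e)"
      have hi: "h i \<in> hardy2" for i using \<open>h1 \<in> hardy2\<close> \<open>h2 \<in> hardy2\<close> by (simp add: h_def)
      have "openin ?U U" unfolding U_def hardy2_topology_def openin_PiE_gen by auto
      moreover have "U \<noteq> {}"
        using hi e by (auto simp: U_def PiE_eq_empty_iff)
      ultimately have pos: "0 < lower_density {n. (\<lambda>i\<in>{..<2}. (T i ^^ n) f) \<in> U}" by (rule dens)
      have sub: "{n. (\<lambda>i\<in>{..<2}. (T i ^^ n) f) \<in> U} \<subseteq> {n. \<forall>i<2. L2_bounded (\<lambda>z. cmod (f ((G i ^^ n) z) - h i z)) e}"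
      proof (intro subsetI CollectI allI impI)
        fix n i assume n: "n \<in> {n. (\<lambda>i\<in>{..<2}. (T i ^^ n) f) \<in> U}" and i: "i < (2::nat)"
        then have "(T i ^^ n) f \<in> mball (h i) e" by (auto simp: U_def PiE_iff)
        then have Ti: "(T i ^^ n) f \<in> hardy2" "hardy2_dist ((T i ^^ n) f) (h i) < e"
          by (auto simp: commute)
        have "L2_bounded (\<lambda>z. cmod ((T i ^^ n) f z - h i z)) e"
          by (rule L2_bounded_weaken[OF L2_bounded_hardy2[OF hardy2_diff[OF Ti(1) hi]]])
             (use Ti(2) in \<open>simp add: hardy2_dist_def\<close>)
        then show "L2_bounded (\<lambda>z. cmod (f ((G i ^^ n) z) - h i z)) e" using L2T[OF f i] by simp
      qed
      show "0 < lower_density {n. L2_bounded (\<lambda>z. cmod (f ((on_plane \<phi>1 ^^ n) z) - h1 z)) e \<and>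
          L2_bounded (\<lambda>z. cmod (f ((on_plane \<phi>2 ^^ n) z) - h2 z)) e}"
        using less_le_trans[OF pos lower_density_mono[OF sub]] by (simp add: two G_def h_def)
    qed
  next
    assume "hypercyclic_pair (on_plane \<phi>1) (on_plane \<phi>2)"
    then obtain f where f: "f \<in> hardy2" and dens: "\<And>h1 h2 e. h1 \<in> hardy2 \<Longrightarrow> h2 \<in> hardy2 \<Longrightarrow> 0 < e \<Longrightarrow>
       0 < lower_density {n. L2_bounded (\<lambda>z. cmod (f ((on_plane \<phi>1 ^^ n) z) - h1 z)) e \<and>
          L2_bounded (\<lambda>z. cmod (f ((on_plane \<phi>2 ^^ n) z) - h2 z)) e}"
      unfolding hypercyclic_pair_def by blast
    have "0 < lower_density {n. (\<lambda>i\<in>{..<2}. (T i ^^ n) f) \<in> U}" if U: "openin ?U U" "U \<noteq> {}" for U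
    proof -
      obtain h where h: "h \<in> U" using U by auto
      then obtain V where V: "\<And>i. i < 2 \<Longrightarrow> openin hardy2_topology (V i)" "h \<in> PiE {..<2} V" "PiE {..<2} V \<subseteq> U"
        using U(1) unfolding openin_product_topology_alt by (metis lessThan_iff)
      have "\<exists>e>0. mball (h i) e \<subseteq> V i" if "i < 2" for i
        using V(1)[OF that] V(2) that unfolding hardy2_topology_def openin_mtopology by (metis PiE_mem lessThan_iff)
      then obtain \<epsilon> where \<epsilon>: "\<And>i. i < 2 \<Longrightarrow> 0 < \<epsilon> i \<and> mball (h i) (\<epsilon> i) \<subseteq> V i" by metis
      have hi: "h i \<in> hardy2" if "i < 2" for i
        using V(1)[OF that] V(2) that openin_subset[of hardy2_topology "V i"] by (auto simp: top PiE_iff)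
      \<comment> \<open>Half of the smaller radius, since a bound by \<open>e\<close> only yields a
        distance of at most \<open>e\<close>, and the balls are open.\<close>
      define e where "e = min (\<epsilon> 0) (\<epsilon> 1) / 2"
      have e: "0 < e" "\<And>i. i < 2 \<Longrightarrow> e < \<epsilon> i" using \<epsilon>[of 0] \<epsilon>[of 1] by (auto simp: e_def less_2_cases_iff)
      have pos: "0 < lower_density {n. L2_bounded (\<lambda>z. cmod (f ((on_plane \<phi>1 ^^ n) z) - h 0 z)) e \<and>
          L2_bounded (\<lambda>z. cmod (f ((on_plane \<phi>2 ^^ n) z) - h 1 z)) e}"
        by (intro dens hi e) auto
      have sub: "{n. L2_bounded (\<lambda>z. cmod (f ((on_plane \<phi>1 ^^ n) z) - h 0 z)) e \<and>
          L2_bounded (\<lambda>z. cmod (f ((on_plane \<phi>2 ^^ n) z) - h 1 z)) e} \<subseteq> {n. (\<lambda>i\<in>{..<2}. (T i ^^ n) f) \<in> U}"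
      proof (intro subsetI CollectI)
        fix n assume "n \<in> {n. L2_bounded (\<lambda>z. cmod (f ((on_plane \<phi>1 ^^ n) z) - h 0 z)) e \<and>
          L2_bounded (\<lambda>z. cmod (f ((on_plane \<phi>2 ^^ n) z) - h 1 z)) e}"
        then have "\<forall>i<2. L2_bounded (\<lambda>z. cmod (f ((G i ^^ n) z) - h i z)) e"
          by (simp add: two G_def)
        then have L: "L2_bounded (\<lambda>z. cmod ((T i ^^ n) f z - h i z)) e" if "i < 2" for i
          using that L2T[OF f that] by simp
        have hol: "(\<lambda>z. f ((G i ^^ n) z)) holomorphic_on unit_disc" for i
          using f by (intro holomorphic_iterate_compose G) (simp add: hardy2_def)
        have Th: "(T i ^^ n) f holomorphic_on unit_disc" if "i < 2" for i
          by (rule holomorphic_transform[OF hol[of i]]) (simp add: T[OF f that])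
        have mem: "(T i ^^ n) f \<in> hardy2" if i: "i < 2" for i
        proof (rule hardy2I(1)[OF Th[OF i]])
          show "L2_bounded (\<lambda>z. cmod ((T i ^^ n) f z)) (e + hardy2_norm (h i))"
          proof (rule L2_bounded_holomorphic[OF Th[OF i] L2_bounded_add[OF L[OF i] L2_bounded_hardy2[OF hi[OF i]]]])
            show "cmod ((T i ^^ n) f z) \<le> cmod ((T i ^^ n) f z - h i z) + cmod (h i z)" for z
              using norm_triangle_ineq[of "(T i ^^ n) f z - h i z" "h i z"] by simp
          qed simp
        qed (simp add: T[OF f i])
        have "(T i ^^ n) f \<in> mball (h i) (\<epsilon> i)" if i: "i < 2" for i
          using hardy2_dist_less[OF mem[OF i] hi[OF i] L[OF i]] e(2)[OF i] mem[OF i] hi[OF i] by (simp add: commute)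
        then have "(T i ^^ n) f \<in> V i" if "i < 2" for i using \<epsilon>[OF that] that by blast
        then have "(\<lambda>i\<in>{..<2}. (T i ^^ n) f) \<in> PiE {..<2} V" by auto
        then show "(\<lambda>i\<in>{..<2}. (T i ^^ n) f) \<in> U" using V(3) by blast
      qed
      show ?thesis by (rule less_le_trans[OF pos lower_density_mono[OF sub]])
    qed
    then show "disjointly_frequently_hypercyclic hardy2_topology [composition_operator \<phi>1, composition_operator \<phi>2]"
      unfolding dfh using f by blast
  qed
qed

section \<open>Affine normal form\<close>

text \<open>The number \<open>1 / \<mu>\<close> is the derivative at the attractive fixed point, and
  \<open>Re b = 0\<close> characterises the automorphisms; both are proved in
  \<open>normal_form\<close>. The condition on \<open>b\<close> excludes the identity.\<close>

definition affine_model :: "(complex \<Rightarrow> complex) \<Rightarrow> complex \<Rightarrow> real \<Rightarrow> complex \<Rightarrow> bool" where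
  "affine_model g \<alpha> \<mu> b \<longleftrightarrow> cmod \<alpha> = 1 \<and> 1 \<le> \<mu> \<and> 0 \<le> Re b \<and> (\<mu> = 1 \<longrightarrow> b \<noteq> 0) \<and>
     g holomorphic_on unit_disc \<and> g ` unit_disc \<subseteq> unit_disc \<and>
     (\<forall>z\<in>unit_disc. half_plane \<alpha> (g z) = of_real \<mu> * half_plane \<alpha> z + b)"

text \<open>The conjugate of the affine map under the Cayley transform, with coefficients normalised
  by \<open>a - \<alpha> * c = 1\<close>. It recovers a symbol from its parameters, so distinct
  symbols have distinct parameters.\<close>

definition affine_moebius :: "complex \<Rightarrow> real \<Rightarrow> complex \<Rightarrow> complex option \<Rightarrow> complex option" where
  "affine_moebius \<alpha> \<mu> b = (let \<kappa> = (of_real \<mu> - 1 - b) / (2 * \<alpha>) in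
     moebius (1 + \<alpha> * \<kappa>) (of_real \<mu> * \<alpha> - \<alpha> - \<kappa> * \<alpha>\<^sup>2) \<kappa> (of_real \<mu> - \<alpha> * \<kappa>))"

lemma moebius_scale: "s \<noteq> 0 \<Longrightarrow> moebius (s * a) (s * b) (s * c) (s * d) = moebius a b c d"
proof
  fix w assume s: "s \<noteq> 0"
  have "s * a * z + s * b = s * (a * z + b)" "s * c * z + s * d = s * (c * z + d)" for z
    by (simp_all add: algebra_simps)
  then show "moebius (s * a) (s * b) (s * c) (s * d) w = moebius a b c d w"
    using s by (auto simp: moebius_def split: option.split)
qed

text \<open>Evaluating at \<open>t * Complex 1 s\<close> for large \<open>t\<close> shows that
  \<open>Re l - s * Im l\<close> is not negative for any \<open>s\<close>, which forces
  \<open>l\<close> to be real; small positive arguments give \<open>0 \<le> Re b\<close>.\<close>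

lemma half_plane_self_map_real:
  assumes l: "l \<noteq> 0" and map: "\<And>w. 0 < Re w \<Longrightarrow> 0 < Re (l * w + b)"
  shows "l = of_real (Re l)" "0 < Re l" "0 \<le> Re b"
proof -
  show b: "0 \<le> Re b"
  proof (rule field_le_epsilon)
    fix e :: real assume e: "0 < e"
    have "0 < Re (l * of_real (e / (1 + \<bar>Re l\<bar>)) + b)" using e by (intro map) (simp add: add_pos_nonneg)
    moreover have "Re l * (e / (1 + \<bar>Re l\<bar>)) \<le> (1 + \<bar>Re l\<bar>) * (e / (1 + \<bar>Re l\<bar>))"
      using e by (intro mult_right_mono) auto
    moreover have "1 + \<bar>Re l\<bar> \<noteq> 0" by (metis abs_ge_zero add_nonneg_eq_0_iff zero_le_one zero_neq_one)
    ultimately show "0 \<le> Re b + e" by simp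
  qed
  have im: "0 \<le> Re l - s * Im l" for s
  proof (rule ccontr)
    assume neg: "\<not> 0 \<le> Re l - s * Im l"
    define X where "X = Re l - s * Im l"
    define t where "t = (Re b + 1) / - X"
    have X: "X < 0" using neg by (simp add: X_def)
    have t: "0 < t" unfolding t_def using b X by (intro divide_pos_pos) auto
    have "0 < Re (l * (of_real t * Complex 1 s) + b)" using t by (intro map) simp
    also have "Re (l * (of_real t * Complex 1 s) + b) = t * X + Re b" by (simp add: X_def algebra_simps)
    also have "t * X = - (Re b + 1)" using X by (simp add: t_def)
    finally show False by simp
  qed
  have "Im l = 0"
  proof (rule ccontr)
    assume "Im l \<noteq> 0"
    then show False using im[of "(Re l + 1) / Im l"] by simp
  qed
  then show "l = of_real (Re l)" by (simp add: complex_eq_iff)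
  moreover have "Re l \<noteq> 0" using l \<open>Im l = 0\<close> by (simp add: complex_eq_iff)
  ultimately show "0 < Re l" using im[of 0] by simp
qed

section \<open>Fixed points of a Moebius map of the disc\<close>

locale disc_moebius =
  fixes a b c d :: complex
  assumes det: "a * d - b * c \<noteq> 0"
    and denom: "\<And>z. z \<in> unit_disc \<Longrightarrow> c * z + d \<noteq> 0"
    and less: "\<And>z. z \<in> unit_disc \<Longrightarrow> cmod (a * z + b) < cmod (c * z + d)"
    and nofix: "\<And>z. z \<in> unit_disc \<Longrightarrow> (a * z + b) / (c * z + d) \<noteq> z"
begin

definition G :: "complex \<Rightarrow> complex" where "G z = (a * z + b) / (c * z + d)"

text \<open>The strict inequality of the open disc persists weakly on the closed one. A zero of the
  denominator would then be a common zero of numerator and denominator, which the determinant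
  excludes.\<close>

lemma closed_disc: assumes "cmod z \<le> 1" shows "c * z + d \<noteq> 0" "cmod (G z) \<le> 1"
proof -
  have "z \<in> closure unit_disc" using assms by simp
  then have le: "cmod (a * z + b) - cmod (c * z + d) \<le> 0"
    by (rule continuous_le_on_closure[rotated])
       (use less in \<open>auto intro!: continuous_intros less_imp_le\<close>)
  show ne: "c * z + d \<noteq> 0"
  proof
    assume 0: "c * z + d = 0"
    then have "a * z + b = 0" using le by simp
    then have "b = - (a * z)" "d = - (c * z)" using 0 by (metis add.commute add_eq_0_iff)+
    then show False using det by simp
  qed
  then show "cmod (G z) \<le> 1" using le by (simp add: G_def norm_divide divide_le_eq)
qed

lemma G_maps: "G ` unit_disc \<subseteq> unit_disc"
  using less denom by (auto simp: G_def norm_divide divide_less_eq)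

lemma G_holomorphic: "G holomorphic_on unit_disc"
  unfolding G_def using denom by (intro holomorphic_intros) auto

lemma boundary_fixed_point: "\<exists>\<alpha>. cmod \<alpha> = 1 \<and> G \<alpha> = \<alpha>"
proof -
  have "continuous_on (cball 0 1) G"
    unfolding G_def using closed_disc by (intro continuous_intros) auto
  moreover have "G ` cball 0 1 \<subseteq> cball 0 1" using closed_disc by auto
  ultimately obtain \<alpha> where \<alpha>: "\<alpha> \<in> cball 0 1" "G \<alpha> = \<alpha>"
    using brouwer[of "cball (0::complex) 1" G] by (auto simp: image_subset_iff_funcset)
  have "\<alpha> \<notin> unit_disc" using nofix \<alpha>(2) by (auto simp: G_def)
  then show ?thesis using \<alpha> by auto
qed

lemma fixed_point_eq: "c * z + d \<noteq> 0 \<Longrightarrow> G z = z \<longleftrightarrow> b = c * z\<^sup>2 + d * z - a * z"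
  by (auto simp: G_def divide_eq_eq power2_eq_square algebra_simps)

text \<open>The reciprocal of the derivative of \<open>G\<close> at a fixed point \<alpha>;
  \<open>slope\<close> and \<open>shift\<close> are the coefficients of the affine map in the
  half-plane.\<close>

definition slope :: "complex \<Rightarrow> complex" where "slope \<alpha> = (c * \<alpha> + d) / (a - \<alpha> * c)"
definition shift :: "complex \<Rightarrow> complex" where "shift \<alpha> = slope \<alpha> - 1 - 2 * \<alpha> * c / (a - \<alpha> * c)"

context
  fixes \<alpha> assumes \<alpha>: "cmod \<alpha> = 1" "G \<alpha> = \<alpha>"
begin

lemma fixed_nonzero: "\<alpha> \<noteq> 0" "c * \<alpha> + d \<noteq> 0" "a - \<alpha> * c \<noteq> 0" "b = c * \<alpha>\<^sup>2 + d * \<alpha> - a * \<alpha>"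
proof -
  show "\<alpha> \<noteq> 0" using \<alpha> by auto
  show ne: "c * \<alpha> + d \<noteq> 0" using closed_disc[of \<alpha>] \<alpha> by simp
  then show b: "b = c * \<alpha>\<^sup>2 + d * \<alpha> - a * \<alpha>" using fixed_point_eq \<alpha> by blast
  have "a * d - b * c = (a - \<alpha> * c) * (c * \<alpha> + d)" unfolding b by (simp add: power2_eq_square algebra_simps)
  then show "a - \<alpha> * c \<noteq> 0" using det by auto
qed

lemma half_plane_G:
  assumes z: "z \<noteq> \<alpha>" "c * z + d \<noteq> 0"
  shows "G z \<noteq> \<alpha>" "half_plane \<alpha> (G z) = slope \<alpha> * half_plane \<alpha> z + shift \<alpha>"
proof -
  define s where "s = a - \<alpha> * c"
  have s: "s \<noteq> 0" using fixed_nonzero(3) by (simp add: s_def)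
  have az: "\<alpha> - z \<noteq> 0" using z by simp
  have num: "\<alpha> * (c * z + d) - (a * z + b) = s * (\<alpha> - z)"
    unfolding fixed_nonzero(4) by (simp add: s_def power2_eq_square algebra_simps)
  have diff: "\<alpha> - G z = s * (\<alpha> - z) / (c * z + d)"
    using z num by (simp add: G_def field_simps)
  then show ne: "G z \<noteq> \<alpha>" using s az z by auto
  then have "half_plane \<alpha> (G z) + 1 = 2 * \<alpha> / (\<alpha> - G z)" by (intro half_plane_plus_one) auto
  also have "\<dots> = 2 * \<alpha> * (c * z + d) / (s * (\<alpha> - z))" unfolding diff by simp
  also have "c * z + d = (c * \<alpha> + d) - c * (\<alpha> - z)" by (simp add: algebra_simps)
  also have "2 * \<alpha> * ((c * \<alpha> + d) - c * (\<alpha> - z)) / (s * (\<alpha> - z)) = (c * \<alpha> + d) / s * (2 * \<alpha> / (\<alpha> - z)) - 2 * \<alpha> * c / s"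
    using s az by (simp add: divide_simps) (simp add: algebra_simps)
  also have "2 * \<alpha> / (\<alpha> - z) = half_plane \<alpha> z + 1" using az by (simp add: half_plane_plus_one)
  finally have "half_plane \<alpha> (G z) = (c * \<alpha> + d) / s * (half_plane \<alpha> z + 1) - 2 * \<alpha> * c / s - 1"
    by (simp add: eq_diff_eq)
  then show "half_plane \<alpha> (G z) = slope \<alpha> * half_plane \<alpha> z + shift \<alpha>"
    by (simp add: slope_def shift_def s_def distrib_left)
qed

lemma slope_real: "slope \<alpha> = of_real (Re (slope \<alpha>))" "0 < Re (slope \<alpha>)" "0 \<le> Re (shift \<alpha>)"
proof -
  have l: "slope \<alpha> \<noteq> 0" using fixed_nonzero by (simp add: slope_def)
  have map: "0 < Re (slope \<alpha> * w + shift \<alpha>)" if w: "0 < Re w" for w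
  proof -
    define z where "z = disc_point \<alpha> w"
    have z: "z \<in> unit_disc" unfolding z_def using \<alpha> w by (intro disc_point_in_disc)
    then have "z \<noteq> \<alpha>" using \<alpha> by auto
    have "half_plane \<alpha> z = w" unfolding z_def using fixed_nonzero Re_pos_neq[OF w] by (intro half_plane_disc_point)
    moreover have "G z \<in> unit_disc" using G_maps z by blast
    then have "0 < Re (half_plane \<alpha> (G z))" by (rule Re_half_plane_pos[OF \<alpha>(1)])
    ultimately show ?thesis using half_plane_G(2)[OF \<open>z \<noteq> \<alpha>\<close> denom[OF z]] by simp
  qed
  show "slope \<alpha> = of_real (Re (slope \<alpha>))" "0 < Re (slope \<alpha>)" "0 \<le> Re (shift \<alpha>)"
    by (rule half_plane_self_map_real[OF l map]; assumption)+
qed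

lemma slope_one_shift: "slope \<alpha> = 1 \<Longrightarrow> shift \<alpha> \<noteq> 0"
proof
  assume 1: "slope \<alpha> = 1" "shift \<alpha> = 0"
  have 0: "0 \<in> unit_disc" by simp
  have "half_plane \<alpha> (G 0) = half_plane \<alpha> 0"
    using half_plane_G(2)[of 0] denom[OF 0] fixed_nonzero 1 by simp
  moreover have "disc_point \<alpha> (half_plane \<alpha> (G 0)) = G 0"
    using half_plane_G(1)[of 0] denom[OF 0] fixed_nonzero by (intro disc_point_half_plane) auto
  moreover have "disc_point \<alpha> (half_plane \<alpha> 0) = 0"
    using fixed_nonzero by (intro disc_point_half_plane) auto
  ultimately have "G 0 = 0" by simp
  then show False using nofix[OF 0] by (simp add: G_def)
qed

end

text \<open>Brouwer's theorem may yield the repulsive fixed point, with slope \<mu> below 1. Then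
  \<open>shift \<alpha> / (1 - \<mu>)\<close> is a fixed point of the affine map in the closed
  half-plane; it gives a second fixed point in the closed disc, necessarily on the circle, and its
  slope is the reciprocal one.\<close>

lemma attracting_fixed_point: "\<exists>\<alpha>. cmod \<alpha> = 1 \<and> G \<alpha> = \<alpha> \<and> 1 \<le> Re (slope \<alpha>)"
proof -
  obtain \<alpha> where \<alpha>: "cmod \<alpha> = 1" "G \<alpha> = \<alpha>" using boundary_fixed_point by blast
  note nz = fixed_nonzero[OF \<alpha>]
  show ?thesis
  proof (cases "1 \<le> Re (slope \<alpha>)")
    case True
    then show ?thesis using \<alpha> by blast
  next
    case False
    define \<mu> where "\<mu> = Re (slope \<alpha>)"
    have \<mu>: "slope \<alpha> = of_real \<mu>" "0 < \<mu>" "\<mu> < 1" using slope_real[OF \<alpha>] False by (auto simp: \<mu>_def)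
    define w where "w = shift \<alpha> / (1 - of_real \<mu>)"
    have w: "slope \<alpha> * w + shift \<alpha> = w"
    proof -
      have "(1 - of_real \<mu>) * w = shift \<alpha>" using \<mu>(3) by (simp add: w_def)
      then show ?thesis by (simp add: \<mu>(1) algebra_simps)
    qed
    have "w = shift \<alpha> / of_real (1 - \<mu>)" by (simp add: w_def)
    then have Rew: "Re w = Re (shift \<alpha>) / (1 - \<mu>)" by (simp only: Re_divide_of_real)
    then have "0 \<le> Re w" using slope_real(3)[OF \<alpha>] \<mu> by simp
    then have w1: "w \<noteq> - 1" by auto
    define z where "z = disc_point \<alpha> w"
    have hz: "half_plane \<alpha> z = w" unfolding z_def using nz w1 by (intro half_plane_disc_point)
    have "w + 1 \<noteq> 0" using w1 by (metis add_eq_0_iff2)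
    have za: "z \<noteq> \<alpha>"
    proof
      assume "z = \<alpha>"
      then have "\<alpha> * (w - 1) = \<alpha> * (w + 1)" using \<open>w + 1 \<noteq> 0\<close> by (simp add: z_def disc_point_def divide_eq_eq)
      then show False using nz by simp
    qed
    have nz1: "1 - (cmod z)\<^sup>2 = 4 * Re w / (cmod (w + 1))\<^sup>2"
      unfolding z_def using \<alpha> w1 by (intro norm_disc_point)
    then have "0 \<le> 1 - (cmod z)\<^sup>2" using \<open>0 \<le> Re w\<close> by simp
    then have z1: "cmod z \<le> 1" by (simp add: abs_square_le_1)
    note dz = closed_disc(1)[OF z1]
    have Gz: "G z = z"
    proof -
      have "half_plane \<alpha> (G z) = w" using half_plane_G(2)[OF \<alpha> za dz] hz w by simp
      then show ?thesis
        using disc_point_half_plane[of \<alpha> "G z"] half_plane_G(1)[OF \<alpha> za dz] nz by (simp add: z_def)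
    qed
    have "z \<notin> unit_disc" using nofix Gz by (auto simp: G_def)
    then have "cmod z = 1" using z1 by simp
    note nz' = fixed_nonzero[OF this Gz]
    have "c * (\<alpha>\<^sup>2 - z\<^sup>2) + (d - a) * (\<alpha> - z) = 0" using nz(4) nz'(4) by (simp add: algebra_simps)
    then have "(\<alpha> - z) * (c * (\<alpha> + z) + d - a) = 0" by (simp add: power2_eq_square algebra_simps)
    then have "c * (\<alpha> + z) + d - a = 0" using za by simp
    then have "c * z + d = a - \<alpha> * c" "a - z * c = c * \<alpha> + d" by (simp_all add: algebra_simps eq_diff_eq)
    then have "slope z = 1 / slope \<alpha>" by (simp add: slope_def)
    then have "slope z = of_real (1 / \<mu>)" unfolding \<mu>(1) by simp
    then have "Re (slope z) = 1 / \<mu>" by (simp only: Re_complex_of_real)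
    then have "1 \<le> Re (slope z)" using \<mu> by simp
    then show ?thesis using \<open>cmod z = 1\<close> Gz by blast
  qed
qed

end

section \<open>Iterates and the normal form of a symbol\<close>

lemma affine_model_iterate:
  assumes m: "affine_model g \<alpha> \<mu> b" and z: "z \<in> unit_disc"
  shows "(g ^^ n) z \<in> unit_disc"
    "half_plane \<alpha> ((g ^^ n) z) = of_real (\<mu> ^ n) * half_plane \<alpha> z + of_real (\<Sum>i<n. \<mu> ^ i) * b"
proof -
  have maps: "g z \<in> unit_disc" and hp: "half_plane \<alpha> (g z) = of_real \<mu> * half_plane \<alpha> z + b" if "z \<in> unit_disc" for z
    using m that unfolding affine_model_def by blast+
  have D: "(g ^^ n) z \<in> unit_disc" for n using maps z by (induction n) (simp_all del: mem_ball)
  show "(g ^^ n) z \<in> unit_disc" by (rule D)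
  show "half_plane \<alpha> ((g ^^ n) z) = of_real (\<mu> ^ n) * half_plane \<alpha> z + of_real (\<Sum>i<n. \<mu> ^ i) * b"
  proof (induction n)
    case (Suc n)
    have "(\<Sum>i<Suc n. \<mu> ^ i) = 1 + \<mu> * (\<Sum>i<n. \<mu> ^ i)"
      by (subst sum.lessThan_Suc_shift) (simp add: sum_distrib_left)
    then show ?case
      using hp[OF D[of n]] by (simp add: Suc algebra_simps)
  qed simp
qed

text \<open>Convergence to \<alpha> means that the half-plane coordinate tends to infinity: linearly
  through \<open>n * b\<close> in the parabolic case, geometrically in the real part
  otherwise.\<close>

lemma affine_model_uniform_limit:
  assumes m: "affine_model g \<alpha> \<mu> b" and K: "compact K" "K \<subseteq> unit_disc"
  shows "uniform_limit K (\<lambda>n. g ^^ n) (\<lambda>_. \<alpha>) sequentially"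
proof (cases "K = {}")
  case False
  have \<alpha>: "cmod \<alpha> = 1" and \<mu>: "1 \<le> \<mu>" and b: "0 \<le> Re b" "\<mu> = 1 \<Longrightarrow> b \<noteq> 0"
    using m by (auto simp: affine_model_def)
  have cont: "continuous_on K (half_plane \<alpha>)"
    using continuous_half_plane[OF \<alpha>] K(2) by (rule continuous_on_subset)
  have far: "\<exists>N. \<forall>n\<ge>N. \<forall>z\<in>K. M \<le> cmod (half_plane \<alpha> ((g ^^ n) z) + 1)" for M
  proof (cases "\<mu> = 1")
    case True
    obtain C where C: "\<And>z. z \<in> K \<Longrightarrow> cmod (half_plane \<alpha> z + 1) \<le> C"
    proof -
      have "continuous_on K (\<lambda>z. cmod (half_plane \<alpha> z + 1))" by (intro continuous_intros cont)
      from continuous_attains_sup[OF K(1) False this] show ?thesis using that by blast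
    qed
    have "0 < cmod b" using b True by simp
    then obtain N where N: "M + C < real N * cmod b" using reals_Archimedean3 by blast
    show ?thesis
    proof (intro exI[of _ N] allI impI ballI)
      fix n z assume n: "N \<le> n" and z: "z \<in> K"
      have "real N * cmod b \<le> real n * cmod b" using n by (intro mult_right_mono) auto
      moreover have "half_plane \<alpha> ((g ^^ n) z) + 1 = of_nat n * b + (half_plane \<alpha> z + 1)"
        using affine_model_iterate(2)[OF m subsetD[OF K(2) z], of n] True by simp
      moreover have "real n * cmod b - cmod (half_plane \<alpha> z + 1) \<le> cmod (of_nat n * b + (half_plane \<alpha> z + 1))"
        using norm_diff_ineq[of "of_nat n * b" "half_plane \<alpha> z + 1"] by (simp add: norm_mult)
      ultimately show "M \<le> cmod (half_plane \<alpha> ((g ^^ n) z) + 1)" using C[OF z] N by (simp only: add.assoc)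
    qed
  next
    case lam: False
    obtain \<delta> where \<delta>: "0 < \<delta>" "\<And>z. z \<in> K \<Longrightarrow> \<delta> \<le> Re (half_plane \<alpha> z)"
    proof -
      have "continuous_on K (\<lambda>z. Re (half_plane \<alpha> z))" by (intro continuous_intros cont)
      from continuous_attains_inf[OF K(1) False this] obtain w where "w \<in> K" "\<forall>z\<in>K. Re (half_plane \<alpha> w) \<le> Re (half_plane \<alpha> z)"
        by blast
      then show ?thesis using that[of "Re (half_plane \<alpha> w)"] Re_half_plane_pos[OF \<alpha>] K(2) by blast
    qed
    have "1 < \<mu>" using \<mu> lam by simp
    then obtain N where N: "M / \<delta> < \<mu> ^ N" using real_arch_pow by blast
    show ?thesis
    proof (intro exI[of _ N] allI impI ballI)
      fix n z assume n: "N \<le> n" and z: "z \<in> K"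
      have "M \<le> \<mu> ^ N * \<delta>" using N \<delta> by (simp add: divide_less_eq)
      also have "\<dots> \<le> \<mu> ^ n * Re (half_plane \<alpha> z)"
        using n \<delta> z \<mu> by (intro mult_mono power_increasing) auto
      also have "\<dots> \<le> Re (half_plane \<alpha> ((g ^^ n) z) + 1)"
        using affine_model_iterate(2)[OF m subsetD[OF K(2) z], of n] b(1) \<mu> by (simp add: sum_nonneg)
      also have "\<dots> \<le> cmod (half_plane \<alpha> ((g ^^ n) z) + 1)" by (rule complex_Re_le_cmod)
      finally show "M \<le> cmod (half_plane \<alpha> ((g ^^ n) z) + 1)" .
    qed
  qed
  show ?thesis
    unfolding uniform_limit_sequentially_iff
  proof (intro allI impI)
    fix e :: real assume e: "0 < e"
    obtain N where N: "\<And>n z. N \<le> n \<Longrightarrow> z \<in> K \<Longrightarrow> 4 / e \<le> cmod (half_plane \<alpha> ((g ^^ n) z) + 1)" using far by blast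
    show "\<exists>N. \<forall>n\<ge>N. \<forall>z\<in>K. dist ((g ^^ n) z) \<alpha> < e"
    proof (intro exI[of _ N] allI impI ballI)
      fix n z assume n: "N \<le> n" and z: "z \<in> K"
      have ne: "\<alpha> - (g ^^ n) z \<noteq> 0"
        by (rule unit_disc_neq[OF \<alpha> affine_model_iterate(1)[OF m subsetD[OF K(2) z]]])
      have "4 / e \<le> 2 / cmod (\<alpha> - (g ^^ n) z)"
        using N[OF n z] half_plane_plus_one[OF ne] \<alpha> by (simp add: norm_divide norm_mult)
      then have "cmod (\<alpha> - (g ^^ n) z) \<le> e / 2" using ne e by (simp add: field_simps)
      then show "dist ((g ^^ n) z) \<alpha> < e" using e by (simp add: dist_norm norm_minus_commute)
    qed
  qed
qed simp

lemma attractive_fixed_point_eq: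
  assumes "affine_model (on_plane \<phi>) \<alpha> \<mu> b" shows "attractive_fixed_point \<phi> = \<alpha>"
  unfolding attractive_fixed_point_def
proof (rule the_equality)
  have \<alpha>: "\<alpha> \<in> sphere 0 1" using assms by (simp add: affine_model_def)
  then show "\<alpha> \<in> sphere 0 1 \<and> (\<forall>K. compact K \<and> K \<subseteq> unit_disc \<longrightarrow> uniform_limit K (\<lambda>n. on_plane \<phi> ^^ n) (\<lambda>_. \<alpha>) sequentially)"
    using affine_model_uniform_limit[OF assms] by blast
  fix \<beta> assume "\<beta> \<in> sphere 0 1 \<and> (\<forall>K. compact K \<and> K \<subseteq> unit_disc \<longrightarrow> uniform_limit K (\<lambda>n. on_plane \<phi> ^^ n) (\<lambda>_. \<beta>) sequentially)"
  then have "uniform_limit {0} (\<lambda>n. on_plane \<phi> ^^ n) (\<lambda>_. \<beta>) sequentially"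
    by (meson centre_in_ball compact_sing empty_subsetI insert_subset zero_less_one)
  then have "(\<lambda>n. (on_plane \<phi> ^^ n) 0) \<longlonglongrightarrow> \<beta>" by (rule tendsto_uniform_limitI) simp
  moreover have "(\<lambda>n. (on_plane \<phi> ^^ n) 0) \<longlonglongrightarrow> \<alpha>"
    by (rule tendsto_uniform_limitI[OF affine_model_uniform_limit[OF assms, where K = "{0}"]]) auto
  ultimately show "\<beta> = \<alpha>" by (rule LIMSEQ_unique)
qed

lemma normal_form:
  assumes lft: "disc_lft \<phi>" and nofix: "\<forall>z\<in>unit_disc. \<phi> (Some z) \<noteq> Some z"
  shows "\<exists>\<mu> b. affine_model (on_plane \<phi>) (attractive_fixed_point \<phi>) \<mu> b \<and> (parabolic \<phi> \<longleftrightarrow> \<mu> = 1) \<and>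
     (hyperbolic \<phi> \<longleftrightarrow> 1 < \<mu>) \<and> (disc_automorphism \<phi> \<longleftrightarrow> Re b = 0) \<and>
     deriv (on_plane \<phi>) (attractive_fixed_point \<phi>) = of_real (1 / \<mu>) \<and>
     \<phi> = affine_moebius (attractive_fixed_point \<phi>) \<mu> b"
proof -
  obtain a b c d where det: "a * d - b * c \<noteq> 0" and \<phi>: "\<phi> = moebius a b c d"
    using lft by (auto simp: disc_lft_def linear_fractional_def)
  have Some: "\<phi> (Some z) \<in> Some ` unit_disc" if "z \<in> unit_disc" for z
    using lft that unfolding disc_lft_def by blast
  have denom: "c * z + d \<noteq> 0" if "z \<in> unit_disc" for z
    using Some[OF that] by (auto simp: \<phi> moebius_def split: if_splits)
  interpret disc_moebius a b c d
  proof
    show "cmod (a * z + b) < cmod (c * z + d)" if "z \<in> unit_disc" for z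
      using Some[OF that] denom[OF that] by (auto simp: \<phi> moebius_def norm_divide)
    show "(a * z + b) / (c * z + d) \<noteq> z" if "z \<in> unit_disc" for z
      using bspec[OF nofix that] denom[OF that] by (simp add: \<phi> moebius_def)
  qed (use det denom in auto)
  have \<phi>G: "\<phi> (Some z) = Some (G z)" "on_plane \<phi> z = G z" if "c * z + d \<noteq> 0" for z
    using that by (auto simp: \<phi> moebius_def G_def on_plane_def)
  obtain \<alpha> where \<alpha>: "cmod \<alpha> = 1" "G \<alpha> = \<alpha>" "1 \<le> Re (slope \<alpha>)" using attracting_fixed_point by blast
  note nz = fixed_nonzero[OF \<alpha>(1,2)]
  define \<mu> where "\<mu> = Re (slope \<alpha>)"
  have \<mu>: "slope \<alpha> = of_real \<mu>" "1 \<le> \<mu>" using slope_real[OF \<alpha>(1,2)] \<alpha>(3) by (auto simp: \<mu>_def)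
  define t where "t = shift \<alpha>"
  have za: "z \<noteq> \<alpha>" if "z \<in> unit_disc" for z using that \<alpha> by auto
  have hpG: "half_plane \<alpha> (G z) = of_real \<mu> * half_plane \<alpha> z + t" if "z \<in> unit_disc" for z
    using half_plane_G(2)[OF \<alpha>(1,2) za[OF that] denom[OF that]] by (simp add: \<mu> t_def)
  have model: "affine_model (on_plane \<phi>) \<alpha> \<mu> t"
    unfolding affine_model_def
  proof (intro conjI impI ballI)
    show "\<mu> = 1 \<Longrightarrow> t \<noteq> 0" using slope_one_shift[OF \<alpha>(1,2)] \<mu> by (simp add: t_def)
    show "0 \<le> Re t" using slope_real(3)[OF \<alpha>(1,2)] by (simp add: t_def)
    show "on_plane \<phi> holomorphic_on unit_disc"
      by (rule holomorphic_transform[OF G_holomorphic]) (simp add: \<phi>G denom)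
    show "on_plane \<phi> ` unit_disc \<subseteq> unit_disc" using G_maps \<phi>G denom by auto
    show "half_plane \<alpha> (on_plane \<phi> z) = of_real \<mu> * half_plane \<alpha> z + t" if "z \<in> unit_disc" for z
      using hpG[OF that] \<phi>G(2)[OF denom[OF that]] by simp
  qed (use \<alpha> \<mu> in auto)
  have afp: "attractive_fixed_point \<phi> = \<alpha>" using model by (rule attractive_fixed_point_eq)
  have fix\<alpha>: "\<phi> (Some \<alpha>) = Some \<alpha>" using \<phi>G(1)[OF nz(2)] \<alpha>(2) by simp
  have other: "\<exists>w. w \<noteq> Some \<alpha> \<and> \<phi> w = w" if l1: "\<mu> \<noteq> 1"
  proof (cases "c = 0")
    case True
    then show ?thesis by (intro exI[of _ None]) (simp add: \<phi> moebius_def)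
  next
    case False
    \<comment> \<open>The second root of the fixed point equation, from the sum of the two
      roots.\<close>
    define x where "x = (a - d) / c - \<alpha>"
    have cx: "c * x + d = a - \<alpha> * c" using False by (simp add: x_def field_simps)
    have "c * \<alpha> + d \<noteq> a - \<alpha> * c"
    proof
      assume "c * \<alpha> + d = a - \<alpha> * c"
      then have "slope \<alpha> = 1" unfolding slope_def using nz(3) by simp
      then show False using l1 \<mu>(1) by simp
    qed
    then have "x \<noteq> \<alpha>" using cx by auto
    moreover have "b = c * x\<^sup>2 + d * x - a * x"
    proof -
      have "c * x\<^sup>2 + d * x - a * x = (c * x + d - a) * x" by (simp add: power2_eq_square algebra_simps)
      also have "\<dots> = - \<alpha> * (c * x)" unfolding cx by simp
      also have "c * x = a - \<alpha> * c - d" using cx by (simp add: eq_diff_eq)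
      finally show ?thesis unfolding nz(4) by (simp add: power2_eq_square algebra_simps)
    qed
    then have "G x = x" using fixed_point_eq cx nz(3) by simp
    moreover have "\<phi> (Some x) = Some (G x)" using cx nz(3) by (intro \<phi>G) simp
    ultimately show ?thesis by (intro exI[of _ "Some x"]) simp
  qed
  have only: "w = Some \<alpha>" if l1: "\<mu> = 1" and w: "\<phi> w = w" for w
  proof (cases w)
    case None
    then have "c = 0" using w by (auto simp: \<phi> moebius_def split: if_splits)
    moreover have "t = of_real \<mu> - 1 - 2 * \<alpha> * c / (a - \<alpha> * c)"
      unfolding t_def shift_def \<mu>(1) ..
    ultimately have "t = 0" using l1 by simp
    then show ?thesis using model l1 by (simp add: affine_model_def)
  next
    case (Some x)
    have cx: "c * x + d \<noteq> 0" using w Some by (auto simp: \<phi> moebius_def split: if_splits)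
    have Gx: "G x = x" using \<phi>G(1)[OF cx] w Some by simp
    show ?thesis
    proof (rule ccontr)
      assume "w \<noteq> Some \<alpha>"
      then have "x \<noteq> \<alpha>" using Some by simp
      then have "half_plane \<alpha> x = half_plane \<alpha> x + t"
        using half_plane_G(2)[OF \<alpha>(1,2) _ cx] Gx \<mu> l1 by (simp add: t_def)
      then show False using model l1 by (simp add: affine_model_def)
    qed
  qed
  have par: "parabolic \<phi> \<longleftrightarrow> \<mu> = 1"
    unfolding parabolic_def afp using fix\<alpha> other only by blast
  have hyp: "hyperbolic \<phi> \<longleftrightarrow> 1 < \<mu>"
    unfolding hyperbolic_def afp using fix\<alpha> other only \<mu>(2) by force
  have auto: "disc_automorphism \<phi> \<longleftrightarrow> Re t = 0"
  proof
    assume "disc_automorphism \<phi>"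
    then have surj: "\<phi> ` (Some ` unit_disc) = Some ` unit_disc" by (simp add: disc_automorphism_def)
    show "Re t = 0"
    proof (rule ccontr)
      assume "Re t \<noteq> 0"
      then have t: "0 < Re t" using model by (simp add: affine_model_def)
      \<comment> \<open>A point whose half-plane coordinate has real part below \<open>Re t\<close>
        is not in the image.\<close>
      define y where "y = disc_point \<alpha> (of_real (Re t / 2))"
      have "y \<in> unit_disc" unfolding y_def using \<alpha>(1) t by (intro disc_point_in_disc) auto
      then obtain x where x: "x \<in> unit_disc" "\<phi> (Some x) = Some y" using surj by (metis (no_types, opaque_lifting) image_iff)
      have "y = G x" using x \<phi>G(1)[OF denom[OF x(1)]] by simp
      moreover have "half_plane \<alpha> y = of_real (Re t / 2)"
        unfolding y_def using nz t by (intro half_plane_disc_point Re_pos_neq) auto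
      ultimately have eq: "of_real (Re t / 2) = of_real \<mu> * half_plane \<alpha> x + t" using hpG[OF x(1)] by simp
      have "Re t / 2 = \<mu> * Re (half_plane \<alpha> x) + Re t" using arg_cong[OF eq, of Re] by simp
      moreover have "0 < \<mu> * Re (half_plane \<alpha> x)" using \<mu> Re_half_plane_pos[OF \<alpha>(1) x(1)] by simp
      ultimately show False using t by simp
    qed
  next
    assume t: "Re t = 0"
    have "Some y \<in> \<phi> ` (Some ` unit_disc)" if y: "y \<in> unit_disc" for y
    proof -
      define w where "w = (half_plane \<alpha> y - t) / of_real \<mu>"
      have w: "0 < Re w" unfolding w_def Re_divide_of_real using t \<mu> Re_half_plane_pos[OF \<alpha>(1) y] by simp
      define x where "x = disc_point \<alpha> w"
      have x: "x \<in> unit_disc" unfolding x_def using \<alpha>(1) w by (intro disc_point_in_disc)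
      have "half_plane \<alpha> x = w" unfolding x_def using nz w by (intro half_plane_disc_point Re_pos_neq) auto
      then have "half_plane \<alpha> (G x) = half_plane \<alpha> y" using hpG[OF x] \<mu> by (simp add: w_def)
      then have "disc_point \<alpha> (half_plane \<alpha> (G x)) = disc_point \<alpha> (half_plane \<alpha> y)" by simp
      moreover have "G x \<in> unit_disc" using G_maps x by blast
      ultimately have "G x = y" using disc_point_half_plane nz(1) za y by metis
      then show ?thesis using x \<phi>G(1)[OF denom[OF x]] by (intro image_eqI[of _ _ "Some x"]) auto
    qed
    then show "disc_automorphism \<phi>"
      using lft unfolding disc_automorphism_def disc_lft_def by blast
  qed
  have deriv: "deriv (on_plane \<phi>) \<alpha> = of_real (1 / \<mu>)"
  proof (rule DERIV_imp_deriv)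
    have "(G has_field_derivative (a * (c * \<alpha> + d) - (a * \<alpha> + b) * c) / ((c * \<alpha> + d) * (c * \<alpha> + d))) (at \<alpha>)"
      unfolding G_def using nz(2) by (auto intro!: derivative_eq_intros)
    also have "(a * (c * \<alpha> + d) - (a * \<alpha> + b) * c) / ((c * \<alpha> + d) * (c * \<alpha> + d)) = 1 / slope \<alpha>"
    proof -
      have "a * (c * \<alpha> + d) - (a * \<alpha> + b) * c = (a - \<alpha> * c) * (c * \<alpha> + d)"
        unfolding nz(4) by (simp add: power2_eq_square algebra_simps)
      then show ?thesis using nz by (simp add: slope_def)
    qed
    finally have "(G has_field_derivative of_real (1 / \<mu>)) (at \<alpha>)" by (simp add: \<mu>)
    moreover have "open {z. c * z + d \<noteq> 0}"
      by (intro open_Collect_neq continuous_intros)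
    ultimately show "(on_plane \<phi> has_field_derivative of_real (1 / \<mu>)) (at \<alpha>)"
      by (rule has_field_derivative_transform_within_open) (use nz \<phi>G(2) in auto)
  qed
  have eq: "\<phi> = affine_moebius \<alpha> \<mu> t"
  proof -
    \<comment> \<open>Up to the scalar \<open>s\<close> the four coefficients depend on \<alpha>,
      \<mu> and \<open>t\<close> only.\<close>
    define s where "s = a - \<alpha> * c"
    have s: "s \<noteq> 0" using nz by (simp add: s_def)
    define \<kappa> where "\<kappa> = (of_real \<mu> - 1 - t) / (2 * \<alpha>)"
    have "of_real \<mu> - 1 - t = 2 * \<alpha> * c / s" by (simp add: t_def shift_def \<mu>(1) s_def)
    then have c: "c = s * \<kappa>" using s nz(1) by (simp add: \<kappa>_def)
    have a: "a = s * (1 + \<alpha> * \<kappa>)"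
    proof -
      have "s + \<alpha> * c = s * (1 + \<alpha> * \<kappa>)" unfolding c by (simp add: algebra_simps)
      then show ?thesis by (simp add: s_def)
    qed
    have "of_real \<mu> * s = c * \<alpha> + d" using \<mu>(1) s by (simp add: slope_def s_def[symmetric] field_simps)
    then have d: "d = s * (of_real \<mu> - \<alpha> * \<kappa>)" unfolding c by (simp add: algebra_simps eq_diff_eq)
    have b: "b = s * (of_real \<mu> * \<alpha> - \<alpha> - \<kappa> * \<alpha>\<^sup>2)"
    proof -
      have "c * \<alpha>\<^sup>2 + d * \<alpha> - a * \<alpha> = (s * \<kappa>) * \<alpha>\<^sup>2 + (s * (of_real \<mu> - \<alpha> * \<kappa>)) * \<alpha> - (s * (1 + \<alpha> * \<kappa>)) * \<alpha>"
        by (simp only: a[symmetric] c[symmetric] d[symmetric])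
      also have "\<dots> = s * (of_real \<mu> * \<alpha> - \<alpha> - \<kappa> * \<alpha>\<^sup>2)"
        by (simp add: power2_eq_square algebra_simps)
      finally show ?thesis using nz(4) by simp
    qed
    have "\<phi> = moebius (s * (1 + \<alpha> * \<kappa>)) (s * (of_real \<mu> * \<alpha> - \<alpha> - \<kappa> * \<alpha>\<^sup>2)) (s * \<kappa>) (s * (of_real \<mu> - \<alpha> * \<kappa>))"
      unfolding \<phi> using a b c d by metis
    also have "\<dots> = affine_moebius \<alpha> \<mu> t"
      unfolding moebius_scale[OF s] affine_moebius_def Let_def \<kappa>_def ..
    finally show ?thesis .
  qed
  show ?thesis
    unfolding afp using model par hyp auto deriv eq by blast
qed

section \<open>Obstructions\<close>

text \<open>Uniform in the position \<open>t\<close>: indices are compared with the integer part of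
  \<open>t / b\<close>, and both sides are bounded by the series of inverse squares. The constant
  \<open>M\<close> absorbs the scale \<open>b\<close> and the rounding, which replaces a square
  \<open>1 + (n - k)\<^sup>2\<close> by \<open>3 + 2 * (n - x)\<^sup>2\<close>.\<close>

lemma sum_inverse_square_bound:
  fixes b :: real assumes b: "b \<noteq> 0"
  shows "\<exists>K>0. \<forall>(J :: nat set) t. finite J \<longrightarrow> (\<Sum>n\<in>J. 1 / (1 + (t - b * real n)\<^sup>2)) \<le> K"
proof -
  define M where "M = max 3 (2 / b\<^sup>2)"
  have M: "0 < M" "3 \<le> M" "2 / b\<^sup>2 \<le> M" by (auto simp: M_def)
  have sm: "summable (\<lambda>n. 1 / (real (Suc n))\<^sup>2)"
    using inverse_power_summable[of 2, where 'a = real] by (subst summable_Suc_iff) (simp add: inverse_eq_divide)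
  define Z where "Z = (\<Sum>n. 1 / (real (Suc n))\<^sup>2)"
  have Z0: "0 \<le> Z" unfolding Z_def by (intro suminf_nonneg sm) auto
  have one_side: "(\<Sum>i\<in>I. 1 / (1 + (real i)\<^sup>2)) \<le> 1 + Z" if "finite I" for I :: "nat set"
  proof -
    have "(\<Sum>i\<in>I. 1 / (1 + (real i)\<^sup>2)) \<le> (\<Sum>i\<in>insert 0 (I - {0}). 1 / (1 + (real i)\<^sup>2))"
      using that by (intro sum_mono2) (auto simp: add_nonneg_eq_0_iff)
    also have "\<dots> = 1 + (\<Sum>i\<in>I - {0}. 1 / (1 + (real i)\<^sup>2))" using that by (subst sum.insert) auto
    also have "(\<Sum>i\<in>I - {0}. 1 / (1 + (real i)\<^sup>2)) \<le> (\<Sum>i\<in>I - {0}. 1 / (real i)\<^sup>2)"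
      by (intro sum_mono divide_left_mono) (auto intro!: mult_pos_pos add_pos_nonneg)
    also have "\<dots> = (\<Sum>i\<in>(\<lambda>i. i - 1) ` (I - {0}). 1 / (real (Suc i))\<^sup>2)"
      by (subst sum.reindex) (auto simp: inj_on_def intro!: sum.cong)
    also have "\<dots> \<le> Z" unfolding Z_def using that by (intro sum_le_suminf sm) auto
    finally show ?thesis by simp
  qed
  show ?thesis
  proof (intro exI[of _ "M * (2 * (1 + Z))"] conjI allI impI)
    show "0 < M * (2 * (1 + Z))" using M Z0 by (simp add: add_pos_nonneg)
    fix J :: "nat set" and t assume J: "finite J"
    define x where "x = t / b"
    define k where "k = \<lfloor>x\<rfloor>"
    have term_le: "1 / (1 + (t - b * real n)\<^sup>2) \<le> M * (1 / (1 + (real_of_int (int n - k))\<^sup>2))" for n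
    proof -
      have "\<bar>real_of_int (int n - k)\<bar> \<le> \<bar>real n - x\<bar> + 1" unfolding k_def by linarith
      then have "(real_of_int (int n - k))\<^sup>2 \<le> (\<bar>real n - x\<bar> + 1)\<^sup>2"
        by (metis abs_ge_zero power2_abs power_mono)
      also have "\<dots> \<le> 2 * (real n - x)\<^sup>2 + 2"
        using zero_le_power2[of "\<bar>real n - x\<bar> - 1"] by (simp add: power2_eq_square algebra_simps)
      finally have le: "1 + (real_of_int (int n - k))\<^sup>2 \<le> 3 + 2 * (real n - x)\<^sup>2" by simp
      have "t - b * real n = b * (x - real n)" using b by (simp add: x_def algebra_simps)
      then have "(t - b * real n)\<^sup>2 = b\<^sup>2 * (real n - x)\<^sup>2" by (simp add: power_mult_distrib power2_commute)
      then have "2 * (real n - x)\<^sup>2 = (2 / b\<^sup>2) * (t - b * real n)\<^sup>2" using b by simp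
      also have "\<dots> \<le> M * (t - b * real n)\<^sup>2" using M by (intro mult_right_mono) auto
      finally have "1 + (real_of_int (int n - k))\<^sup>2 \<le> M * (1 + (t - b * real n)\<^sup>2)"
        using le M(2) unfolding distrib_left by linarith
      moreover have "0 < 1 + (real_of_int (int n - k))\<^sup>2" "0 < 1 + (t - b * real n)\<^sup>2"
        by (simp_all add: add_pos_nonneg)
      ultimately show ?thesis by (simp add: field_simps)
    qed
    have "(\<Sum>n\<in>J. 1 / (1 + (t - b * real n)\<^sup>2)) \<le> (\<Sum>n\<in>J. M * (1 / (1 + (real_of_int (int n - k))\<^sup>2)))"
      by (intro sum_mono term_le)
    also have "\<dots> = M * (\<Sum>n\<in>J. 1 / (1 + (real_of_int (int n - k))\<^sup>2))" by (simp add: sum_distrib_left)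
    also have "(\<Sum>n\<in>J. 1 / (1 + (real_of_int (int n - k))\<^sup>2)) =
       (\<Sum>n\<in>{n\<in>J. k \<le> int n}. 1 / (1 + (real_of_int (int n - k))\<^sup>2)) + (\<Sum>n\<in>{n\<in>J. \<not> k \<le> int n}. 1 / (1 + (real_of_int (int n - k))\<^sup>2))"
      using J by (subst sum.union_disjoint[symmetric]) (auto intro!: sum.cong)
    also have "(\<Sum>n\<in>{n\<in>J. k \<le> int n}. 1 / (1 + (real_of_int (int n - k))\<^sup>2)) = (\<Sum>i\<in>(\<lambda>n. nat (int n - k)) ` {n\<in>J. k \<le> int n}. 1 / (1 + (real i)\<^sup>2))"
      by (subst sum.reindex) (auto simp: inj_on_def intro!: sum.cong)
    also have "\<dots> \<le> 1 + Z" using J by (intro one_side) auto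
    also have "(\<Sum>n\<in>{n\<in>J. \<not> k \<le> int n}. 1 / (1 + (real_of_int (int n - k))\<^sup>2)) = (\<Sum>i\<in>(\<lambda>n. nat (k - int n)) ` {n\<in>J. \<not> k \<le> int n}. 1 / (1 + (real i)\<^sup>2))"
      by (subst sum.reindex) (auto simp: inj_on_def power2_commute intro!: sum.cong)
    also have "\<dots> \<le> 1 + Z" using J by (intro one_side) auto
    finally show "(\<Sum>n\<in>J. 1 / (1 + (t - b * real n)\<^sup>2)) \<le> M * (2 * (1 + Z))" using M by simp
  qed
qed

lemma lower_density_posD:
  assumes "0 < lower_density A"
  shows "\<exists>\<delta>>0. \<exists>N. \<forall>n\<ge>N. \<delta> * real n \<le> real (card (A \<inter> {1..n}))"
proof -
  obtain \<delta> where \<delta>: "0 < ereal \<delta>" "ereal \<delta> < lower_density A" using ereal_dense2[OF assms] by blast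
  then have "eventually (\<lambda>n. ereal \<delta> < ereal (real (card (A \<inter> {1..n})) / real n)) sequentially"
    unfolding lower_density_def by (intro less_LiminfD)
  then obtain N where N: "\<And>n. N \<le> n \<Longrightarrow> \<delta> < real (card (A \<inter> {1..n})) / real n"
    by (auto simp: eventually_at_top_linorder)
  show ?thesis
  proof (intro exI[of _ \<delta>] conjI exI[of _ N] allI impI)
    fix n assume "N \<le> n"
    from N[OF this] show "\<delta> * real n \<le> real (card (A \<inter> {1..n}))"
      by (cases "n = 0") (auto simp: less_divide_eq)
  qed (use \<delta> in simp)
qed

lemma lower_density_pos_infinite:
  assumes "0 < lower_density A" shows "infinite A"
proof
  assume fin: "finite A"
  obtain \<delta> N where \<delta>: "0 < \<delta>" and N: "\<And>n. N \<le> n \<Longrightarrow> \<delta> * real n \<le> real (card (A \<inter> {1..n}))"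
    using lower_density_posD[OF assms] by blast
  obtain n where n: "real (card A) < real n * \<delta>" using reals_Archimedean3[OF \<delta>] by blast
  have "real n * \<delta> \<le> \<delta> * real (max n N)" using \<delta> by simp
  also have "\<dots> \<le> real (card (A \<inter> {1..max n N}))" by (rule N) simp
  also have "\<dots> \<le> real (card A)" using fin by (intro of_nat_mono card_mono) auto
  finally show False using n by simp
qed

lemma hypercyclic_pair_swap: "hypercyclic_pair g1 g2 \<Longrightarrow> hypercyclic_pair g2 g1"
  unfolding hypercyclic_pair_def by (subst conj_commute) blast

section \<open>Values of approximating functions along orbits\<close>

definition disc_poly :: "complex poly \<Rightarrow> complex \<Rightarrow> complex" where
  "disc_poly p z = (if z \<in> unit_disc then poly p z else 0)"

lemma holomorphic_poly: "poly p holomorphic_on A"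
  by (induction p) (auto intro!: holomorphic_intros simp: fun_eq_iff intro: holomorphic_transform[of "\<lambda>z. a + z * poly p z" for a p])

lemma poly_bounded_disc: "\<exists>C\<ge>0. \<forall>z\<in>unit_disc. cmod (poly p z) \<le> C"
proof -
  have "compact (poly p ` cball 0 1)"
    by (intro compact_continuous_image continuous_intros) auto
  then obtain C where "\<forall>z\<in>cball 0 1. cmod (poly p z) \<le> C"
    using compact_imp_bounded bounded_iff by (metis imageI)
  moreover from this have "0 \<le> C" by (metis centre_in_cball norm_ge_zero order.trans zero_le_one)
  ultimately show ?thesis by auto
qed

lemma disc_poly_hardy2: "disc_poly p \<in> hardy2"
proof -
  obtain C where C: "0 \<le> C" "\<And>z. z \<in> unit_disc \<Longrightarrow> cmod (poly p z) \<le> C" using poly_bounded_disc by blast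
  have hol: "disc_poly p holomorphic_on unit_disc"
    by (rule holomorphic_transform[OF holomorphic_poly]) (simp add: disc_poly_def)
  have "L2_bounded (\<lambda>z. cmod (disc_poly p z)) C"
    by (rule L2_bounded_holomorphic[OF hol L2_bounded_const[OF C(1)]]) (use C(2) in \<open>simp_all add: disc_poly_def\<close>)
  then show ?thesis by (intro hardy2I(1)[OF hol]) (simp_all add: disc_poly_def)
qed

lemma approximation_at_point:
  assumes f: "f \<in> hardy2" and g: "g ` unit_disc \<subseteq> unit_disc" "g holomorphic_on unit_disc"
    and b: "L2_bounded (\<lambda>z. cmod (f ((g ^^ n) z) - disc_poly p z)) e" and z: "z \<in> unit_disc"
  shows "cmod (f ((g ^^ n) z) - poly p z) \<le> e / sqrt (1 - (cmod z)\<^sup>2)"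
proof -
  have "(\<lambda>z. f ((g ^^ n) z) - disc_poly p z) holomorphic_on unit_disc"
    using f disc_poly_hardy2[of p] by (intro holomorphic_intros holomorphic_iterate_compose g) (auto simp: hardy2_def)
  from point_evaluation_bound[OF this b z] show ?thesis using z by (simp add: disc_poly_def)
qed

text \<open>In the sector at height \<open>t\<close> the kernels are of size \<open>t\<close>, while
  two points of bounded Euclidean distance have pseudohyperbolic distance of order
  \<open>1 / t\<close>, which enters squared; a factor \<open>1 / t\<close> remains.\<close>

lemma half_plane_difference_bound:
  assumes f: "f \<in> hardy2" and \<alpha>: "cmod \<alpha> = 1" and t: "0 < t" and c: "0 < c"
    and w: "c * t \<le> Re w" "cmod (w + 1) \<le> C * t" and w': "c * t \<le> Re w'" "cmod (w' + 1) \<le> C * t"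
    and K: "cmod (w - w') \<le> K"
  shows "(cmod (f (disc_point \<alpha> w) - f (disc_point \<alpha> w')))\<^sup>2 \<le> (hardy2_norm f)\<^sup>2 * (C\<^sup>2 * K\<^sup>2 / (8 * c ^ 3) / t)"
proof -
  have ct: "0 < c * t" using c t by simp
  have re: "0 < Re w" "0 < Re w'" using w w' ct by linarith+
  have ne: "w \<noteq> - 1" "w' \<noteq> - 1" using re Re_pos_neq by auto
  have D: "disc_point \<alpha> w \<in> unit_disc" "disc_point \<alpha> w' \<in> unit_disc" using disc_point_in_disc \<alpha> re by blast+
  have hol: "f holomorphic_on unit_disc" using f by (simp add: hardy2_def)
  have w1: "w + 1 \<noteq> 0" "w' + 1 \<noteq> 0" using ne by (metis add_eq_0_iff2)+
  have k: "1 / (1 - (cmod (disc_point \<alpha> v))\<^sup>2) \<le> C\<^sup>2 * t / (4 * c)" if v: "c * t \<le> Re v" "cmod (v + 1) \<le> C * t" for v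
  proof -
    have re: "0 < Re v" using v ct by linarith
    then have "1 / (1 - (cmod (disc_point \<alpha> v))\<^sup>2) = (cmod (v + 1))\<^sup>2 / (4 * Re v)"
      by (subst norm_disc_point[OF \<alpha> Re_pos_neq]) auto
    also have "\<dots> \<le> (C * t)\<^sup>2 / (4 * (c * t))"
      using v ct re by (intro frac_le power_mono) auto
    also have "\<dots> = C\<^sup>2 * t / (4 * c)" using t by (simp add: power2_eq_square)
    finally show ?thesis .
  qed
  have diff: "disc_point \<alpha> w - disc_point \<alpha> w' = 2 * \<alpha> * (w - w') / ((w + 1) * (w' + 1))"
    using w1 by (simp add: disc_point_def field_simps)
  have "cmod (cnj w' + 1) = cmod (w' + 1)" by (metis complex_cnj_add complex_cnj_one complex_mod_cnj)
  then have "(cmod (disc_point \<alpha> w - disc_point \<alpha> w'))\<^sup>2 / (cmod (1 - disc_point \<alpha> w * cnj (disc_point \<alpha> w')))\<^sup>2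
     = (cmod (w - w'))\<^sup>2 / (cmod (w + cnj w'))\<^sup>2"
    unfolding diff disc_point_kernel[OF \<alpha> ne] power_divide[symmetric] norm_divide[symmetric]
    using w1 \<alpha> by (simp add: norm_divide norm_mult del: distrib_left_numeral)
  also have "\<dots> \<le> K\<^sup>2 / (2 * (c * t))\<^sup>2"
  proof (intro frac_le power_mono)
    show "2 * (c * t) \<le> cmod (w + cnj w')" using complex_Re_le_cmod[of "w + cnj w'"] w w' by simp
  qed (use K ct in auto)
  finally have ph: "(cmod (disc_point \<alpha> w - disc_point \<alpha> w'))\<^sup>2 / (cmod (1 - disc_point \<alpha> w * cnj (disc_point \<alpha> w')))\<^sup>2
     \<le> K\<^sup>2 / (2 * (c * t))\<^sup>2" .
  have "(cmod (f (disc_point \<alpha> w) - f (disc_point \<alpha> w')))\<^sup>2 \<le> (hardy2_norm f)\<^sup>2 *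
     ((C\<^sup>2 * t / (4 * c) + C\<^sup>2 * t / (4 * c)) * (K\<^sup>2 / (2 * (c * t))\<^sup>2))"
    by (rule order.trans[OF point_difference_bound[OF hol L2_bounded_hardy2[OF f] D]])
       (intro mult_left_mono mult_mono add_mono k w w' ph; use c t in auto)
  also have "(C\<^sup>2 * t / (4 * c) + C\<^sup>2 * t / (4 * c)) * (K\<^sup>2 / (2 * (c * t))\<^sup>2) = C\<^sup>2 * K\<^sup>2 / (8 * c ^ 3) / t"
    using c t by (simp add: power2_eq_square power3_eq_cube field_simps)
  finally show ?thesis .
qed

lemma half_plane_difference_tendsto:
  assumes f: "f \<in> hardy2" and \<alpha>: "cmod \<alpha> = 1" and c: "0 < c" and t: "filterlim t at_top sequentially"
    and w: "\<And>n. 0 < t n \<Longrightarrow> c * t n \<le> Re (w n) \<and> cmod (w n + 1) \<le> C * t n"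
    and w': "\<And>n. 0 < t n \<Longrightarrow> c * t n \<le> Re (w' n) \<and> cmod (w' n + 1) \<le> C * t n"
    and K: "\<And>n. cmod (w n - w' n) \<le> K"
  shows "(\<lambda>n. f (disc_point \<alpha> (w n)) - f (disc_point \<alpha> (w' n))) \<longlonglongrightarrow> 0"
proof -
  have "(\<lambda>n. (cmod (f (disc_point \<alpha> (w n)) - f (disc_point \<alpha> (w' n))))\<^sup>2) \<longlonglongrightarrow> 0"
  proof (rule tendsto_sandwich[OF _ _ tendsto_const])
    have "(\<lambda>n. (hardy2_norm f)\<^sup>2 * (C\<^sup>2 * K\<^sup>2 / (8 * c ^ 3) / t n)) \<longlonglongrightarrow> (hardy2_norm f)\<^sup>2 * 0"
      by (intro tendsto_mult_left tendsto_divide_0[OF tendsto_const] filterlim_at_top_imp_at_infinity t)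
    then show "(\<lambda>n. (hardy2_norm f)\<^sup>2 * (C\<^sup>2 * K\<^sup>2 / (8 * c ^ 3) / t n)) \<longlonglongrightarrow> 0" by simp
    have "eventually (\<lambda>n. 0 < t n) sequentially" using t by (simp add: filterlim_at_top_dense)
    then show "eventually (\<lambda>n. (cmod (f (disc_point \<alpha> (w n)) - f (disc_point \<alpha> (w' n))))\<^sup>2 \<le>
       (hardy2_norm f)\<^sup>2 * (C\<^sup>2 * K\<^sup>2 / (8 * c ^ 3) / t n)) sequentially"
      by (rule eventually_mono) (use half_plane_difference_bound[OF f \<alpha> _ c] w w' K in blast)
  qed auto
  then have "(\<lambda>n. sqrt ((cmod (f (disc_point \<alpha> (w n)) - f (disc_point \<alpha> (w' n))))\<^sup>2)) \<longlonglongrightarrow> sqrt 0"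
    by (intro tendsto_intros)
  then show ?thesis by (simp add: tendsto_norm_zero_iff)
qed

lemma filterlim_power_at_top:
  assumes "1 < (\<mu>::real)" shows "filterlim (\<lambda>n. \<mu> ^ n) at_top sequentially"
  unfolding filterlim_at_top
proof
  fix Z
  obtain N where N: "Z < \<mu> ^ N" using real_arch_pow[OF assms] by blast
  show "eventually (\<lambda>n. Z \<le> \<mu> ^ n) sequentially"
    unfolding eventually_at_top_linorder
  proof (intro exI[of _ N] allI impI)
    fix n assume "N \<le> n"
    then have "\<mu> ^ N \<le> \<mu> ^ n" using assms by (intro power_increasing) auto
    with N show "Z \<le> \<mu> ^ n" by simp
  qed
qed

lemma not_tendsto_zero:
  fixes X :: "nat \<Rightarrow> complex"
  assumes "X \<longlonglongrightarrow> 0" and "infinite {n. cmod (X n - c) \<le> cmod c / 2}" and "c \<noteq> 0"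
  shows False
proof -
  have "eventually (\<lambda>n. cmod (X n) < cmod c / 2) sequentially"
    by (rule order_tendstoD(2)[OF tendsto_norm_zero[OF assms(1)]]) (use assms(3) in simp)
  then obtain N where N: "\<And>n. N \<le> n \<Longrightarrow> cmod (X n) < cmod c / 2" by (auto simp: eventually_at_top_linorder)
  obtain n where "N \<le> n" "cmod (X n - c) \<le> cmod c / 2"
    using assms(2) unfolding infinite_nat_iff_unbounded_le by blast
  then show False using N[of n] norm_triangle_ineq4[of "X n" "X n - c"] by simp
qed

lemma affine_model_disc_point:
  assumes m: "affine_model g \<alpha> \<mu> b" and z: "z \<in> unit_disc"
  shows "(g ^^ n) z = disc_point \<alpha> (of_real (\<mu> ^ n) * half_plane \<alpha> z + of_real (\<Sum>i<n. \<mu> ^ i) * b)"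
proof -
  have "\<alpha> \<noteq> 0" "\<alpha> \<noteq> (g ^^ n) z"
    using m affine_model_iterate(1)[OF m z, of n] by (auto simp: affine_model_def)
  from disc_point_half_plane[OF this] show ?thesis
    unfolding affine_model_iterate(2)[OF m z] by simp
qed

lemma parabolic_nonautomorphism_not_hypercyclic:
  assumes m: "affine_model g \<alpha> 1 b" and b: "0 < Re b"
  shows "\<not> hypercyclic_pair g g'"
proof
  assume "hypercyclic_pair g g'"
  then obtain f where f: "f \<in> hardy2" and dens: "\<And>h1 h2 e. h1 \<in> hardy2 \<Longrightarrow> h2 \<in> hardy2 \<Longrightarrow> 0 < e \<Longrightarrow>
       0 < lower_density {n. L2_bounded (\<lambda>z. cmod (f ((g ^^ n) z) - h1 z)) e \<and>
          L2_bounded (\<lambda>z. cmod (f ((g' ^^ n) z) - h2 z)) e}"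
    unfolding hypercyclic_pair_def by blast
  have \<alpha>: "cmod \<alpha> = 1" "\<alpha> \<noteq> 0" and g: "g ` unit_disc \<subseteq> unit_disc" "g holomorphic_on unit_disc"
    using m by (auto simp: affine_model_def)
  \<comment> \<open>The points 0 and \<open>y\<close> have half-plane coordinates 1 and 2; their
    orbits keep the Euclidean distance 1 and stay in a sector, because \<open>Re b\<close> is
    positive.\<close>
  define y where "y = disc_point \<alpha> 2"
  have y: "y \<in> unit_disc" unfolding y_def using \<alpha> by (intro disc_point_in_disc) auto
  have y3: "y = \<alpha> / 3" by (simp add: y_def disc_point_def)
  have hy: "half_plane \<alpha> y = 2" unfolding y_def using \<alpha> by (intro half_plane_disc_point) auto
  have h0: "half_plane \<alpha> 0 = 1" using \<alpha> by (simp add: half_plane_def)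
  let ?X = "\<lambda>n. f ((g ^^ n) y) - f ((g ^^ n) 0)"
  have "(\<lambda>n. f (disc_point \<alpha> (2 + of_nat n * b)) - f (disc_point \<alpha> (1 + of_nat n * b))) \<longlonglongrightarrow> 0"
  proof (rule half_plane_difference_tendsto[where C = "3 + cmod b" and c = "Re b" and K = 1, OF f \<alpha>(1) b filterlim_real_sequentially])
    fix n assume n: "0 < real n"
    have "cmod (2 + of_nat n * b + 1) \<le> 3 * 1 + real n * cmod b"
      using norm_triangle_ineq[of 3 "of_nat n * b"] by (simp add: norm_mult)
    also have "\<dots> \<le> 3 * real n + real n * cmod b" using n by (intro add_mono mult_left_mono) auto
    finally show "Re b * real n \<le> Re (2 + of_nat n * b) \<and> cmod (2 + of_nat n * b + 1) \<le> (3 + cmod b) * real n"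
      by (simp add: algebra_simps)
    have "cmod (1 + of_nat n * b + 1) \<le> 2 * 1 + real n * cmod b"
      using norm_triangle_ineq[of 2 "of_nat n * b"] by (simp add: norm_mult)
    also have "\<dots> \<le> 3 * real n + real n * cmod b" using n by (intro add_mono mult_mono) auto
    finally show "Re b * real n \<le> Re (1 + of_nat n * b) \<and> cmod (1 + of_nat n * b + 1) \<le> (3 + cmod b) * real n"
      by (simp add: algebra_simps)
  qed simp
  then have "?X \<longlonglongrightarrow> 0"
    using affine_model_disc_point[OF m y] affine_model_disc_point[OF m, of 0] by (simp add: hy h0)
  \<comment> \<open>The target is the identity function. The errors \<open>1 / 20\<close> at 0 and
    \<open>1 / 10\<close> at \<open>y\<close> sum to less than
    \<open>cmod y / 2 = 1 / 6\<close>.\<close>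
  moreover have "infinite {n. cmod (?X n - y) \<le> cmod y / 2}"
  proof (rule infinite_super[OF _ lower_density_pos_infinite[OF dens[of "disc_poly [:0, 1:]" "disc_poly 0" "1 / 20"]]])
    show "{n. L2_bounded (\<lambda>z. cmod (f ((g ^^ n) z) - disc_poly [:0, 1:] z)) (1 / 20) \<and>
          L2_bounded (\<lambda>z. cmod (f ((g' ^^ n) z) - disc_poly 0 z)) (1 / 20)} \<subseteq> {n. cmod (?X n - y) \<le> cmod y / 2}"
    proof (clarify)
      fix n assume L: "L2_bounded (\<lambda>z. cmod (f ((g ^^ n) z) - disc_poly [:0, 1:] z)) (1 / 20)"
      have "cmod (f ((g ^^ n) 0) - poly [:0, 1:] 0) \<le> 1 / 20 / sqrt (1 - (cmod 0)\<^sup>2)"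
        by (rule approximation_at_point[OF f g L]) simp
      moreover have "cmod (f ((g ^^ n) y) - poly [:0, 1:] y) \<le> 1 / 20 / sqrt (1 - (cmod y)\<^sup>2)"
        by (rule approximation_at_point[OF f g L y])
      moreover have "1 / 20 / sqrt (1 - (cmod y)\<^sup>2) \<le> 1 / 10"
      proof -
        have "1 / 2 \<le> sqrt (1 - (cmod y)\<^sup>2)" using \<alpha> by (intro real_le_rsqrt) (simp add: y3 norm_divide power2_eq_square)
        then have "1 / 20 / sqrt (1 - (cmod y)\<^sup>2) \<le> 1 / 20 / (1 / 2)"
          by (intro divide_left_mono mult_pos_pos) linarith+
        then show ?thesis by simp
      qed
      ultimately have "cmod (f ((g ^^ n) 0)) \<le> 1 / 20" "cmod (f ((g ^^ n) y) - y) \<le> 1 / 10" by auto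
      moreover have "cmod (?X n - y) \<le> cmod (f ((g ^^ n) y) - y) + cmod (f ((g ^^ n) 0))"
        using norm_triangle_ineq4[of "f ((g ^^ n) y) - y" "f ((g ^^ n) 0)"] by (simp add: algebra_simps)
      moreover have "cmod y = 1 / 3" using \<alpha> by (simp add: y3 norm_divide)
      ultimately show "cmod (?X n - y) \<le> cmod y / 2" by simp
    qed
  qed (auto intro: disc_poly_hardy2)
  ultimately show False by (rule not_tendsto_zero) (use \<alpha> in \<open>simp add: y3\<close>)
qed

lemma geometric_partial_sum_le:
  assumes "1 < (\<mu>::real)" shows "0 \<le> (\<Sum>i<n. \<mu> ^ i)" "(\<Sum>i<n. \<mu> ^ i) = (\<mu> ^ n - 1) / (\<mu> - 1)"
  using assms by (auto intro!: sum_nonneg simp: geometric_sum)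

lemma equal_multipliers_not_hypercyclic:
  assumes m1: "affine_model g1 \<alpha> \<mu> b1" and m2: "affine_model g2 \<alpha> \<mu> b2" and \<mu>: "1 < \<mu>"
  shows "\<not> hypercyclic_pair g1 g2"
proof
  assume "hypercyclic_pair g1 g2"
  then obtain f where f: "f \<in> hardy2" and dens: "\<And>h1 h2 e. h1 \<in> hardy2 \<Longrightarrow> h2 \<in> hardy2 \<Longrightarrow> 0 < e \<Longrightarrow>
       0 < lower_density {n. L2_bounded (\<lambda>z. cmod (f ((g1 ^^ n) z) - h1 z)) e \<and>
          L2_bounded (\<lambda>z. cmod (f ((g2 ^^ n) z) - h2 z)) e}"
    unfolding hypercyclic_pair_def by blast
  have \<alpha>: "cmod \<alpha> = 1" "\<alpha> \<noteq> 0" and b: "0 \<le> Re b1" "0 \<le> Re b2"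
    and g1: "g1 ` unit_disc \<subseteq> unit_disc" "g1 holomorphic_on unit_disc"
    and g2: "g2 ` unit_disc \<subseteq> unit_disc" "g2 holomorphic_on unit_disc"
    using m1 m2 by (auto simp: affine_model_def)
  \<comment> \<open>Orbits started at \<open>w1\<close> and \<open>w1 + d\<close> keep the
    difference \<open>d\<close> at all times: the shifts contribute
    \<open>(\<mu> ^ n - 1) * d\<close>, which the dilated difference \<open>\<mu> ^ n * d\<close>
    exceeds by exactly \<open>d\<close>. The size of \<open>w1\<close> keeps both real parts at
    least 1.\<close>
  define d where "d = (b1 - b2) / of_real (\<mu> - 1)"
  define w1 :: complex where "w1 = of_real (1 + cmod d)"
  define w2 where "w2 = w1 + d"
  have re: "1 \<le> Re w1" "1 \<le> Re w2"
    using abs_Re_le_cmod[of d] by (auto simp: w1_def w2_def)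
  define y1 y2 where "y1 = disc_point \<alpha> w1" and "y2 = disc_point \<alpha> w2"
  have y: "y1 \<in> unit_disc" "y2 \<in> unit_disc"
    unfolding y1_def y2_def using disc_point_in_disc[OF \<alpha>(1)] re by (meson less_le_trans zero_less_one)+
  have hy: "half_plane \<alpha> y1 = w1" "half_plane \<alpha> y2 = w2"
    unfolding y1_def y2_def using \<alpha> re by (auto intro!: half_plane_disc_point Re_pos_neq)
  define S where "S n = (\<Sum>i<n. \<mu> ^ i)" for n
  have S: "0 \<le> S n" "S n = (\<mu> ^ n - 1) / (\<mu> - 1)" for n
    using geometric_partial_sum_le[OF \<mu>] by (auto simp: S_def)
  define C where "C = cmod w1 + cmod w2 + (cmod b1 + cmod b2) / (\<mu> - 1) + 1"
  have bound: "1 * \<mu> ^ n \<le> Re (of_real (\<mu> ^ n) * w + of_real (S n) * b) \<and> cmod (of_real (\<mu> ^ n) * w + of_real (S n) * b + 1) \<le> C * \<mu> ^ n"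
    if "1 \<le> Re w" "0 \<le> Re b" "cmod w + cmod b / (\<mu> - 1) + 1 \<le> C" for w b n
  proof
    have "\<mu> ^ n * 1 \<le> \<mu> ^ n * Re w" using that \<mu> by (intro mult_left_mono) auto
    then show "1 * \<mu> ^ n \<le> Re (of_real (\<mu> ^ n) * w + of_real (S n) * b)"
      using S(1)[of n] that by (simp add: add_increasing2)
    have "S n \<le> \<mu> ^ n / (\<mu> - 1)" unfolding S(2) using \<mu> by (intro divide_right_mono) auto
    then have "S n * cmod b \<le> \<mu> ^ n / (\<mu> - 1) * cmod b" by (intro mult_right_mono) auto
    moreover have "cmod (of_real (\<mu> ^ n) * w + of_real (S n) * b + 1) \<le> \<mu> ^ n * cmod w + S n * cmod b + 1"
      using norm_triangle_ineq[of "of_real (\<mu> ^ n) * w + of_real (S n) * b" 1] norm_triangle_ineq[of "of_real (\<mu> ^ n) * w" "of_real (S n) * b"] S(1)[of n] \<mu>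
      by (simp add: norm_mult norm_power)
    moreover have "1 \<le> \<mu> ^ n" using \<mu> by (simp add: one_le_power)
    ultimately have "cmod (of_real (\<mu> ^ n) * w + of_real (S n) * b + 1) \<le> \<mu> ^ n * (cmod w + cmod b / (\<mu> - 1) + 1)"
      unfolding distrib_left by simp
    also have "\<dots> \<le> \<mu> ^ n * C" using that \<mu> by (intro mult_left_mono) auto
    finally show "cmod (of_real (\<mu> ^ n) * w + of_real (S n) * b + 1) \<le> C * \<mu> ^ n" by (simp add: mult.commute)
  qed
  let ?X = "\<lambda>n. f ((g1 ^^ n) y1) - f ((g2 ^^ n) y2)"
  have "(\<lambda>n. f (disc_point \<alpha> (of_real (\<mu> ^ n) * w1 + of_real (S n) * b1)) - f (disc_point \<alpha> (of_real (\<mu> ^ n) * w2 + of_real (S n) * b2))) \<longlonglongrightarrow> 0"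
  proof (rule half_plane_difference_tendsto[where C = C and c = 1 and t = "\<lambda>n. \<mu> ^ n" and K = "cmod d", OF f \<alpha>(1) zero_less_one])
    show "filterlim (\<lambda>n. \<mu> ^ n) at_top sequentially" using \<mu> by (rule filterlim_power_at_top)
    have nn: "0 \<le> cmod b1 / (\<mu> - 1)" "0 \<le> cmod b2 / (\<mu> - 1)" using \<mu> by auto
    show "1 * \<mu> ^ n \<le> Re (of_real (\<mu> ^ n) * w1 + of_real (S n) * b1) \<and> cmod (of_real (\<mu> ^ n) * w1 + of_real (S n) * b1 + 1) \<le> C * \<mu> ^ n" for n
      by (rule bound) (use re b nn in \<open>auto simp: C_def add_divide_distrib\<close>)
    show "1 * \<mu> ^ n \<le> Re (of_real (\<mu> ^ n) * w2 + of_real (S n) * b2) \<and> cmod (of_real (\<mu> ^ n) * w2 + of_real (S n) * b2 + 1) \<le> C * \<mu> ^ n" for n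
      by (rule bound) (use re b nn in \<open>auto simp: C_def add_divide_distrib\<close>)
    show "cmod (of_real (\<mu> ^ n) * w1 + of_real (S n) * b1 - (of_real (\<mu> ^ n) * w2 + of_real (S n) * b2)) \<le> cmod d" for n
    proof -
      have "of_real (S n) * (b1 - b2) = of_real (\<mu> ^ n - 1) * d"
        unfolding S(2) d_def by simp
      then have "of_real (\<mu> ^ n) * w1 + of_real (S n) * b1 - (of_real (\<mu> ^ n) * w2 + of_real (S n) * b2) = - d"
        by (simp add: w2_def algebra_simps)
      then show ?thesis by simp
    qed
  qed
  then have X0: "?X \<longlonglongrightarrow> 0"
    using affine_model_disc_point[OF m1 y(1)] affine_model_disc_point[OF m2 y(2)] by (simp add: hy S_def)
  define r where "r = min (sqrt (1 - (cmod y1)\<^sup>2)) (sqrt (1 - (cmod y2)\<^sup>2))"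
  have r: "0 < r" using norm_square_less_one y by (simp add: r_def del: mem_ball)
  have inf: "infinite {n. cmod (?X n - 1) \<le> cmod 1 / 2}"
  proof (rule infinite_super[OF _ lower_density_pos_infinite[OF dens[of "disc_poly 1" "disc_poly 0" "r / 4"]]])
    show "{n. L2_bounded (\<lambda>z. cmod (f ((g1 ^^ n) z) - disc_poly 1 z)) (r / 4) \<and>
          L2_bounded (\<lambda>z. cmod (f ((g2 ^^ n) z) - disc_poly 0 z)) (r / 4)} \<subseteq> {n. cmod (?X n - 1) \<le> cmod 1 / 2}"
    proof clarify
      fix n assume L: "L2_bounded (\<lambda>z. cmod (f ((g1 ^^ n) z) - disc_poly 1 z)) (r / 4)"
         "L2_bounded (\<lambda>z. cmod (f ((g2 ^^ n) z) - disc_poly 0 z)) (r / 4)"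
      have "r / 4 / sqrt (1 - (cmod y1)\<^sup>2) \<le> r / 4 / r" "r / 4 / sqrt (1 - (cmod y2)\<^sup>2) \<le> r / 4 / r"
        using r by (auto simp: r_def intro!: divide_left_mono)
      with approximation_at_point[OF f g1 L(1) y(1)] approximation_at_point[OF f g2 L(2) y(2)]
      have "cmod (f ((g1 ^^ n) y1) - 1) \<le> 1 / 4" "cmod (f ((g2 ^^ n) y2)) \<le> 1 / 4" using r by auto
      then show "cmod (?X n - 1) \<le> cmod 1 / 2"
        using norm_triangle_ineq4[of "f ((g1 ^^ n) y1) - 1" "f ((g2 ^^ n) y2)"] by (simp add: algebra_simps)
    qed
  qed (use r in \<open>auto intro: disc_poly_hardy2\<close>)
  show False by (rule not_tendsto_zero[OF X0 inf]) simp
qed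

section \<open>A parabolic and a hyperbolic automorphism with common attractor\<close>

lemma disc_point_gram:
  assumes \<alpha>: "cmod \<alpha> = 1" and p: "0 < Re p" and q: "0 < Re q"
  shows "(\<lambda>i. (disc_point \<alpha> p ^ i / (1 + p)) * cnj (disc_point \<alpha> q ^ i / (1 + q))) sums (1 / (2 * (p + cnj q)))"
proof -
  have ne: "p \<noteq> - 1" "q \<noteq> - 1" using p q Re_pos_neq by auto
  have "1 + p \<noteq> 0" "1 + cnj q \<noteq> 0"
    using p q by (auto simp: complex_eq_iff)
  moreover have "p + cnj q \<noteq> 0" using p q by (auto simp: complex_eq_iff)
  ultimately have eq: "1 / (1 - disc_point \<alpha> p * cnj (disc_point \<alpha> q)) * (1 / ((1 + p) * (1 + cnj q))) = 1 / (2 * (p + cnj q))"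
    unfolding disc_point_kernel[OF \<alpha> ne] by (simp add: add.commute)
  have "(\<lambda>i. disc_point \<alpha> p ^ i * cnj (disc_point \<alpha> q ^ i) * (1 / ((1 + p) * (1 + cnj q)))) sums
     (1 / (1 - disc_point \<alpha> p * cnj (disc_point \<alpha> q)) * (1 / ((1 + p) * (1 + cnj q))))"
    by (rule sums_mult2[OF geometric_kernel[OF disc_point_in_disc[OF \<alpha> p] disc_point_in_disc[OF \<alpha> q]]])
  then show ?thesis unfolding eq by simp
qed

text \<open>The second differences in the Gram matrix decay like \<open>1 / \<bar>n - j\<bar>\<^sup>3\<close>, so that Schur's test applies;
  for plain point evaluations one would need Hilbert's inequality.\<close>

lemma second_difference_kernel:
  fixes k :: complex
  assumes k: "Re k = 0"
  shows "cmod (1 / (2 + k) - 2 / (3 + k) + 1 / (4 + k)) \<le> 2 / (1 + (Im k)\<^sup>2)"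
proof -
  have ne: "2 + k \<noteq> 0" "3 + k \<noteq> 0" "4 + k \<noteq> 0" using k by (auto simp: complex_eq_iff)
  have eq: "1 / (2 + k) - 2 / (3 + k) + 1 / (4 + k) = 2 / ((2 + k) * (3 + k) * (4 + k))"
    using ne by (simp add: divide_simps) (simp add: algebra_simps)
  have n: "(cmod (of_real r + k))\<^sup>2 = r\<^sup>2 + (Im k)\<^sup>2" for r
    unfolding cmod_power2 using k by simp
  have "1 + (Im k)\<^sup>2 \<le> (cmod (2 + k))\<^sup>2" using n[of 2] by simp
  also have "\<dots> \<le> cmod (2 + k) * cmod (3 + k) * cmod (4 + k)"
  proof -
    have "(cmod (2 + k))\<^sup>2 \<le> (cmod (3 + k))\<^sup>2" using n[of 2] n[of 3] by simp
    then have 3: "cmod (2 + k) \<le> cmod (3 + k)" by (rule power2_le_imp_le) simp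
    have "1 \<le> cmod (4 + k)" using complex_Re_le_cmod[of "4 + k"] k by simp
    then have "cmod (2 + k) * cmod (2 + k) * 1 \<le> cmod (2 + k) * cmod (3 + k) * cmod (4 + k)"
      using 3 by (intro mult_mono) auto
    then show ?thesis by (simp add: power2_eq_square)
  qed
  finally have le: "1 + (Im k)\<^sup>2 \<le> cmod (2 + k) * cmod (3 + k) * cmod (4 + k)" .
  have "cmod (2 / ((2 + k) * (3 + k) * (4 + k))) = 2 / (cmod (2 + k) * cmod (3 + k) * cmod (4 + k))"
    by (simp add: norm_divide norm_mult)
  also have "\<dots> \<le> 2 / (1 + (Im k)\<^sup>2)"
    using le by (intro divide_left_mono mult_pos_pos) (auto simp: add_pos_nonneg ne)
  finally show ?thesis unfolding eq .
qed

text \<open>Under \<open>g2 ^^ m\<close> the parabolic orbit points have preimages with real part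
  \<open>r / M\<close> and spacing \<open>\<bar>a\<bar> / M\<close>, where
  \<open>M = \<mu> ^ m\<close>. About \<open>M\<close> of them stay in a bounded region, where the
  weights \<open>1 / (1 + p)\<close> are not small. The Gram entries are at most \<open>M\<close>
  times a summable function of \<open>n - j\<close>, so a function of norm \<epsilon> can be large
  at no more than a multiple of \<open>\<epsilon>\<^sup>2 * M\<close> of these times, whereas
  positive lower density requires a fixed proportion of \<open>M\<close>.\<close>

lemma parabolic_hyperbolic_automorphism_not_hypercyclic:
  assumes m1: "affine_model g1 \<alpha> 1 b1" and b1: "Re b1 = 0"
    and m2: "affine_model g2 \<alpha> \<mu> b2" and b2: "Re b2 = 0" and \<mu>: "1 < \<mu>"
  shows "\<not> hypercyclic_pair g1 g2"
proof
  assume "hypercyclic_pair g1 g2"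
  then obtain f where f: "f \<in> hardy2" and dens: "\<And>h1 h2 e. h1 \<in> hardy2 \<Longrightarrow> h2 \<in> hardy2 \<Longrightarrow> 0 < e \<Longrightarrow>
       0 < lower_density {n. L2_bounded (\<lambda>z. cmod (f ((g1 ^^ n) z) - h1 z)) e \<and>
          L2_bounded (\<lambda>z. cmod (f ((g2 ^^ n) z) - h2 z)) e}"
    unfolding hypercyclic_pair_def by blast
  have \<alpha>: "cmod \<alpha> = 1" "\<alpha> \<noteq> 0"
    and g1: "g1 ` unit_disc \<subseteq> unit_disc" "g1 holomorphic_on unit_disc"
    and g2: "g2 ` unit_disc \<subseteq> unit_disc" "g2 holomorphic_on unit_disc"
    and "b1 \<noteq> 0"
    using m1 m2 by (auto simp: affine_model_def)
  define a where "a = Im b1"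
  have a: "a \<noteq> 0" using \<open>b1 \<noteq> 0\<close> b1 by (auto simp: a_def complex_eq_iff)
  obtain K where K: "0 < K" "\<And>(J :: nat set) t. finite J \<Longrightarrow> (\<Sum>n\<in>J. 1 / (1 + (t - a * real n)\<^sup>2)) \<le> K"
    using sum_inverse_square_bound[OF a] by blast
  \<comment> \<open>The fixed point of the affine map of \<open>g2\<close>; it lies on the imaginary
    axis because \<open>g2\<close> is an automorphism.\<close>
  define \<beta> where "\<beta> = - b2 / of_real (\<mu> - 1)"
  have \<beta>: "Re \<beta> = 0" using b2 unfolding \<beta>_def Re_divide_of_real by simp
  have b2\<beta>: "of_real (\<Sum>i<m. \<mu> ^ i) * b2 = \<beta> - of_real (\<mu> ^ m) * \<beta>" for m
  proof -
    have "of_real (\<mu> - 1) \<noteq> (0 :: complex)" using \<mu> by (simp only: of_real_eq_0_iff)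
    then have "b2 = - of_real (\<mu> - 1) * \<beta>" unfolding \<beta>_def by (simp del: of_real_diff)
    then have "of_real (\<Sum>i<m. \<mu> ^ i) * b2 = - of_real ((\<Sum>i<m. \<mu> ^ i) * (\<mu> - 1)) * \<beta>"
      by (simp only: of_real_mult mult_minus_left mult_minus_right mult.assoc)
    also have "(\<Sum>i<m. \<mu> ^ i) * (\<mu> - 1) = \<mu> ^ m - 1"
      unfolding geometric_partial_sum_le(2)[OF \<mu>] using \<mu> by simp
    finally show ?thesis by (simp add: algebra_simps)
  qed
  define C where "C = 2 * (1 + cmod \<beta>) + cmod b1"
  have C: "2 \<le> C" by (simp add: C_def)
  \<comment> \<open>Small enough for \<open>(1 - e) / C - 2 * e\<close> to exceed
    \<open>1 / (2 * C)\<close>: 15/16 minus 1/4 is more than 1/2.\<close>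
  define e where "e = 1 / (8 * C)"
  have e: "0 < e" "e \<le> 1 / 16" using C by (auto simp: e_def field_simps)
  \<comment> \<open>Equal to 1 at 0 and to 0 at \<open>\<alpha> / 3\<close>, the point with
    half-plane coordinate 2, so that a function approximating it has clearly different values at the
    two points.\<close>
  define P where "P = [:1, - 3 / \<alpha>:]"
  define y where "y = disc_point \<alpha> 2"
  have y: "y \<in> unit_disc" unfolding y_def by (rule disc_point_in_disc[OF \<alpha>(1)]) simp
  have y3: "y = \<alpha> / 3" by (simp add: y_def disc_point_def)
  have hy: "half_plane \<alpha> y = 2" unfolding y_def using \<alpha> by (intro half_plane_disc_point) auto
  have h0: "half_plane \<alpha> 0 = 1" using \<alpha> by (simp add: half_plane_def)
  define A where "A = {n. L2_bounded (\<lambda>z. cmod (f ((g1 ^^ n) z) - disc_poly P z)) e}"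
  have "0 < lower_density A"
    by (rule less_le_trans[OF dens[OF disc_poly_hardy2[of P] disc_poly_hardy2[of 0] e(1)] lower_density_mono])
       (auto simp: A_def)
  then obtain \<delta> N0 where \<delta>: "0 < \<delta>" and N0: "\<And>n. N0 \<le> n \<Longrightarrow> \<delta> * real n \<le> real (card (A \<inter> {1..n}))"
    using lower_density_posD by blast
  have A0: "1 - e \<le> cmod (f ((g1 ^^ n) 0))" and Ay: "cmod (f ((g1 ^^ n) y)) \<le> 2 * e" if n: "n \<in> A" for n
  proof -
    have L: "L2_bounded (\<lambda>z. cmod (f ((g1 ^^ n) z) - disc_poly P z)) e" using n by (simp add: A_def)
    have "cmod (f ((g1 ^^ n) 0) - poly P 0) \<le> e / sqrt (1 - (cmod 0)\<^sup>2)"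
      by (rule approximation_at_point[OF f g1 L]) simp
    then have "cmod (f ((g1 ^^ n) 0) - 1) \<le> e" by (simp add: P_def)
    then show "1 - e \<le> cmod (f ((g1 ^^ n) 0))"
      using norm_triangle_ineq3[of "f ((g1 ^^ n) 0)" 1] by simp
    have "cmod (f ((g1 ^^ n) y) - poly P y) \<le> e / sqrt (1 - (cmod y)\<^sup>2)"
      by (rule approximation_at_point[OF f g1 L y])
    also have "\<dots> \<le> e / (1 / 2)"
    proof -
      have "1 / 2 \<le> sqrt (1 - (cmod y)\<^sup>2)" using \<alpha> by (intro real_le_rsqrt) (simp add: y3 norm_divide power2_eq_square)
      then show ?thesis using e by (intro divide_left_mono mult_pos_pos) linarith+
    qed
    finally show "cmod (f ((g1 ^^ n) y)) \<le> 2 * e" using \<alpha> by (simp add: P_def y3)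
  qed
  have main: "real (card (A \<inter> {1..N})) \<le> 4 * C\<^sup>2 * K * \<epsilon>\<^sup>2 * \<mu> ^ m"
    if L: "L2_bounded (\<lambda>z. cmod (f ((g2 ^^ m) z) - disc_poly 0 z)) \<epsilon>" and N: "real N \<le> \<mu> ^ m" for m N \<epsilon>
  proof -
    define M where "M = \<mu> ^ m"
    have M: "1 \<le> M" using \<mu> by (simp add: M_def one_le_power)
    define G where "G z = f ((g2 ^^ m) z)" for z
    have hol: "G holomorphic_on unit_disc"
      unfolding G_def using f by (intro holomorphic_iterate_compose g2) (simp add: hardy2_def)
    have GL: "L2_bounded (\<lambda>z. cmod (G z)) \<epsilon>"
      using L by (simp add: G_def disc_poly_def cong: if_cong)
    obtain c where c: "\<And>z. z \<in> unit_disc \<Longrightarrow> (\<lambda>i. c i * z ^ i) sums G z"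
      using holomorphic_disc_power_series[OF hol] by blast
    define B where "B = A \<inter> {1..N}"
    have B: "finite B" by (simp add: B_def)
    \<comment> \<open>Half-plane coordinates of the preimages of \<open>r + n * b1\<close> under the
      iterate of \<open>g2\<close>; \<open>r\<close> is 1 for the orbit of 0 and 2 for the orbit of
      \<open>y\<close>.\<close>
    define p where "p r n = (of_real r + of_nat n * b1 - \<beta>) / of_real M + \<beta>" for r :: real and n
    have rep: "Re (p r n) = r / M" for r n
      unfolding p_def using b1 \<beta> by (simp add: Re_divide_of_real)
    have p1: "0 < Re (p 1 n)" "0 < Re (p 2 n)" for n unfolding rep using M by auto
    have Gp: "G (disc_point \<alpha> (p r n)) = f (disc_point \<alpha> (of_real r + of_nat n * b1))" if r: "0 < r" for r n
    proof -
      have re: "0 < Re (p r n)" unfolding rep using r M by simp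
      have D: "disc_point \<alpha> (p r n) \<in> unit_disc" by (rule disc_point_in_disc[OF \<alpha>(1) re])
      have "half_plane \<alpha> (disc_point \<alpha> (p r n)) = p r n"
        using \<alpha> Re_pos_neq[OF re] by (intro half_plane_disc_point)
      moreover have "of_real M * p r n + (\<beta> - of_real M * \<beta>) = of_real r + of_nat n * b1"
        using M by (simp add: p_def distrib_left)
      ultimately show ?thesis
        unfolding G_def affine_model_disc_point[OF m2 D] b2\<beta> M_def[symmetric] by simp
    qed
    have G0: "G (disc_point \<alpha> (p 1 n)) = f ((g1 ^^ n) 0)" "G (disc_point \<alpha> (p 2 n)) = f ((g1 ^^ n) y)" for n
      using Gp[of 1 n] Gp[of 2 n] affine_model_disc_point[OF m1, of 0 n] affine_model_disc_point[OF m1 y, of n]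
      by (simp_all add: h0 hy)
    \<comment> \<open>Division by \<open>1 + p\<close> turns the kernels into
      \<open>1 / (2 * (p + cnj q))\<close>. Taking the difference of the levels 1 and 2 makes the
      Gram entries second differences in the real part.\<close>
    define E where "E n i = disc_point \<alpha> (p 1 n) ^ i / (1 + p 1 n) - disc_point \<alpha> (p 2 n) ^ i / (1 + p 2 n)" for n i
    define L where "L n = G (disc_point \<alpha> (p 1 n)) / (1 + p 1 n) - G (disc_point \<alpha> (p 2 n)) / (1 + p 2 n)" for n
    define Gr where "Gr n j = of_real (M / 2) * (1 / (2 + of_real (real n - real j) * b1) - 2 / (3 + of_real (real n - real j) * b1) + 1 / (4 + of_real (real n - real j) * b1))" for n j
    have gram: "(\<lambda>i. E n i * cnj (E j i)) sums Gr n j" for n j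
    proof -
      have sum: "p r n + cnj (p s j) = (of_real (r + s) + of_real (real n - real j) * b1) / of_real M" for r s
      proof -
        have "cnj b1 = - b1" "cnj \<beta> = - \<beta>" using b1 \<beta> by (auto simp: complex_eq_iff)
        then show ?thesis by (simp add: p_def diff_divide_distrib add_divide_distrib algebra_simps)
      qed
      have K4: "(\<lambda>i. (disc_point \<alpha> (p r n) ^ i / (1 + p r n)) * cnj (disc_point \<alpha> (p s j) ^ i / (1 + p s j))) sums
          (of_real (M / 2) * (1 / (of_real (r + s) + of_real (real n - real j) * b1)))" if "0 < r" "0 < s" for r s
      proof -
        have "0 < Re (p r n)" "0 < Re (p s j)" using that M by (simp_all add: rep)
        from disc_point_gram[OF \<alpha>(1) this] show ?thesis unfolding sum by simp
      qed
      have "(\<lambda>i. E n i * cnj (E j i)) = (\<lambda>i.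
          (disc_point \<alpha> (p 1 n) ^ i / (1 + p 1 n)) * cnj (disc_point \<alpha> (p 1 j) ^ i / (1 + p 1 j))
        - (disc_point \<alpha> (p 2 n) ^ i / (1 + p 2 n)) * cnj (disc_point \<alpha> (p 1 j) ^ i / (1 + p 1 j))
        - ((disc_point \<alpha> (p 1 n) ^ i / (1 + p 1 n)) * cnj (disc_point \<alpha> (p 2 j) ^ i / (1 + p 2 j))
        - (disc_point \<alpha> (p 2 n) ^ i / (1 + p 2 n)) * cnj (disc_point \<alpha> (p 2 j) ^ i / (1 + p 2 j))))"
        unfolding E_def complex_cnj_diff by (simp only: left_diff_distrib right_diff_distrib)
      moreover have "Gr n j = of_real (M / 2) * (1 / (of_real (1 + 1) + of_real (real n - real j) * b1))
          - of_real (M / 2) * (1 / (of_real (2 + 1) + of_real (real n - real j) * b1))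
          - (of_real (M / 2) * (1 / (of_real (1 + 2) + of_real (real n - real j) * b1))
          - of_real (M / 2) * (1 / (of_real (2 + 2) + of_real (real n - real j) * b1)))"
      proof -
        have alg: "c * (x - 2 * y + z) = c * x - c * y - (c * y - c * z)" for c x y z :: complex
          by (simp add: algebra_simps)
        show ?thesis
          unfolding Gr_def using alg[of "of_real (M / 2)" "1 / (2 + of_real (real n - real j) * b1)" "1 / (3 + of_real (real n - real j) * b1)"
              "1 / (4 + of_real (real n - real j) * b1)"] by simp
      qed
      ultimately show ?thesis by (simp only:) (intro sums_diff K4; simp)
    qed
    have Lsum: "(\<lambda>i. c i * E n i) sums L n" for n
    proof -
      have "(\<lambda>i. c i * disc_point \<alpha> (p 1 n) ^ i / (1 + p 1 n) - c i * disc_point \<alpha> (p 2 n) ^ i / (1 + p 2 n)) sums L n"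
        unfolding L_def using p1[of n] \<alpha> by (intro sums_diff sums_divide c disc_point_in_disc)
      then show ?thesis by (simp add: E_def right_diff_distrib)
    qed
    have Llow: "1 / (2 * C) \<le> cmod (L n)" if n: "n \<in> B" for n
    proof -
      have nA: "n \<in> A" and nN: "real n \<le> M" using n N by (auto simp: B_def M_def)
      have "cmod (p 1 n) \<le> cmod (1 + of_nat n * b1 - \<beta>) / M + cmod \<beta>"
        unfolding p_def using norm_triangle_ineq[of "(of_real 1 + of_nat n * b1 - \<beta>) / of_real M" \<beta>] M by (simp add: norm_divide)
      also have "cmod (1 + of_nat n * b1 - \<beta>) \<le> 1 + real n * cmod b1 + cmod \<beta>"
        using norm_triangle_ineq4[of "1 + of_nat n * b1" \<beta>] norm_triangle_ineq[of 1 "of_nat n * b1"] by (simp add: norm_mult)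
      also have "\<dots> \<le> M * 1 + M * cmod b1 + M * cmod \<beta>"
        using nN M by (intro add_mono mult_right_mono) (auto simp: mult_le_cancel_right1)
      also have "(M * 1 + M * cmod b1 + M * cmod \<beta>) / M = 1 + cmod b1 + cmod \<beta>" using M by (simp add: field_simps)
      finally have "cmod (p 1 n) \<le> 1 + cmod b1 + cmod \<beta> + cmod \<beta>" using M by (simp add: divide_right_mono)
      then have up: "cmod (1 + p 1 n) \<le> C" using norm_triangle_ineq[of 1 "p 1 n"] by (simp add: C_def)
      have lo: "1 \<le> cmod (1 + p r n)" if "0 < Re (p r n)" for r
        using complex_Re_le_cmod[of "1 + p r n"] that by simp
      have "(1 - e) / C \<le> cmod (f ((g1 ^^ n) 0)) / cmod (1 + p 1 n)"
        using A0[OF nA] up lo[OF p1(1)] e by (intro frac_le) auto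
      moreover have "cmod (f ((g1 ^^ n) y)) / cmod (1 + p 2 n) \<le> 2 * e / 1"
        using Ay[OF nA] lo[OF p1(2)] e by (intro frac_le) auto
      moreover have "cmod (f ((g1 ^^ n) 0)) / cmod (1 + p 1 n) - cmod (f ((g1 ^^ n) y)) / cmod (1 + p 2 n) \<le> cmod (L n)"
        unfolding L_def G0 using norm_triangle_ineq2[of "f ((g1 ^^ n) 0) / (1 + p 1 n)" "f ((g1 ^^ n) y) / (1 + p 2 n)"]
        by (simp add: norm_divide)
      moreover have "1 / (2 * C) \<le> (1 - e) / C - 2 * e"
      proof -
        have "(1 - 1 / 16) / C \<le> (1 - e) / C" using e C by (intro divide_right_mono) auto
        moreover have "2 * e = (1 / 4) / C" using C by (simp add: e_def)
        moreover have "1 / (2 * C) = (1 / 2) / C" by simp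
        ultimately show ?thesis using C by (simp add: diff_divide_distrib[symmetric] field_simps)
      qed
      ultimately show ?thesis by linarith
    qed
    \<comment> \<open>Phases that align the values, so that the Gram bound controls the sum of their
      moduli.\<close>
    define s where "s n = cnj (sgn (L n))" for n
    have s1: "cmod (s n) \<le> 1" for n by (simp add: s_def norm_sgn)
    have sL: "s n * L n = of_real (cmod (L n))" for n
    proof (cases "L n = 0")
      case False
      have "cnj (L n) * L n = of_real (cmod (L n)) * of_real (cmod (L n))"
        using complex_norm_square[of "L n"] by (simp add: mult.commute power2_eq_square)
      then show ?thesis using False by (simp add: s_def sgn_eq)
    qed (simp add: s_def)
    have "(cmod (\<Sum>n\<in>B. s n * L n))\<^sup>2 \<le> \<epsilon>\<^sup>2 * cmod (\<Sum>n\<in>B. \<Sum>j\<in>B. s n * cnj (s j) * Gr n j)"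
      by (rule functional_bound[OF c GL B gram Lsum])
    also have "cmod (\<Sum>n\<in>B. \<Sum>j\<in>B. s n * cnj (s j) * Gr n j) \<le> (\<Sum>n\<in>B. M * K)"
    proof (rule sum_norm_le)
      fix n assume "n \<in> B"
      have "cmod (\<Sum>j\<in>B. s n * cnj (s j) * Gr n j) \<le> (\<Sum>j\<in>B. M * (1 / (1 + (a * real n - a * real j)\<^sup>2)))"
      proof (rule sum_norm_le)
        fix j assume "j \<in> B"
        have "Re (of_real (real n - real j) * b1) = 0" using b1 by simp
        from second_difference_kernel[OF this]
        have "cmod (Gr n j) \<le> M / 2 * (2 / (1 + (Im (of_real (real n - real j) * b1))\<^sup>2))"
          unfolding Gr_def norm_mult using M by (intro mult_mono) auto
        also have "Im (of_real (real n - real j) * b1) = a * real n - a * real j" by (simp add: a_def algebra_simps)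
        finally have Gr: "cmod (Gr n j) \<le> M * (1 / (1 + (a * real n - a * real j)\<^sup>2))" by simp
        have "cmod (s n * cnj (s j) * Gr n j) \<le> 1 * cmod (Gr n j)"
          unfolding norm_mult complex_mod_cnj using s1[of n] s1[of j] by (intro mult_right_mono mult_le_one) auto
        with Gr show "cmod (s n * cnj (s j) * Gr n j) \<le> M * (1 / (1 + (a * real n - a * real j)\<^sup>2))" by simp
      qed
      also have "\<dots> = M * (\<Sum>j\<in>B. 1 / (1 + (a * real n - a * real j)\<^sup>2))" by (simp add: sum_distrib_left)
      also have "\<dots> \<le> M * K" using M K(2)[OF B] by (intro mult_left_mono) auto
      finally show "cmod (\<Sum>j\<in>B. s n * cnj (s j) * Gr n j) \<le> M * K" .
    qed
    also have "(\<Sum>n\<in>B. M * K) = real (card B) * (M * K)" by simp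
    finally have sq: "(cmod (\<Sum>n\<in>B. s n * L n))\<^sup>2 \<le> \<epsilon>\<^sup>2 * (real (card B) * (M * K))" by (simp add: mult_left_mono)
    have "(\<Sum>n\<in>B. s n * L n) = of_real (\<Sum>n\<in>B. cmod (L n))" by (simp add: sL)
    then have "cmod (\<Sum>n\<in>B. s n * L n) = (\<Sum>n\<in>B. cmod (L n))" by (simp only: norm_of_real) (simp add: sum_nonneg)
    moreover have "(\<Sum>n\<in>B. 1 / (2 * C)) \<le> (\<Sum>n\<in>B. cmod (L n))" by (rule sum_mono) (rule Llow)
    ultimately have "real (card B) / (2 * C) \<le> cmod (\<Sum>n\<in>B. s n * L n)" by simp
    then have "(real (card B) / (2 * C))\<^sup>2 \<le> (cmod (\<Sum>n\<in>B. s n * L n))\<^sup>2" using C by (intro power_mono) auto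
    with sq have le: "(real (card B))\<^sup>2 / (4 * C\<^sup>2) \<le> \<epsilon>\<^sup>2 * (real (card B) * (M * K))"
      by (simp add: power_divide power_mult_distrib)
    show ?thesis
    proof (cases "card B = 0")
      case True
      then show ?thesis using K \<mu> by (simp add: B_def)
    next
      case False
      then have "real (card B) > 0" by simp
      moreover have "real (card B) * real (card B) \<le> real (card B) * (4 * C\<^sup>2 * K * \<epsilon>\<^sup>2 * M)"
        using le C by (simp add: divide_le_eq power2_eq_square mult_ac)
      ultimately have "real (card B) \<le> 4 * C\<^sup>2 * K * \<epsilon>\<^sup>2 * M" by (simp only: mult_le_cancel_left_pos)
      then show ?thesis by (simp add: B_def M_def)
    qed
  qed
  \<comment> \<open>Makes the upper bound \<open>\<delta> / 4 * \<mu> ^ m\<close>, half of the lower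
    bound \<open>\<delta> / 2 * \<mu> ^ m\<close>.\<close>
  define \<epsilon> where "\<epsilon> = sqrt (\<delta> / (16 * C\<^sup>2 * K))"
  have \<epsilon>: "0 < \<epsilon>" "4 * C\<^sup>2 * K * \<epsilon>\<^sup>2 = \<delta> / 4" using \<delta> K C by (auto simp: \<epsilon>_def)
  have "eventually (\<lambda>m. real N0 + 2 \<le> \<mu> ^ m) sequentially"
    using filterlim_power_at_top[OF \<mu>] by (auto simp: filterlim_at_top)
  then obtain m0 where m0: "\<And>m. m0 \<le> m \<Longrightarrow> real N0 + 2 \<le> \<mu> ^ m" by (auto simp: eventually_at_top_linorder)
  have "infinite {n. L2_bounded (\<lambda>z. cmod (f ((g1 ^^ n) z) - disc_poly 0 z)) \<epsilon> \<and>
          L2_bounded (\<lambda>z. cmod (f ((g2 ^^ n) z) - disc_poly 0 z)) \<epsilon>}"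
    by (intro lower_density_pos_infinite dens disc_poly_hardy2 \<epsilon>)
  then obtain m where m: "m0 \<le> m" "L2_bounded (\<lambda>z. cmod (f ((g2 ^^ m) z) - disc_poly 0 z)) \<epsilon>"
    unfolding infinite_nat_iff_unbounded_le by blast
  define N where "N = nat \<lfloor>\<mu> ^ m\<rfloor>"
  have pow: "real N0 + 2 \<le> \<mu> ^ m" using m0 m by simp
  then have N: "real N \<le> \<mu> ^ m" "\<mu> ^ m - 1 \<le> real N" by (simp_all add: N_def)
  then have "N0 \<le> N" using pow by linarith
  have "\<delta> * (\<mu> ^ m / 2) \<le> \<delta> * real N" using N pow \<delta> by (intro mult_left_mono) auto
  also have "\<dots> \<le> real (card (A \<inter> {1..N}))" by (rule N0[OF \<open>N0 \<le> N\<close>])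
  also have "\<dots> \<le> 4 * C\<^sup>2 * K * \<epsilon>\<^sup>2 * \<mu> ^ m" by (rule main[OF m(2) N(1)])
  also have "\<dots> = \<delta> / 4 * \<mu> ^ m" unfolding \<epsilon>(2) ..
  finally show False using \<delta> pow by simp
qed

section \<open>Test functions on the half-plane\<close>

text \<open>Exponentials are dominated by multiples of \<open>1 / (1 + x\<^sup>2)\<close>, so the
  uniformity in \<open>t\<close> is inherited.\<close>

lemma exp_sum_bound:
  fixes L c :: real
  assumes L: "L \<noteq> 0" and c: "0 < c"
  shows "\<exists>K>0. \<forall>(J :: nat set) t. finite J \<longrightarrow> (\<Sum>n\<in>J. exp (- c * \<bar>t - L * real n\<bar>)) \<le> K"
proof -
  obtain K where K: "0 < K" "\<And>(J :: nat set) t. finite J \<Longrightarrow> (\<Sum>n\<in>J. 1 / (1 + (t - L * real n)\<^sup>2)) \<le> K"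
    using sum_inverse_square_bound[OF L] by blast
  define M where "M = max 1 (2 / c\<^sup>2)"
  have M: "1 \<le> M" "2 / c\<^sup>2 \<le> M" by (auto simp: M_def)
  have le: "exp (- c * \<bar>x\<bar>) \<le> M * (1 / (1 + x\<^sup>2))" for x
  proof -
    have "x\<^sup>2 = (2 / c\<^sup>2) * ((c * \<bar>x\<bar>)\<^sup>2 / 2)" using c by (simp add: power_mult_distrib)
    also have "\<dots> \<le> M * ((c * \<bar>x\<bar>)\<^sup>2 / 2)" using M by (intro mult_right_mono) auto
    finally have "1 + x\<^sup>2 \<le> M * (1 + (c * \<bar>x\<bar>)\<^sup>2 / 2)" using M unfolding distrib_left by linarith
    also have "\<dots> \<le> M * exp (c * \<bar>x\<bar>)"
      using exp_lower_Taylor_quadratic[of "c * \<bar>x\<bar>"] c M by (intro mult_left_mono) (auto intro: order.trans[rotated])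
    finally have "1 + x\<^sup>2 \<le> M * exp (c * \<bar>x\<bar>)" .
    then have "(1 + x\<^sup>2) * exp (- (c * \<bar>x\<bar>)) \<le> M * exp (c * \<bar>x\<bar>) * exp (- (c * \<bar>x\<bar>))" by (rule mult_right_mono) simp
    also have "\<dots> = M" by (simp add: exp_minus)
    finally show ?thesis by (simp add: pos_le_divide_eq add_pos_nonneg mult.commute)
  qed
  show ?thesis
  proof (intro exI[of _ "M * K"] conjI allI impI)
    fix J :: "nat set" and t assume J: "finite J"
    have "(\<Sum>n\<in>J. exp (- c * \<bar>t - L * real n\<bar>)) \<le> (\<Sum>n\<in>J. M * (1 / (1 + (t - L * real n)\<^sup>2)))"
      by (intro sum_mono le)
    also have "\<dots> = M * (\<Sum>n\<in>J. 1 / (1 + (t - L * real n)\<^sup>2))" by (simp add: sum_distrib_left)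
    also have "\<dots> \<le> M * K" using K(2)[OF J] M by (intro mult_left_mono) auto
    finally show "(\<Sum>n\<in>J. exp (- c * \<bar>t - L * real n\<bar>)) \<le> M * K" .
  qed (use M K in auto)
qed

text \<open>Third order decay: two factors make the translates by \<open>\<i> * a * n\<close>
  summable, and the third remains to make the sum small.\<close>

definition parabolic_test :: "(complex \<Rightarrow> complex) \<Rightarrow> bool" where
  "parabolic_test U \<longleftrightarrow> U holomorphic_on {w. 0 < Re w} \<and> (\<exists>C\<ge>0. \<forall>w. 0 < Re w \<longrightarrow> cmod (U w) \<le> C / cmod (w + 1) ^ 3)"

text \<open>A zero of first order at the origin and first order decay at infinity, so that both the
  small and the large dilates are small.\<close>

definition hyperbolic_test :: "(complex \<Rightarrow> complex) \<Rightarrow> bool" where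
  "hyperbolic_test U \<longleftrightarrow> U holomorphic_on {w. 0 < Re w} \<and> (\<exists>C\<ge>0. \<forall>w. 0 < Re w \<longrightarrow> cmod (U w) \<le> C * cmod w / (cmod (w + 1))\<^sup>2)"

lemma cmod_pos_of_Re_pos: "0 < Re w \<Longrightarrow> 0 < cmod w"
  using complex_Re_le_cmod[of w] by linarith

lemma cmod_le_cmod_add:
  assumes "0 \<le> Re w" "0 \<le> (Y::real)" shows "cmod w \<le> cmod (w + of_real Y)"
proof -
  have "(cmod w)\<^sup>2 \<le> (cmod (w + of_real Y))\<^sup>2"
    unfolding cmod_power2 using assms by (simp add: power_mono)
  then show ?thesis by (rule power2_le_imp_le) simp
qed

lemma kernel_antimono:
  assumes "0 \<le> Re w" "0 \<le> Y" "Y \<le> (Y'::real)"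
  shows "cmod ((w + 1) / (w + 1 + of_real Y')) \<le> cmod ((w + 1) / (w + 1 + of_real Y))"
proof -
  have "cmod (w + 1 + of_real Y) \<le> cmod (w + 1 + of_real Y + of_real (Y' - Y))"
    using assms by (intro cmod_le_cmod_add) auto
  also have "w + 1 + of_real Y + of_real (Y' - Y) = w + 1 + of_real Y'" by simp
  finally have "cmod (w + 1 + of_real Y) \<le> cmod (w + 1 + of_real Y')" .
  moreover have "0 < cmod (w + 1 + of_real Y)"
    using assms by (intro cmod_pos_of_Re_pos) simp
  ultimately show ?thesis unfolding norm_divide by (intro divide_left_mono mult_pos_pos norm_ge_zero) linarith+
qed

lemma holomorphic_half_plane_compose:
  assumes U: "U holomorphic_on {w. 0 < Re w}" and h: "h holomorphic_on unit_disc" "\<And>z. z \<in> unit_disc \<Longrightarrow> 0 < Re (h z)"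
  shows "(\<lambda>z. U (h z)) holomorphic_on unit_disc"
proof -
  have "(U \<circ> h) holomorphic_on unit_disc"
    by (rule holomorphic_on_compose_gen[OF h(1) U]) (use h(2) in blast)
  then show ?thesis by (simp add: o_def)
qed

text \<open>Either \<open>cmod (w + 1)\<close> is below \<open>N\<close> and the shift dominates, or
  the kernel on the right is at least 1/2. The right-hand side does not depend on \<open>s\<close>,
  so it serves all shifts of size at least \<open>N\<close> at once.\<close>

lemma shifted_kernel:
  assumes w: "0 < Re w" and N: "0 < N" "N \<le> \<bar>s\<bar>"
  shows "1 / cmod (w + 1 + \<i> * of_real s) \<le> 1 / N + 2 * cmod ((w + 1) / (w + 1 + of_real N))"
proof -
  let ?q = "w + 1 + \<i> * of_real s"
  have q1: "1 \<le> cmod ?q" using complex_Re_le_cmod[of ?q] w by simp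
  have wN: "0 < cmod (w + 1 + of_real N)" using w N by (intro cmod_pos_of_Re_pos) simp
  show ?thesis
  proof (cases "N \<le> cmod (w + 1)")
    case True
    have "cmod (w + 1 + of_real N) \<le> cmod (w + 1) + N" using norm_triangle_ineq[of "w + 1" "of_real N"] N by simp
    also have "\<dots> \<le> 2 * cmod (w + 1)" using True by simp
    finally have "1 \<le> 2 * cmod ((w + 1) / (w + 1 + of_real N))" using wN by (simp add: norm_divide)
    moreover have "1 / cmod ?q \<le> 1" using q1 by (subst divide_le_eq_1_pos) linarith+
    ultimately show ?thesis using N by (smt (verit) divide_nonneg_pos)
  next
    case False
    have "cmod (w + 1 + of_real N) \<le> cmod (w + 1) + N" using norm_triangle_ineq[of "w + 1" "of_real N"] N by simp
    also have "\<dots> \<le> 2 * N" using False by simp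
    finally have "cmod (w + 1) / (2 * N) \<le> cmod ((w + 1) / (w + 1 + of_real N))"
      using wN N unfolding norm_divide by (intro divide_left_mono) auto
    then have 1: "cmod (w + 1) / N \<le> 2 * cmod ((w + 1) / (w + 1 + of_real N))" by simp
    have "cmod (\<i> * of_real s) = \<bar>s\<bar>" by (simp add: norm_mult)
    then have "N \<le> cmod ?q + cmod (w + 1)" using N norm_triangle_ineq4[of ?q "w + 1"] by simp
    also have "\<dots> \<le> cmod ?q + cmod ?q * cmod (w + 1)" using q1 by (simp add: mult_le_cancel_right1)
    finally have "N / (cmod ?q * N) \<le> (cmod ?q + cmod ?q * cmod (w + 1)) / (cmod ?q * N)"
      using q1 N by (intro divide_right_mono) auto
    then have "1 / cmod ?q \<le> 1 / N + cmod (w + 1) / N"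
      using q1 N by (simp add: add_divide_distrib split: if_splits)
    with 1 show ?thesis by simp
  qed
qed

text \<open>One of the three factors of the decay is bounded by \<open>M\<close>, the other two are
  summed over \<open>n\<close>. Keeping \<open>M\<close> free allows a constant, a kernel or
  \<open>1 / Re w\<close> to be inserted later.\<close>

lemma parabolic_test_sum:
  assumes U: "parabolic_test U" and a: "a \<noteq> 0"
  shows "\<exists>K>0. \<forall>(J :: nat set) c w M. finite J \<longrightarrow> 0 < Re w \<longrightarrow> 0 \<le> M \<longrightarrow> (\<forall>n\<in>J. 1 / cmod (w + 1 + \<i> * of_real (c - a * real n)) \<le> M) \<longrightarrow>
     (\<Sum>n\<in>J. cmod (U (w + \<i> * of_real (c - a * real n)))) \<le> K * M"
proof -
  obtain C where C: "0 \<le> C" "\<And>w. 0 < Re w \<Longrightarrow> cmod (U w) \<le> C / cmod (w + 1) ^ 3"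
    using U by (auto simp: parabolic_test_def)
  obtain K where K: "0 < K" "\<And>(J :: nat set) t. finite J \<Longrightarrow> (\<Sum>n\<in>J. 1 / (1 + (t - a * real n)\<^sup>2)) \<le> K"
    using sum_inverse_square_bound[OF a] by blast
  show ?thesis
  proof (intro exI[of _ "(C + 1) * K"] conjI allI impI)
    show "0 < (C + 1) * K" using C K by simp
    fix J :: "nat set" and c w M
    assume J: "finite J" and w: "0 < Re w" and M0: "0 \<le> M" and M: "\<forall>n\<in>J. 1 / cmod (w + 1 + \<i> * of_real (c - a * real n)) \<le> M"
    show "(\<Sum>n\<in>J. cmod (U (w + \<i> * of_real (c - a * real n)))) \<le> (C + 1) * K * M"
    proof -
      have "cmod (U (w + \<i> * of_real (c - a * real n))) \<le> C * M * (1 / (1 + (Im w + c - a * real n)\<^sup>2))" if n: "n \<in> J" for n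
      proof -
        let ?q = "w + 1 + \<i> * of_real (c - a * real n)"
        have q1: "1 \<le> cmod ?q" using complex_Re_le_cmod[of ?q] w by simp
        have "1 + (Im w + c - a * real n)\<^sup>2 \<le> (cmod ?q)\<^sup>2"
        proof -
          have "1\<^sup>2 \<le> (Re w + 1)\<^sup>2" using w by (intro power_mono) auto
          then show ?thesis unfolding cmod_power2 by (simp add: algebra_simps)
        qed
        then have "1 / (cmod ?q)\<^sup>2 \<le> 1 / (1 + (Im w + c - a * real n)\<^sup>2)"
          using q1 by (intro divide_left_mono mult_pos_pos) (auto simp: add_pos_nonneg)
        then have le: "C * (1 / cmod ?q) * (1 / (cmod ?q)\<^sup>2) \<le> C * M * (1 / (1 + (Im w + c - a * real n)\<^sup>2))"
          using M n C M0 by (intro mult_mono) auto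
        have "cmod (U (w + \<i> * of_real (c - a * real n))) \<le> C / cmod ?q ^ 3"
          using C(2)[of "w + \<i> * of_real (c - a * real n)"] w by (simp add: add.assoc add.commute add.left_commute)
        also have "C / cmod ?q ^ 3 = C * (1 / cmod ?q) * (1 / (cmod ?q)\<^sup>2)"
          by (simp add: power3_eq_cube power2_eq_square)
        finally show ?thesis using le by (rule order.trans)
      qed
      then have "(\<Sum>n\<in>J. cmod (U (w + \<i> * of_real (c - a * real n)))) \<le> (\<Sum>n\<in>J. C * M * (1 / (1 + (Im w + c - a * real n)\<^sup>2)))"
        by (rule sum_mono)
      also have "\<dots> = C * M * (\<Sum>n\<in>J. 1 / (1 + (Im w + c - a * real n)\<^sup>2))" by (simp add: sum_distrib_left)
      also have "\<dots> \<le> C * M * K" using K(2)[OF J] C M0 by (intro mult_left_mono) auto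
      also have "\<dots> \<le> (C + 1) * M * K" using K M0 by (intro mult_right_mono) auto
      finally show ?thesis by (simp add: mult_ac)
    qed
  qed
qed

lemma L2_bounded_kernel_real:
  assumes \<alpha>: "cmod \<alpha> = 1" and Y: "0 < Y"
  shows "L2_bounded (\<lambda>z. cmod ((half_plane \<alpha> z + 1) / (half_plane \<alpha> z + 1 + of_real Y))) (1 / sqrt Y)"
proof -
  have "L2_bounded (\<lambda>z. cmod ((half_plane \<alpha> z + 1) / (half_plane \<alpha> z + (1 + of_real Y)))) (1 / sqrt (Re (1 + of_real Y)))"
    using \<alpha> Y by (intro L2_bounded_kernel) auto
  then have "L2_bounded (\<lambda>z. cmod ((half_plane \<alpha> z + 1) / (half_plane \<alpha> z + 1 + of_real Y))) (1 / sqrt (1 + Y))"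
    by (simp add: add.assoc)
  moreover have "1 / sqrt (1 + Y) \<le> 1 / sqrt Y" using Y by (intro divide_left_mono mult_pos_pos) auto
  ultimately show ?thesis by (rule L2_bounded_weaken)
qed

lemma parabolic_shift_bound:
  assumes U: "parabolic_test U" and a: "a \<noteq> 0" and \<alpha>: "cmod \<alpha> = 1"
  shows "\<exists>K>0. \<forall>(J :: nat set) c N. finite J \<longrightarrow> 0 < N \<longrightarrow> (\<forall>n\<in>J. N \<le> \<bar>c - a * real n\<bar>) \<longrightarrow>
     L2_bounded (\<lambda>z. cmod (\<Sum>n\<in>J. U (half_plane \<alpha> z + \<i> * of_real (c - a * real n)))) (K * (1 / N + 2 / sqrt N))"
proof -
  obtain K where K: "0 < K" "\<And>(J :: nat set) c w M. finite J \<Longrightarrow> 0 < Re w \<Longrightarrow> 0 \<le> M \<Longrightarrow> (\<forall>n\<in>J. 1 / cmod (w + 1 + \<i> * of_real (c - a * real n)) \<le> M) \<Longrightarrow>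
     (\<Sum>n\<in>J. cmod (U (w + \<i> * of_real (c - a * real n)))) \<le> K * M"
    using parabolic_test_sum[OF U a] by blast
  show ?thesis
  proof (intro exI[of _ K] conjI allI impI K)
    fix J :: "nat set" and c N
    assume J: "finite J" and N: "0 < N" and s: "\<forall>n\<in>J. N \<le> \<bar>c - a * real n\<bar>"
    have "L2_bounded (\<lambda>z. K * (1 / N + 2 * cmod ((half_plane \<alpha> z + 1) / (half_plane \<alpha> z + 1 + of_real N)))) (K * (1 / N + 2 * (1 / sqrt N)))"
      using K N by (intro L2_bounded_cmult L2_bounded_add L2_bounded_const L2_bounded_kernel_real \<alpha>) auto
    then show "L2_bounded (\<lambda>z. cmod (\<Sum>n\<in>J. U (half_plane \<alpha> z + \<i> * of_real (c - a * real n)))) (K * (1 / N + 2 / sqrt N))"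
    proof (rule L2_bounded_holomorphic[rotated])
      show "(\<lambda>z. \<Sum>n\<in>J. U (half_plane \<alpha> z + \<i> * of_real (c - a * real n))) holomorphic_on unit_disc"
        using U Re_half_plane_pos[OF \<alpha>]
        by (intro holomorphic_on_sum holomorphic_half_plane_compose[of U] holomorphic_intros holomorphic_half_plane \<alpha>)
           (auto simp: parabolic_test_def)
      fix z assume z: "z \<in> unit_disc"
      have re: "0 < Re (half_plane \<alpha> z)" using Re_half_plane_pos[OF \<alpha> z] .
      have "cmod (\<Sum>n\<in>J. U (half_plane \<alpha> z + \<i> * of_real (c - a * real n))) \<le> (\<Sum>n\<in>J. cmod (U (half_plane \<alpha> z + \<i> * of_real (c - a * real n))))"
        by (rule norm_sum)
      also have "\<dots> \<le> K * (1 / N + 2 * cmod ((half_plane \<alpha> z + 1) / (half_plane \<alpha> z + 1 + of_real N)))"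

      proof (rule K(2)[OF J re])
        show "\<forall>n\<in>J. 1 / cmod (half_plane \<alpha> z + 1 + \<i> * of_real (c - a * real n)) \<le>
            1 / N + 2 * cmod ((half_plane \<alpha> z + 1) / (half_plane \<alpha> z + 1 + of_real N))"
          using shifted_kernel[OF re N] s by blast
      qed (use N in \<open>auto intro!: add_nonneg_nonneg\<close>)
      finally show "cmod (\<Sum>n\<in>J. U (half_plane \<alpha> z + \<i> * of_real (c - a * real n))) \<le> \<dots>" .
    qed simp
  qed
qed

lemma hyperbolic_test_bounds:
  assumes "cmod u \<le> C * cmod w / (cmod (w + 1))\<^sup>2" "0 \<le> C" "0 < Re w"
  shows "cmod u \<le> C * (1 / cmod (w + 1))" "cmod u \<le> C * (cmod w / cmod (w + 1))"
proof -
  have 1: "1 \<le> cmod (w + 1)" using cmod_plus_one_ge assms by simp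
  have "cmod w \<le> cmod (w + of_real 1)" using assms by (intro cmod_le_cmod_add) auto
  then have le: "cmod w \<le> cmod (w + 1)" by simp
  have "cmod w / (cmod (w + 1))\<^sup>2 = cmod w / cmod (w + 1) * (1 / cmod (w + 1))" by (simp add: power2_eq_square)
  moreover have "cmod w / cmod (w + 1) \<le> 1" using le 1 by (subst divide_le_eq_1_pos) linarith+
  then have "cmod w / cmod (w + 1) * (1 / cmod (w + 1)) \<le> 1 * (1 / cmod (w + 1))"
    by (intro mult_right_mono) auto
  moreover have "1 / cmod (w + 1) \<le> 1" using 1 by (subst divide_le_eq_1_pos) linarith+
  then have "cmod w / cmod (w + 1) * (1 / cmod (w + 1)) \<le> cmod w / cmod (w + 1) * 1"
    by (intro mult_left_mono) auto
  ultimately have "cmod w / (cmod (w + 1))\<^sup>2 \<le> 1 / cmod (w + 1)" "cmod w / (cmod (w + 1))\<^sup>2 \<le> cmod w / cmod (w + 1)"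
    by linarith+
  from this[THEN mult_left_mono, OF assms(2)]
  show "cmod u \<le> C * (1 / cmod (w + 1))" "cmod u \<le> C * (cmod w / cmod (w + 1))"
    using assms(1) by simp_all
qed

text \<open>For \<open>x \<ge> 0\<close> the decay at infinity is used, for \<open>x < 0\<close> the
  zero at the origin. Both reduce to kernels with pole \<open>- p\<close>, where
  \<open>Re p \<ge> exp (- x)\<close>, and give the rate
  \<open>exp (- \<bar>x\<bar> / 2)\<close>.\<close>

lemma hyperbolic_dilation_bound:
  assumes U: "U holomorphic_on {w. 0 < Re w}" "\<And>w. 0 < Re w \<Longrightarrow> cmod (U w) \<le> C * cmod w / (cmod (w + 1))\<^sup>2" "0 \<le> C"
    and \<alpha>: "cmod \<alpha> = 1" and \<gamma>: "Re \<gamma> \<le> 0"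
  shows "L2_bounded (\<lambda>z. cmod (U (of_real (exp x) * (half_plane \<alpha> z - \<gamma>)))) (C * (2 + cmod \<gamma>) * exp (- \<bar>x\<bar> / 2))"
proof -
  define s p where "s = exp x" and "p = of_real (1 / s) - \<gamma>"
  have s: "0 < s" by (simp add: s_def)
  have "0 < 1 / s" "Re p = 1 / s - Re \<gamma>" using s by (auto simp: p_def)
  then have p: "0 < Re p" "1 / s \<le> Re p" using \<gamma> by linarith+
  have rtp: "1 / sqrt (Re p) \<le> sqrt s"
  proof -
    have "1 / sqrt (Re p) \<le> 1 / sqrt (1 / s)" using p s by (intro divide_left_mono mult_pos_pos) auto
    then show ?thesis using s by (simp add: real_sqrt_divide)
  qed
  have rew: "0 < Re (of_real s * (half_plane \<alpha> z - \<gamma>))" if "z \<in> unit_disc" for z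
    using Re_half_plane_pos[OF \<alpha> that] \<gamma> s by simp
  have hol: "(\<lambda>z. U (of_real s * (half_plane \<alpha> z - \<gamma>))) holomorphic_on unit_disc"
    by (intro holomorphic_half_plane_compose[OF U(1)] holomorphic_intros holomorphic_half_plane \<alpha> rew)
  have v1: "of_real s * (half_plane \<alpha> z - \<gamma>) + 1 = of_real s * (half_plane \<alpha> z + p)" for z
    using s by (simp add: p_def algebra_simps)
  have "L2_bounded (\<lambda>z. cmod (U (of_real s * (half_plane \<alpha> z - \<gamma>)))) (C * (2 + cmod \<gamma>) * exp (- \<bar>x\<bar> / 2))"
  proof (cases "0 \<le> x")
    case True
    have "L2_bounded (\<lambda>z. C / s * cmod (1 / (half_plane \<alpha> z + p))) (C / s * (1 / sqrt (Re p)))"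
      using U s by (intro L2_bounded_cmult L2_bounded_inverse \<alpha> p) auto
    then show ?thesis
    proof (rule L2_bounded_holomorphic[OF hol])
      fix z assume z: "z \<in> unit_disc"
      have "cmod (U (of_real s * (half_plane \<alpha> z - \<gamma>))) \<le> C * (1 / cmod (of_real s * (half_plane \<alpha> z - \<gamma>) + 1))"
        by (rule hyperbolic_test_bounds(1)[OF U(2)[OF rew[OF z]] U(3) rew[OF z]])
      also have "\<dots> = C / s * cmod (1 / (half_plane \<alpha> z + p))"
        unfolding v1 norm_mult using s by (simp add: norm_divide)
      finally show "cmod (U (of_real s * (half_plane \<alpha> z - \<gamma>))) \<le> C / s * cmod (1 / (half_plane \<alpha> z + p))" .
    next
      have "C / s * (1 / sqrt (Re p)) \<le> C / s * sqrt s" using U(3) s rtp by (intro mult_left_mono) auto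
      also have "\<dots> = C * (1 / sqrt s)" using s by (simp add: field_simps)
      also have "1 / sqrt s = exp (- x / 2)"
      proof -
        have "sqrt s = exp (x / 2)" unfolding s_def by (intro real_sqrt_unique) (simp_all flip: exp_double)
        then show ?thesis by (simp add: exp_minus inverse_eq_divide)
      qed
      also have "C * exp (- x / 2) \<le> C * (2 + cmod \<gamma>) * exp (- x / 2)"
        using U(3) by (intro mult_right_mono) (auto simp: mult_le_cancel_left1)
      finally show "C / s * (1 / sqrt (Re p)) \<le> C * (2 + cmod \<gamma>) * exp (- \<bar>x\<bar> / 2)" using True by simp
    qed
  next
    case False
    let ?w = "half_plane \<alpha>"
    have "L2_bounded (\<lambda>z. C * (cmod ((?w z + 1) / (?w z + p)) + cmod (1 + \<gamma>) * cmod (1 / (?w z + p)))) (C * (1 / sqrt (Re p) + cmod (1 + \<gamma>) * (1 / sqrt (Re p))))"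
      using U by (intro L2_bounded_cmult L2_bounded_add L2_bounded_inverse L2_bounded_kernel \<alpha> p) auto
    then show ?thesis
    proof (rule L2_bounded_holomorphic[OF hol])
      fix z assume z: "z \<in> unit_disc"
      have "cmod (U (of_real s * (?w z - \<gamma>))) \<le> C * (cmod (of_real s * (?w z - \<gamma>)) / cmod (of_real s * (?w z - \<gamma>) + 1))"
        by (rule hyperbolic_test_bounds(2)[OF U(2)[OF rew[OF z]] U(3) rew[OF z]])
      also have "\<dots> = C * (cmod (?w z - \<gamma>) / cmod (?w z + p))"
        unfolding v1 norm_mult using s by simp
      also have "\<dots> \<le> C * ((cmod (?w z + 1) + cmod (1 + \<gamma>)) / cmod (?w z + p))"
        using U(3) norm_triangle_ineq4[of "?w z + 1" "1 + \<gamma>"] by (intro mult_left_mono divide_right_mono) auto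
      finally show "cmod (U (of_real s * (?w z - \<gamma>))) \<le> C * (cmod ((?w z + 1) / (?w z + p)) + cmod (1 + \<gamma>) * cmod (1 / (?w z + p)))"
        unfolding norm_divide by (simp add: add_divide_distrib)
    next
      have "1 / sqrt (Re p) + cmod (1 + \<gamma>) * (1 / sqrt (Re p)) = (1 + cmod (1 + \<gamma>)) * (1 / sqrt (Re p))" by (simp add: add_divide_distrib)
      also have "\<dots> \<le> (2 + cmod \<gamma>) * sqrt s"
        using norm_triangle_ineq[of 1 \<gamma>] rtp p by (intro mult_mono) auto
      also have "sqrt s = exp (- \<bar>x\<bar> / 2)" unfolding s_def using False by (intro real_sqrt_unique) (simp_all flip: exp_double)
      finally show "C * (1 / sqrt (Re p) + cmod (1 + \<gamma>) * (1 / sqrt (Re p))) \<le> C * (2 + cmod \<gamma>) * exp (- \<bar>x\<bar> / 2)"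
        using U(3) by (simp add: mult_left_mono mult.assoc)
    qed
  qed
  then show ?thesis by (simp add: s_def)
qed

text \<open>The rate \<open>exp (- \<bar>x\<bar> / 2)\<close> is split: one half sums over
  \<open>n\<close>, the other gives \<open>exp (- N / 4)\<close>. The centre \<gamma> ranges over a
  bounded set, because along the orbit of another map it depends on the time.\<close>

lemma hyperbolic_shift_bound:
  assumes U: "hyperbolic_test U" and L: "L \<noteq> 0" and \<alpha>: "cmod \<alpha> = 1" and \<Gamma>: "0 \<le> \<Gamma>"
  shows "\<exists>K>0. \<forall>(J :: nat set) c N \<gamma>. finite J \<longrightarrow> Re \<gamma> \<le> 0 \<longrightarrow> cmod \<gamma> \<le> \<Gamma> \<longrightarrow> (\<forall>n\<in>J. N \<le> \<bar>c - L * real n\<bar>) \<longrightarrow>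
     L2_bounded (\<lambda>z. \<Sum>n\<in>J. cmod (U (of_real (exp (c - L * real n)) * (half_plane \<alpha> z - \<gamma>)))) (K * exp (- N / 4))"
proof -
  obtain C where C: "0 \<le> C" "\<And>w. 0 < Re w \<Longrightarrow> cmod (U w) \<le> C * cmod w / (cmod (w + 1))\<^sup>2"
    and hol: "U holomorphic_on {w. 0 < Re w}"
    using U by (auto simp: hyperbolic_test_def)
  obtain K where K: "0 < K" "\<And>(J :: nat set) t. finite J \<Longrightarrow> (\<Sum>n\<in>J. exp (- (1/4) * \<bar>t - L * real n\<bar>)) \<le> K"
    using exp_sum_bound[OF L, of "1/4"] by auto
  show ?thesis
  proof (intro exI[of _ "(C + 1) * (2 + \<Gamma>) * K"] conjI allI impI)
    show "0 < (C + 1) * (2 + \<Gamma>) * K" using C K \<Gamma> by (simp add: add_pos_nonneg)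
    fix J :: "nat set" and c N \<gamma>
    assume J: "finite J" and \<gamma>: "Re \<gamma> \<le> 0" "cmod \<gamma> \<le> \<Gamma>" and N: "\<forall>n\<in>J. N \<le> \<bar>c - L * real n\<bar>"
    have "L2_bounded (\<lambda>z. \<Sum>n\<in>J. cmod (U (of_real (exp (c - L * real n)) * (half_plane \<alpha> z - \<gamma>)))) (\<Sum>n\<in>J. C * (2 + cmod \<gamma>) * exp (- \<bar>c - L * real n\<bar> / 2))"
      using hyperbolic_dilation_bound[OF hol C(2) C(1) \<alpha> \<gamma>(1)] by (intro L2_bounded_sum J)
    moreover have "(\<Sum>n\<in>J. C * (2 + cmod \<gamma>) * exp (- \<bar>c - L * real n\<bar> / 2)) \<le> (C + 1) * (2 + \<Gamma>) * K * exp (- N / 4)"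
    proof -
      have "C * (2 + cmod \<gamma>) * exp (- \<bar>c - L * real n\<bar> / 2) \<le> (C + 1) * (2 + \<Gamma>) * (exp (- N / 4) * exp (- (1/4) * \<bar>c - L * real n\<bar>))" if "n \<in> J" for n
      proof (intro mult_mono)
        have "N \<le> \<bar>c - L * real n\<bar>" using N that by blast
        then show "exp (- \<bar>c - L * real n\<bar> / 2) \<le> exp (- N / 4) * exp (- (1/4) * \<bar>c - L * real n\<bar>)"
          by (simp flip: exp_add)
      qed (use C \<gamma> \<Gamma> in auto)
      then have "(\<Sum>n\<in>J. C * (2 + cmod \<gamma>) * exp (- \<bar>c - L * real n\<bar> / 2)) \<le> (\<Sum>n\<in>J. (C + 1) * (2 + \<Gamma>) * (exp (- N / 4) * exp (- (1/4) * \<bar>c - L * real n\<bar>)))"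
        by (rule sum_mono)
      also have "\<dots> = (C + 1) * (2 + \<Gamma>) * exp (- N / 4) * (\<Sum>n\<in>J. exp (- (1/4) * \<bar>c - L * real n\<bar>))"
        by (simp add: sum_distrib_left mult.assoc)
      also have "\<dots> \<le> (C + 1) * (2 + \<Gamma>) * exp (- N / 4) * K" using K(2)[OF J] C \<Gamma> by (intro mult_left_mono) auto
      finally show ?thesis by (simp add: mult_ac)
    qed
    ultimately show "L2_bounded (\<lambda>z. \<Sum>n\<in>J. cmod (U (of_real (exp (c - L * real n)) * (half_plane \<alpha> z - \<gamma>)))) ((C + 1) * (2 + \<Gamma>) * K * exp (- N / 4))"
      by (rule L2_bounded_weaken)
  qed
qed

text \<open>The logarithms of the moduli of the dilates form an arithmetic progression, along which
  \<open>exp (- \<bar>ln (cmod w)\<bar>)\<close> is summable uniformly in \<open>v\<close>.\<close>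

lemma hyperbolic_test_sum:
  assumes U: "hyperbolic_test U" and L: "0 < L"
  shows "\<exists>K>0. \<forall>(J :: nat set) v. finite J \<longrightarrow> 0 < Re v \<longrightarrow> (\<Sum>n\<in>J. cmod (U (of_real (exp (- L * real n)) * v))) \<le> K"
proof -
  obtain C where C: "0 \<le> C" "\<And>w. 0 < Re w \<Longrightarrow> cmod (U w) \<le> C * cmod w / (cmod (w + 1))\<^sup>2"
    using U by (auto simp: hyperbolic_test_def)
  obtain K where K: "0 < K" "\<And>(J :: nat set) t. finite J \<Longrightarrow> (\<Sum>n\<in>J. exp (- 1 * \<bar>t - L * real n\<bar>)) \<le> K"
    using exp_sum_bound[of L 1] L by auto
  have le: "cmod (U w) \<le> C * exp (- \<bar>ln (cmod w)\<bar>)" if w: "0 < Re w" for w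
  proof -
    have w0: "0 < cmod w" using w by (rule cmod_pos_of_Re_pos)
    have 1: "1 \<le> cmod (w + 1)" using cmod_plus_one_ge w by simp
    have "cmod w \<le> cmod (w + of_real 1)" using w by (intro cmod_le_cmod_add) auto
    then have le: "cmod w \<le> cmod (w + 1)" by simp
    have "cmod (U w) \<le> C * (1 / cmod w)"
      using hyperbolic_test_bounds(1)[OF C(2)[OF w] C(1) w] w0 le C(1)
      by (meson divide_left_mono mult_left_mono mult_pos_pos order.trans order.strict_trans2 zero_le_one)
    moreover have "cmod (U w) \<le> C * cmod w"
    proof -
      have "cmod w / cmod (w + 1) \<le> cmod w / 1" using 1 by (intro divide_left_mono) auto
      then have "C * (cmod w / cmod (w + 1)) \<le> C * cmod w" using C(1) by (intro mult_left_mono) auto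
      then show ?thesis using hyperbolic_test_bounds(2)[OF C(2)[OF w] C(1) w] by simp
    qed
    moreover have "exp (- \<bar>ln (cmod w)\<bar>) = 1 / cmod w \<or> exp (- \<bar>ln (cmod w)\<bar>) = cmod w"
      using w0 by (cases "0 \<le> ln (cmod w)") (auto simp: exp_minus inverse_eq_divide)
    ultimately show ?thesis by metis
  qed
  show ?thesis
  proof (intro exI[of _ "(C + 1) * K"] conjI allI impI)
    show "0 < (C + 1) * K" using C K by simp
    fix J :: "nat set" and v assume J: "finite J" and v: "0 < Re v"
    have v0: "0 < cmod v" using v by (rule cmod_pos_of_Re_pos)
    have "cmod (U (of_real (exp (- L * real n)) * v)) \<le> C * exp (- 1 * \<bar>ln (cmod v) - L * real n\<bar>)" for n
    proof -
      have "ln (cmod (of_real (exp (- L * real n)) * v)) = ln (cmod v) - L * real n"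
        using v0 by (simp add: norm_mult ln_mult)
      then show ?thesis using le[of "of_real (exp (- L * real n)) * v"] v by simp
    qed
    then have "(\<Sum>n\<in>J. cmod (U (of_real (exp (- L * real n)) * v))) \<le> (\<Sum>n\<in>J. C * exp (- 1 * \<bar>ln (cmod v) - L * real n\<bar>))"
      by (intro sum_mono)
    also have "\<dots> = C * (\<Sum>n\<in>J. exp (- 1 * \<bar>ln (cmod v) - L * real n\<bar>))" by (simp add: sum_distrib_left)
    also have "\<dots> \<le> C * K" using K(2)[OF J] C by (intro mult_left_mono) auto
    also have "\<dots> \<le> (C + 1) * K" using K by simp
    finally show "(\<Sum>n\<in>J. cmod (U (of_real (exp (- L * real n)) * v))) \<le> (C + 1) * K" .
  qed
qed

section \<open>Density of the test functions\<close>

lemma holomorphic_disc_point: "disc_point \<alpha> holomorphic_on {w. 0 < Re w}"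
  unfolding disc_point_def by (intro holomorphic_intros) (auto simp: complex_eq_iff)

lemma poly_disc_point_half_plane:
  assumes "cmod \<alpha> = 1" "z \<in> unit_disc" shows "disc_point \<alpha> (half_plane \<alpha> z) = z"
  using assms by (intro disc_point_half_plane) auto

lemma L2_bounded_const_cmod: "0 \<le> e \<Longrightarrow> 0 \<le> C \<Longrightarrow> C \<le> e \<Longrightarrow> L2_bounded (\<lambda>_. C) e"
  using L2_bounded_weaken L2_bounded_const by blast

text \<open>The cube of \<open>Y / (w + 1 + Y)\<close> supplies the decay, and for large
  \<open>Y\<close> it is close to 1 in quadratic mean although not uniformly.\<close>

lemma parabolic_test_dense:
  assumes \<alpha>: "cmod \<alpha> = 1" and e: "0 < e"
  shows "\<exists>U. parabolic_test U \<and> L2_bounded (\<lambda>z. cmod (poly p z - U (half_plane \<alpha> z))) e"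
proof -
  obtain C where C: "0 \<le> C" "\<And>z. z \<in> unit_disc \<Longrightarrow> cmod (poly p z) \<le> C" using poly_bounded_disc by blast
  \<comment> \<open>Gives \<open>3 * C / sqrt Y \<le> e\<close>, where 3 comes from factoring
    \<open>1 - t ^ 3\<close>.\<close>
  define Y where "Y = (3 * C / e + 1)\<^sup>2"
  have c1: "1 \<le> 3 * C / e + 1" using C e by simp
  then have Y: "0 < Y" "sqrt Y = 3 * C / e + 1" by (auto simp: Y_def)
  define t where "t w = of_real Y / (w + 1 + of_real Y)" for w :: complex
  define U where "U w = poly p (disc_point \<alpha> w) * t w ^ 3" for w
  have den: "w + 1 + of_real Y \<noteq> 0" "0 < cmod (w + 1 + of_real Y)" "cmod (w + 1) \<le> cmod (w + 1 + of_real Y)" "Y \<le> cmod (w + 1 + of_real Y)" "0 < cmod (w + 1)"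
    if "0 < Re w" for w
  proof -
    show "0 < cmod (w + 1 + of_real Y)" using that Y by (intro cmod_pos_of_Re_pos) simp
    then show "w + 1 + of_real Y \<noteq> 0" by auto
    show "cmod (w + 1) \<le> cmod (w + 1 + of_real Y)" using that Y by (intro cmod_le_cmod_add) auto
    show "Y \<le> cmod (w + 1 + of_real Y)" using complex_Re_le_cmod[of "w + 1 + of_real Y"] that by simp
    show "0 < cmod (w + 1)" using that by (intro cmod_pos_of_Re_pos) simp
  qed
  have U: "parabolic_test U"
    unfolding parabolic_test_def
  proof (intro conjI exI[of _ "C * Y ^ 3"] allI impI)
    have "(\<lambda>w. poly p (disc_point \<alpha> w)) holomorphic_on {w. 0 < Re w}"
      using holomorphic_on_compose[OF holomorphic_disc_point holomorphic_poly] by (simp add: o_def)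
    then show "U holomorphic_on {w. 0 < Re w}"
      unfolding U_def t_def using den by (intro holomorphic_on_mult) (auto intro!: holomorphic_intros)
    show "0 \<le> C * Y ^ 3" using C Y by simp
    fix w assume w: "0 < Re w"
    have "cmod (t w) \<le> Y / cmod (w + 1)"
      unfolding t_def norm_divide using den[OF w] Y by (auto intro!: divide_left_mono mult_pos_pos)
    then have "cmod (poly p (disc_point \<alpha> w)) * cmod (t w) ^ 3 \<le> C * (Y / cmod (w + 1)) ^ 3"
      using C(1) C(2)[OF disc_point_in_disc[OF \<alpha> w]] by (intro mult_mono power_mono) auto
    then show "cmod (U w) \<le> C * Y ^ 3 / cmod (w + 1) ^ 3"
      by (simp add: U_def norm_mult norm_power power_divide)
  qed
  have "L2_bounded (\<lambda>z. 3 * C * cmod ((half_plane \<alpha> z + 1) / (half_plane \<alpha> z + 1 + of_real Y))) (3 * C * (1 / sqrt Y))"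
    using C Y by (intro L2_bounded_cmult L2_bounded_kernel_real \<alpha>) auto
  then have "L2_bounded (\<lambda>z. cmod (poly p z - U (half_plane \<alpha> z))) e"
  proof (rule L2_bounded_holomorphic[rotated])
    show "(\<lambda>z. poly p z - U (half_plane \<alpha> z)) holomorphic_on unit_disc"
      using U Re_half_plane_pos[OF \<alpha>] by (intro holomorphic_intros holomorphic_poly holomorphic_half_plane_compose[of U] holomorphic_half_plane \<alpha>)
         (auto simp: parabolic_test_def)
    show "3 * C * (1 / sqrt Y) \<le> e" unfolding Y(2) using C e c1 by (simp add: field_simps)
    fix z assume z: "z \<in> unit_disc"
    define w where "w = half_plane \<alpha> z"
    have w: "0 < Re w" unfolding w_def using Re_half_plane_pos[OF \<alpha> z] .
    have t1: "cmod (t w) \<le> 1" using den[OF w] Y by (simp add: t_def norm_divide)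
    have "poly p z - U w = poly p z * ((1 + t w + t w ^ 2) * (1 - t w))"
      unfolding U_def w_def poly_disc_point_half_plane[OF \<alpha> z] by (simp add: power2_eq_square power3_eq_cube algebra_simps)
    moreover have "1 - t w = (w + 1) / (w + 1 + of_real Y)" using den[OF w] by (simp add: t_def field_simps)
    moreover have "cmod (1 + t w + t w ^ 2) \<le> 3"
    proof -
      have "cmod (t w ^ 2) \<le> 1" using t1 by (simp add: norm_power power_le_one)
      then show ?thesis using t1 norm_triangle_ineq[of "1 + t w" "t w ^ 2"] norm_triangle_ineq[of 1 "t w"] by simp
    qed
    ultimately have "cmod (poly p z - U w) \<le> C * (3 * cmod ((w + 1) / (w + 1 + of_real Y)))"
      using C(1) C(2)[OF z] by (simp only: norm_mult) (intro mult_mono; simp)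
    then show "cmod (poly p z - U (half_plane \<alpha> z)) \<le> 3 * C * cmod ((half_plane \<alpha> z + 1) / (half_plane \<alpha> z + 1 + of_real Y))"
      by (simp add: w_def mult_ac)
  qed
  with U show ?thesis by blast
qed

text \<open>As a function of \<open>v = w - \<beta>\<close> the coordinate \<open>z\<close> has its
  pole at \<open>- 1 - \<beta>\<close>, possibly inside the half-plane \<open>0 < Re v\<close> on
  which test functions have to live. Expanding \<open>1 / (w + 1)\<close> in powers of
  \<open>k / X\<close>, with \<open>X = w + 1 + k\<close>, moves the pole to the left; on the image
  of the disc the ratio is at most \<open>k / (k + 1)\<close>.\<close>

lemma inverse_extension:
  assumes \<alpha>: "cmod \<alpha> = 1" and \<beta>: "Re \<beta> \<le> 0" and e: "0 < e"
  shows "\<exists>Q C. Q holomorphic_on {v. 0 < Re v} \<and> (\<forall>v. 0 < Re v \<longrightarrow> cmod (Q v) \<le> C) \<and>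
     (\<forall>z\<in>unit_disc. cmod (z - Q (half_plane \<alpha> z - \<beta>)) \<le> e)"
proof -
  define k where "k = cmod \<beta>"
  have k: "0 \<le> k" "- k \<le> Re \<beta>" using abs_Re_le_cmod[of \<beta>] by (auto simp: k_def)
  have "k / (k + 1) < 1" using k by simp
  then obtain J where J: "(k / (k + 1)) ^ J < e / 2" using e real_arch_pow_inv[of "e / 2" "k / (k + 1)"] by auto
  define X where "X v = v + \<beta> + of_real k + 1" for v
  define S where "S v = (\<Sum>j<J. of_real k ^ j / X v ^ Suc j)" for v
  have X1: "1 \<le> cmod (X v)" if "0 < Re v" for v
    using complex_Re_le_cmod[of "X v"] that k by (simp add: X_def)
  then have X0: "X v \<noteq> 0" if "0 < Re v" for v using that by fastforce
  define Q where "Q v = \<alpha> * (1 - 2 * S v)" for v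
  show ?thesis
  proof (intro exI[of _ Q] exI[of _ "1 + 2 * (\<Sum>j<J. k ^ j)"] conjI allI impI ballI)
    have "X holomorphic_on {v. 0 < Re v}" unfolding X_def by (intro holomorphic_intros)
    then show "Q holomorphic_on {v. 0 < Re v}"
      unfolding Q_def S_def using X0 by (intro holomorphic_intros) auto
  next
    fix v assume v: "0 < Re v"
    have "cmod (S v) \<le> (\<Sum>j<J. k ^ j)"
      unfolding S_def
    proof (rule sum_norm_le)
      fix j
      have "1 \<le> cmod (X v) ^ Suc j" using X1[OF v] by (rule one_le_power)
      then have "k ^ j / cmod (X v) ^ Suc j \<le> k ^ j / 1" using k by (intro divide_left_mono) auto
      then show "cmod (of_real k ^ j / X v ^ Suc j) \<le> k ^ j" using k by (simp add: norm_divide norm_power norm_mult)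
    qed
    then show "cmod (Q v) \<le> 1 + 2 * (\<Sum>j<J. k ^ j)"
      using norm_triangle_ineq4[of 1 "2 * S v"] \<alpha> by (simp add: Q_def norm_mult)
  next
    fix z assume z: "z \<in> unit_disc"
    define w where "w = half_plane \<alpha> z"
    have w: "0 < Re w" unfolding w_def using Re_half_plane_pos[OF \<alpha> z] .
    have Xw: "X (w - \<beta>) = w + 1 + of_real k" by (simp add: X_def)
    have re: "0 < Re (w - \<beta>)" using w \<beta> by simp
    have w1: "w + 1 \<noteq> 0" "1 \<le> cmod (w + 1)" using w cmod_plus_one_ge[of w] by (auto simp: complex_eq_iff)
    define q where "q = of_real k / X (w - \<beta>)"
    have Xk: "k + 1 \<le> cmod (X (w - \<beta>))" unfolding Xw using complex_Re_le_cmod[of "w + 1 + of_real k"] w by simp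
    have "cmod q \<le> k / (k + 1)"
      unfolding q_def norm_divide using Xk k by (simp add: frac_le)
    then have qJ: "cmod q ^ J \<le> (k / (k + 1)) ^ J" by (intro power_mono) auto
    have q1: "1 - q = (w + 1) / X (w - \<beta>)" using X0[OF re] by (simp add: q_def Xw field_simps)
    have "S (w - \<beta>) = (\<Sum>j<J. q ^ j) / X (w - \<beta>)"
      unfolding S_def q_def sum_divide_distrib by (rule sum.cong) (auto simp: power_divide)
    moreover have "(1 - q) * (\<Sum>j<J. q ^ j) = 1 - q ^ J" by (rule one_diff_power_eq[symmetric])
    ultimately have "(w + 1) * S (w - \<beta>) = 1 - q ^ J" unfolding q1 by simp
    then have "S (w - \<beta>) = (1 - q ^ J) / (w + 1)" using w1 by (simp add: field_simps)
    then have err: "1 / (w + 1) - S (w - \<beta>) = q ^ J / (w + 1)" by (simp add: diff_divide_distrib)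
    have "z = \<alpha> * (1 - 2 * (1 / (w + 1)))"
    proof -
      have "z = disc_point \<alpha> w" unfolding w_def poly_disc_point_half_plane[OF \<alpha> z] ..
      also have "\<dots> = \<alpha> * (1 - 2 * (1 / (w + 1)))" using w1 by (simp add: disc_point_def field_simps)
      finally show ?thesis .
    qed
    then have "z - Q (w - \<beta>) = - 2 * \<alpha> * (1 / (w + 1) - S (w - \<beta>))" by (simp add: Q_def algebra_simps)
    then have "cmod (z - Q (w - \<beta>)) = 2 * (cmod q ^ J / cmod (w + 1))"
      unfolding err using \<alpha> by (simp add: norm_mult norm_divide norm_power)
    also have "\<dots> \<le> 2 * (cmod q ^ J / 1)" using w1 by (intro mult_left_mono divide_left_mono) auto
    also have "\<dots> \<le> e" using qJ J by simp
    finally show "cmod (z - Q (half_plane \<alpha> z - \<beta>)) \<le> e" by (simp add: w_def)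
  qed
qed

lemma polynomial_extension:
  assumes \<alpha>: "cmod \<alpha> = 1" and \<beta>: "Re \<beta> \<le> 0"
  shows "0 < e \<Longrightarrow> \<exists>Q C. Q holomorphic_on {v. 0 < Re v} \<and> (\<forall>v. 0 < Re v \<longrightarrow> cmod (Q v) \<le> C) \<and>
     (\<forall>z\<in>unit_disc. cmod (poly p z - Q (half_plane \<alpha> z - \<beta>)) \<le> e)"
proof (induction p arbitrary: e)
  case 0
  then show ?case by (intro exI[of _ "\<lambda>_. 0"] exI[of _ 0]) auto
next
  case (pCons a q)
  obtain B where B: "0 \<le> B" "\<And>z. z \<in> unit_disc \<Longrightarrow> cmod (poly q z) \<le> B" using poly_bounded_disc by blast
  \<comment> \<open>The bound 1 keeps \<open>Q1\<close> below \<open>B + 1\<close> on the image of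
    the disc; the second accuracy is scaled to compensate this factor.\<close>
  have pos: "0 < min 1 (e / 2)" "0 < e / (2 * (B + 1))" using pCons.prems B(1) by auto
  from pCons.IH[OF pos(1)] obtain Q1 C1 where Q1': "Q1 holomorphic_on {v. 0 < Re v} \<and> (\<forall>v. 0 < Re v \<longrightarrow> cmod (Q1 v) \<le> C1) \<and>
     (\<forall>z\<in>unit_disc. cmod (poly q z - Q1 (half_plane \<alpha> z - \<beta>)) \<le> min 1 (e / 2))" by (elim exE)
  from inverse_extension[OF \<alpha> \<beta> pos(2)] obtain Q2 C2 where Q2': "Q2 holomorphic_on {v. 0 < Re v} \<and> (\<forall>v. 0 < Re v \<longrightarrow> cmod (Q2 v) \<le> C2) \<and>
     (\<forall>z\<in>unit_disc. cmod (z - Q2 (half_plane \<alpha> z - \<beta>)) \<le> e / (2 * (B + 1)))" by (elim exE)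
  have Q1: "Q1 holomorphic_on {v. 0 < Re v}" "0 < Re v \<Longrightarrow> cmod (Q1 v) \<le> C1"
     "z \<in> unit_disc \<Longrightarrow> cmod (poly q z - Q1 (half_plane \<alpha> z - \<beta>)) \<le> min 1 (e / 2)" for v z
    using Q1' by blast+
  have Q2: "Q2 holomorphic_on {v. 0 < Re v}" "0 < Re v \<Longrightarrow> cmod (Q2 v) \<le> C2"
     "z \<in> unit_disc \<Longrightarrow> cmod (z - Q2 (half_plane \<alpha> z - \<beta>)) \<le> e / (2 * (B + 1))" for v z
    using Q2' by blast+
  have C: "0 \<le> C2" using order.trans[OF norm_ge_zero Q2(2)[of 1]] by simp
  show ?case
  proof (intro exI[of _ "\<lambda>v. a + Q2 v * Q1 v"] exI[of _ "cmod a + C2 * C1"] conjI allI impI ballI)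
    show "(\<lambda>v. a + Q2 v * Q1 v) holomorphic_on {v. 0 < Re v}" by (intro holomorphic_intros Q1 Q2)
    show "cmod (a + Q2 v * Q1 v) \<le> cmod a + C2 * C1" if "0 < Re v" for v
    proof -
      have "cmod (Q2 v) * cmod (Q1 v) \<le> C2 * C1" using Q1(2)[OF that] Q2(2)[OF that] C by (intro mult_mono) auto
      then show ?thesis using norm_triangle_ineq[of a "Q2 v * Q1 v"] by (simp add: norm_mult)
    qed
    fix z assume z: "z \<in> unit_disc"
    let ?v = "half_plane \<alpha> z - \<beta>"
    have Q1b: "cmod (Q1 ?v) \<le> B + 1"
      using B(2)[OF z] Q1(3)[OF z] norm_triangle_ineq3[of "poly q z" "Q1 ?v"] by linarith
    have "poly (pCons a q) z - (a + Q2 ?v * Q1 ?v) = z * (poly q z - Q1 ?v) + (z - Q2 ?v) * Q1 ?v"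
      by (simp add: algebra_simps)
    also have "cmod \<dots> \<le> cmod z * cmod (poly q z - Q1 ?v) + cmod (z - Q2 ?v) * cmod (Q1 ?v)"
      using norm_triangle_ineq by (simp flip: norm_mult)
    also have "\<dots> \<le> 1 * (e / 2) + e / (2 * (B + 1)) * (B + 1)"
      using Q1(3)[OF z] Q2(3)[OF z] Q1b z pCons.prems B(1) by (intro add_mono mult_mono) auto
    also have "\<dots> = e" using B(1) by (simp add: field_simps)
    finally show "cmod (poly (pCons a q) z - (a + Q2 ?v * Q1 ?v)) \<le> e" .
  qed
qed

text \<open>The factor \<open>\<psi>\<close> vanishes at the origin and decays at infinity; as
  \<open>Y\<close> grows it tends to 1 in quadratic mean, at the rate
  \<open>1 / sqrt Y\<close>.\<close>

lemma hyperbolic_test_dense: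
  assumes \<alpha>: "cmod \<alpha> = 1" and \<beta>: "Re \<beta> \<le> 0" and e: "0 < e"
  shows "\<exists>U. hyperbolic_test U \<and> L2_bounded (\<lambda>z. cmod (poly p z - U (half_plane \<alpha> z - \<beta>))) e"
proof -
  from polynomial_extension[OF \<alpha> \<beta> half_gt_zero[OF e], of p] obtain Q C where Q': "Q holomorphic_on {v. 0 < Re v} \<and>
     (\<forall>v. 0 < Re v \<longrightarrow> cmod (Q v) \<le> C) \<and> (\<forall>z\<in>unit_disc. cmod (poly p z - Q (half_plane \<alpha> z - \<beta>)) \<le> e / 2)" by (elim exE)
  have Q: "Q holomorphic_on {v. 0 < Re v}" "0 < Re v \<Longrightarrow> cmod (Q v) \<le> C"
     "z \<in> unit_disc \<Longrightarrow> cmod (poly p z - Q (half_plane \<alpha> z - \<beta>)) \<le> e / 2" for v z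
    using Q' by blast+
  have C: "0 \<le> C" using order.trans[OF norm_ge_zero Q(2)[of 1]] by simp
  \<comment> \<open>Three errors of size \<open>1 / sqrt Y\<close> arise, with the weights 1, 1 and
    \<open>cmod (1 + \<beta>)\<close>; \<open>Y\<close> makes \<open>C * R / sqrt Y\<close> at most
    \<open>e / 2\<close>.\<close>
  define R where "R = 2 + cmod (1 + \<beta>)"
  have R: "2 \<le> R" by (simp add: R_def)
  define Y where "Y = (2 * C * R / e + 1)\<^sup>2"
  have c1: "1 \<le> 2 * C * R / e + 1" using C e R by simp
  then have Y: "1 \<le> Y" "sqrt Y = 2 * C * R / e + 1" by (auto simp: Y_def one_le_power)
  define \<psi> where "\<psi> v = v / (v + of_real (1 / Y)) * (of_real Y / (v + of_real Y))" for v :: complex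
  define U where "U v = Q v * \<psi> v" for v
  have den: "0 < cmod (v + of_real (1 / Y))" "0 < cmod (v + of_real Y)" "cmod v \<le> cmod (v + of_real (1 / Y))"
     "cmod v \<le> cmod (v + of_real Y)" "cmod (v + 1) \<le> cmod (v + of_real Y)" "cmod (v + 1) / Y \<le> cmod (v + of_real (1 / Y))" "1 \<le> cmod (v + 1)"
    if v: "0 < Re v" for v
  proof -
    have pos: "0 < cmod (v + of_real y)" if "0 \<le> y" for y
      using v that by (intro cmod_pos_of_Re_pos) simp
    show "0 < cmod (v + of_real (1 / Y))" "0 < cmod (v + of_real Y)"
      using Y by (intro pos; simp)+
    show "cmod v \<le> cmod (v + of_real (1 / Y))" "cmod v \<le> cmod (v + of_real Y)"
      using v Y by (auto intro!: cmod_le_cmod_add simp del: of_real_divide)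
    have "cmod (v + 1) \<le> cmod (v + 1 + of_real (Y - 1))" using v Y by (intro cmod_le_cmod_add) auto
    then show "cmod (v + 1) \<le> cmod (v + of_real Y)" by simp
    have "cmod (of_real Y * v + 1) = cmod (v + 1 + of_real (Y - 1) * v)" by (simp add: algebra_simps)
    have "(cmod (v + 1))\<^sup>2 \<le> (cmod (of_real Y * v + 1))\<^sup>2"
    proof -
      have "(Re v + 1)\<^sup>2 \<le> (Y * Re v + 1)\<^sup>2" using v Y by (intro power_mono) (auto simp: mult_le_cancel_right1)
      moreover have "1 * (Im v)\<^sup>2 \<le> Y\<^sup>2 * (Im v)\<^sup>2" using Y by (intro mult_right_mono) (auto simp: one_le_power)
      ultimately show ?thesis unfolding cmod_power2 by (simp add: power_mult_distrib)
    qed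
    then have "cmod (v + 1) \<le> cmod (of_real Y * v + 1)" by (rule power2_le_imp_le) simp
    also have "of_real Y * v + 1 = of_real Y * (v + of_real (1 / Y))" using Y by (simp add: distrib_left)
    finally show "cmod (v + 1) / Y \<le> cmod (v + of_real (1 / Y))" using Y by (simp add: norm_mult divide_le_eq mult.commute)
    show "1 \<le> cmod (v + 1)" using v by (intro cmod_plus_one_ge) simp
  qed
  have U: "hyperbolic_test U"
    unfolding hyperbolic_test_def
  proof (intro conjI exI[of _ "C * Y\<^sup>2"] allI impI)
    show "U holomorphic_on {w. 0 < Re w}"
      unfolding U_def \<psi>_def using den(1,2) by (intro holomorphic_intros Q) auto
    show "0 \<le> C * Y\<^sup>2" using C by simp
    fix v assume v: "0 < Re v"
    have "cmod (\<psi> v) = cmod v * (1 / cmod (v + of_real (1 / Y))) * (Y / cmod (v + of_real Y))"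
      using Y by (simp add: \<psi>_def norm_mult norm_divide del: of_real_divide)
    also have "\<dots> \<le> cmod v * (1 / (cmod (v + 1) / Y)) * (Y / cmod (v + 1))"
    proof -
      have c0: "0 < cmod (v + 1)" using den(7)[OF v] by linarith
      then have c1: "0 < cmod (v + 1) / Y" using Y by (intro divide_pos_pos) linarith+
      have "1 / cmod (v + of_real (1 / Y)) \<le> 1 / (cmod (v + 1) / Y)"
        by (intro frac_le c1 den(6)[OF v]) auto
      moreover have "Y / cmod (v + of_real Y) \<le> Y / cmod (v + 1)"
        using Y by (intro frac_le c0 den(5)[OF v]) auto
      ultimately show ?thesis using Y by (intro mult_mono mult_nonneg_nonneg) auto
    qed
    also have "\<dots> = Y\<^sup>2 * cmod v / (cmod (v + 1))\<^sup>2" by (simp add: power2_eq_square)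
    finally have "cmod (Q v) * cmod (\<psi> v) \<le> C * (Y\<^sup>2 * cmod v / (cmod (v + 1))\<^sup>2)"
      using Q(2)[OF v] C by (intro mult_mono) auto
    then show "cmod (U v) \<le> C * Y\<^sup>2 * cmod v / (cmod (v + 1))\<^sup>2" by (simp add: U_def norm_mult)
  qed
  define p1 p2 where "p1 = of_real (1 / Y) - \<beta>" and "p2 = of_real Y - \<beta>"
  have re1: "Re p1 = 1 / Y - Re \<beta>" "Re p2 = Y - Re \<beta>" by (simp_all add: p1_def p2_def)
  have "0 < 1 / Y" using Y by simp
  then have p: "0 < Re p1" "1 / Y \<le> Re p1" "0 < Re p2" "Y \<le> Re p2" using \<beta> Y(1) re1 by linarith+
  let ?w = "half_plane \<alpha>"
  have "L2_bounded (\<lambda>z. e / 2 + C * (1 / Y * cmod (1 / (?w z + p1)) + (cmod ((?w z + 1) / (?w z + p2)) + cmod (1 + \<beta>) * cmod (1 / (?w z + p2)))))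
     (e / 2 + C * (1 / Y * (1 / sqrt (Re p1)) + (1 / sqrt (Re p2) + cmod (1 + \<beta>) * (1 / sqrt (Re p2)))))"
    using C e Y by (intro L2_bounded_add L2_bounded_cmult L2_bounded_const L2_bounded_inverse L2_bounded_kernel \<alpha> p) auto
  then have "L2_bounded (\<lambda>z. cmod (poly p z - U (half_plane \<alpha> z - \<beta>))) e"
  proof (rule L2_bounded_holomorphic[rotated])
    show "(\<lambda>z. poly p z - U (half_plane \<alpha> z - \<beta>)) holomorphic_on unit_disc"
    proof (intro holomorphic_intros holomorphic_poly holomorphic_half_plane_compose[of U] holomorphic_half_plane \<alpha>)
      show "U holomorphic_on {w. 0 < Re w}" using U by (simp add: hyperbolic_test_def)
      show "0 < Re (half_plane \<alpha> z - \<beta>)" if "z \<in> unit_disc" for z using Re_half_plane_pos[OF \<alpha> that] \<beta> by simp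
    qed
    have s0: "0 < sqrt Y" using Y(1) by simp
    have "1 / Y * (1 / sqrt (Re p1)) \<le> 1 / Y * (1 / sqrt (1 / Y))"
      using p Y(1) by (intro mult_left_mono divide_left_mono mult_pos_pos) auto
    also have "\<dots> = 1 / sqrt Y" using Y(1) by (simp add: real_sqrt_divide field_simps)
    finally have i1: "1 / Y * (1 / sqrt (Re p1)) \<le> 1 / sqrt Y" .
    have i2: "1 / sqrt (Re p2) \<le> 1 / sqrt Y" using p Y(1) by (intro divide_left_mono mult_pos_pos) auto
    have "C * (1 / Y * (1 / sqrt (Re p1)) + (1 / sqrt (Re p2) + cmod (1 + \<beta>) * (1 / sqrt (Re p2))))
       \<le> C * (1 / sqrt Y + (1 / sqrt Y + cmod (1 + \<beta>) * (1 / sqrt Y)))"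
      using C i1 i2 by (intro mult_left_mono add_mono) auto
    also have "\<dots> = C * R / sqrt Y" by (simp add: R_def distrib_left distrib_right add_divide_distrib)
    also have "\<dots> \<le> e / 2"
    proof -
      have "C * R * 2 \<le> e * sqrt Y" unfolding Y(2) using e by (simp add: distrib_left)
      then show ?thesis using s0 by (simp add: divide_le_eq)
    qed
    finally show "e / 2 + C * (1 / Y * (1 / sqrt (Re p1)) + (1 / sqrt (Re p2) + cmod (1 + \<beta>) * (1 / sqrt (Re p2)))) \<le> e" by linarith
    fix z assume z: "z \<in> unit_disc"
    define v where "v = half_plane \<alpha> z - \<beta>"
    have w: "0 < Re (half_plane \<alpha> z)" using Re_half_plane_pos[OF \<alpha> z] .
    have v: "0 < Re v" using w \<beta> by (simp add: v_def)
    have v1: "v + of_real (1 / Y) = ?w z + p1" and v2: "v + of_real Y = ?w z + p2" by (simp_all add: v_def p1_def p2_def)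
    have ne: "?w z + p1 \<noteq> 0" "?w z + p2 \<noteq> 0" using den(1,2)[OF v] unfolding v1 v2 by auto
    have "1 - \<psi> v = of_real (1 / Y) / (?w z + p1) + v / (?w z + p1) * (v / (?w z + p2))"
    proof -
      have aux: "1 - x / X = y / X" if "x + y = X" "X \<noteq> 0" for x y X :: complex
        using that by (auto simp: divide_simps)
      have "1 - v / (?w z + p1) = of_real (1 / Y) / (?w z + p1)" by (rule aux[OF v1 ne(1)])
      moreover have "1 - of_real Y / (?w z + p2) = v / (?w z + p2)"
        by (rule aux[OF _ ne(2)]) (simp add: v2[symmetric])
      moreover have "1 - x * y = (1 - x) + x * (1 - y)" for x y :: complex by (simp add: algebra_simps)
      ultimately show ?thesis unfolding \<psi>_def v1 v2 by metis
    qed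
    then have "cmod (1 - \<psi> v) \<le> cmod (of_real (1 / Y) / (?w z + p1)) + cmod (v / (?w z + p1) * (v / (?w z + p2)))"
      by (simp only: norm_triangle_ineq)
    also have "cmod (of_real (1 / Y) / (?w z + p1)) = 1 / Y * cmod (1 / (?w z + p1))" using Y(1) by (simp add: norm_divide norm_mult)
    also have "cmod (v / (?w z + p1) * (v / (?w z + p2))) \<le> 1 * (cmod v / cmod (?w z + p2))"
    proof -
      have "cmod v / cmod (?w z + p1) \<le> 1" using den(1,3)[OF v] unfolding v1 by (subst divide_le_eq_1_pos) auto
      then show ?thesis unfolding norm_mult norm_divide by (intro mult_right_mono) auto
    qed
    also have "cmod v \<le> cmod (?w z + 1) + cmod (1 + \<beta>)" using norm_triangle_ineq4[of "?w z + 1" "1 + \<beta>"] by (simp add: v_def)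
    then have "1 * (cmod v / cmod (?w z + p2)) \<le> cmod ((?w z + 1) / (?w z + p2)) + cmod (1 + \<beta>) * cmod (1 / (?w z + p2))"
      unfolding norm_divide by (simp add: divide_right_mono flip: add_divide_distrib)
    finally have \<psi>: "cmod (1 - \<psi> v) \<le> 1 / Y * cmod (1 / (?w z + p1)) + (cmod ((?w z + 1) / (?w z + p2)) + cmod (1 + \<beta>) * cmod (1 / (?w z + p2)))" by simp
    have "poly p z - U v = (poly p z - Q v) + Q v * (1 - \<psi> v)" by (simp add: U_def algebra_simps)
    then have "cmod (poly p z - U v) \<le> cmod (poly p z - Q v) + cmod (Q v) * cmod (1 - \<psi> v)"
      by (metis norm_mult norm_triangle_ineq)
    also have "\<dots> \<le> e / 2 + C * (1 / Y * cmod (1 / (?w z + p1)) + (cmod ((?w z + 1) / (?w z + p2)) + cmod (1 + \<beta>) * cmod (1 / (?w z + p2))))"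
      using Q(3)[OF z] Q(2)[OF v] \<psi> C by (intro add_mono mult_mono) (auto simp: v_def)
    finally show "cmod (poly p z - U (half_plane \<alpha> z - \<beta>)) \<le> \<dots>" by (simp add: v_def)
  qed
  with U show ?thesis by blast
qed

section \<open>Transported test functions\<close>

text \<open>The test function composed with the inverse of the \<open>n\<close>-th iterate. The
  summand 0 brings the shift into the form \<open>c - a * real n\<close> of the summation
  lemmas.\<close>

definition parabolic_piece :: "complex \<Rightarrow> real \<Rightarrow> (complex \<Rightarrow> complex) \<Rightarrow> nat \<Rightarrow> complex \<Rightarrow> complex" where
  "parabolic_piece \<alpha> a U n z = U (half_plane \<alpha> z + \<i> * of_real (0 - a * real n))"

text \<open>The inverse of the \<open>n\<close>-th iterate contracts towards the centre \<beta>, and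
  the test function takes the coordinate centred there. This makes sense for non-automorphisms too,
  as the test function lives on the half-plane \<open>0 < Re v\<close>.\<close>

definition hyperbolic_piece :: "complex \<Rightarrow> complex \<Rightarrow> real \<Rightarrow> (complex \<Rightarrow> complex) \<Rightarrow> nat \<Rightarrow> complex \<Rightarrow> complex" where
  "hyperbolic_piece \<alpha> \<beta> L U n z = U (of_real (exp (- L * real n)) * (half_plane \<alpha> z - \<beta>))"

text \<open>The finite fixed point of \<open>w \<mapsto> \<mu> w + b\<close>, that is, the repulsive
  fixed point of the symbol.\<close>

definition center :: "real \<Rightarrow> complex \<Rightarrow> complex" where
  "center \<mu> b = - b / of_real (\<mu> - 1)"

lemma Re_center: "1 < \<mu> \<Longrightarrow> 0 \<le> Re b \<Longrightarrow> Re (center \<mu> b) \<le> 0"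
  unfolding center_def Re_divide_of_real by simp

lemma parabolic_iterate:
  assumes m: "affine_model g \<alpha> 1 b" and b: "Re b = 0" and z: "z \<in> unit_disc"
  shows "half_plane \<alpha> ((g ^^ m) z) = half_plane \<alpha> z + \<i> * of_real (Im b * real m)"
proof -
  have "b = \<i> * of_real (Im b)" using b by (simp add: complex_eq_iff)
  then have "of_nat m * b = \<i> * of_real (Im b * real m)" by (metis mult.assoc mult.commute of_real_mult of_real_of_nat_eq)
  then show ?thesis unfolding affine_model_iterate(2)[OF m z] by simp
qed

lemma hyperbolic_iterate:
  assumes m: "affine_model g \<alpha> \<mu> b" and \<mu>: "1 < \<mu>" and z: "z \<in> unit_disc"
  shows "half_plane \<alpha> ((g ^^ m) z) = center \<mu> b + of_real (exp (ln \<mu> * real m)) * (half_plane \<alpha> z - center \<mu> b)"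
proof -
  have "exp (ln \<mu> * real m) = \<mu> ^ m" using \<mu> by (simp add: exp_of_nat2_mult)
  moreover have "of_real (\<Sum>i<m. \<mu> ^ i) * b = center \<mu> b - of_real (\<mu> ^ m) * center \<mu> b"
  proof -
    have "of_real (\<mu> - 1) \<noteq> (0 :: complex)" using \<mu> by (simp only: of_real_eq_0_iff)
    then have "b = - of_real (\<mu> - 1) * center \<mu> b" unfolding center_def by (simp del: of_real_diff)
    then have "of_real (\<Sum>i<m. \<mu> ^ i) * b = - of_real ((\<Sum>i<m. \<mu> ^ i) * (\<mu> - 1)) * center \<mu> b"
      by (metis (no_types) of_real_mult mult_minus_left mult_minus_right mult.assoc)
    also have "(\<Sum>i<m. \<mu> ^ i) * (\<mu> - 1) = \<mu> ^ m - 1"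
      unfolding geometric_partial_sum_le(2)[OF \<mu>] using \<mu> by simp
    finally show ?thesis by (simp add: algebra_simps)
  qed
  ultimately show ?thesis unfolding affine_model_iterate(2)[OF m z] by (simp add: algebra_simps)
qed

lemma holomorphic_parabolic_piece:
  assumes "parabolic_test U" "cmod \<alpha> = 1" shows "parabolic_piece \<alpha> a U n holomorphic_on unit_disc"
  unfolding parabolic_piece_def using assms Re_half_plane_pos[OF assms(2)]
  by (intro holomorphic_half_plane_compose[of U] holomorphic_intros holomorphic_half_plane) (auto simp: parabolic_test_def)

lemma Re_dilation_pos:
  assumes "cmod \<alpha> = 1" "Re \<beta> \<le> 0" "z \<in> unit_disc"
  shows "0 < Re (of_real (exp x) * (half_plane \<alpha> z - \<beta>))"
  using Re_half_plane_pos[OF assms(1,3)] assms(2) by simp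

lemma holomorphic_hyperbolic_piece:
  assumes "hyperbolic_test U" "cmod \<alpha> = 1" "Re \<beta> \<le> 0" shows "hyperbolic_piece \<alpha> \<beta> L U n holomorphic_on unit_disc"
  unfolding hyperbolic_piece_def using assms Re_dilation_pos[OF assms(2,3)]
  by (intro holomorphic_half_plane_compose[of U] holomorphic_intros holomorphic_half_plane) (auto simp: hyperbolic_test_def simp del: times_complex.sel)

lemma L2_bounded_cong:
  assumes "L2_bounded v C" "\<And>z. z \<in> unit_disc \<Longrightarrow> u z = v z" shows "L2_bounded u C"
proof -
  have "continuous_on unit_disc u = continuous_on unit_disc v" using assms(2) by (intro continuous_on_cong) auto
  then show ?thesis using assms(1) circle_norm_cong[OF assms(2)] by (simp add: L2_bounded_def)
qed

lemma shift_bound_small: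
  assumes "0 < (e::real)" "0 < K" shows "\<exists>N0>0. \<forall>N\<ge>N0. K * (1 / N + 2 / sqrt N) \<le> e"
proof -
  define N0 where "N0 = (3 * K / e + 1)\<^sup>2"
  have "0 \<le> 3 * K / e" using assms by (intro divide_nonneg_pos) auto
  then have c: "1 \<le> 3 * K / e + 1" by linarith
  have N0: "1 \<le> N0" "sqrt N0 = 3 * K / e + 1"
    unfolding N0_def real_sqrt_abs using c one_le_power[OF c, of 2] by linarith+
  have "K * (1 / N + 2 / sqrt N) \<le> e" if N: "N0 \<le> N" for N
  proof -
    have N1: "1 \<le> N" using N0 N by simp
    then have s1: "1 \<le> sqrt N" by simp
    have "sqrt N * 1 \<le> sqrt N * sqrt N" using s1 by (intro mult_left_mono) auto
    then have "sqrt N \<le> N" using N1 by simp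
    then have "1 / N \<le> 1 / sqrt N" using s1 by (intro divide_left_mono mult_pos_pos) auto
    then have "K * (1 / N + 2 / sqrt N) \<le> K * (3 / sqrt N)" using assms by (intro mult_left_mono) auto
    also have "\<dots> \<le> K * (3 / sqrt N0)" using N N0(1) assms by (intro mult_left_mono divide_left_mono mult_pos_pos) auto
    also have "\<dots> = 3 * K / (3 * K / e + 1)" unfolding N0(2) by simp
    also have "\<dots> \<le> e"
    proof -
      have "0 < 3 * K / e + 1" using c by linarith
      moreover have "3 * K \<le> e * (3 * K / e + 1)" using assms by (simp add: distrib_left)
      ultimately show ?thesis by (simp only: pos_divide_le_eq)
    qed
    finally show ?thesis .
  qed
  then show ?thesis using N0(1) by (intro exI[of _ N0]) auto
qed

text \<open>At its own time a piece reproduces the target exactly; at the others the shifts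
  \<open>Im b * (m - n)\<close> have modulus at least \<open>\<bar>Im b\<bar> * N\<close>.\<close>

lemma parabolic_tracks:
  assumes m: "affine_model g \<alpha> 1 b" and b: "Re b = 0" and U: "parabolic_test U"
  shows "tracks g E (\<lambda>z. U (half_plane \<alpha> z)) (parabolic_piece \<alpha> (Im b) U)"
proof -
  have \<alpha>: "cmod \<alpha> = 1" and "b \<noteq> 0" using m by (auto simp: affine_model_def)
  then have a: "Im b \<noteq> 0" using b by (auto simp: complex_eq_iff)
  have eq: "parabolic_piece \<alpha> (Im b) U n ((g ^^ m) z) = U (half_plane \<alpha> z + \<i> * of_real (Im b * real m - Im b * real n))"
    if "z \<in> unit_disc" for n m z
    by (simp add: parabolic_piece_def parabolic_iterate[OF m b that] algebra_simps)
  obtain K where K: "0 < K" "\<And>(J :: nat set) c N. finite J \<Longrightarrow> 0 < N \<Longrightarrow> (\<forall>n\<in>J. N \<le> \<bar>c - Im b * real n\<bar>) \<Longrightarrow>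
     L2_bounded (\<lambda>z. cmod (\<Sum>n\<in>J. U (half_plane \<alpha> z + \<i> * of_real (c - Im b * real n)))) (K * (1 / N + 2 / sqrt N))"
    using parabolic_shift_bound[OF U a \<alpha>] by blast
  show ?thesis
    unfolding tracks_def
  proof (intro allI impI)
    fix e :: real assume e: "0 < e"
    obtain N0 where N0: "0 < N0" "\<And>N. N0 \<le> N \<Longrightarrow> K * (1 / N + 2 / sqrt N) \<le> e"
      using shift_bound_small[OF e K(1)] by blast
    obtain M where M: "N0 / \<bar>Im b\<bar> < real M" using reals_Archimedean2 by blast
    then have MN: "N0 \<le> \<bar>Im b\<bar> * real M" using a by (simp add: divide_less_eq mult.commute)
    show "\<exists>N. (\<forall>m\<in>E. N \<le> m \<longrightarrow> L2_bounded (\<lambda>z. cmod (parabolic_piece \<alpha> (Im b) U m ((g ^^ m) z) - U (half_plane \<alpha> z))) e) \<and>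
     (\<forall>m\<in>insert 0 E. \<forall>J. finite J \<longrightarrow> J \<subseteq> E \<longrightarrow> (\<forall>n\<in>J. int N \<le> \<bar>int n - int m\<bar>) \<longrightarrow>
        L2_bounded (\<lambda>z. cmod (\<Sum>n\<in>J. parabolic_piece \<alpha> (Im b) U n ((g ^^ m) z))) e)"
    proof (intro exI[of _ M] conjI ballI allI impI)
      fix m
      show "L2_bounded (\<lambda>z. cmod (parabolic_piece \<alpha> (Im b) U m ((g ^^ m) z) - U (half_plane \<alpha> z))) e"
        by (rule L2_bounded_cong[of "\<lambda>_. 0"]) (use e in \<open>auto simp: eq intro!: L2_bounded_const_cmod\<close>)
    next
      fix m J assume J: "finite J" and s: "\<forall>n\<in>J. int M \<le> \<bar>int n - int m\<bar>"
      have "\<forall>n\<in>J. N0 \<le> \<bar>Im b * real m - Im b * real n\<bar>"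
      proof
        fix n assume "n \<in> J"
        then have "int M \<le> \<bar>int n - int m\<bar>" using s by blast
        then have "real M \<le> \<bar>real m - real n\<bar>" by linarith
        then have "\<bar>Im b\<bar> * real M \<le> \<bar>Im b\<bar> * \<bar>real m - real n\<bar>" by (intro mult_left_mono) auto
        with MN show "N0 \<le> \<bar>Im b * real m - Im b * real n\<bar>" by (simp flip: abs_mult add: right_diff_distrib)
      qed
      from L2_bounded_weaken[OF K(2)[OF J N0(1) this] N0(2)[OF order_refl]]
      show "L2_bounded (\<lambda>z. cmod (\<Sum>n\<in>J. parabolic_piece \<alpha> (Im b) U n ((g ^^ m) z))) e"
        by (rule L2_bounded_cong) (simp add: eq)
    qed
  qed
qed

lemma exp_bound_small:
  assumes "0 < (e::real)" "0 < K" shows "\<exists>N0. \<forall>N\<ge>N0. K * exp (- N / 4) \<le> e"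
proof (intro exI[of _ "4 * ln (K / e)"] allI impI)
  fix N assume "4 * ln (K / e) \<le> N"
  then have "exp (- N / 4) \<le> exp (- ln (K / e))" by simp
  also have "\<dots> = e / K" using assms by (simp add: exp_minus)
  finally show "K * exp (- N / 4) \<le> e" using assms by (simp add: field_simps)
qed

lemma L2_bounded_sum_cmod:
  assumes "L2_bounded (\<lambda>z. \<Sum>n\<in>J. cmod (f n z)) C" "\<And>n. n \<in> J \<Longrightarrow> f n holomorphic_on unit_disc" "C \<le> C'"
  shows "L2_bounded (\<lambda>z. cmod (\<Sum>n\<in>J. f n z)) C'"
  by (rule L2_bounded_holomorphic[OF _ assms(1) norm_sum assms(3)]) (intro holomorphic_on_sum assms(2))

lemma hyperbolic_piece_iterate:
  assumes m: "affine_model g \<alpha> \<mu> b" and \<mu>: "1 < \<mu>" and z: "z \<in> unit_disc"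
  shows "hyperbolic_piece \<alpha> (center \<mu> b) (ln \<mu>) U n ((g ^^ m) z) =
    U (of_real (exp (ln \<mu> * real m - ln \<mu> * real n)) * (half_plane \<alpha> z - center \<mu> b))"
proof -
  have "exp (ln \<mu> * real m - ln \<mu> * real n) = exp (- ln \<mu> * real n) * exp (ln \<mu> * real m)" by (simp flip: exp_add)
  then show ?thesis by (simp add: hyperbolic_piece_def hyperbolic_iterate[OF m \<mu> z] mult.assoc)
qed

lemma hyperbolic_tracks:
  assumes m: "affine_model g \<alpha> \<mu> b" and \<mu>: "1 < \<mu>" and U: "hyperbolic_test U"
  shows "tracks g E (\<lambda>z. U (half_plane \<alpha> z - center \<mu> b)) (hyperbolic_piece \<alpha> (center \<mu> b) (ln \<mu>) U)"
proof -
  define \<beta> L where "\<beta> = center \<mu> b" and "L = ln \<mu>"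
  have \<alpha>: "cmod \<alpha> = 1" and "0 \<le> Re b" using m by (auto simp: affine_model_def)
  then have \<beta>: "Re \<beta> \<le> 0" unfolding \<beta>_def using \<mu> by (intro Re_center)
  have L: "0 < L" using \<mu> by (simp add: L_def)
  have eq: "hyperbolic_piece \<alpha> \<beta> L U n ((g ^^ m) z) = U (of_real (exp (L * real m - L * real n)) * (half_plane \<alpha> z - \<beta>))"
    if "z \<in> unit_disc" for n m z
    unfolding \<beta>_def L_def by (rule hyperbolic_piece_iterate[OF m \<mu> that])
  have hol: "(\<lambda>z. U (of_real (exp x) * (half_plane \<alpha> z - \<beta>))) holomorphic_on unit_disc" for x
    using U Re_dilation_pos[OF \<alpha> \<beta>]
    by (intro holomorphic_half_plane_compose[of U] holomorphic_intros holomorphic_half_plane \<alpha>) (auto simp: hyperbolic_test_def simp del: times_complex.sel)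
  obtain K where K: "0 < K" "\<And>(J :: nat set) c N \<gamma>. finite J \<Longrightarrow> Re \<gamma> \<le> 0 \<Longrightarrow> cmod \<gamma> \<le> cmod \<beta> \<Longrightarrow> (\<forall>n\<in>J. N \<le> \<bar>c - L * real n\<bar>) \<Longrightarrow>
     L2_bounded (\<lambda>z. \<Sum>n\<in>J. cmod (U (of_real (exp (c - L * real n)) * (half_plane \<alpha> z - \<gamma>)))) (K * exp (- N / 4))"
    using hyperbolic_shift_bound[OF U _ \<alpha>, of L "cmod \<beta>"] L by auto
  have "tracks g E (\<lambda>z. U (half_plane \<alpha> z - \<beta>)) (hyperbolic_piece \<alpha> \<beta> L U)"
    unfolding tracks_def
  proof (intro allI impI)
    fix e :: real assume e: "0 < e"
    obtain N0 where N0: "\<And>N. N0 \<le> N \<Longrightarrow> K * exp (- N / 4) \<le> e"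
      using exp_bound_small[OF e K(1)] by blast
    obtain M where M: "N0 / L < real M" using reals_Archimedean2 by blast
    then have MN: "N0 \<le> L * real M" using L by (simp add: divide_less_eq mult.commute)
    show "\<exists>N. (\<forall>m\<in>E. N \<le> m \<longrightarrow> L2_bounded (\<lambda>z. cmod (hyperbolic_piece \<alpha> \<beta> L U m ((g ^^ m) z) - U (half_plane \<alpha> z - \<beta>))) e) \<and>
     (\<forall>m\<in>insert 0 E. \<forall>J. finite J \<longrightarrow> J \<subseteq> E \<longrightarrow> (\<forall>n\<in>J. int N \<le> \<bar>int n - int m\<bar>) \<longrightarrow>
        L2_bounded (\<lambda>z. cmod (\<Sum>n\<in>J. hyperbolic_piece \<alpha> \<beta> L U n ((g ^^ m) z))) e)"
    proof (intro exI[of _ M] conjI ballI allI impI)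
      fix m
      show "L2_bounded (\<lambda>z. cmod (hyperbolic_piece \<alpha> \<beta> L U m ((g ^^ m) z) - U (half_plane \<alpha> z - \<beta>))) e"
        by (rule L2_bounded_cong[of "\<lambda>_. 0"]) (use e in \<open>auto simp: eq intro!: L2_bounded_const_cmod\<close>)
    next
      fix m J assume J: "finite J" and s: "\<forall>n\<in>J. int M \<le> \<bar>int n - int m\<bar>"
      have "\<forall>n\<in>J. N0 \<le> \<bar>L * real m - L * real n\<bar>"
      proof
        fix n assume "n \<in> J"
        then have "int M \<le> \<bar>int n - int m\<bar>" using s by blast
        then have "real M \<le> \<bar>real m - real n\<bar>" by linarith
        then have "L * real M \<le> \<bar>L\<bar> * \<bar>real m - real n\<bar>" using L by (simp add: mult_left_mono)
        with MN show "N0 \<le> \<bar>L * real m - L * real n\<bar>" by (simp flip: abs_mult add: right_diff_distrib)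
      qed
      from L2_bounded_sum_cmod[OF K(2)[OF J \<beta> order_refl this] hol N0[OF order_refl]]
      show "L2_bounded (\<lambda>z. cmod (\<Sum>n\<in>J. hyperbolic_piece \<alpha> \<beta> L U n ((g ^^ m) z))) e"
        by (rule L2_bounded_cong) (simp add: eq)
    qed
  qed
  then show ?thesis by (simp add: \<beta>_def L_def)
qed

text \<open>For \<open>m\<close>, \<open>n\<close> in the blocks, \<open>m / n\<close> is either at
  most \<open>(1 + r) / 2\<close> or at least \<open>2 * r\<close>: the condition
  \<open>H * (r - 1) > 2\<close> settles a common block, and \<open>H > 4 * r\<close> the case of
  \<open>m\<close> in a later block.\<close>

lemma blocks_ratio:
  fixes r :: real assumes r: "1 < r"
  shows "\<exists>H\<ge>2. \<exists>c>0. \<forall>m\<in>insert 0 (blocks H). \<forall>n\<in>insert 0 (blocks H). c * real (max m n) \<le> \<bar>real m - r * real n\<bar>"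
proof -
  obtain H where H: "max (4 * r) (2 / (r - 1)) < real H" using reals_Archimedean2 by blast
  then have H4: "4 * r < real H" and "2 / (r - 1) < real H" by auto
  then have H2: "2 < real H * (r - 1)" using r by (simp add: divide_less_eq)
  have H1: "2 \<le> H" using H4 r by linarith
  define c where "c = min ((r - 1) / 4) (1 / 2)"
  have "0 < c" using r by (simp add: c_def)
  moreover have "c \<le> (r - 1) / 4" "c \<le> 1 / 2" unfolding c_def by (rule min.cobounded1, rule min.cobounded2)
  ultimately have c: "0 < c" "c \<le> (r - 1) / 4" "c \<le> 1 / 2" by blast+
  show ?thesis
  proof (intro exI[of _ H] exI[of _ c] conjI H1 c(1) ballI)
    fix m n assume m: "m \<in> insert 0 (blocks H)" and n: "n \<in> insert 0 (blocks H)"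
    have small: "c * real (max m n) \<le> \<bar>real m - r * real n\<bar>" if mn: "real m \<le> (1 + (r - 1) / 2) * real n"
    proof -
      have "real (max m n) \<le> (1 + (r - 1) / 2) * real n" using mn r by (auto simp: max_def distrib_right)
      then have "c * real (max m n) \<le> c * ((1 + (r - 1) / 2) * real n)" using c by (intro mult_left_mono) auto
      also have "\<dots> = (c + c * ((r - 1) / 2)) * real n" by (simp add: algebra_simps)
      also have "\<dots> \<le> ((r - 1) / 4 + 1 / 2 * ((r - 1) / 2)) * real n"
        using c r by (intro mult_right_mono add_mono) auto
      also have "\<dots> = (r - 1) / 2 * real n" by (simp add: field_simps)
      also have "\<dots> = r * real n - (1 + (r - 1) / 2) * real n" by (simp add: algebra_simps)
      also have "\<dots> \<le> r * real n - real m" using mn by simp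
      finally show ?thesis by simp
    qed
    have large: "c * real (max m n) \<le> \<bar>real m - r * real n\<bar>" if nm: "r * real n \<le> real m / 2"
    proof -
      have "1 * real n \<le> r * real n" using r by (intro mult_right_mono) auto
      then have "max m n = m" using nm by auto
      then have "c * real (max m n) \<le> 1 / 2 * real m" using c(3) by (simp only:) (rule mult_right_mono; simp)
      also have "\<dots> \<le> real m - r * real n" using nm by simp
      finally show ?thesis by simp
    qed
    consider "m = 0" | "n = 0" | "m \<in> blocks H" "n \<in> blocks H" using m n by auto
    then show "c * real (max m n) \<le> \<bar>real m - r * real n\<bar>"
    proof cases
      case 1
      then show ?thesis using r by (intro small) (auto intro!: mult_nonneg_nonneg)
    next
      case 2
      then show ?thesis by (intro large) auto
    next
      case 3
      then obtain p q where p: "H ^ Suc p \<le> m" "m \<le> H ^ Suc p + H ^ p" and q: "H ^ Suc q \<le> n" "n \<le> H ^ Suc q + H ^ q"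
        by (auto simp: blocks_def)
      have Hp: "real (H ^ p) * real H \<le> real m" "real m \<le> real (H ^ p) * real H + real (H ^ p)"
        using p by (simp_all flip: of_nat_mult of_nat_add of_nat_power add: mult.commute)
      have Hq: "real (H ^ q) * real H \<le> real n" "real n \<le> real (H ^ q) * real H + real (H ^ q)"
        using q by (simp_all flip: of_nat_mult of_nat_add of_nat_power add: mult.commute)
      consider "p = q" | "p < q" | "q < p" by linarith
      then show ?thesis
      proof cases
        case 1
        have "real (H ^ q) * 2 \<le> real (H ^ q) * (real H * (r - 1))" using H2 by (intro mult_left_mono) auto
        also have "\<dots> \<le> real n * (r - 1)" using Hq r by (simp flip: mult.assoc add: mult_right_mono)
        finally have "real (H ^ q) \<le> (r - 1) / 2 * real n" by (simp add: field_simps)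
        then show ?thesis using Hp Hq 1 by (intro small) (simp add: distrib_right)
      next
        case 2
        have "H ^ Suc p \<le> H ^ q" using 2 H1 by (intro power_increasing) auto
        moreover have "H ^ p \<le> H ^ q" using 2 H1 by (intro power_increasing) auto
        moreover have "2 * H ^ q \<le> H ^ Suc q" using H1 by simp
        ultimately have "m \<le> n" using p q by linarith
        then have "real m \<le> real n" by simp
        also have "\<dots> \<le> (1 + (r - 1) / 2) * real n" using r by (simp add: distrib_right)
        finally show ?thesis by (rule small)
      next
        case 3
        have "H ^ Suc q \<le> H ^ p" using 3 H1 by (intro power_increasing) auto
        then have "real (H ^ Suc q) \<le> real (H ^ p)" by (rule of_nat_mono)
        moreover have "real (H ^ q) \<le> real (H ^ Suc q)" using H1 by (intro of_nat_mono power_increasing) auto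
        ultimately have "real n \<le> 2 * real (H ^ p)" using Hq(2) by (simp add: mult.commute)
        then have "r * real n \<le> r * (2 * real (H ^ p))" using r by (intro mult_left_mono) auto
        also have "\<dots> = real (H ^ p) * (4 * r) / 2" by simp
        also have "\<dots> \<le> real (H ^ p) * real H / 2" using H4 by (intro divide_right_mono mult_left_mono) auto
        also have "\<dots> \<le> real m / 2" using Hp by simp
        finally show ?thesis by (rule large)
      qed
    qed
  qed
qed

text \<open>Only the ratio \<open>y / x\<close> matters, up to exchanging the roles of
  \<open>m\<close> and \<open>n\<close> when it is between 0 and 1. For a negative ratio the two
  terms add up, and any blocks will do.\<close>

lemma blocks_separate:
  fixes x y :: real assumes xy: "x \<noteq> y" "x \<noteq> 0" "y \<noteq> 0"
  shows "\<exists>H\<ge>2. \<exists>c>0. \<forall>m\<in>insert 0 (blocks H). \<forall>n\<in>insert 0 (blocks H). c * real (max m n) \<le> \<bar>x * real m - y * real n\<bar>"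
proof -
  define r where "r = y / x"
  have eq: "\<bar>x * real m - y * real n\<bar> = \<bar>x\<bar> * \<bar>real m - r * real n\<bar>" for m n
    using xy by (simp add: r_def flip: abs_mult) (simp add: algebra_simps)
  have eq': "\<bar>x * real m - y * real n\<bar> = \<bar>y\<bar> * \<bar>real n - 1 / r * real m\<bar>" for m n
    using xy by (simp add: r_def abs_minus_commute flip: abs_mult) (simp add: algebra_simps)
  have "r \<noteq> 0" "r \<noteq> 1" using xy by (auto simp: r_def)
  then consider "1 < r" | "0 < r" "r < 1" | "r < 0" by linarith
  then show ?thesis
  proof cases
    case 1
    obtain H c where H: "2 \<le> H" "0 < c" "\<forall>m\<in>insert 0 (blocks H). \<forall>n\<in>insert 0 (blocks H). c * real (max m n) \<le> \<bar>real m - r * real n\<bar>"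
      using blocks_ratio[OF 1] by blast
    have "\<forall>m\<in>insert 0 (blocks H). \<forall>n\<in>insert 0 (blocks H). \<bar>x\<bar> * c * real (max m n) \<le> \<bar>x * real m - y * real n\<bar>"
      unfolding eq mult.assoc using H(3) by (intro ballI mult_left_mono) auto
    then show ?thesis using H xy by (intro exI[of _ H] conjI exI[of _ "\<bar>x\<bar> * c"]) auto
  next
    case 2
    then have "1 < 1 / r" by simp
    obtain H c where H: "2 \<le> H" "0 < c" "\<forall>m\<in>insert 0 (blocks H). \<forall>n\<in>insert 0 (blocks H). c * real (max m n) \<le> \<bar>real m - 1 / r * real n\<bar>"
      using blocks_ratio[OF \<open>1 < 1 / r\<close>] by blast
    have "\<bar>y\<bar> * c * real (max m n) \<le> \<bar>x * real m - y * real n\<bar>"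
      if "m \<in> insert 0 (blocks H)" "n \<in> insert 0 (blocks H)" for m n
      unfolding eq' mult.assoc using H(3)[rule_format, OF that(2,1)] by (intro mult_left_mono) (auto simp: max.commute)
    then show ?thesis using H xy by (intro exI[of _ H] conjI exI[of _ "\<bar>y\<bar> * c"]) auto
  next
    case 3
    have "min \<bar>x\<bar> \<bar>y\<bar> * real (max m n) \<le> \<bar>x * real m - y * real n\<bar>" for m n
    proof -
      have "\<bar>x * real m - y * real n\<bar> = \<bar>x\<bar> * (real m - r * real n)"
        unfolding eq using mult_nonpos_nonneg[of r "real n"] 3 by simp
      also have "\<dots> = \<bar>x\<bar> * real m + \<bar>x\<bar> * (- r) * real n" by (simp add: algebra_simps)
      also have "\<bar>x\<bar> * (- r) = \<bar>y\<bar>"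
      proof -
        have "\<bar>x\<bar> * \<bar>r\<bar> = \<bar>y\<bar>" using xy by (simp add: r_def abs_divide)
        then show ?thesis using 3 by simp
      qed
      finally have "\<bar>x * real m - y * real n\<bar> = \<bar>x\<bar> * real m + \<bar>y\<bar> * real n" .
      moreover have "min \<bar>x\<bar> \<bar>y\<bar> * real m \<le> \<bar>x\<bar> * real m" "min \<bar>x\<bar> \<bar>y\<bar> * real n \<le> \<bar>y\<bar> * real n"
        by (intro mult_right_mono; simp)+
      moreover have "0 \<le> \<bar>x\<bar> * real m" "0 \<le> \<bar>y\<bar> * real n" by auto
      ultimately have "min \<bar>x\<bar> \<bar>y\<bar> * real m \<le> \<bar>x * real m - y * real n\<bar>" "min \<bar>x\<bar> \<bar>y\<bar> * real n \<le> \<bar>x * real m - y * real n\<bar>"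
        by linarith+
      then show ?thesis by (simp only: max_def split: if_splits) simp
    qed
    then show ?thesis using xy by (intro exI[of _ 2] conjI exI[of _ "min \<bar>x\<bar> \<bar>y\<bar>"]) auto
  qed
qed

lemma max_archimedean:
  fixes c N0 :: real assumes c: "0 < c"
  shows "\<exists>M. \<forall>m n. M \<le> max m n \<longrightarrow> N0 \<le> c * real (max m n)"
proof -
  obtain M where M: "N0 / c < real M" using reals_Archimedean2 by blast
  show ?thesis
  proof (intro exI[of _ M] allI impI)
    fix m n assume "M \<le> max m n"
    then have "c * real M \<le> c * real (max m n)" using c by (intro mult_left_mono of_nat_mono) auto
    moreover have "N0 < c * real M" using M c by (simp add: divide_less_eq mult.commute)
    ultimately show "N0 \<le> c * real (max m n)" by linarith
  qed
qed

lemma parabolic_parabolic_vanishes: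
  assumes m: "affine_model g \<alpha> 1 b" and b: "Re b = 0" and m': "affine_model g' \<alpha> 1 b'" and b': "Re b' = 0"
    and U: "parabolic_test U" and c: "0 < c"
    and sep: "\<forall>m\<in>insert 0 E. \<forall>n\<in>insert 0 E. c * real (max m n) \<le> \<bar>Im b' * real m - Im b * real n\<bar>"
  shows "vanishes g' E (parabolic_piece \<alpha> (Im b) U)"
proof -
  have \<alpha>: "cmod \<alpha> = 1" and "b \<noteq> 0" using m by (auto simp: affine_model_def)
  then have a: "Im b \<noteq> 0" using b by (auto simp: complex_eq_iff)
  have eq: "parabolic_piece \<alpha> (Im b) U n ((g' ^^ m) z) = U (half_plane \<alpha> z + \<i> * of_real (Im b' * real m - Im b * real n))"
    if "z \<in> unit_disc" for n m z
    by (simp add: parabolic_piece_def parabolic_iterate[OF m' b' that] algebra_simps)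
  obtain K where K: "0 < K" "\<And>(J :: nat set) c N. finite J \<Longrightarrow> 0 < N \<Longrightarrow> (\<forall>n\<in>J. N \<le> \<bar>c - Im b * real n\<bar>) \<Longrightarrow>
     L2_bounded (\<lambda>z. cmod (\<Sum>n\<in>J. U (half_plane \<alpha> z + \<i> * of_real (c - Im b * real n)))) (K * (1 / N + 2 / sqrt N))"
    using parabolic_shift_bound[OF U a \<alpha>] by blast
  show ?thesis
    unfolding vanishes_def
  proof (intro allI impI)
    fix e :: real assume e: "0 < e"
    obtain N0 where N0: "0 < N0" "\<And>N. N0 \<le> N \<Longrightarrow> K * (1 / N + 2 / sqrt N) \<le> e"
      using shift_bound_small[OF e K(1)] by blast
    obtain M where M: "\<And>m n. M \<le> max m n \<Longrightarrow> N0 \<le> c * real (max m n)" using max_archimedean[OF c] by blast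
    show "\<exists>N. \<forall>m\<in>insert 0 E. \<forall>J. finite J \<longrightarrow> J \<subseteq> E \<longrightarrow> (\<forall>n\<in>J. N \<le> max m n) \<longrightarrow>
        L2_bounded (\<lambda>z. cmod (\<Sum>n\<in>J. parabolic_piece \<alpha> (Im b) U n ((g' ^^ m) z))) e"
    proof (intro exI[of _ M] ballI allI impI)
      fix m J assume mE: "m \<in> insert 0 E" and J: "finite J" "J \<subseteq> E" and s: "\<forall>n\<in>J. M \<le> max m n"
      have "\<forall>n\<in>J. N0 \<le> \<bar>Im b' * real m - Im b * real n\<bar>"
      proof
        fix n assume n: "n \<in> J"
        then have "N0 \<le> c * real (max m n)" using s by (intro M) blast
        also have "\<dots> \<le> \<bar>Im b' * real m - Im b * real n\<bar>" using sep mE J n by blast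
        finally show "N0 \<le> \<bar>Im b' * real m - Im b * real n\<bar>" .
      qed
      from L2_bounded_weaken[OF K(2)[OF J(1) N0(1) this] N0(2)[OF order_refl]]
      show "L2_bounded (\<lambda>z. cmod (\<Sum>n\<in>J. parabolic_piece \<alpha> (Im b) U n ((g' ^^ m) z))) e"
        by (rule L2_bounded_cong) (simp add: eq)
    qed
  qed
qed

lemma hyperbolic_hyperbolic_vanishes:
  assumes m: "affine_model g \<alpha> \<mu> b" and \<mu>: "1 < \<mu>" and m': "affine_model g' \<alpha> \<mu>' b'" and \<mu>': "1 < \<mu>'"
    and U: "hyperbolic_test U" and c: "0 < c"
    and sep: "\<forall>m\<in>insert 0 E. \<forall>n\<in>insert 0 E. c * real (max m n) \<le> \<bar>ln \<mu>' * real m - ln \<mu> * real n\<bar>"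
  shows "vanishes g' E (hyperbolic_piece \<alpha> (center \<mu> b) (ln \<mu>) U)"
proof -
  define \<beta> L \<beta>' L' where "\<beta> = center \<mu> b" and "L = ln \<mu>" and "\<beta>' = center \<mu>' b'" and "L' = ln \<mu>'"
  have \<alpha>: "cmod \<alpha> = 1" and "0 \<le> Re b" "0 \<le> Re b'" using m m' by (auto simp: affine_model_def)
  then have \<beta>: "Re \<beta> \<le> 0" "Re \<beta>' \<le> 0" unfolding \<beta>_def \<beta>'_def using \<mu> \<mu>' by (auto intro: Re_center)
  have L: "0 < L" "0 < L'" using \<mu> \<mu>' by (auto simp: L_def L'_def)
  \<comment> \<open>The centre seen from time 0: following the other map up to time \<open>m\<close>
    and contracting back averages the two centres, so that \<gamma> stays bounded with nonpositive
    real part, uniformly in \<open>m\<close>.\<close>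
  define \<gamma> where "\<gamma> m = of_real (1 - exp (- L' * real m)) * \<beta>' + of_real (exp (- L' * real m)) * \<beta>" for m
  have t: "0 \<le> 1 - exp (- L' * real m)" "exp (- L' * real m) \<le> 1" for m using L by auto
  have \<gamma>: "Re (\<gamma> m) \<le> 0" "cmod (\<gamma> m) \<le> cmod \<beta>' + cmod \<beta>" for m
  proof -
    have "(1 - exp (- L' * real m)) * Re \<beta>' \<le> 0" "exp (- L' * real m) * Re \<beta> \<le> 0"
      using \<beta> t[of m] by (auto intro!: mult_nonneg_nonpos)
    then show "Re (\<gamma> m) \<le> 0" by (simp add: \<gamma>_def)
    have "cmod (\<gamma> m) \<le> (1 - exp (- L' * real m)) * cmod \<beta>' + exp (- L' * real m) * cmod \<beta>"
      unfolding \<gamma>_def using t[of m] by (intro order.trans[OF norm_triangle_ineq]) (simp only: norm_mult norm_of_real; simp)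
    also have "\<dots> \<le> 1 * cmod \<beta>' + 1 * cmod \<beta>" using t[of m] by (intro add_mono mult_right_mono) auto
    finally show "cmod (\<gamma> m) \<le> cmod \<beta>' + cmod \<beta>" by simp
  qed
  have eq: "hyperbolic_piece \<alpha> \<beta> L U n ((g' ^^ m) z) = U (of_real (exp (L' * real m - L * real n)) * (half_plane \<alpha> z - \<gamma> m))"
    if "z \<in> unit_disc" for n m z
  proof -
    have e1: "exp (L' * real m - L * real n) = exp (- L * real n) * exp (L' * real m)" by (simp flip: exp_add)
    have "exp (L' * real m) * exp (- L' * real m) = 1" by (simp flip: exp_add)
    then have e2: "of_real (exp (L' * real m)) * of_real (exp (- L' * real m)) = (1 :: complex)" by (simp only: flip: of_real_mult) simp
    have "of_real (exp (L' * real m)) * (half_plane \<alpha> z - \<gamma> m) = \<beta>' + of_real (exp (L' * real m)) * (half_plane \<alpha> z - \<beta>') - \<beta>"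
    proof -
      have "of_real (exp (L' * real m)) * (half_plane \<alpha> z - \<gamma> m) =
        of_real (exp (L' * real m)) * (half_plane \<alpha> z - \<beta>') + (of_real (exp (L' * real m)) * of_real (exp (- L' * real m))) * (\<beta>' - \<beta>)"
        by (simp only: \<gamma>_def of_real_diff of_real_1) (simp only: algebra_simps mult_1)
      then show ?thesis unfolding e2 by simp
    qed
    then show ?thesis
      unfolding hyperbolic_piece_def hyperbolic_iterate[OF m' \<mu>' that] \<beta>'_def[symmetric] L'_def[symmetric] e1 of_real_mult mult.assoc by simp
  qed
  have hol: "(\<lambda>z. U (of_real (exp x) * (half_plane \<alpha> z - \<gamma> m))) holomorphic_on unit_disc" for x m
    using U Re_dilation_pos[OF \<alpha> \<gamma>(1)[of m]]
    by (intro holomorphic_half_plane_compose[of U] holomorphic_intros holomorphic_half_plane \<alpha>) (auto simp: hyperbolic_test_def simp del: times_complex.sel)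
  obtain K where K: "0 < K" "\<And>(J :: nat set) c N \<gamma>. finite J \<Longrightarrow> Re \<gamma> \<le> 0 \<Longrightarrow> cmod \<gamma> \<le> cmod \<beta>' + cmod \<beta> \<Longrightarrow> (\<forall>n\<in>J. N \<le> \<bar>c - L * real n\<bar>) \<Longrightarrow>
     L2_bounded (\<lambda>z. \<Sum>n\<in>J. cmod (U (of_real (exp (c - L * real n)) * (half_plane \<alpha> z - \<gamma>)))) (K * exp (- N / 4))"
    using hyperbolic_shift_bound[OF U _ \<alpha>, of L "cmod \<beta>' + cmod \<beta>"] L by auto
  have "vanishes g' E (hyperbolic_piece \<alpha> \<beta> L U)"
    unfolding vanishes_def
  proof (intro allI impI)
    fix e :: real assume e: "0 < e"
    obtain N0 where N0: "\<And>N. N0 \<le> N \<Longrightarrow> K * exp (- N / 4) \<le> e"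
      using exp_bound_small[OF e K(1)] by blast
    obtain M where M: "\<And>m n. M \<le> max m n \<Longrightarrow> N0 \<le> c * real (max m n)" using max_archimedean[OF c] by blast
    show "\<exists>N. \<forall>m\<in>insert 0 E. \<forall>J. finite J \<longrightarrow> J \<subseteq> E \<longrightarrow> (\<forall>n\<in>J. N \<le> max m n) \<longrightarrow>
        L2_bounded (\<lambda>z. cmod (\<Sum>n\<in>J. hyperbolic_piece \<alpha> \<beta> L U n ((g' ^^ m) z))) e"
    proof (intro exI[of _ M] ballI allI impI)
      fix m J assume mE: "m \<in> insert 0 E" and J: "finite J" "J \<subseteq> E" and s: "\<forall>n\<in>J. M \<le> max m n"
      have "\<forall>n\<in>J. N0 \<le> \<bar>L' * real m - L * real n\<bar>"
      proof
        fix n assume n: "n \<in> J"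
        then have "N0 \<le> c * real (max m n)" using s by (intro M) blast
        also have "\<dots> \<le> \<bar>L' * real m - L * real n\<bar>" unfolding L_def L'_def using sep mE J n by blast
        finally show "N0 \<le> \<bar>L' * real m - L * real n\<bar>" .
      qed
      from L2_bounded_sum_cmod[OF K(2)[OF J(1) \<gamma>(1) \<gamma>(2) this] hol N0[OF order_refl]]
      show "L2_bounded (\<lambda>z. cmod (\<Sum>n\<in>J. hyperbolic_piece \<alpha> \<beta> L U n ((g' ^^ m) z))) e"
        by (rule L2_bounded_cong) (simp add: eq)
    qed
  qed
  then show ?thesis by (simp add: \<beta>_def L_def)
qed

section \<open>Distinct attractive fixed points and maps of the same type\<close>

text \<open>Late sums are small except where the half-plane coordinate is of size at least about
  \<open>1 / \<delta>\<close>, that is, near \<alpha>; there the kernel is of order 1 and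
  \<open>K\<close> bounds the sum.\<close>

definition tame :: "complex \<Rightarrow> (nat \<Rightarrow> complex \<Rightarrow> complex) \<Rightarrow> bool" where
  "tame \<alpha> y \<longleftrightarrow> (\<exists>K>0. (\<forall>J z. finite J \<longrightarrow> z \<in> unit_disc \<longrightarrow> cmod (\<Sum>n\<in>J. y n z) \<le> K) \<and>
     (\<forall>\<delta>>0. \<exists>N. \<forall>J z. finite J \<longrightarrow> (\<forall>n\<in>J. N \<le> n) \<longrightarrow> z \<in> unit_disc \<longrightarrow>
        cmod (\<Sum>n\<in>J. y n z) \<le> \<delta> + K * cmod ((half_plane \<alpha> z + 1) / (half_plane \<alpha> z + 1 + of_real (1 / \<delta>)))))"

text \<open>The free bound \<open>M\<close> of \<open>parabolic_test_sum\<close> is 1 for the crude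
  estimate, and the majorant of \<open>shifted_kernel\<close> for late times.\<close>

lemma parabolic_tame:
  assumes U: "parabolic_test U" and a: "a \<noteq> 0" and \<alpha>: "cmod \<alpha> = 1"
  shows "tame \<alpha> (parabolic_piece \<alpha> a U)"
proof -
  obtain K where K: "0 < K" "\<And>(J :: nat set) c w M. finite J \<Longrightarrow> 0 < Re w \<Longrightarrow> 0 \<le> M \<Longrightarrow> (\<forall>n\<in>J. 1 / cmod (w + 1 + \<i> * of_real (c - a * real n)) \<le> M) \<Longrightarrow>
     (\<Sum>n\<in>J. cmod (U (w + \<i> * of_real (c - a * real n)))) \<le> K * M"
    using parabolic_test_sum[OF U a] by blast
  have sum: "cmod (\<Sum>n\<in>J. parabolic_piece \<alpha> a U n z) \<le> K * M"
    if "finite J" "z \<in> unit_disc" "0 \<le> M" "\<forall>n\<in>J. 1 / cmod (half_plane \<alpha> z + 1 + \<i> * of_real (0 - a * real n)) \<le> M" for J z M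
    unfolding parabolic_piece_def
    using K(2)[OF that(1) Re_half_plane_pos[OF \<alpha> that(2)] that(3,4)] by (rule order.trans[OF norm_sum])
  show ?thesis
    unfolding tame_def
  proof (intro exI[of _ "2 * K"] conjI allI impI)
    show "0 < 2 * K" using K by simp
    fix J :: "nat set" and z assume J: "finite J" and z: "z \<in> unit_disc"
    have "cmod (\<Sum>n\<in>J. parabolic_piece \<alpha> a U n z) \<le> K * 1"
    proof (rule sum[OF J z])
      have "1 \<le> cmod (half_plane \<alpha> z + 1 + \<i> * of_real (0 - a * real n))" for n
        using complex_Re_le_cmod[of "half_plane \<alpha> z + 1 + \<i> * of_real (0 - a * real n)"] Re_half_plane_pos[OF \<alpha> z] by simp
      then show "\<forall>n\<in>J. 1 / cmod (half_plane \<alpha> z + 1 + \<i> * of_real (0 - a * real n)) \<le> 1"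
        by (metis divide_le_eq_1_pos less_le_trans zero_less_one)
    qed simp
    then show "cmod (\<Sum>n\<in>J. parabolic_piece \<alpha> a U n z) \<le> 2 * K" using K by simp
  next
    fix \<delta> :: real assume \<delta>: "0 < \<delta>"
    define N' where "N' = max (1 / \<delta>) (K / \<delta>)"
    have N': "0 < N'" "1 / \<delta> \<le> N'" "K / \<delta> \<le> N'" using \<delta> by (auto simp: N'_def less_max_iff_disj)
    obtain M where M: "N' / \<bar>a\<bar> < real M" using reals_Archimedean2 by blast
    then have MN: "N' \<le> \<bar>a\<bar> * real M" using a by (simp add: divide_less_eq mult.commute)
    show "\<exists>N. \<forall>J z. finite J \<longrightarrow> (\<forall>n\<in>J. N \<le> n) \<longrightarrow> z \<in> unit_disc \<longrightarrow>
        cmod (\<Sum>n\<in>J. parabolic_piece \<alpha> a U n z) \<le> \<delta> + 2 * K * cmod ((half_plane \<alpha> z + 1) / (half_plane \<alpha> z + 1 + of_real (1 / \<delta>)))"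
    proof (intro exI[of _ M] allI impI)
      fix J z assume J: "finite J" and n: "\<forall>n\<in>J. M \<le> n" and z: "z \<in> unit_disc"
      let ?w = "half_plane \<alpha> z"
      have w: "0 < Re ?w" using Re_half_plane_pos[OF \<alpha> z] .
      have "cmod (\<Sum>n\<in>J. parabolic_piece \<alpha> a U n z) \<le> K * (1 / N' + 2 * cmod ((?w + 1) / (?w + 1 + of_real N')))"
      proof (rule sum[OF J z])
        show "\<forall>n\<in>J. 1 / cmod (?w + 1 + \<i> * of_real (0 - a * real n)) \<le> 1 / N' + 2 * cmod ((?w + 1) / (?w + 1 + of_real N'))"
        proof
          fix n assume "n \<in> J"
          then have "\<bar>a\<bar> * real M \<le> \<bar>a\<bar> * real n" using n by (intro mult_left_mono) auto
          then have "N' \<le> \<bar>0 - a * real n\<bar>" using MN by (simp add: abs_mult)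
          then show "1 / cmod (?w + 1 + \<i> * of_real (0 - a * real n)) \<le> 1 / N' + 2 * cmod ((?w + 1) / (?w + 1 + of_real N'))"
            by (rule shifted_kernel[OF w N'(1)])
        qed
      qed (use N' in \<open>auto intro!: add_nonneg_nonneg\<close>)
      also have "\<dots> = K / N' + 2 * K * cmod ((?w + 1) / (?w + 1 + of_real N'))" by (simp add: distrib_left)
      also have "\<dots> \<le> \<delta> + 2 * K * cmod ((?w + 1) / (?w + 1 + of_real (1 / \<delta>)))"
      proof (intro add_mono mult_left_mono)
        show "K / N' \<le> \<delta>" using N' \<delta> by (simp add: divide_le_eq mult.commute)
        show "cmod ((?w + 1) / (?w + 1 + of_real N')) \<le> cmod ((?w + 1) / (?w + 1 + of_real (1 / \<delta>)))"
          using w \<delta> N' by (intro kernel_antimono) auto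
      qed (use K in auto)
      finally show "cmod (\<Sum>n\<in>J. parabolic_piece \<alpha> a U n z) \<le> \<delta> + 2 * K * cmod ((?w + 1) / (?w + 1 + of_real (1 / \<delta>)))" .
    qed
  qed
qed

text \<open>With \<open>R = 1 / \<delta>\<close>: where \<open>cmod (w - \<beta>) \<le> R\<close>
  the late dilates are close to the zero of \<open>U\<close>, elsewhere the kernel is at least
  \<open>1 / (1 + c0)\<close>.\<close>

lemma hyperbolic_tame:
  assumes U: "hyperbolic_test U" and L: "0 < L" and \<alpha>: "cmod \<alpha> = 1" and \<beta>: "Re \<beta> \<le> 0"
  shows "tame \<alpha> (hyperbolic_piece \<alpha> \<beta> L U)"
proof -
  obtain K where K: "0 < K" "\<And>(J :: nat set) v. finite J \<Longrightarrow> 0 < Re v \<Longrightarrow> (\<Sum>n\<in>J. cmod (U (of_real (exp (- L * real n)) * v))) \<le> K"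
    using hyperbolic_test_sum[OF U L] by blast
  obtain C where C: "0 \<le> C" "\<And>w. 0 < Re w \<Longrightarrow> cmod (U w) \<le> C * cmod w / (cmod (w + 1))\<^sup>2"
    using U by (auto simp: hyperbolic_test_def)
  obtain K2 where K2: "0 < K2" "\<And>(J :: nat set) t. finite J \<Longrightarrow> (\<Sum>n\<in>J. exp (- (1 / 2) * \<bar>t - L * real n\<bar>)) \<le> K2"
    using exp_sum_bound[of L "1 / 2"] L by auto
  define c0 where "c0 = 1 + cmod (1 + \<beta>)"
  have c0: "1 \<le> c0" by (simp add: c0_def)
  have v: "0 < Re (half_plane \<alpha> z - \<beta>)" if "z \<in> unit_disc" for z
    using Re_half_plane_pos[OF \<alpha> that] \<beta> by simp
  have sum: "cmod (\<Sum>n\<in>J. hyperbolic_piece \<alpha> \<beta> L U n z) \<le> K" if "finite J" "z \<in> unit_disc" for J z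
    unfolding hyperbolic_piece_def using K(2)[OF that(1) v[OF that(2)]] by (rule order.trans[OF norm_sum])
  have KK: "K \<le> K * (1 + c0)" using K c0 by simp
  show ?thesis
    unfolding tame_def
  proof (intro exI[of _ "K * (1 + c0)"] conjI allI impI)
    show "0 < K * (1 + c0)" using K c0 by simp
    show "cmod (\<Sum>n\<in>J. hyperbolic_piece \<alpha> \<beta> L U n z) \<le> K * (1 + c0)" if "finite J" "z \<in> unit_disc" for J z
      using sum[OF that] KK by linarith
    fix \<delta> :: real assume \<delta>: "0 < \<delta>"
    define R where "R = 1 / \<delta>"
    have R: "0 < R" using \<delta> by (simp add: R_def)
    have "filterlim (\<lambda>n. (exp (L / 2)) ^ n) at_top sequentially" using L by (intro filterlim_power_at_top) simp
    then have "eventually (\<lambda>n. C * R * K2 / \<delta> \<le> exp (L / 2) ^ n) sequentially" by (simp add: filterlim_at_top)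
    then obtain N where "C * R * K2 / \<delta> \<le> exp (L / 2) ^ N" by (auto simp: eventually_at_top_linorder)
    then have "C * R * K2 / \<delta> \<le> exp (real N * (L / 2))" by (simp only: exp_of_nat_mult)
    then have "C * R * K2 * exp (- (real N * (L / 2))) \<le> \<delta>"
      using \<delta> by (simp add: exp_minus field_simps)
    then have N: "C * R * K2 * exp (- L * real N / 2) \<le> \<delta>" by (simp add: mult.commute)
    show "\<exists>N. \<forall>J z. finite J \<longrightarrow> (\<forall>n\<in>J. N \<le> n) \<longrightarrow> z \<in> unit_disc \<longrightarrow>
        cmod (\<Sum>n\<in>J. hyperbolic_piece \<alpha> \<beta> L U n z) \<le> \<delta> + K * (1 + c0) * cmod ((half_plane \<alpha> z + 1) / (half_plane \<alpha> z + 1 + of_real (1 / \<delta>)))"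
    proof (intro exI[of _ N] allI impI)
      fix J z assume J: "finite J" and n: "\<forall>n\<in>J. N \<le> n" and z: "z \<in> unit_disc"
      let ?w = "half_plane \<alpha> z"
      let ?g = "cmod ((?w + 1) / (?w + 1 + of_real (1 / \<delta>)))"
      have w: "0 < Re ?w" using Re_half_plane_pos[OF \<alpha> z] .
      have w1: "1 \<le> cmod (?w + 1)" using w by (intro cmod_plus_one_ge) simp
      show "cmod (\<Sum>n\<in>J. hyperbolic_piece \<alpha> \<beta> L U n z) \<le> \<delta> + K * (1 + c0) * ?g"
      proof (cases "cmod (?w - \<beta>) \<le> R")
        case True
        have "cmod (hyperbolic_piece \<alpha> \<beta> L U n z) \<le> C * R * exp (- L * real N / 2) * exp (- (1 / 2) * \<bar>0 - L * real n\<bar>)" if "n \<in> J" for n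
        proof -
          let ?u = "of_real (exp (- L * real n)) * (?w - \<beta>)"
          have u: "0 < Re ?u" using v[OF z] by simp
          have u1: "1 \<le> cmod (?u + 1)" using u by (intro cmod_plus_one_ge) simp
          have "cmod (U ?u) \<le> C * (cmod ?u / cmod (?u + 1))" by (rule hyperbolic_test_bounds(2)[OF C(2)[OF u] C(1) u])
          also have "\<dots> \<le> C * (cmod ?u / 1)" using u1 C by (intro mult_left_mono divide_left_mono) auto
          also have "\<dots> = C * (exp (- L * real n) * cmod (?w - \<beta>))" by (simp only: norm_mult norm_of_real) simp
          also have "\<dots> \<le> C * (exp (- L * real n) * R)" using True C by (intro mult_left_mono) auto
          also have "exp (- L * real n) \<le> exp (- L * real N / 2) * exp (- (1 / 2) * \<bar>0 - L * real n\<bar>)"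
          proof -
            have "L * real N \<le> L * real n" using n that L by (intro mult_left_mono) auto
            moreover have "\<bar>0 - L * real n\<bar> = L * real n" using L by simp
            ultimately show ?thesis unfolding mult_exp_exp exp_le_cancel_iff by (simp add: algebra_simps)
          qed
          finally show ?thesis using C R by (simp add: hyperbolic_piece_def mult_left_mono mult_right_mono mult_ac)
        qed
        then have "cmod (\<Sum>n\<in>J. hyperbolic_piece \<alpha> \<beta> L U n z) \<le> (\<Sum>n\<in>J. C * R * exp (- L * real N / 2) * exp (- (1 / 2) * \<bar>0 - L * real n\<bar>))"
          by (rule sum_norm_le)
        also have "\<dots> = C * R * exp (- L * real N / 2) * (\<Sum>n\<in>J. exp (- (1 / 2) * \<bar>0 - L * real n\<bar>))" by (rule sum_distrib_left[symmetric])
        also have "\<dots> \<le> C * R * exp (- L * real N / 2) * K2" using C R by (intro mult_left_mono K2(2)[OF J] mult_nonneg_nonneg) auto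
        also have "\<dots> \<le> \<delta>" using N by (simp add: mult_ac)
        finally show ?thesis using K c0 by (intro add_increasing2) auto
      next
        case False
        have "cmod (?w - \<beta>) \<le> cmod (?w + 1) + cmod (1 + \<beta>)" using norm_triangle_ineq4[of "?w + 1" "1 + \<beta>"] by simp
        also have "\<dots> \<le> cmod (?w + 1) + cmod (1 + \<beta>) * cmod (?w + 1)"
          using mult_left_mono[OF w1, of "cmod (1 + \<beta>)"] by simp
        finally have Rw: "R \<le> c0 * cmod (?w + 1)" using False by (simp add: c0_def distrib_right)
        have "cmod (?w + 1 + of_real R) \<le> cmod (?w + 1) + R" using norm_triangle_ineq[of "?w + 1" "of_real R"] R by simp
        also have "\<dots> \<le> (1 + c0) * cmod (?w + 1)" using Rw by (simp add: distrib_right)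
        finally have "cmod (?w + 1 + of_real R) \<le> (1 + c0) * cmod (?w + 1)" .
        moreover have "0 < cmod (?w + 1 + of_real R)" using w R by (intro cmod_pos_of_Re_pos) simp
        ultimately have "1 \<le> (1 + c0) * ?g" unfolding norm_divide R_def by simp
        then have "K * 1 \<le> K * ((1 + c0) * ?g)" using K by (intro mult_left_mono) auto
        then show ?thesis using sum[OF J z] \<delta> by (simp add: mult.assoc)
      qed
    qed
  qed
qed

text \<open>The factor vanishing at \<open>\<alpha>'\<close> compensates the growth of the norm of \<open>C\<^sub>g\<close>, so that the bound does not depend on \<open>m\<close>.\<close>

lemma kernel_at_other_point:
  assumes m: "affine_model g \<alpha>' \<mu> b" and \<alpha>: "cmod \<alpha> = 1" and Y: "0 < Y"
  shows "L2_bounded (\<lambda>z. cmod (((g ^^ m) z - \<alpha>') * ((half_plane \<alpha> ((g ^^ m) z) + 1) / (half_plane \<alpha> ((g ^^ m) z) + 1 + of_real Y)))) (2 / sqrt Y)"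
proof -
  have \<alpha>': "cmod \<alpha>' = 1" "1 \<le> \<mu>" "0 \<le> Re b" using m by (auto simp: affine_model_def)
  \<comment> \<open>In the disc variable the pole of the kernel is at
    \<open>\<rho> * \<alpha>\<close>, outside the closed disc; \<open>d\<close> is its difference
    from \<open>\<alpha>'\<close>.\<close>
  define \<rho> where "\<rho> = 1 + 2 / Y"
  have \<rho>: "1 < \<rho>" using Y by (simp add: \<rho>_def)
  have \<rho>2: "4 / Y \<le> \<rho>\<^sup>2 - 1" using Y by (simp add: \<rho>_def power2_eq_square algebra_simps)
  define d where "d = of_real \<rho> * \<alpha> - \<alpha>'"
  have nr: "cmod (of_real \<rho> * \<alpha>) = \<rho>" using \<alpha> \<rho> by (simp add: norm_mult)
  then have d0: "d \<noteq> 0" using \<alpha>'(1) \<rho> by (auto simp: d_def)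
  \<comment> \<open>The point \<open>- p\<close> is the image of \<open>\<rho> * \<alpha>\<close>
    under \<open>half_plane \<alpha>'\<close>, so in that coordinate the product becomes a multiple
    of \<open>1 / (W + p)\<close>.\<close>
  define p where "p = (of_real \<rho> * \<alpha> + \<alpha>') / d"
  have rep: "Re p = (\<rho>\<^sup>2 - 1) / (cmod d)\<^sup>2"
  proof -
    have "(cmod (of_real \<rho> * \<alpha>))\<^sup>2 - (cmod \<alpha>')\<^sup>2 = \<rho>\<^sup>2 - 1" unfolding nr using \<alpha>' by simp
    then show ?thesis
      unfolding p_def Re_divide d_def cmod_power2 by (simp add: power2_eq_square algebra_simps)
  qed
  moreover have "0 < \<rho>\<^sup>2 - 1" using \<rho>2 Y by (intro less_le_trans[OF _ \<rho>2]) simp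
  ultimately have p: "0 < Re p" using d0 by simp
  define M B where "M = \<mu> ^ m" and "B = of_real (\<Sum>i<m. \<mu> ^ i) * b"
  have M: "1 \<le> M" using \<alpha>' by (simp add: M_def one_le_power)
  have B: "0 \<le> Re B" using \<alpha>' by (simp add: B_def sum_nonneg)
  define s where "s = (B + p) / of_real M"
  have res: "Re s = (Re B + Re p) / M" unfolding s_def Re_divide_of_real by simp
  then have s: "0 < Re s" using M B p by simp
  have "L2_bounded (\<lambda>z. 4 / (Y * cmod d * M) * cmod (1 / (half_plane \<alpha>' z + s))) (4 / (Y * cmod d * M) * (1 / sqrt (Re s)))"
    using Y M by (intro L2_bounded_cmult L2_bounded_inverse \<alpha>' s) auto
  moreover have "4 / (Y * cmod d * M) * (1 / sqrt (Re s)) \<le> 2 / sqrt Y"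
  proof -
    have "2 / (sqrt Y * cmod d) \<le> sqrt (Re p)"
    proof (rule real_le_rsqrt)
      have "(2 / (sqrt Y * cmod d))\<^sup>2 = 4 / Y / (cmod d)\<^sup>2" using Y by (simp add: power_divide power_mult_distrib)
      also have "\<dots> \<le> Re p" unfolding rep using \<rho>2 by (intro divide_right_mono) auto
      finally show "(2 / (sqrt Y * cmod d))\<^sup>2 \<le> Re p" .
    qed
    also have "\<dots> \<le> M * sqrt (Re s)"
    proof (rule real_le_lsqrt)
      have "Re p \<le> Re B + Re p" using B by simp
      also have "\<dots> \<le> M * (Re B + Re p)" using M B p by simp
      also have "M * (Re B + Re p) = M\<^sup>2 * Re s" unfolding res using M by (simp add: power2_eq_square)
      also have "\<dots> = (M * sqrt (Re s))\<^sup>2" using s by (simp add: power_mult_distrib)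
      finally show "Re p \<le> (M * sqrt (Re s))\<^sup>2" .
    qed (use M s in auto)
    finally have le: "2 / (sqrt Y * cmod d) \<le> M * sqrt (Re s)" .
    have "4 / (Y * cmod d * M) * (1 / sqrt (Re s)) = 4 / (Y * cmod d) / (M * sqrt (Re s))" by simp
    also have "\<dots> \<le> 4 / (Y * cmod d) / (2 / (sqrt Y * cmod d))"
      using le Y d0 M s by (intro divide_left_mono mult_pos_pos divide_pos_pos) auto
    also have "\<dots> = 2 * (sqrt Y / Y)" using Y d0 by simp
    also have "sqrt Y / Y = 1 / sqrt Y" using Y by (simp add: real_div_sqrt divide_eq_eq field_simps)
    finally show ?thesis by simp
  qed
  ultimately have "L2_bounded (\<lambda>z. 4 / (Y * cmod d * M) * cmod (1 / (half_plane \<alpha>' z + s))) (2 / sqrt Y)" by (rule L2_bounded_weaken)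
  then show ?thesis
  proof (rule L2_bounded_cong)
    fix z assume z: "z \<in> unit_disc"
    define \<zeta> W where "\<zeta> = (g ^^ m) z" and "W = half_plane \<alpha>' \<zeta>"
    have \<zeta>: "\<zeta> \<in> unit_disc" unfolding \<zeta>_def by (rule affine_model_iterate(1)[OF m z])
    have W: "W = of_real M * half_plane \<alpha>' z + B" unfolding W_def \<zeta>_def affine_model_iterate(2)[OF m z] by (simp add: M_def B_def)
    have W0: "0 < Re W" unfolding W_def by (rule Re_half_plane_pos[OF \<alpha>'(1) \<zeta>])
    have M0: "of_real M \<noteq> (0 :: complex)" using M by simp
    have Ws: "W + p = of_real M * (half_plane \<alpha>' z + s)" proof -
      have "of_real M * s = B + p" unfolding s_def times_divide_eq_right using M0 by (rule nonzero_mult_div_cancel_left)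
      then show ?thesis unfolding W by (simp add: distrib_left)
    qed
    have Wp: "W + p \<noteq> 0" using W0 p by (auto simp: complex_eq_iff)
    have W1: "W + 1 \<noteq> 0" using W0 by (auto simp: complex_eq_iff)
    have a1: "\<alpha> - \<zeta> \<noteq> 0" "\<alpha>' - \<zeta> \<noteq> 0" using unit_disc_neq \<alpha> \<alpha>' \<zeta> by blast+
    have \<zeta>W: "\<zeta> = \<alpha>' * (W - 1) / (W + 1)"
      using poly_disc_point_half_plane[OF \<alpha>'(1) \<zeta>] by (simp add: W_def disc_point_def)
    have r1: "\<zeta> - \<alpha>' = - 2 * \<alpha>' / (W + 1)" unfolding \<zeta>W using W1 by (simp add: field_simps)
    have r2: "of_real \<rho> * \<alpha> - \<zeta> = d * (W + p) / (W + 1)"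
    proof -
      have "d * p = of_real \<rho> * \<alpha> + \<alpha>'" unfolding p_def times_divide_eq_right using d0 by (rule nonzero_mult_div_cancel_left)
      then have "d * (W + p) = d * W + (of_real \<rho> * \<alpha> + \<alpha>')" by (simp add: distrib_left)
      also have "\<dots> = of_real \<rho> * \<alpha> * (W + 1) - \<alpha>' * (W - 1)" by (simp add: d_def algebra_simps)
      finally show ?thesis unfolding \<zeta>W using W1 by (simp add: field_simps)
    qed
    have r0: "of_real \<rho> * \<alpha> - \<zeta> \<noteq> 0" unfolding r2 using d0 Wp W1 by simp
    have Y0: "of_real Y \<noteq> (0 :: complex)" using Y by simp
    have "half_plane \<alpha> \<zeta> + 1 + of_real Y = of_real Y * (of_real \<rho> * \<alpha> - \<zeta>) / (\<alpha> - \<zeta>)"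
      unfolding half_plane_plus_one[OF a1(1)] using a1 Y0 by (simp add: \<rho>_def field_simps)
    then have "(half_plane \<alpha> \<zeta> + 1) / (half_plane \<alpha> \<zeta> + 1 + of_real Y) = 2 * \<alpha> / (of_real Y * (of_real \<rho> * \<alpha> - \<zeta>))"
      unfolding half_plane_plus_one[OF a1(1)] using a1 by simp
    then have "(\<zeta> - \<alpha>') * ((half_plane \<alpha> \<zeta> + 1) / (half_plane \<alpha> \<zeta> + 1 + of_real Y)) = - 4 * \<alpha>' * \<alpha> / (of_real Y * d * (W + p))"
      unfolding r1 r2 using W1 by (simp, simp only: mult.assoc)
    then show "cmod (((g ^^ m) z - \<alpha>') * ((half_plane \<alpha> ((g ^^ m) z) + 1) / (half_plane \<alpha> ((g ^^ m) z) + 1 + of_real Y))) =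
       4 / (Y * cmod d * M) * cmod (1 / (half_plane \<alpha>' z + s))"
      unfolding \<zeta>_def[symmetric] Ws using \<alpha> \<alpha>' Y M by (simp add: norm_divide norm_mult)
  qed
qed

text \<open>In the half-plane the distance is \<open>2 / \<mu> ^ m\<close> times the modulus of
  \<open>1 / (w + p m)\<close>. For \<mu> above 1 the prefactor beats the norm, which grows at most
  like the square root of \<open>\<mu> ^ m\<close>; for \<mu> equal to 1 the point
  \<open>p m\<close> tends to infinity, possibly in an imaginary direction.\<close>

lemma distance_to_attractor_small:
  assumes m: "affine_model g \<alpha> \<mu> b" and e: "0 < e"
  shows "\<exists>N. \<forall>m\<ge>N. L2_bounded (\<lambda>z. cmod ((g ^^ m) z - \<alpha>)) e"
proof -
  have \<alpha>: "cmod \<alpha> = 1" and \<mu>: "1 \<le> \<mu>" and b: "0 \<le> Re b" "\<mu> = 1 \<Longrightarrow> b \<noteq> 0" using m by (auto simp: affine_model_def)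
  define S where "S m = (\<Sum>i<m. \<mu> ^ i)" for m
  have S: "0 \<le> S m" for m using \<mu> by (simp add: S_def sum_nonneg)
  define p where "p m = (of_real (S m) * b + 1) / of_real (\<mu> ^ m)" for m
  have Mpos: "0 < \<mu> ^ m" for m using \<mu> by simp
  have rep: "Re (p m) = (S m * Re b + 1) / \<mu> ^ m" for m unfolding p_def Re_divide_of_real by simp
  have p: "0 < Re (p m)" "1 / \<mu> ^ m \<le> Re (p m)" for m
    unfolding rep using S[of m] b Mpos[of m] by (auto intro!: divide_pos_pos divide_right_mono add_nonneg_pos)
  have eq: "cmod ((g ^^ m) z - \<alpha>) = 2 / \<mu> ^ m * cmod (1 / (half_plane \<alpha> z + p m))" if z: "z \<in> unit_disc" for m z
  proof -
    have ne: "\<alpha> - (g ^^ m) z \<noteq> 0" by (rule unit_disc_neq[OF \<alpha> affine_model_iterate(1)[OF m z]])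
    have "of_real (\<mu> ^ m) \<noteq> (0 :: complex)" using Mpos[of m] by (simp only: of_real_eq_0_iff)
    then have "of_real (\<mu> ^ m) * p m = of_real (S m) * b + 1" by (simp add: p_def del: of_real_power)
    then have "half_plane \<alpha> ((g ^^ m) z) + 1 = of_real (\<mu> ^ m) * (half_plane \<alpha> z + p m)"
      unfolding affine_model_iterate(2)[OF m z] S_def[symmetric] distrib_left by simp
    then have "2 * \<alpha> / (\<alpha> - (g ^^ m) z) = of_real (\<mu> ^ m) * (half_plane \<alpha> z + p m)" unfolding half_plane_plus_one[OF ne] .
    then have "cmod (2 * \<alpha> / (\<alpha> - (g ^^ m) z)) = \<mu> ^ m * cmod (half_plane \<alpha> z + p m)"
      using Mpos[of m] by (simp only: norm_mult norm_of_real abs_of_pos)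
    then have "2 / cmod ((g ^^ m) z - \<alpha>) = \<mu> ^ m * cmod (half_plane \<alpha> z + p m)"
      using \<alpha> by (simp add: norm_divide norm_mult norm_minus_commute)
    then have "2 / (2 / cmod ((g ^^ m) z - \<alpha>)) = 2 / (\<mu> ^ m * cmod (half_plane \<alpha> z + p m))" by simp
    then show ?thesis using ne by (simp add: norm_divide)
  qed
  show ?thesis
  proof (cases "\<mu> = 1")
    case True
    have b0: "0 < cmod b" using b True by simp
    obtain N where N: "(4 / e + 1) / cmod b < real N" using reals_Archimedean2 by blast
    show ?thesis
    proof (intro exI[of _ N] allI impI)
      fix m assume "N \<le> m"
      then have "(4 / e + 1) / cmod b < real m" using N by simp
      then have "4 / e + 1 < real m * cmod b" using b0 by (simp add: divide_less_eq)
      moreover have "p m = of_nat m * b + 1" using True by (simp add: p_def S_def)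
      moreover have "real m * cmod b - 1 \<le> cmod (of_nat m * b + 1)" using norm_diff_ineq[of "of_nat m * b" 1] by (simp add: norm_mult)
      ultimately have pm: "4 / e < cmod (p m)" by simp
      have "0 < 4 / e" using e by simp
      then have p0: "0 < cmod (p m)" using pm by linarith
      have "1 \<le> Re (p m)" using p(2)[of m] True by simp
      then have "1 / sqrt (Re (p m)) \<le> 1" by simp
      then have "2 / \<mu> ^ m * ((1 + 1 / sqrt (Re (p m))) / cmod (p m)) \<le> 2 * (2 / cmod (p m))"
        using True p0 by (simp add: divide_right_mono)
      also have "\<dots> \<le> e" using pm p0 e by (simp add: field_simps)
      finally have le: "2 / \<mu> ^ m * ((1 + 1 / sqrt (Re (p m))) / cmod (p m)) \<le> e" .
      have "L2_bounded (\<lambda>z. 2 / \<mu> ^ m * cmod (1 / (half_plane \<alpha> z + p m))) (2 / \<mu> ^ m * ((1 + 1 / sqrt (Re (p m))) / cmod (p m)))"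
        using Mpos[of m] by (intro L2_bounded_cmult L2_bounded_inverse_far \<alpha> p) auto
      from L2_bounded_weaken[OF this le] show "L2_bounded (\<lambda>z. cmod ((g ^^ m) z - \<alpha>)) e"
        by (rule L2_bounded_cong) (rule eq)
    qed
  next
    case False
    then have "1 < \<mu>" using \<mu> by simp
    then obtain N where N: "4 / e\<^sup>2 < \<mu> ^ N" using real_arch_pow by blast
    show ?thesis
    proof (intro exI[of _ N] allI impI)
      fix m assume "N \<le> m"
      then have "\<mu> ^ N \<le> \<mu> ^ m" using \<mu> by (intro power_increasing) auto
      then have M: "4 / e\<^sup>2 \<le> \<mu> ^ m" using N by simp
      have "1 / sqrt (Re (p m)) \<le> 1 / sqrt (1 / \<mu> ^ m)" using p[of m] Mpos[of m] by (intro divide_left_mono mult_pos_pos) auto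
      then have "2 / \<mu> ^ m * (1 / sqrt (Re (p m))) \<le> 2 / \<mu> ^ m * sqrt (\<mu> ^ m)"
        using Mpos[of m] by (intro mult_left_mono) (auto simp: real_sqrt_divide)
      also have "\<dots> = 2 * (sqrt (\<mu> ^ m) / \<mu> ^ m)" by simp
      also have "sqrt (\<mu> ^ m) / \<mu> ^ m = 1 / sqrt (\<mu> ^ m)" using sqrt_divide_self_eq[OF less_imp_le[OF Mpos]] by (simp add: inverse_eq_divide)
      also have "2 * (1 / sqrt (\<mu> ^ m)) \<le> e"
      proof -
        have "2 / e \<le> sqrt (\<mu> ^ m)" using M by (intro real_le_rsqrt) (simp add: power_divide)
        then have "2 \<le> e * sqrt (\<mu> ^ m)" using e by (simp add: divide_le_eq mult.commute)
        moreover have "0 < sqrt (\<mu> ^ m)" using Mpos[of m] by simp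
        ultimately show ?thesis by (simp only: mult_1_right times_divide_eq_right pos_divide_le_eq)
      qed
      finally have le: "2 / \<mu> ^ m * (1 / sqrt (Re (p m))) \<le> e" .
      have "L2_bounded (\<lambda>z. 2 / \<mu> ^ m * cmod (1 / (half_plane \<alpha> z + p m))) (2 / \<mu> ^ m * (1 / sqrt (Re (p m))))"
        using Mpos[of m] by (intro L2_bounded_cmult L2_bounded_inverse \<alpha> p) auto
      from L2_bounded_weaken[OF this le] show "L2_bounded (\<lambda>z. cmod ((g ^^ m) z - \<alpha>)) e"
        by (rule L2_bounded_cong) (rule eq)
    qed
  qed
qed

lemma affine_modelD:
  assumes "affine_model g \<alpha> \<mu> b"
  shows "cmod \<alpha> = 1" "1 \<le> \<mu>" "0 \<le> Re b" "g holomorphic_on unit_disc" "g ` unit_disc \<subseteq> unit_disc"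
  using assms by (auto simp: affine_model_def)

text \<open>Packages both types of maps, so that distinct attractive fixed points are treated once
  for all types.\<close>

lemma tame_tracking:
  assumes m: "affine_model g \<alpha> \<mu> b" and b: "\<mu> = 1 \<Longrightarrow> Re b = 0" and e: "0 < e"
  shows "\<exists>u y C. u holomorphic_on unit_disc \<and> L2_bounded (\<lambda>z. cmod (poly p z - u z)) e \<and> (\<forall>n. y n holomorphic_on unit_disc) \<and>
     tracks g E u y \<and> tame \<alpha> y \<and> 0 \<le> C \<and> (\<forall>z\<in>unit_disc. cmod (u z) \<le> C)"
proof (cases "\<mu> = 1")
  case True
  note \<alpha> = affine_modelD(1)[OF m]
  have m1: "affine_model g \<alpha> 1 b" using m True by simp
  have a: "Im b \<noteq> 0" using m b True by (auto simp: affine_model_def complex_eq_iff)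
  obtain U where U: "parabolic_test U" "L2_bounded (\<lambda>z. cmod (poly p z - U (half_plane \<alpha> z))) e"
    using parabolic_test_dense[OF \<alpha> e] by blast
  obtain C where C: "0 \<le> C" "\<And>w. 0 < Re w \<Longrightarrow> cmod (U w) \<le> C / cmod (w + 1) ^ 3" using U by (auto simp: parabolic_test_def)
  have "(\<lambda>z. U (half_plane \<alpha> z)) holomorphic_on unit_disc"
    using U(1) Re_half_plane_pos[OF \<alpha>]
    by (intro holomorphic_half_plane_compose[of U] holomorphic_half_plane \<alpha>) (auto simp: parabolic_test_def)
  moreover have "cmod (U (half_plane \<alpha> z)) \<le> C" if "z \<in> unit_disc" for z
  proof -
    have w: "0 < Re (half_plane \<alpha> z)" using Re_half_plane_pos[OF \<alpha> that] .
    have "1 \<le> cmod (half_plane \<alpha> z + 1) ^ 3" using w by (intro one_le_power cmod_plus_one_ge) simp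
    then have "C / cmod (half_plane \<alpha> z + 1) ^ 3 \<le> C / 1" using C by (intro divide_left_mono) auto
    then show ?thesis using C(2)[OF w] by simp
  qed
  ultimately show ?thesis
    using U C(1) parabolic_tracks[OF m1 b[OF True] U(1), of E] parabolic_tame[OF U(1) a \<alpha>] holomorphic_parabolic_piece[OF U(1) \<alpha>] by blast
next
  case False
  note \<alpha> = affine_modelD(1)[OF m]
  have \<mu>: "1 < \<mu>" using affine_modelD(2)[OF m] False by simp
  define \<beta> where "\<beta> = center \<mu> b"
  have \<beta>: "Re \<beta> \<le> 0" unfolding \<beta>_def by (rule Re_center[OF \<mu> affine_modelD(3)[OF m]])
  obtain U where U: "hyperbolic_test U" "L2_bounded (\<lambda>z. cmod (poly p z - U (half_plane \<alpha> z - \<beta>))) e"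
    using hyperbolic_test_dense[OF \<alpha> \<beta> e] by blast
  obtain C where C: "0 \<le> C" "\<And>w. 0 < Re w \<Longrightarrow> cmod (U w) \<le> C * cmod w / (cmod (w + 1))\<^sup>2" using U by (auto simp: hyperbolic_test_def)
  have v: "0 < Re (half_plane \<alpha> z - \<beta>)" if "z \<in> unit_disc" for z using Re_half_plane_pos[OF \<alpha> that] \<beta> by simp
  have "(\<lambda>z. U (half_plane \<alpha> z - \<beta>)) holomorphic_on unit_disc"
    using U(1) v by (intro holomorphic_half_plane_compose[of U] holomorphic_intros holomorphic_half_plane \<alpha>) (auto simp: hyperbolic_test_def)
  moreover have "cmod (U (half_plane \<alpha> z - \<beta>)) \<le> C" if z: "z \<in> unit_disc" for z
  proof -
    let ?v = "half_plane \<alpha> z - \<beta>"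
    have "cmod (U ?v) \<le> C * (cmod ?v / cmod (?v + 1))" by (rule hyperbolic_test_bounds(2)[OF C(2)[OF v[OF z]] C(1) v[OF z]])
    also have "\<dots> \<le> C * 1"
    proof (rule mult_left_mono[OF _ C(1)])
      have "cmod ?v \<le> cmod (?v + of_real 1)" using v[OF z] by (intro cmod_le_cmod_add) auto
      then show "cmod ?v / cmod (?v + 1) \<le> 1" by (simp add: divide_le_eq_1)
    qed
    finally show ?thesis by simp
  qed
  moreover have "0 < ln \<mu>" using \<mu> by simp
  ultimately show ?thesis
    using U C(1) hyperbolic_tracks[OF m \<mu> U(1), of E] hyperbolic_tame[OF U(1) _ \<alpha> \<beta>] holomorphic_hyperbolic_piece[OF U(1) \<alpha> \<beta>]
    unfolding \<beta>_def[symmetric] by blast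
qed

text \<open>The factor is 1 at \<alpha>, where the orbit of \<open>g\<close> ends up, so it changes
  little at late times; otherwise only its bound \<open>2 / d\<close> is used.\<close>

lemma tracks_times_attractor_factor:
  assumes m: "affine_model g \<alpha> \<mu> b" and \<alpha>': "cmod \<alpha>' = 1" "\<alpha> \<noteq> \<alpha>'"
    and t: "tracks g E u y" and u: "u holomorphic_on unit_disc" and y: "\<And>n. y n holomorphic_on unit_disc"
    and C: "0 \<le> C" "\<And>z. z \<in> unit_disc \<Longrightarrow> cmod (u z) \<le> C"
  shows "tracks g E u (\<lambda>n z. (z - \<alpha>') / (\<alpha> - \<alpha>') * y n z)"
  unfolding tracks_def
proof (intro allI impI)
  fix e :: real assume e: "0 < e"
  define d where "d = cmod (\<alpha> - \<alpha>')"
  have d: "0 < d" using \<alpha>' by (simp add: d_def)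
  note g = affine_modelD(5,4)[OF m]
  have in_disc: "(g ^^ m) z \<in> unit_disc" if "z \<in> unit_disc" for m z by (rule iterate_in_disc[OF g(1) that])
  have e1: "0 < e * d / 4" and e2: "0 < e * d / (2 * (C + 1))" using e d C by auto
  obtain N1 where N1: "\<And>m. m \<in> E \<Longrightarrow> N1 \<le> m \<Longrightarrow> L2_bounded (\<lambda>z. cmod (y m ((g ^^ m) z) - u z)) (e * d / 4)"
      "\<And>m J. m \<in> insert 0 E \<Longrightarrow> finite J \<Longrightarrow> J \<subseteq> E \<Longrightarrow> (\<forall>n\<in>J. int N1 \<le> \<bar>int n - int m\<bar>) \<Longrightarrow>
        L2_bounded (\<lambda>z. cmod (\<Sum>n\<in>J. y n ((g ^^ m) z))) (e * d / 4)"
    using t e1 unfolding tracks_def by (elim allE[of _ "e * d / 4"] impE exE conjE) (assumption, blast)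
  obtain N2 where N2: "\<And>m. N2 \<le> m \<Longrightarrow> L2_bounded (\<lambda>z. cmod ((g ^^ m) z - \<alpha>)) (e * d / (2 * (C + 1)))"
    using distance_to_attractor_small[OF m e2] by blast
  have k: "cmod (((g ^^ m) z - \<alpha>') / (\<alpha> - \<alpha>')) \<le> 2 / d" if "z \<in> unit_disc" for m z
    using norm_triangle_ineq4[of "(g ^^ m) z" \<alpha>'] in_disc[OF that, of m] \<alpha>' d
    by (simp add: norm_divide d_def divide_right_mono)
  show "\<exists>N. (\<forall>m\<in>E. N \<le> m \<longrightarrow> L2_bounded (\<lambda>z. cmod (((g ^^ m) z - \<alpha>') / (\<alpha> - \<alpha>') * y m ((g ^^ m) z) - u z)) e) \<and>
     (\<forall>m\<in>insert 0 E. \<forall>J. finite J \<longrightarrow> J \<subseteq> E \<longrightarrow> (\<forall>n\<in>J. int N \<le> \<bar>int n - int m\<bar>) \<longrightarrow>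
        L2_bounded (\<lambda>z. cmod (\<Sum>n\<in>J. ((g ^^ m) z - \<alpha>') / (\<alpha> - \<alpha>') * y n ((g ^^ m) z))) e)"
  proof (intro exI[of _ "max N1 N2"] conjI ballI allI impI)
    fix m assume mE: "m \<in> E" and mN: "max N1 N2 \<le> m"
    show "L2_bounded (\<lambda>z. cmod (((g ^^ m) z - \<alpha>') / (\<alpha> - \<alpha>') * y m ((g ^^ m) z) - u z)) e"
    proof (rule L2_bounded_holomorphic)
      show "(\<lambda>z. ((g ^^ m) z - \<alpha>') / (\<alpha> - \<alpha>') * y m ((g ^^ m) z) - u z) holomorphic_on unit_disc"
        using \<alpha>' by (intro holomorphic_intros holomorphic_iterate g holomorphic_iterate_compose y u) auto
      show "L2_bounded (\<lambda>z. 2 / d * cmod (y m ((g ^^ m) z) - u z) + C / d * cmod ((g ^^ m) z - \<alpha>)) (2 / d * (e * d / 4) + C / d * (e * d / (2 * (C + 1))))"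
        using mE mN d C by (intro L2_bounded_add L2_bounded_cmult N1 N2) auto
      show "2 / d * (e * d / 4) + C / d * (e * d / (2 * (C + 1))) \<le> e"
      proof -
        have "C / d * (e * d / (2 * (C + 1))) = e / 2 * (C / (C + 1))" using d C by simp
        also have "\<dots> \<le> e / 2 * 1" using e C by (intro mult_left_mono) auto
        finally have "C / d * (e * d / (2 * (C + 1))) \<le> e / 2" by (simp only: mult_1_right)
        moreover have "2 / d * (e * d / 4) = e / 2" using d by simp
        ultimately show ?thesis by (metis add_left_mono field_sum_of_halves)
      qed
      fix z assume z: "z \<in> unit_disc"
      let ?k = "((g ^^ m) z - \<alpha>') / (\<alpha> - \<alpha>')"
      have "?k - 1 = ((g ^^ m) z - \<alpha>) / (\<alpha> - \<alpha>')" using \<alpha>' by (simp add: field_simps)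
      then have k1: "cmod (?k - 1) = cmod ((g ^^ m) z - \<alpha>) / d" by (simp add: norm_divide d_def)
      have "?k * y m ((g ^^ m) z) - u z = ?k * (y m ((g ^^ m) z) - u z) + (?k - 1) * u z" by (simp add: ring_distribs)
      then have "cmod (?k * y m ((g ^^ m) z) - u z) \<le> cmod (?k * (y m ((g ^^ m) z) - u z)) + cmod ((?k - 1) * u z)"
        by (simp only: norm_triangle_ineq)
      also have "cmod (?k * (y m ((g ^^ m) z) - u z)) \<le> 2 / d * cmod (y m ((g ^^ m) z) - u z)"
        unfolding norm_mult[of ?k] by (intro mult_right_mono k[OF z]) auto
      also have "cmod ((?k - 1) * u z) \<le> cmod ((g ^^ m) z - \<alpha>) / d * C"
        unfolding norm_mult k1 using C(2)[OF z] d by (intro mult_left_mono) auto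
      finally show "cmod (?k * y m ((g ^^ m) z) - u z) \<le> 2 / d * cmod (y m ((g ^^ m) z) - u z) + C / d * cmod ((g ^^ m) z - \<alpha>)"
        by (simp add: mult.commute)
    qed
  next
    fix m J assume mE: "m \<in> insert 0 E" and J: "finite J" "J \<subseteq> E" and s: "\<forall>n\<in>J. int (max N1 N2) \<le> \<bar>int n - int m\<bar>"
    show "L2_bounded (\<lambda>z. cmod (\<Sum>n\<in>J. ((g ^^ m) z - \<alpha>') / (\<alpha> - \<alpha>') * y n ((g ^^ m) z))) e"
    proof (rule L2_bounded_holomorphic)
      show "(\<lambda>z. \<Sum>n\<in>J. ((g ^^ m) z - \<alpha>') / (\<alpha> - \<alpha>') * y n ((g ^^ m) z)) holomorphic_on unit_disc"
        using \<alpha>' by (intro holomorphic_intros holomorphic_iterate g holomorphic_iterate_compose y) auto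
      show "L2_bounded (\<lambda>z. 2 / d * cmod (\<Sum>n\<in>J. y n ((g ^^ m) z))) (2 / d * (e * d / 4))"
        using mE J s d by (intro L2_bounded_cmult N1) auto
      show "2 / d * (e * d / 4) \<le> e" using d e by simp
      fix z assume z: "z \<in> unit_disc"
      show "cmod (\<Sum>n\<in>J. ((g ^^ m) z - \<alpha>') / (\<alpha> - \<alpha>') * y n ((g ^^ m) z)) \<le> 2 / d * cmod (\<Sum>n\<in>J. y n ((g ^^ m) z))"
        unfolding sum_distrib_left[symmetric] norm_mult by (intro mult_right_mono k[OF z]) auto
    qed
  qed
qed

text \<open>For late \<open>m\<close> the factor itself is small along the orbit and the sums are
  bounded. For the remaining \<open>m\<close> all \<open>n\<close> are late, and
  \<open>kernel_at_other_point\<close> turns the exceptional region near \<alpha> into a small norm,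
  uniformly in \<open>m\<close>.\<close>

lemma tame_times_attractor_factor_vanishes:
  assumes m: "affine_model g' \<alpha>' \<mu>' b'" and \<alpha>: "cmod \<alpha> = 1" "\<alpha> \<noteq> \<alpha>'"
    and t: "tame \<alpha> y" and y: "\<And>n. y n holomorphic_on unit_disc"
  shows "vanishes g' E (\<lambda>n z. (z - \<alpha>') / (\<alpha> - \<alpha>') * y n z)"
  unfolding vanishes_def
proof (intro allI impI)
  fix e :: real assume e: "0 < e"
  define d where "d = cmod (\<alpha> - \<alpha>')"
  have d: "0 < d" using \<alpha> by (simp add: d_def)
  note \<alpha>' = affine_modelD(1)[OF m] and g = affine_modelD(5,4)[OF m]
  have in_disc: "(g' ^^ m) z \<in> unit_disc" if "z \<in> unit_disc" for m z by (rule iterate_in_disc[OF g(1) that])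
  obtain K where K: "0 < K" "\<And>J z. finite J \<Longrightarrow> z \<in> unit_disc \<Longrightarrow> cmod (\<Sum>n\<in>J. y n z) \<le> K"
     "\<And>\<delta>. 0 < \<delta> \<Longrightarrow> \<exists>N. \<forall>J z. finite J \<longrightarrow> (\<forall>n\<in>J. N \<le> n) \<longrightarrow> z \<in> unit_disc \<longrightarrow>
        cmod (\<Sum>n\<in>J. y n z) \<le> \<delta> + K * cmod ((half_plane \<alpha> z + 1) / (half_plane \<alpha> z + 1 + of_real (1 / \<delta>)))"
    using t unfolding tame_def by blast
  \<comment> \<open>With \<open>sqrt \<delta> = s\<close> and \<open>\<delta> \<le> s\<close>, the
    total \<open>2 * \<delta> + 2 * K * s\<close> is at most \<open>e * d\<close>.\<close>
  define s where "s = min 1 (e * d / (2 + 2 * K))"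
  define \<delta> where "\<delta> = s\<^sup>2"
  have "0 < e * d / (2 + 2 * K)" using e d K by simp
  then have s: "0 < s" "s \<le> 1" "s \<le> e * d / (2 + 2 * K)" unfolding s_def by (simp_all del: zero_less_divide_iff)
  have \<delta>: "0 < \<delta>" "sqrt \<delta> = s" "\<delta> \<le> s" unfolding \<delta>_def using s power_le_one_iff by (auto simp: power2_eq_square mult_left_le_one_le)
  have "s * (2 + 2 * K) \<le> e * d" using s(3) K by (simp add: pos_le_divide_eq)
  moreover have "\<delta> * 2 \<le> s * 2" using \<delta> by simp
  ultimately have "2 * \<delta> + K * (2 * s) \<le> e * d" by (simp add: algebra_simps)
  then have small: "1 / d * (2 * \<delta> + K * (2 * s)) \<le> e" using d by (simp add: divide_le_eq mult.commute)
  obtain N2 where N2: "\<And>J z. finite J \<Longrightarrow> (\<forall>n\<in>J. N2 \<le> n) \<Longrightarrow> z \<in> unit_disc \<Longrightarrow>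
        cmod (\<Sum>n\<in>J. y n z) \<le> \<delta> + K * cmod ((half_plane \<alpha> z + 1) / (half_plane \<alpha> z + 1 + of_real (1 / \<delta>)))"
    using K(3)[OF \<delta>(1)] by blast
  have "0 < e * d / K" using e d K by simp
  from distance_to_attractor_small[OF m this] obtain N1
    where N1: "\<And>m. N1 \<le> m \<Longrightarrow> L2_bounded (\<lambda>z. cmod ((g' ^^ m) z - \<alpha>')) (e * d / K)" by blast
  have eq: "cmod (\<Sum>n\<in>J. (\<zeta> - \<alpha>') / (\<alpha> - \<alpha>') * y n \<zeta>) = 1 / d * (cmod (\<zeta> - \<alpha>') * cmod (\<Sum>n\<in>J. y n \<zeta>))" for J \<zeta>
    unfolding sum_distrib_left[symmetric] by (simp add: norm_mult norm_divide d_def)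
  show "\<exists>N. \<forall>m\<in>insert 0 E. \<forall>J. finite J \<longrightarrow> J \<subseteq> E \<longrightarrow> (\<forall>n\<in>J. N \<le> max m n) \<longrightarrow>
        L2_bounded (\<lambda>z. cmod (\<Sum>n\<in>J. ((g' ^^ m) z - \<alpha>') / (\<alpha> - \<alpha>') * y n ((g' ^^ m) z))) e"
  proof (intro exI[of _ "max N1 N2"] ballI allI impI)
    fix m J assume J: "finite J" and s': "\<forall>n\<in>J. max N1 N2 \<le> max m n"
    have hol: "(\<lambda>z. \<Sum>n\<in>J. ((g' ^^ m) z - \<alpha>') / (\<alpha> - \<alpha>') * y n ((g' ^^ m) z)) holomorphic_on unit_disc"
      using \<alpha> by (intro holomorphic_intros holomorphic_iterate g holomorphic_iterate_compose y) auto
    show "L2_bounded (\<lambda>z. cmod (\<Sum>n\<in>J. ((g' ^^ m) z - \<alpha>') / (\<alpha> - \<alpha>') * y n ((g' ^^ m) z))) e"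
    proof (cases "max N1 N2 \<le> m")
      case True
      show ?thesis
      proof (rule L2_bounded_holomorphic[OF hol])
        show "L2_bounded (\<lambda>z. K / d * cmod ((g' ^^ m) z - \<alpha>')) (K / d * (e * d / K))"
          using True K d by (intro L2_bounded_cmult N1) auto
        show "K / d * (e * d / K) \<le> e" using K d by simp
        fix z assume z: "z \<in> unit_disc"
        have "cmod ((g' ^^ m) z - \<alpha>') * cmod (\<Sum>n\<in>J. y n ((g' ^^ m) z)) \<le> cmod ((g' ^^ m) z - \<alpha>') * K"
          by (intro mult_left_mono K(2)[OF J in_disc[OF z]]) auto
        then show "cmod (\<Sum>n\<in>J. ((g' ^^ m) z - \<alpha>') / (\<alpha> - \<alpha>') * y n ((g' ^^ m) z)) \<le> K / d * cmod ((g' ^^ m) z - \<alpha>')"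
          unfolding eq using d by (simp add: divide_right_mono mult.commute)
      qed
    next
      case False
      then have n: "\<forall>n\<in>J. N2 \<le> n" using s' by fastforce
      let ?k = "\<lambda>z. (half_plane \<alpha> ((g' ^^ m) z) + 1) / (half_plane \<alpha> ((g' ^^ m) z) + 1 + of_real (1 / \<delta>))"
      show ?thesis
      proof (rule L2_bounded_holomorphic[OF hol _ _ small])
        have "L2_bounded (\<lambda>z. cmod (((g' ^^ m) z - \<alpha>') * ?k z)) (2 / sqrt (1 / \<delta>))"
          using \<delta> by (intro kernel_at_other_point[OF m \<alpha>(1)]) auto
        also have "2 / sqrt (1 / \<delta>) = 2 * s" by (simp add: real_sqrt_divide \<delta>)
        finally show "L2_bounded (\<lambda>z. 1 / d * (2 * \<delta> + K * cmod (((g' ^^ m) z - \<alpha>') * ?k z))) (1 / d * (2 * \<delta> + K * (2 * s)))"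
          using d \<delta> K by (intro L2_bounded_cmult L2_bounded_add L2_bounded_const) auto
        fix z assume z: "z \<in> unit_disc"
        have two: "cmod ((g' ^^ m) z - \<alpha>') \<le> 2"
          using norm_triangle_ineq4[of "(g' ^^ m) z" \<alpha>'] in_disc[OF z, of m] \<alpha>' by simp
        have "cmod ((g' ^^ m) z - \<alpha>') * cmod (\<Sum>n\<in>J. y n ((g' ^^ m) z)) \<le> cmod ((g' ^^ m) z - \<alpha>') * (\<delta> + K * cmod (?k z))"
          by (intro mult_left_mono N2[OF J n in_disc[OF z]]) auto
        also have "\<dots> \<le> 2 * \<delta> + K * cmod (((g' ^^ m) z - \<alpha>') * ?k z)"
          using mult_right_mono[OF two, of \<delta>] \<delta> unfolding norm_mult distrib_left mult.left_commute[of _ K] by linarith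
        finally show "cmod (\<Sum>n\<in>J. ((g' ^^ m) z - \<alpha>') / (\<alpha> - \<alpha>') * y n ((g' ^^ m) z)) \<le> 1 / d * (2 * \<delta> + K * cmod (((g' ^^ m) z - \<alpha>') * ?k z))"
          unfolding eq using d by (intro mult_left_mono) auto
      qed
    qed
  qed
qed

lemma steers_distinct_attractors:
  assumes m: "affine_model g \<alpha> \<mu> b" and b: "\<mu> = 1 \<Longrightarrow> Re b = 0" and m': "affine_model g' \<alpha>' \<mu>' b'" and ne: "\<alpha> \<noteq> \<alpha>'"
  shows "steers g g' E"
  unfolding steers_def
proof (intro allI impI)
  fix p and e :: real assume e: "0 < e"
  obtain u y C where u: "u holomorphic_on unit_disc" "L2_bounded (\<lambda>z. cmod (poly p z - u z)) e"
    and y: "\<And>n. y n holomorphic_on unit_disc" "tracks g E u y" "tame \<alpha> y" and C: "0 \<le> C" "\<And>z. z \<in> unit_disc \<Longrightarrow> cmod (u z) \<le> C"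
    using tame_tracking[OF m b e, of p E] by blast
  have "(\<lambda>z. (z - \<alpha>') / (\<alpha> - \<alpha>') * y n z) holomorphic_on unit_disc" for n
    using ne by (intro holomorphic_intros y) auto
  then show "\<exists>u y. u holomorphic_on unit_disc \<and> L2_bounded (\<lambda>z. cmod (poly p z - u z)) e \<and> (\<forall>n. y n holomorphic_on unit_disc) \<and>
     tracks g E u y \<and> vanishes g' E y"
    by (intro exI[of _ u] exI[of _ "\<lambda>n z. (z - \<alpha>') / (\<alpha> - \<alpha>') * y n z"] conjI allI u
          tracks_times_attractor_factor[OF m affine_modelD(1)[OF m'] ne y(2) u(1) y(1) C]
          tame_times_attractor_factor_vanishes[OF m' affine_modelD(1)[OF m] ne y(3,1)])
qed

lemma steers_parabolic_parabolic:
  assumes m: "affine_model g \<alpha> 1 b" and b: "Re b = 0" and m': "affine_model g' \<alpha> 1 b'" and b': "Re b' = 0" and c: "0 < c"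
    and sep: "\<forall>m\<in>insert 0 E. \<forall>n\<in>insert 0 E. c * real (max m n) \<le> \<bar>Im b' * real m - Im b * real n\<bar>"
  shows "steers g g' E"
  unfolding steers_def
proof (intro allI impI)
  fix p and e :: real assume e: "0 < e"
  note \<alpha> = affine_modelD(1)[OF m]
  obtain U where U: "parabolic_test U" "L2_bounded (\<lambda>z. cmod (poly p z - U (half_plane \<alpha> z))) e"
    using parabolic_test_dense[OF \<alpha> e] by blast
  have "(\<lambda>z. U (half_plane \<alpha> z)) holomorphic_on unit_disc"
    using U(1) Re_half_plane_pos[OF \<alpha>]
    by (intro holomorphic_half_plane_compose[of U] holomorphic_half_plane \<alpha>) (auto simp: parabolic_test_def)
  then show "\<exists>u y. u holomorphic_on unit_disc \<and> L2_bounded (\<lambda>z. cmod (poly p z - u z)) e \<and> (\<forall>n. y n holomorphic_on unit_disc) \<and>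
     tracks g E u y \<and> vanishes g' E y"
    using U holomorphic_parabolic_piece[OF U(1) \<alpha>] parabolic_tracks[OF m b U(1)] parabolic_parabolic_vanishes[OF m b m' b' U(1) c sep] by blast
qed

lemma steers_hyperbolic_hyperbolic:
  assumes m: "affine_model g \<alpha> \<mu> b" and \<mu>: "1 < \<mu>" and m': "affine_model g' \<alpha> \<mu>' b'" and \<mu>': "1 < \<mu>'" and c: "0 < c"
    and sep: "\<forall>m\<in>insert 0 E. \<forall>n\<in>insert 0 E. c * real (max m n) \<le> \<bar>ln \<mu>' * real m - ln \<mu> * real n\<bar>"
  shows "steers g g' E"
  unfolding steers_def
proof (intro allI impI)
  fix p and e :: real assume e: "0 < e"
  note \<alpha> = affine_modelD(1)[OF m]
  have \<beta>: "Re (center \<mu> b) \<le> 0" by (rule Re_center[OF \<mu> affine_modelD(3)[OF m]])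
  obtain U where U: "hyperbolic_test U" "L2_bounded (\<lambda>z. cmod (poly p z - U (half_plane \<alpha> z - center \<mu> b))) e"
    using hyperbolic_test_dense[OF \<alpha> \<beta> e] by blast
  have "(\<lambda>z. U (half_plane \<alpha> z - center \<mu> b)) holomorphic_on unit_disc"
    using U(1) Re_dilation_pos[OF \<alpha> \<beta>, of _ 0]
    by (intro holomorphic_half_plane_compose[of U] holomorphic_intros holomorphic_half_plane \<alpha>) (auto simp: hyperbolic_test_def)
  then show "\<exists>u y. u holomorphic_on unit_disc \<and> L2_bounded (\<lambda>z. cmod (poly p z - u z)) e \<and> (\<forall>n. y n holomorphic_on unit_disc) \<and>
     tracks g E u y \<and> vanishes g' E y"
    using U holomorphic_hyperbolic_piece[OF U(1) \<alpha> \<beta>] hyperbolic_tracks[OF m \<mu> U(1)] hyperbolic_hyperbolic_vanishes[OF m \<mu> m' \<mu>' U(1) c sep] by blast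
qed

section \<open>A parabolic and a hyperbolic map with a common attractive fixed point\<close>

text \<open>Without a compensating factor the constant \<open>X\<close> may grow with
  \<open>m\<close>; this is harmless where only finitely many \<open>m\<close> occur.\<close>

lemma kernel_at_iterate:
  assumes m: "affine_model g \<alpha> \<mu> b"
  shows "\<exists>X>0. \<forall>Y>0. L2_bounded (\<lambda>z. cmod ((half_plane \<alpha> ((g ^^ m) z) + 1) / (half_plane \<alpha> ((g ^^ m) z) + 1 + of_real Y))) (X / sqrt Y)"
proof -
  note \<alpha> = affine_modelD(1)[OF m] and g = affine_modelD(5,4)[OF m]
  define M B where "M = \<mu> ^ m" and "B = of_real (\<Sum>i<m. \<mu> ^ i) * b"
  have M: "1 \<le> M" using affine_modelD(2)[OF m] by (simp add: M_def one_le_power)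
  have B: "0 \<le> Re B" using affine_modelD(2,3)[OF m] by (simp add: B_def sum_nonneg)
  define q where "q = (B + 1) / of_real M"
  define c where "c = 1 + cmod (q - 1)"
  have c: "1 \<le> c" by (simp add: c_def)
  have M0: "of_real M \<noteq> (0 :: complex)" using M by simp
  show ?thesis
  proof (intro exI[of _ "c * sqrt M"] conjI allI impI)
    show "0 < c * sqrt M" using c M by simp
    fix Y :: real assume Y: "0 < Y"
    define p where "p = (B + 1 + of_real Y) / of_real M"
    have rep: "Re p = (Re B + 1 + Y) / M" unfolding p_def Re_divide_of_real by simp
    then have p: "Y / M \<le> Re p" using B M by (simp add: divide_right_mono)
    have p0: "0 < Re p" using Y M by (intro less_le_trans[OF _ p]) simp
    show "L2_bounded (\<lambda>z. cmod ((half_plane \<alpha> ((g ^^ m) z) + 1) / (half_plane \<alpha> ((g ^^ m) z) + 1 + of_real Y))) (c * sqrt M / sqrt Y)"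
    proof (rule L2_bounded_holomorphic)
      have "half_plane \<alpha> ((g ^^ m) z) + 1 + of_real Y \<noteq> 0" if "z \<in> unit_disc" for z
        using half_plane_add_neq_0[OF \<alpha> _ affine_model_iterate(1)[OF m that], of "1 + of_real Y"] Y by (simp add: add.assoc)
      then show "(\<lambda>z. (half_plane \<alpha> ((g ^^ m) z) + 1) / (half_plane \<alpha> ((g ^^ m) z) + 1 + of_real Y)) holomorphic_on unit_disc"
        by (intro holomorphic_intros holomorphic_iterate_compose[OF g] holomorphic_half_plane \<alpha>) blast
      show "L2_bounded (\<lambda>z. c * cmod ((half_plane \<alpha> z + 1) / (half_plane \<alpha> z + p))) (c * (1 / sqrt (Re p)))"
        using c by (intro L2_bounded_cmult L2_bounded_kernel \<alpha> p0) auto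
      have "1 / sqrt (Re p) \<le> 1 / sqrt (Y / M)" using p p0 Y M by (intro divide_left_mono mult_pos_pos) auto
      then show "c * (1 / sqrt (Re p)) \<le> c * sqrt M / sqrt Y" using c mult_left_mono[of "1 / sqrt (Re p)" "sqrt M / sqrt Y" c] by (simp add: real_sqrt_divide)
      fix z assume z: "z \<in> unit_disc"
      let ?w = "half_plane \<alpha> z"
      have w: "0 < Re ?w" using Re_half_plane_pos[OF \<alpha> z] .
      have W: "half_plane \<alpha> ((g ^^ m) z) = of_real M * ?w + B" by (simp add: affine_model_iterate(2)[OF m z] M_def B_def)
      have "of_real M * q = B + 1" "of_real M * p = B + 1 + of_real Y"
        unfolding q_def p_def times_divide_eq_right using M0 by (rule nonzero_mult_div_cancel_left)+
      then have e: "half_plane \<alpha> ((g ^^ m) z) + 1 = of_real M * (?w + q)" "half_plane \<alpha> ((g ^^ m) z) + 1 + of_real Y = of_real M * (?w + p)"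
        unfolding W distrib_left by (simp_all add: add.assoc)
      have "cmod (?w + q) \<le> cmod (?w + 1) + cmod (q - 1)" using norm_triangle_ineq[of "?w + 1" "q - 1"] by simp
      also have "\<dots> \<le> c * cmod (?w + 1)"
        using mult_left_mono[OF cmod_plus_one_ge[of ?w], of "cmod (q - 1)"] w by (simp add: c_def distrib_right)
      finally have "cmod (?w + q) / cmod (?w + p) \<le> c * cmod (?w + 1) / cmod (?w + p)" by (rule divide_right_mono) simp
      then show "cmod ((half_plane \<alpha> ((g ^^ m) z) + 1) / (half_plane \<alpha> ((g ^^ m) z) + 1 + of_real Y)) \<le> c * cmod ((?w + 1) / (?w + p))"
        unfolding e(2) unfolding e(1) using M0 by (simp add: norm_divide norm_mult)
    qed
  qed
qed

text \<open>For a non-automorphism this is a drift to the right, uniform in the starting point,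
  which tells the orbit apart from that of a parabolic automorphism.\<close>

lemma Re_hyperbolic_iterate_ge:
  assumes m: "affine_model g \<alpha> \<mu> b" and z: "z \<in> unit_disc"
  shows "real m * Re b \<le> Re (half_plane \<alpha> ((g ^^ m) z))"
proof -
  note \<mu> = affine_modelD(2)[OF m]
  have "real m = (\<Sum>i<m. 1)" by simp
  also have "\<dots> \<le> (\<Sum>i<m. \<mu> ^ i)" by (intro sum_mono one_le_power \<mu>)
  finally have "real m * Re b \<le> (\<Sum>i<m. \<mu> ^ i) * Re b" using affine_modelD(3)[OF m] by (rule mult_right_mono)
  also have "\<dots> \<le> \<mu> ^ m * Re (half_plane \<alpha> z) + (\<Sum>i<m. \<mu> ^ i) * Re b"
    using Re_half_plane_pos[OF affine_modelD(1)[OF m] z] \<mu> by simp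
  finally show ?thesis unfolding affine_model_iterate(2)[OF m z] by (simp flip: of_real_power of_real_sum)
qed

text \<open>From time \<open>m0\<close> on every point of the orbit of \<open>g'\<close> is so far
  to the right that any sum of translates is at most \<open>e\<close>. Before \<open>m0\<close>
  there are finitely many orbit times, and late \<open>n\<close> give the kernel of
  \<open>parabolic_tame\<close>.\<close>

lemma parabolic_hyperbolic_vanishes:
  assumes m: "affine_model g' \<alpha> \<mu>' b'" and b': "0 < Re b'" and U: "parabolic_test U" and a: "a \<noteq> 0"
  shows "vanishes g' E (parabolic_piece \<alpha> a U)"
  unfolding vanishes_def
proof (intro allI impI)
  fix e :: real assume e: "0 < e"
  note \<alpha> = affine_modelD(1)[OF m] and g = affine_modelD(5,4)[OF m]
  have in_disc: "(g' ^^ m) z \<in> unit_disc" if "z \<in> unit_disc" for m z by (rule iterate_in_disc[OF g(1) that])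
  obtain K where K: "0 < K"
     "\<And>\<delta>. 0 < \<delta> \<Longrightarrow> \<exists>N. \<forall>J z. finite J \<longrightarrow> (\<forall>n\<in>J. N \<le> n) \<longrightarrow> z \<in> unit_disc \<longrightarrow>
        cmod (\<Sum>n\<in>J. parabolic_piece \<alpha> a U n z) \<le> \<delta> + K * cmod ((half_plane \<alpha> z + 1) / (half_plane \<alpha> z + 1 + of_real (1 / \<delta>)))"
    using parabolic_tame[OF U a \<alpha>] unfolding tame_def by blast
  obtain K' where K': "0 < K'" "\<And>(J :: nat set) c w M. finite J \<Longrightarrow> 0 < Re w \<Longrightarrow> 0 \<le> M \<Longrightarrow> (\<forall>n\<in>J. 1 / cmod (w + 1 + \<i> * of_real (c - a * real n)) \<le> M) \<Longrightarrow>
     (\<Sum>n\<in>J. cmod (U (w + \<i> * of_real (c - a * real n)))) \<le> K' * M"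
    using parabolic_test_sum[OF U a] by blast
  obtain m0 where m0: "K' / (e * Re b') < real m0" using reals_Archimedean2 by blast
  have "\<exists>X>0. \<forall>Y>0. L2_bounded (\<lambda>z. cmod ((half_plane \<alpha> ((g' ^^ m) z) + 1) / (half_plane \<alpha> ((g' ^^ m) z) + 1 + of_real Y))) (X / sqrt Y)" for m
    by (rule kernel_at_iterate[OF m])
  then obtain X where X: "\<And>m. 0 < X m" "\<And>m Y. 0 < Y \<Longrightarrow>
      L2_bounded (\<lambda>z. cmod ((half_plane \<alpha> ((g' ^^ m) z) + 1) / (half_plane \<alpha> ((g' ^^ m) z) + 1 + of_real Y))) (X m / sqrt Y)"
    by metis
  define X' where "X' = sum X {..<m0}"
  have X': "0 \<le> X'" "\<And>m. m < m0 \<Longrightarrow> X m \<le> X'"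
    unfolding X'_def using less_imp_le[OF X(1)] by (auto intro!: sum_nonneg member_le_sum)
  define s where "s = min 1 (e / (1 + K * X'))"
  define \<delta> where "\<delta> = s\<^sup>2"
  have KX: "0 < 1 + K * X'" using K X' by (simp add: add_pos_nonneg)
  then have "0 < e / (1 + K * X')" using e by simp
  then have s: "0 < s" "s \<le> 1" "s \<le> e / (1 + K * X')" unfolding s_def by (simp_all del: zero_less_divide_iff)
  have \<delta>: "0 < \<delta>" "sqrt \<delta> = s" "\<delta> \<le> s" unfolding \<delta>_def using s by (auto simp: power2_eq_square mult_left_le_one_le)
  have "s * (1 + K * X') \<le> e" using s(3) KX by (simp only: pos_le_divide_eq)
  then have small: "\<delta> + K * (X' * s) \<le> e" using \<delta> by (simp add: algebra_simps)
  obtain N2 where N2: "\<And>J z. finite J \<Longrightarrow> (\<forall>n\<in>J. N2 \<le> n) \<Longrightarrow> z \<in> unit_disc \<Longrightarrow>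
        cmod (\<Sum>n\<in>J. parabolic_piece \<alpha> a U n z) \<le> \<delta> + K * cmod ((half_plane \<alpha> z + 1) / (half_plane \<alpha> z + 1 + of_real (1 / \<delta>)))"
    using K(2)[OF \<delta>(1)] by blast
  show "\<exists>N. \<forall>m\<in>insert 0 E. \<forall>J. finite J \<longrightarrow> J \<subseteq> E \<longrightarrow> (\<forall>n\<in>J. N \<le> max m n) \<longrightarrow>
        L2_bounded (\<lambda>z. cmod (\<Sum>n\<in>J. parabolic_piece \<alpha> a U n ((g' ^^ m) z))) e"
  proof (intro exI[of _ "max m0 N2"] ballI allI impI)
    fix k J assume J: "finite J" and s': "\<forall>n\<in>J. max m0 N2 \<le> max k n"
    have hol: "(\<lambda>z. \<Sum>n\<in>J. parabolic_piece \<alpha> a U n ((g' ^^ k) z)) holomorphic_on unit_disc"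
      by (intro holomorphic_on_sum holomorphic_iterate_compose g holomorphic_parabolic_piece U \<alpha>)
    show "L2_bounded (\<lambda>z. cmod (\<Sum>n\<in>J. parabolic_piece \<alpha> a U n ((g' ^^ k) z))) e"
    proof (cases "m0 \<le> k")
      case True
      show ?thesis
      proof (rule L2_bounded_holomorphic[OF hol L2_bounded_const[of e] _ order_refl])
        fix z assume z: "z \<in> unit_disc"
        let ?W = "half_plane \<alpha> ((g' ^^ k) z)"
        have W: "0 < Re ?W" by (rule Re_half_plane_pos[OF \<alpha> in_disc[OF z]])
        have "K' < real m0 * (e * Re b')" using m0 e b' by (simp add: divide_less_eq)
        also have "\<dots> \<le> real k * (e * Re b')" using True e b' by (intro mult_right_mono) auto
        also have "\<dots> = e * (real k * Re b')" by simp
        also have "\<dots> \<le> e * Re ?W" using e by (intro mult_left_mono Re_hyperbolic_iterate_ge[OF m z]) auto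
        finally have KW: "K' \<le> e * Re ?W" by simp
        have "cmod (\<Sum>n\<in>J. parabolic_piece \<alpha> a U n ((g' ^^ k) z)) \<le> K' * (1 / Re ?W)"
          unfolding parabolic_piece_def
        proof (rule order.trans[OF norm_sum K'(2)[OF J W]])
          have "Re ?W \<le> cmod (?W + 1 + \<i> * of_real (0 - a * real n))" for n
            using complex_Re_le_cmod[of "?W + 1 + \<i> * of_real (0 - a * real n)"] by simp
          then show "\<forall>n\<in>J. 1 / cmod (?W + 1 + \<i> * of_real (0 - a * real n)) \<le> 1 / Re ?W"
            using W by (intro ballI divide_left_mono mult_pos_pos) (auto intro: less_le_trans simp del: zero_less_norm_iff)
        qed (use W in auto)
        also have "\<dots> \<le> e" using KW W by (simp add: divide_le_eq)
        finally show "cmod (\<Sum>n\<in>J. parabolic_piece \<alpha> a U n ((g' ^^ k) z)) \<le> e" .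
      qed (use e in auto)
    next
      case False
      then have n: "\<forall>n\<in>J. N2 \<le> n" and k: "k < m0" using s' by fastforce+
      let ?k = "\<lambda>z. (half_plane \<alpha> ((g' ^^ k) z) + 1) / (half_plane \<alpha> ((g' ^^ k) z) + 1 + of_real (1 / \<delta>))"
      show ?thesis
      proof (rule L2_bounded_holomorphic[OF hol _ _ small])
        have "L2_bounded (\<lambda>z. cmod (?k z)) (X k / sqrt (1 / \<delta>))"
          using \<delta> by (intro X(2)) auto
        also have "X k / sqrt (1 / \<delta>) = X k * s" by (simp add: real_sqrt_divide \<delta>)
        finally have "L2_bounded (\<lambda>z. cmod (?k z)) (X' * s)"
          by (rule L2_bounded_weaken) (use X'(2)[OF k] s in \<open>auto intro!: mult_right_mono\<close>)
        then show "L2_bounded (\<lambda>z. \<delta> + K * cmod (?k z)) (\<delta> + K * (X' * s))"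
          using \<delta> K by (intro L2_bounded_cmult L2_bounded_add L2_bounded_const) auto
        show "cmod (\<Sum>n\<in>J. parabolic_piece \<alpha> a U n ((g' ^^ k) z)) \<le> \<delta> + K * cmod (?k z)" if "z \<in> unit_disc" for z
          by (rule N2[OF J n in_disc[OF that]])
      qed
    qed
  qed
qed

lemma steers_parabolic_hyperbolic:
  assumes m: "affine_model g \<alpha> 1 b" and b: "Re b = 0" and m': "affine_model g' \<alpha> \<mu>' b'" and b': "0 < Re b'"
  shows "steers g g' E"
  unfolding steers_def
proof (intro allI impI)
  fix p and e :: real assume e: "0 < e"
  note \<alpha> = affine_modelD(1)[OF m]
  have a: "Im b \<noteq> 0" using m b by (auto simp: affine_model_def complex_eq_iff)
  obtain U where U: "parabolic_test U" "L2_bounded (\<lambda>z. cmod (poly p z - U (half_plane \<alpha> z))) e"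
    using parabolic_test_dense[OF \<alpha> e] by blast
  have "(\<lambda>z. U (half_plane \<alpha> z)) holomorphic_on unit_disc"
    using U(1) Re_half_plane_pos[OF \<alpha>]
    by (intro holomorphic_half_plane_compose[of U] holomorphic_half_plane \<alpha>) (auto simp: parabolic_test_def)
  then show "\<exists>u y. u holomorphic_on unit_disc \<and> L2_bounded (\<lambda>z. cmod (poly p z - u z)) e \<and> (\<forall>n. y n holomorphic_on unit_disc) \<and>
     tracks g E u y \<and> vanishes g' E y"
    using U holomorphic_parabolic_piece[OF U(1) \<alpha>] parabolic_tracks[OF m b U(1)] parabolic_hyperbolic_vanishes[OF m' b' U(1) a] by blast
qed

section \<open>Multipliers that separate the two orbits\<close>

lemma norm_exp_minus_one_le:
  fixes u :: complex assumes "Re u \<le> 0" shows "cmod (exp u - 1) \<le> cmod u"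
proof -
  have "cmod (exp u - exp 0) \<le> 1 * cmod (u - 0)"
  proof (rule field_differentiable_bound[of "{v. Re v \<le> 0}" exp exp])
    show "convex {v. Re v \<le> 0}" by (rule convex_halfspace_Re_le)
    show "(exp has_field_derivative exp v) (at v within {v. Re v \<le> 0})" for v by (rule DERIV_subset[OF DERIV_exp]) simp
  qed (use assms in auto)
  then show ?thesis by simp
qed

text \<open>The function is \<open>exp (N (1 / (1 + \<rho> q) - 1))\<close> with \<open>\<rho>\<close> close to 1: it equals 1 at 0, and \<open>Re (1 / (1 + q)) = 1 / 2\<close>
  on the unit circle except at \<open>-1\<close>.\<close>

lemma disc_multiplier:
  fixes \<eta> \<delta> :: real
  assumes \<eta>: "0 < \<eta>" "\<eta> < 1" and \<delta>: "0 < \<delta>" "\<delta> \<le> 2"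
  shows "\<exists>b M \<theta> r. b holomorphic_on unit_disc \<and> 0 < M \<and> 0 < \<theta> \<and> 0 < r \<and> (\<forall>q\<in>unit_disc. cmod (b q) \<le> M) \<and>
     (\<forall>q\<in>unit_disc. \<forall>e. cmod e = 1 \<longrightarrow> \<delta> \<le> cmod (1 + e) \<longrightarrow> cmod (q - e) \<le> \<theta> \<longrightarrow> cmod (b q) \<le> \<eta>) \<and>
     (\<forall>q. cmod q \<le> r \<longrightarrow> cmod (b q - 1) \<le> \<eta>)"
proof -
  define N where "N = - 4 * ln \<eta>"
  have N: "0 < N" "exp (- N / 4) = \<eta>" using \<eta> by (auto simp: N_def)
  \<comment> \<open>\<tau> serves both as \<open>1 - \<rho>\<close> and as the tolerance for
    \<open>q - e\<close>. It is quadratic in \<delta> so that, with \<open>p = \<rho> * q\<close>,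
    the quantity \<open>1 - (cmod p)\<^sup>2\<close>, at most \<open>4 * \<tau>\<close>, is small
    against \<open>(cmod (1 + p))\<^sup>2\<close>, whose lower bound is a multiple of
    \<open>\<delta>\<^sup>2 = 64 * \<tau>\<close>.\<close>
  define \<tau> where "\<tau> = \<delta>\<^sup>2 / 64"
  have "\<delta>\<^sup>2 \<le> 2 * \<delta>" using \<delta> by (simp add: power2_eq_square)
  then have \<tau>: "0 < \<tau>" "\<tau> \<le> \<delta> / 32" "\<tau> \<le> 1 / 16" "64 * \<tau> = \<delta>\<^sup>2" using \<delta> by (auto simp: \<tau>_def)
  define \<rho> where "\<rho> = 1 - \<tau>"
  have \<rho>: "0 < \<rho>" "\<rho> < 1" using \<tau> by (auto simp: \<rho>_def)
  define b where "b q = exp (of_real N * (1 / (1 + of_real \<rho> * q) - 1))" for q :: complex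
  have nb: "cmod (b q) = exp (N * (Re (1 / (1 + of_real \<rho> * q)) - 1))" for q by (simp only: b_def norm_exp_eq_Re) simp
  have pq: "cmod (of_real \<rho> * q) = \<rho> * cmod q" for q using \<rho> by (simp add: norm_mult)
  have far: "\<tau> \<le> cmod (1 + of_real \<rho> * q)" if "q \<in> unit_disc" for q
  proof -
    have "\<rho> * cmod q \<le> \<rho> * 1" using that \<rho> by (intro mult_left_mono) auto
    then show ?thesis using norm_diff_ineq[of 1 "of_real \<rho> * q"] pq[of q] by (simp add: \<rho>_def)
  qed
  have "isCont b 0" unfolding b_def by (intro continuous_intros) auto
  moreover have "b 0 = 1" by (simp add: b_def)
  ultimately obtain r' where r': "0 < r'" "\<And>q. cmod q < r' \<Longrightarrow> cmod (b q - 1) < \<eta>"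
    using \<eta> by (auto simp: continuous_at_eps_delta dist_norm)
  show ?thesis
  proof (rule exI[of _ b], rule exI[of _ "exp (N * (1 / \<tau>))"], rule exI[of _ \<tau>], rule exI[of _ "r' / 2"], intro conjI ballI allI impI)
    have "1 + of_real \<rho> * q \<noteq> 0" if "q \<in> unit_disc" for q using far[OF that] \<tau>(1) by auto
    then show "b holomorphic_on unit_disc" unfolding b_def by (intro holomorphic_intros) auto
    show "cmod (b q - 1) \<le> \<eta>" if "cmod q \<le> r' / 2" for q using r' that by (intro less_imp_le r'(2)) linarith
    show "cmod (b q) \<le> exp (N * (1 / \<tau>))" if q: "q \<in> unit_disc" for q
    proof -
      have "Re (1 / (1 + of_real \<rho> * q)) \<le> cmod (1 / (1 + of_real \<rho> * q))" by (rule complex_Re_le_cmod)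
      also have "\<dots> = 1 / cmod (1 + of_real \<rho> * q)" by (simp add: norm_divide)
      also have "\<dots> \<le> 1 / \<tau>" using far[OF q] \<tau> by (intro divide_left_mono mult_pos_pos) linarith+
      finally show ?thesis unfolding nb exp_le_cancel_iff using N by (intro mult_left_mono) linarith+
    qed
    fix q e assume q: "q \<in> unit_disc" and e: "cmod e = 1" "\<delta> \<le> cmod (1 + e)" "cmod (q - e) \<le> \<tau>"
    let ?p = "of_real \<rho> * q"
    have q1: "1 - \<tau> \<le> cmod q" using norm_triangle_ineq3[of q e] e by linarith
    have "(1 - \<tau>)\<^sup>2 \<le> cmod ?p" unfolding pq unfolding power2_eq_square \<rho>_def using q1 \<tau> by (intro mult_left_mono) auto
    moreover have "(1 - \<tau>)\<^sup>2 = 1 - 2 * \<tau> + \<tau>\<^sup>2" "(1 - 2 * \<tau>)\<^sup>2 = 1 - 4 * \<tau> + 4 * \<tau>\<^sup>2" by (simp_all add: power2_eq_square algebra_simps)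
    note sq = this
    ultimately have "1 - 2 * \<tau> \<le> cmod ?p" using zero_le_power2[of \<tau>] by linarith
    then have "(1 - 2 * \<tau>)\<^sup>2 \<le> (cmod ?p)\<^sup>2" using \<tau> by (intro power_mono) auto
    then have p2: "1 - (cmod ?p)\<^sup>2 \<le> 4 * \<tau>" using sq(2) zero_le_power2[of \<tau>] by linarith
    have "cmod (?p - q) = \<tau> * cmod q"
    proof -
      have "?p - q = - of_real \<tau> * q" by (simp add: \<rho>_def algebra_simps)
      then show ?thesis using \<tau> by (simp add: norm_mult)
    qed
    also have "\<dots> \<le> \<tau> * 1" using q \<tau> by (intro mult_left_mono) auto
    finally have "cmod (?p - q) \<le> \<tau>" by simp
    moreover have "1 + e = (1 + ?p) - ((?p - q) + (q - e))" by simp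
    then have "cmod (1 + e) \<le> cmod (1 + ?p) + (cmod (?p - q) + cmod (q - e))"
      by (metis norm_triangle_ineq4 norm_triangle_ineq add_left_mono order.trans)
    ultimately have "\<delta> * (15 / 16) \<le> cmod (1 + ?p)" using e \<tau> by linarith
    then have "(\<delta> * (15 / 16))\<^sup>2 \<le> (cmod (1 + ?p))\<^sup>2" using \<delta> by (intro power_mono) auto
    then have p3: "64 * \<tau> * (225 / 256) \<le> (cmod (1 + ?p))\<^sup>2" unfolding \<tau>(4) by (simp add: power_mult_distrib power2_eq_square)
    then have p4: "0 < (cmod (1 + ?p))\<^sup>2" using \<tau> by (intro less_le_trans[OF _ p3]) simp
    \<comment> \<open>The excess of \<open>Re (1 / (1 + p))\<close> over 1/2 is
      \<open>(1 - (cmod p)\<^sup>2) / (2 * (cmod (1 + p))\<^sup>2)\<close>, here at most 1/4; so the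
      exponent is at most \<open>- N / 4\<close>, which determines \<open>N\<close>.\<close>
    have "Re (1 / (1 + ?p)) = (1 + Re ?p) / (cmod (1 + ?p))\<^sup>2" unfolding Re_divide cmod_power2 by simp
    also have "(1 + Re ?p) = ((cmod (1 + ?p))\<^sup>2 + (1 - (cmod ?p)\<^sup>2)) / 2" unfolding cmod_power2 by (simp add: power2_eq_square algebra_simps)
    also have "\<dots> \<le> 3 / 4 * (cmod (1 + ?p))\<^sup>2" using p2 p3 \<tau> by argo
    finally have "Re (1 / (1 + ?p)) \<le> 3 / 4 * (cmod (1 + ?p))\<^sup>2 / (cmod (1 + ?p))\<^sup>2" by (simp only: divide_right_mono zero_le_power2)
    then have "Re (1 / (1 + ?p)) - 1 \<le> - 1 / 4" using p4 by simp
    then have "N * (Re (1 / (1 + ?p)) - 1) \<le> N * (- 1 / 4)" using N by (intro mult_left_mono) auto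
    then have "cmod (b q) \<le> exp (- N / 4)" unfolding nb by simp
    then show "cmod (b q) \<le> \<eta>" unfolding N(2) .
  qed (use N \<tau> r' in auto)
qed

text \<open>The substitution \<open>q = exp (- k * w)\<close> has the imaginary period
  \<open>\<bar>a\<bar> * D\<close>, so a shift by \<open>\<i> * a * m\<close> multiplies
  \<open>q\<close> by a \<open>D\<close>-th root of unity. For \<open>cmod w\<close> up to
  \<open>\<theta> * D\<close> the shifted \<open>q\<close> stays close to that root; beyond, the
  kernel is at least 1/2 and the bound \<open>M\<close> suffices. \<open>M\<close> and \<theta> come
  from the disc, hence before \<open>D\<close>.\<close>

lemma half_plane_multiplier:
  fixes \<eta> \<delta> a :: real
  assumes \<eta>: "0 < \<eta>" "\<eta> < 1" and \<delta>: "0 < \<delta>" "\<delta> \<le> 2" and a: "a \<noteq> 0"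
  shows "\<exists>M>0. \<exists>\<theta>>0. \<forall>D::nat. 0 < D \<longrightarrow> (\<exists>B T. B holomorphic_on {w. 0 < Re w} \<and> (\<forall>w. 0 < Re w \<longrightarrow> cmod (B w) \<le> M) \<and>
     (\<forall>w. 0 < Re w \<longrightarrow> T \<le> Re w \<longrightarrow> cmod (B w - 1) \<le> \<eta>) \<and>
     (\<forall>w m. 0 < Re w \<longrightarrow> \<delta> \<le> cmod (1 + cis (2 * pi * real m / real D)) \<longrightarrow>
        cmod (B (w + \<i> * of_real (a * real m))) \<le> \<eta> + 2 * M * cmod ((w + 1) / (w + 1 + of_real (\<theta> * real D)))))"
proof -
  obtain b M \<theta> r where b: "b holomorphic_on unit_disc" and pos: "0 < M" "0 < \<theta>" "0 < r"
    and M: "\<And>q. q \<in> unit_disc \<Longrightarrow> cmod (b q) \<le> M"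
    and small: "\<And>q e. q \<in> unit_disc \<Longrightarrow> cmod e = 1 \<Longrightarrow> \<delta> \<le> cmod (1 + e) \<Longrightarrow> cmod (q - e) \<le> \<theta> \<Longrightarrow> cmod (b q) \<le> \<eta>"
    and near: "\<And>q. cmod q \<le> r \<Longrightarrow> cmod (b q - 1) \<le> \<eta>"
    using disc_multiplier[OF \<eta> \<delta>] by (elim exE conjE) blast
  define \<theta>' where "\<theta>' = \<theta> * \<bar>a\<bar> / (2 * pi)"
  have \<theta>': "0 < \<theta>'" using pos a by (simp add: \<theta>'_def)
  show ?thesis
  proof (rule exI[of _ M], intro conjI pos, rule exI[of _ \<theta>'], intro conjI \<theta>' allI impI)
    fix D :: nat assume D: "0 < D"
    define k where "k = 2 * pi / (\<bar>a\<bar> * real D)"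
    have k: "0 < k" using a D by (simp add: k_def)
    have \<theta>k: "\<theta> = k * (\<theta>' * real D)" using a D by (simp add: k_def \<theta>'_def)
    have q: "exp (- of_real k * w) \<in> unit_disc" if "0 < Re w" for w using k that by simp
    show "\<exists>B T. B holomorphic_on {w. 0 < Re w} \<and> (\<forall>w. 0 < Re w \<longrightarrow> cmod (B w) \<le> M) \<and>
     (\<forall>w. 0 < Re w \<longrightarrow> T \<le> Re w \<longrightarrow> cmod (B w - 1) \<le> \<eta>) \<and>
     (\<forall>w m. 0 < Re w \<longrightarrow> \<delta> \<le> cmod (1 + cis (2 * pi * real m / real D)) \<longrightarrow>
        cmod (B (w + \<i> * of_real (a * real m))) \<le> \<eta> + 2 * M * cmod ((w + 1) / (w + 1 + of_real (\<theta>' * real D))))"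
    proof (intro exI[of _ "\<lambda>w. b (exp (- of_real k * w))"] exI[of _ "- ln r / k"] conjI allI impI)
      have "(b \<circ> (\<lambda>w. exp (- of_real k * w))) holomorphic_on {w. 0 < Re w}"
        using q by (intro holomorphic_on_compose_gen[OF _ b] holomorphic_intros) blast
      then show "(\<lambda>w. b (exp (- of_real k * w))) holomorphic_on {w. 0 < Re w}" by (simp add: o_def)
      show "cmod (b (exp (- of_real k * w))) \<le> M" if "0 < Re w" for w by (rule M[OF q[OF that]])
      show "cmod (b (exp (- of_real k * w)) - 1) \<le> \<eta>" if "- ln r / k \<le> Re w" for w
      proof (rule near)
        have "- ln r \<le> k * Re w" using that k by (metis pos_divide_le_eq mult.commute)
        then have "exp (- (k * Re w)) \<le> exp (ln r)" by simp
        then show "cmod (exp (- of_real k * w)) \<le> r" using pos by (simp add: norm_exp_eq_Re)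
      qed
      fix w m assume w: "0 < Re w" and m: "\<delta> \<le> cmod (1 + cis (2 * pi * real m / real D))"
      let ?g = "cmod ((w + 1) / (w + 1 + of_real (\<theta>' * real D)))"
      let ?q = "exp (- of_real k * (w + \<i> * of_real (a * real m)))"
      have qd: "?q \<in> unit_disc" using w by (intro q) simp
      show "cmod (b ?q) \<le> \<eta> + 2 * M * ?g"
      proof (cases "cmod w \<le> \<theta>' * real D")
        case True
        define e where "e = cis (- k * a * real m)"
        have "?q = exp (- of_real k * w) * e" by (simp add: e_def cis_conv_exp ring_distribs mult_ac flip: exp_add)
        then have "?q - e = (exp (- of_real k * w) - 1) * e" by (simp add: left_diff_distrib)
        then have "cmod (?q - e) = cmod (exp (- of_real k * w) - 1)" by (simp add: norm_mult e_def)
        also have "\<dots> \<le> cmod (- of_real k * w)" using k w by (intro norm_exp_minus_one_le) simp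
        also have "\<dots> = k * cmod w" using k by (simp add: norm_mult)
        also have "\<dots> \<le> \<theta>" unfolding \<theta>k using True k by (intro mult_left_mono) auto
        finally have "cmod (?q - e) \<le> \<theta>" .
        moreover have "\<delta> \<le> cmod (1 + e)"
        proof (cases "0 < a")
          case True
          then have "e = cnj (cis (2 * pi * real m / real D))" using a D by (simp add: e_def k_def cis_cnj)
          then have "cmod (1 + e) = cmod (cnj (1 + cis (2 * pi * real m / real D)))" by simp
          then show ?thesis using m by (simp only: complex_mod_cnj)
        next
          case False
          then have "e = cis (2 * pi * real m / real D)" using a D by (simp add: e_def k_def)
          then show ?thesis using m by simp
        qed
        ultimately have "cmod (b ?q) \<le> \<eta>" by (intro small[OF qd, of e]) (auto simp: e_def)
        then show ?thesis using pos by (intro add_increasing2) auto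
      next
        case False
        have "cmod w \<le> cmod (w + of_real 1)" using w by (intro cmod_le_cmod_add) auto
        then have w1: "\<theta>' * real D \<le> cmod (w + 1)" using False by simp
        have "cmod (w + 1 + of_real (\<theta>' * real D)) \<le> cmod (w + 1) + \<theta>' * real D"
          using norm_triangle_ineq[of "w + 1" "of_real (\<theta>' * real D)"] \<theta>' by (simp add: norm_mult)
        then have "cmod (w + 1 + of_real (\<theta>' * real D)) \<le> 2 * cmod (w + 1)" using w1 by linarith
        moreover have "0 < cmod (w + 1 + of_real (\<theta>' * real D))" using w \<theta>' by (intro cmod_pos_of_Re_pos) (simp add: add_pos_nonneg)
        ultimately have "1 \<le> 2 * ?g" unfolding norm_divide by (simp add: le_divide_eq)
        then have "M * 1 \<le> M * (2 * ?g)" using pos by (intro mult_left_mono) auto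
        then show ?thesis using M[OF qd] \<eta> by (simp add: mult.left_commute mult.assoc)
      qed
    qed
  qed
qed

text \<open>Each condition \<open>P j\<close> holds eventually, so the index may tend to infinity
  provided it waits for the thresholds \<open>N j\<close>; index 0 is the fallback.\<close>

lemma slow_index:
  fixes P :: "nat \<Rightarrow> nat \<Rightarrow> bool"
  assumes "\<And>n. P 0 n" "\<And>j. \<exists>N. \<forall>n\<ge>N. P j n"
  shows "\<exists>f. (\<forall>n. P (f n) n) \<and> (\<forall>k. \<exists>N. \<forall>n\<ge>N. k \<le> f n)"
proof -
  obtain N where N: "\<And>j n. N j \<le> n \<Longrightarrow> P j n" using assms(2) by metis
  define S where "S n = {j. j \<le> n \<and> (j = 0 \<or> N j \<le> n)}" for n
  have S: "finite (S n)" "S n \<noteq> {}" for n by (auto simp: S_def)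
  have "Max (S n) \<in> S n" for n by (rule Max_in[OF S])
  then have "P (Max (S n)) n" for n using assms(1) N by (metis (mono_tags, lifting) S_def mem_Collect_eq)
  moreover have "k \<le> Max (S n)" if "max k (N k) \<le> n" for k n using that by (intro Max_ge S(1)) (auto simp: S_def)
  ultimately show ?thesis by (intro exI[of _ "\<lambda>n. Max (S n)"]) blast
qed

lemma geometric_tail_bound:
  fixes A :: "nat set" assumes "finite A" "\<And>j. j \<in> A \<Longrightarrow> j0 \<le> j"
  shows "(\<Sum>j\<in>A. (1 / 2 :: real) ^ j) \<le> 2 * (1 / 2) ^ j0"
proof -
  have e: "(\<Sum>j\<in>{j0..<j0 + k}. (1 / 2 :: real) ^ j) = 2 * (1 / 2) ^ j0 - 2 * (1 / 2) ^ (j0 + k)" for k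
    by (induction k) auto
  have "A \<subseteq> {j0..<j0 + Suc (Max A)}"
  proof
    fix j assume "j \<in> A"
    then have "j0 \<le> j" "j \<le> Max A" using assms by auto
    then show "j \<in> {j0..<j0 + Suc (Max A)}" by simp
  qed
  then have "(\<Sum>j\<in>A. (1 / 2 :: real) ^ j) \<le> (\<Sum>j\<in>{j0..<j0 + Suc (Max A)}. (1 / 2) ^ j)" by (intro sum_mono2) auto
  then show ?thesis unfolding e using zero_le_power[of "1 / 2 :: real" "j0 + Suc (Max A)"] by linarith
qed

text \<open>The scales \<open>D j\<close> grow so fast that the multipliers for \<open>D j\<close> stay summably small along the parabolic orbit, and
  \<open>f n\<close> grows so slowly that the multiplier of scale \<open>D (f n)\<close> is already close to 1 where the hyperbolic orbit is at time \<open>n / 2\<close>.\<close>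

lemma multipliers:
  assumes \<alpha>: "cmod \<alpha> = 1" and a: "a \<noteq> (0 :: real)" and c: "0 < (c :: real)" and L: "0 < (L :: real)"
  shows "\<exists>E Q \<eta>. rich E \<and> (\<forall>n. Q n holomorphic_on {w. 0 < Re w}) \<and>
     (\<forall>n w. 0 < Re w \<longrightarrow> cmod (Q n w) \<le> 2 * exp (L * real n)) \<and>
     (\<forall>m n w. 0 < Re w \<longrightarrow> n \<le> 2 * m \<longrightarrow> c * real m \<le> Re w \<longrightarrow> cmod (Q n w - 1) \<le> \<eta> n) \<and>
     (\<forall>n. \<eta> n \<le> 1) \<and> (\<forall>e>0. \<exists>N. \<forall>n\<ge>N. \<eta> n \<le> (e :: real)) \<and>
     (\<forall>e>0. \<exists>N. \<forall>m\<in>insert 0 E. \<forall>J. finite J \<longrightarrow> (\<forall>n\<in>J. N \<le> n) \<longrightarrow>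
        (\<exists>v. L2_bounded v e \<and> (\<forall>z\<in>unit_disc. 0 \<le> v z \<and> (\<forall>n\<in>J. cmod (Q n (half_plane \<alpha> z + \<i> * of_real (a * real m))) \<le> v z))))"
proof -
  obtain \<delta>0 :: "nat \<Rightarrow> real" where \<delta>0: "\<And>j. 0 < \<delta>0 j"
    and rich: "\<And>F :: nat \<Rightarrow> nat. \<exists>D :: nat \<Rightarrow> nat. (\<forall>j. F j \<le> D j \<and> 0 < D j) \<and> rich {m \<in> blocks 2. \<forall>j. \<delta>0 j \<le> cmod (1 + cis (2 * pi * real m / real (D j)))}"
    using rich_blocks_windows[of 2] by auto
  define \<delta> where "\<delta> j = min (\<delta>0 j) 2" for j
  have \<delta>: "0 < \<delta> j" "\<delta> j \<le> 2" for j using \<delta>0 by (auto simp: \<delta>_def)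
  define \<epsilon> where "\<epsilon> j = (1 / 2 :: real) ^ Suc j" for j
  have \<epsilon>: "0 < \<epsilon> j" "\<epsilon> j < 1" for j unfolding \<epsilon>_def by (simp, rule power_Suc_less_one) auto
  define R where "R j M \<theta> D B T \<longleftrightarrow> B holomorphic_on {w. 0 < Re w} \<and> (\<forall>w. 0 < Re w \<longrightarrow> cmod (B w) \<le> M) \<and>
     (\<forall>w. 0 < Re w \<longrightarrow> T \<le> Re w \<longrightarrow> cmod (B w - 1) \<le> \<epsilon> j) \<and>
     (\<forall>w m. 0 < Re w \<longrightarrow> \<delta> j \<le> cmod (1 + cis (2 * pi * real m / real D)) \<longrightarrow>
        cmod (B (w + \<i> * of_real (a * real m))) \<le> \<epsilon> j + 2 * M * cmod ((w + 1) / (w + 1 + of_real (\<theta> * real D))))"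
    for j M \<theta> and D :: nat and B and T :: real
  have "\<exists>M>0. \<exists>\<theta>>0. \<forall>D. 0 < D \<longrightarrow> (\<exists>B T. R j M \<theta> D B T)" for j
    unfolding R_def by (rule half_plane_multiplier[OF \<epsilon> \<delta> a])
  then obtain M \<theta> where pos: "\<And>j. 0 < M j" "\<And>j. 0 < \<theta> j" and M: "\<And>j D. 0 < D \<Longrightarrow> \<exists>B T. R j (M j) (\<theta> j) D B T"
    by metis
  \<comment> \<open>Makes \<open>2 * M j / sqrt (Y j)\<close> at most \<open>(1 / 2) ^ j\<close>, so
    that the kernel terms of all scales are summable.\<close>
  define F where "F j = nat \<lceil>(2 * M j * 2 ^ j)\<^sup>2 / \<theta> j\<rceil>" for j
  obtain D where D: "\<And>j. F j \<le> D j" "\<And>j. 0 < D j" and rich': "rich {m \<in> blocks 2. \<forall>j. \<delta>0 j \<le> cmod (1 + cis (2 * pi * real m / real (D j)))}"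
    using rich[of F] by blast
  define E where "E = {m. \<forall>j. \<delta> j \<le> cmod (1 + cis (2 * pi * real m / real (D j)))}"
  have E: "rich E" using rich' by (rule rich_subset) (auto simp: E_def \<delta>_def min.coboundedI1)
  have window: "\<delta> j \<le> cmod (1 + cis (2 * pi * real m / real (D j)))" if "m \<in> insert 0 E" for m j
    using that \<delta>(2)[of j] by (auto simp: E_def)
  define Y where "Y j = \<theta> j * real (D j)" for j
  have Y: "(2 * M j * 2 ^ j)\<^sup>2 \<le> Y j" for j
  proof -
    have "(2 * M j * 2 ^ j)\<^sup>2 / \<theta> j \<le> real (D j)" using D(1)[of j] by (simp add: F_def nat_ceiling_le_eq)
    then show ?thesis using pos(2)[of j] by (simp add: Y_def pos_divide_le_eq mult.commute)
  qed
  have Y0: "0 < Y j" for j using pos D by (simp add: Y_def)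
  have MY: "2 * M j / sqrt (Y j) \<le> (1 / 2) ^ j" for j
  proof -
    have "2 * M j * 2 ^ j \<le> sqrt (Y j)" by (rule real_le_rsqrt[OF Y])
    then show ?thesis using Y0[of j] by (simp add: divide_le_eq power_divide field_simps)
  qed
  have "\<exists>B T. R j (M j) (\<theta> j) (D j) B T" for j by (rule M[OF D(2)])
  then obtain B T where R: "\<And>j. R j (M j) (\<theta> j) (D j) (B j) (T j)" by metis
  have hol: "B j holomorphic_on {w. 0 < Re w}" for j using R[of j] by (simp add: R_def)
  have B: "cmod (B j w) \<le> M j" if "0 < Re w" for j w using R[of j] that by (simp add: R_def)
  have T: "cmod (B j w - 1) \<le> \<epsilon> j" if "0 < Re w" "T j \<le> Re w" for j w using R[of j] that by (simp add: R_def)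
  have cross: "cmod (B j (w + \<i> * of_real (a * real m))) \<le> \<epsilon> j + 2 * M j * cmod ((w + 1) / (w + 1 + of_real (Y j)))"
    if "0 < Re w" "\<delta> j \<le> cmod (1 + cis (2 * pi * real m / real (D j)))" for j w m
    using R[of j] that unfolding R_def Y_def by blast
  define P where "P j n \<longleftrightarrow> j = 0 \<or> (2 * T j \<le> c * real n \<and> M j \<le> 2 * exp (L * real n))" for j n
  have "\<exists>N. \<forall>n\<ge>N. P j n" for j
  proof -
    obtain N1 where N1: "2 * T j / c < real N1" using reals_Archimedean2 by blast
    obtain N2 where N2: "M j / L < real N2" using reals_Archimedean2 by blast
    show ?thesis
    proof (intro exI[of _ "max N1 N2"] allI impI)
      fix n assume n: "max N1 N2 \<le> n"
      then have "2 * T j / c \<le> real n" "M j / L \<le> real n" using N1 N2 by linarith+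
      then have "2 * T j \<le> c * real n" and Mn: "M j \<le> L * real n" using c L by (metis pos_divide_le_eq mult.commute)+
      moreover have "M j \<le> 2 * exp (L * real n)" using exp_ge_add_one_self[of "L * real n"] Mn pos(1)[of j] by linarith
      ultimately show "P j n" by (simp add: P_def)
    qed
  qed
  moreover have "P 0 n" for n by (simp add: P_def)
  ultimately obtain f where f: "\<And>n. P (f n) n" and f_large: "\<And>k. \<exists>N. \<forall>n\<ge>N. k \<le> f n"
    using slow_index[of P] by blast
  define Q where "Q n = (if f n = 0 then (\<lambda>_. 1) else B (f n))" for n
  show ?thesis
  proof (intro exI[of _ E] exI[of _ Q] exI[of _ "\<lambda>n. \<epsilon> (f n)"] conjI E allI impI)
    show "Q n holomorphic_on {w. 0 < Re w}" for n using hol by (simp add: Q_def)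
    show "cmod (Q n w) \<le> 2 * exp (L * real n)" if w: "0 < Re w" for n w
    proof (cases "f n = 0")
      case True
      have "1 \<le> exp (L * real n)" using L by simp
      moreover have "cmod (Q n w) = 1" using True by (simp add: Q_def)
      ultimately show ?thesis by linarith
    next
      case False
      then have "M (f n) \<le> 2 * exp (L * real n)" using f[of n] by (simp add: P_def)
      then show ?thesis using False B[OF w, of "f n"] by (simp add: Q_def)
    qed
    show "cmod (Q n w - 1) \<le> \<epsilon> (f n)" if w: "0 < Re w" and n: "n \<le> 2 * m" and m: "c * real m \<le> Re w" for m n w
    proof (cases "f n = 0")
      case True
      then show ?thesis unfolding Q_def using \<epsilon>(1)[of 0] by simp
    next
      case False
      have "c * real n \<le> c * (2 * real m)" using n c by (intro mult_left_mono) auto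
      moreover have "2 * T (f n) \<le> c * real n" using f[of n] False by (simp add: P_def)
      ultimately have "T (f n) \<le> Re w" using m by simp
      then show ?thesis using False T[OF w] by (simp add: Q_def)
    qed
    show "\<epsilon> (f n) \<le> 1" for n using \<epsilon>(2)[of "f n"] by simp
    show "\<exists>N. \<forall>n\<ge>N. \<epsilon> (f n) \<le> e" if "0 < e" for e :: real
    proof -
      obtain k where k: "(1 / 2 :: real) ^ k < e" using real_arch_pow_inv[OF \<open>0 < e\<close>, of "1 / 2"] by auto
      obtain N where N: "\<forall>n\<ge>N. k \<le> f n" using f_large by blast
      have "\<epsilon> (f n) \<le> e" if "N \<le> n" for n
      proof -
        have "\<epsilon> (f n) \<le> (1 / 2) ^ k" unfolding \<epsilon>_def using N that by (intro power_decreasing) (auto simp: le_SucI)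
        then show ?thesis using k by simp
      qed
      then show ?thesis by blast
    qed
    fix e :: real assume e: "0 < e"
    have "0 < e / 4" using e by simp
    then obtain k where k: "(1 / 2 :: real) ^ k < e / 4" using real_arch_pow_inv[of "e / 4" "1 / 2"] by auto
    obtain N where N: "\<forall>n\<ge>N. Suc k \<le> f n" using f_large by blast
    show "\<exists>N. \<forall>m\<in>insert 0 E. \<forall>J. finite J \<longrightarrow> (\<forall>n\<in>J. N \<le> n) \<longrightarrow>
        (\<exists>v. L2_bounded v e \<and> (\<forall>z\<in>unit_disc. 0 \<le> v z \<and> (\<forall>n\<in>J. cmod (Q n (half_plane \<alpha> z + \<i> * of_real (a * real m))) \<le> v z)))"
    proof (intro exI[of _ N] ballI allI impI)
      fix m and J :: "nat set" assume m: "m \<in> insert 0 E" and J: "finite J" and n: "\<forall>n\<in>J. N \<le> n"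
      \<comment> \<open>Many \<open>n\<close> may share the scale \<open>f n\<close>; summing over
        the image of \<open>J\<close> under \<open>f\<close> counts every scale once, so that the
        bound is the same however large \<open>J\<close> is.\<close>
      define t where "t j z = \<epsilon> j + 2 * M j * cmod ((half_plane \<alpha> z + 1) / (half_plane \<alpha> z + 1 + of_real (Y j)))" for j z
      have t0: "0 \<le> t j z" for j z using \<epsilon>(1)[of j] pos(1)[of j] by (simp add: t_def)
      have "L2_bounded (\<lambda>z. \<Sum>j\<in>f ` J. t j z) (\<Sum>j\<in>f ` J. \<epsilon> j + 2 * M j * (1 / sqrt (Y j)))"
        unfolding t_def using J \<epsilon> pos by (intro L2_bounded_sum L2_bounded_add L2_bounded_cmult L2_bounded_const L2_bounded_kernel_real \<alpha> Y0) (auto intro: less_imp_le)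
      moreover have "(\<Sum>j\<in>f ` J. \<epsilon> j + 2 * M j * (1 / sqrt (Y j))) \<le> e"
      proof -
        have "\<epsilon> j + 2 * M j * (1 / sqrt (Y j)) \<le> 2 * (1 / 2) ^ j" for j
          using MY[of j] zero_le_power[of "1 / 2 :: real" j] by (simp add: \<epsilon>_def del: zero_le_power)
        then have "(\<Sum>j\<in>f ` J. \<epsilon> j + 2 * M j * (1 / sqrt (Y j))) \<le> (\<Sum>j\<in>f ` J. 2 * (1 / 2) ^ j)" by (rule sum_mono)
        also have "\<dots> = 2 * (\<Sum>j\<in>f ` J. (1 / 2) ^ j)" by (rule sum_distrib_left[symmetric])
        also have "\<dots> \<le> 2 * (2 * (1 / 2) ^ k)"
          using J n N by (intro mult_left_mono geometric_tail_bound) (auto dest: Suc_leD)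
        also have "\<dots> \<le> e" using k by simp
        finally show ?thesis .
      qed
      ultimately have "L2_bounded (\<lambda>z. \<Sum>j\<in>f ` J. t j z) e" by (rule L2_bounded_weaken)
      moreover have "cmod (Q n (half_plane \<alpha> z + \<i> * of_real (a * real m))) \<le> (\<Sum>j\<in>f ` J. t j z)" if nJ: "n \<in> J" and z: "z \<in> unit_disc" for n z
      proof -
        have "Suc k \<le> f n" using N n nJ by blast
        then have "Q n = B (f n)" by (simp add: Q_def)
        then have "cmod (Q n (half_plane \<alpha> z + \<i> * of_real (a * real m))) \<le> t (f n) z"
          unfolding t_def using cross[OF Re_half_plane_pos[OF \<alpha> z] window[OF m]] by simp
        also have "\<dots> \<le> (\<Sum>j\<in>f ` J. t j z)" using J nJ t0 by (intro member_le_sum) auto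
        finally show ?thesis .
      qed
      ultimately show "\<exists>v. L2_bounded v e \<and> (\<forall>z\<in>unit_disc. 0 \<le> v z \<and> (\<forall>n\<in>J. cmod (Q n (half_plane \<alpha> z + \<i> * of_real (a * real m))) \<le> v z))"
        using t0 by (intro exI[of _ "\<lambda>z. \<Sum>j\<in>f ` J. t j z"]) (auto intro: sum_nonneg)
    qed
  qed
qed

section \<open>Test functions with multipliers along both orbits\<close>

definition multiplied_piece :: "(nat \<Rightarrow> complex \<Rightarrow> complex) \<Rightarrow> complex \<Rightarrow> complex \<Rightarrow> real \<Rightarrow> (complex \<Rightarrow> complex) \<Rightarrow> nat \<Rightarrow> complex \<Rightarrow> complex" where
  "multiplied_piece Q \<alpha> \<beta> L U n z = Q n (half_plane \<alpha> z) * hyperbolic_piece \<alpha> \<beta> L U n z"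

lemma holomorphic_multiplied_piece:
  assumes "\<And>n. Q n holomorphic_on {w. 0 < Re w}" "hyperbolic_test U" "cmod \<alpha> = 1" "Re \<beta> \<le> 0"
  shows "multiplied_piece Q \<alpha> \<beta> L U n holomorphic_on unit_disc"
proof -
  have "(\<lambda>z. Q n (half_plane \<alpha> z)) holomorphic_on unit_disc"
    using assms(1)[of n] Re_half_plane_pos[OF assms(3)]
    by (intro holomorphic_half_plane_compose[of "Q n"] holomorphic_half_plane assms) auto
  then show ?thesis
    unfolding multiplied_piece_def by (intro holomorphic_on_mult holomorphic_hyperbolic_piece assms)
qed

text \<open>Up to \<open>n = 2 * m\<close> the drift to the right keeps \<open>Q n\<close> within
  distance 1 of 1. For larger \<open>n\<close> it may be as large as
  \<open>2 * exp (L * n / 8)\<close>, but then \<open>n - m\<close> is at least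
  \<open>n / 2\<close>, so with \<open>x = L * (m - n)\<close> this is at most
  \<open>2 * exp (\<bar>x\<bar> / 4)\<close> and is absorbed by the dilation rate
  \<open>exp (- \<bar>x\<bar> / 2)\<close>.\<close>

lemma multiplied_tracks:
  assumes m: "affine_model g \<alpha> \<mu> b" and \<mu>: "1 < \<mu>" and b: "0 < Re b" and U: "hyperbolic_test U"
    and Q: "\<And>n. Q n holomorphic_on {w. 0 < Re w}" "\<And>n w. 0 < Re w \<Longrightarrow> cmod (Q n w) \<le> 2 * exp (ln \<mu> / 8 * real n)"
    and Q1: "\<And>m n w. 0 < Re w \<Longrightarrow> n \<le> 2 * m \<Longrightarrow> Re b * real m \<le> Re w \<Longrightarrow> cmod (Q n w - 1) \<le> \<eta> n"
    and \<eta>: "\<And>n. \<eta> n \<le> 1" "\<And>e. 0 < e \<Longrightarrow> \<exists>N. \<forall>n\<ge>N. \<eta> n \<le> (e :: real)"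
  shows "tracks g E (\<lambda>z. U (half_plane \<alpha> z - center \<mu> b)) (multiplied_piece Q \<alpha> (center \<mu> b) (ln \<mu>) U)"
proof -
  define \<beta> L where "\<beta> = center \<mu> b" and "L = ln \<mu>"
  note \<alpha> = affine_modelD(1)[OF m] and g = affine_modelD(5,4)[OF m]
  have \<beta>: "Re \<beta> \<le> 0" unfolding \<beta>_def by (rule Re_center[OF \<mu> affine_modelD(3)[OF m]])
  have L: "0 < L" using \<mu> by (simp add: L_def)
  let ?y = "multiplied_piece Q \<alpha> \<beta> L U"
  define W where "W k z = half_plane \<alpha> ((g ^^ k) z)" for k z
  have W: "0 < Re (W k z)" "Re b * real k \<le> Re (W k z)" if "z \<in> unit_disc" for k z
    using Re_half_plane_pos[OF \<alpha> affine_model_iterate(1)[OF m that]] Re_hyperbolic_iterate_ge[OF m that] by (simp_all add: W_def mult.commute)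
  have eq: "?y n ((g ^^ k) z) = Q n (W k z) * U (of_real (exp (L * real k - L * real n)) * (half_plane \<alpha> z - \<beta>))" if "z \<in> unit_disc" for n k z
    unfolding multiplied_piece_def W_def \<beta>_def L_def hyperbolic_piece_iterate[OF m \<mu> that] ..
  have hol: "(\<lambda>z. ?y n ((g ^^ k) z)) holomorphic_on unit_disc" for n k
    by (intro holomorphic_iterate_compose g holomorphic_multiplied_piece Q U \<alpha> \<beta>)
  obtain C where C: "0 \<le> C" "\<And>w. 0 < Re w \<Longrightarrow> cmod (U w) \<le> C * cmod w / (cmod (w + 1))\<^sup>2" and U': "U holomorphic_on {w. 0 < Re w}"
    using U by (auto simp: hyperbolic_test_def)
  have v: "0 < Re (half_plane \<alpha> z - \<beta>)" if "z \<in> unit_disc" for z using Re_half_plane_pos[OF \<alpha> that] \<beta> by simp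
  have UC: "cmod (U v) \<le> C" if v: "0 < Re v" for v
  proof -
    have "1 \<le> cmod (v + 1)" using v by (intro cmod_plus_one_ge) simp
    then have "1 / cmod (v + 1) \<le> 1" by (subst divide_le_eq_1_pos) linarith+
    then have "C * (1 / cmod (v + 1)) \<le> C * 1" using C by (intro mult_left_mono) auto
    then show ?thesis using hyperbolic_test_bounds(1)[OF C(2)[OF v] C(1) v] by simp
  qed
  define K1 where "K1 = C * (2 + cmod \<beta>)"
  have K1: "0 \<le> K1" using C by (simp add: K1_def)
  have dil: "L2_bounded (\<lambda>z. cmod (U (of_real (exp x) * (half_plane \<alpha> z - \<beta>)))) (K1 * exp (- \<bar>x\<bar> / 2))" for x
    unfolding K1_def by (rule hyperbolic_dilation_bound[OF U' C(2,1) \<alpha> \<beta>])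
  obtain K2 where K2: "0 < K2" "\<And>(J :: nat set) t. finite J \<Longrightarrow> (\<Sum>n\<in>J. exp (- (1 / 8) * \<bar>t - L * real n\<bar>)) \<le> K2"
    using exp_sum_bound[of L "1 / 8"] L by auto
  have Qb: "cmod (Q n (W k z)) \<le> 2 * exp (\<bar>L * real k - L * real n\<bar> / 4)" if z: "z \<in> unit_disc" for n k z
  proof (cases "n \<le> 2 * k")
    case True
    have "cmod (Q n (W k z)) \<le> cmod (Q n (W k z) - 1) + 1" using norm_triangle_ineq[of "Q n (W k z) - 1" 1] by simp
    also have "\<dots> \<le> 2" using Q1[OF W(1)[OF z] True W(2)[OF z]] \<eta>(1)[of n] by linarith
    also have "2 \<le> 2 * exp (\<bar>L * real k - L * real n\<bar> / 4)" by simp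
    finally show ?thesis .
  next
    case False
    then have "real n * (1 / 8) \<le> (real n - real k) / 4" by simp
    then have "L * (real n * (1 / 8)) \<le> L * ((real n - real k) / 4)" using L by (intro mult_left_mono) auto
    also have "\<dots> = (L * real n - L * real k) / 4" by (simp add: right_diff_distrib)
    also have "\<dots> \<le> \<bar>L * real k - L * real n\<bar> / 4"
      by (rule divide_right_mono) (metis abs_ge_minus_self minus_diff_eq, simp)
    finally have "exp (L / 8 * real n) \<le> exp (\<bar>L * real k - L * real n\<bar> / 4)" by (simp add: mult_ac)
    then show ?thesis using Q(2)[OF W(1)[OF z], of n k] unfolding L_def by linarith
  qed
  have "tracks g E (\<lambda>z. U (half_plane \<alpha> z - \<beta>)) ?y"
    unfolding tracks_def
  proof (intro allI impI)
    fix e :: real assume e: "0 < e"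
    have "0 < e / (C + 1)" using e C by simp
    then obtain N1 where N1: "\<forall>n\<ge>N1. \<eta> n \<le> e / (C + 1)" using \<eta>(2) by blast
    obtain N0 where N0: "\<And>N. N0 \<le> N \<Longrightarrow> 2 * (K1 + 1) * K2 * exp (- N / 4) \<le> e"
      using exp_bound_small[OF e, of "2 * (K1 + 1) * K2"] K1 K2 by auto
    obtain N2 where "N0 / (L / 2) < real N2" using reals_Archimedean2 by blast
    then have N2: "N0 \<le> L * real N2 / 2" using L by (simp add: divide_less_eq mult.commute)
    show "\<exists>N. (\<forall>k\<in>E. N \<le> k \<longrightarrow> L2_bounded (\<lambda>z. cmod (?y k ((g ^^ k) z) - U (half_plane \<alpha> z - \<beta>))) e) \<and>
     (\<forall>k\<in>insert 0 E. \<forall>J. finite J \<longrightarrow> J \<subseteq> E \<longrightarrow> (\<forall>n\<in>J. int N \<le> \<bar>int n - int k\<bar>) \<longrightarrow>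
        L2_bounded (\<lambda>z. cmod (\<Sum>n\<in>J. ?y n ((g ^^ k) z))) e)"
    proof (intro exI[of _ "max N1 N2"] conjI ballI allI impI)
      fix k assume k: "max N1 N2 \<le> k"
      show "L2_bounded (\<lambda>z. cmod (?y k ((g ^^ k) z) - U (half_plane \<alpha> z - \<beta>))) e"
      proof (rule L2_bounded_holomorphic[OF _ L2_bounded_const[of e] _ order_refl])
        have "(\<lambda>z. U (half_plane \<alpha> z - \<beta>)) holomorphic_on unit_disc"
          using U' v by (intro holomorphic_half_plane_compose[of U] holomorphic_intros holomorphic_half_plane \<alpha>) auto
        then show "(\<lambda>z. ?y k ((g ^^ k) z) - U (half_plane \<alpha> z - \<beta>)) holomorphic_on unit_disc" by (intro holomorphic_on_diff hol)
        fix z assume z: "z \<in> unit_disc"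
        have "?y k ((g ^^ k) z) - U (half_plane \<alpha> z - \<beta>) = (Q k (W k z) - 1) * U (half_plane \<alpha> z - \<beta>)"
          by (simp add: eq[OF z] left_diff_distrib)
        then have "cmod (?y k ((g ^^ k) z) - U (half_plane \<alpha> z - \<beta>)) = cmod (Q k (W k z) - 1) * cmod (U (half_plane \<alpha> z - \<beta>))"
          by (simp only: norm_mult)
        also have "\<dots> \<le> e / (C + 1) * C"
        proof (intro mult_mono UC v z)
          have "cmod (Q k (W k z) - 1) \<le> \<eta> k" by (rule Q1[OF W(1)[OF z] _ W(2)[OF z]]) simp
          then show "cmod (Q k (W k z) - 1) \<le> e / (C + 1)" using N1 k by (meson max.boundedE order.trans)
        qed (use e C in auto)
        also have "\<dots> = e * (C / (C + 1))" by simp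
        also have "\<dots> \<le> e * 1" using e C by (intro mult_left_mono) auto
        finally show "cmod (?y k ((g ^^ k) z) - U (half_plane \<alpha> z - \<beta>)) \<le> e" by simp
      qed (use e in auto)
    next
      fix k J assume J: "finite J" and s: "\<forall>n\<in>J. int (max N1 N2) \<le> \<bar>int n - int k\<bar>"
      define x where "x n = L * real k - L * real n" for n
      have x: "L * real N2 \<le> \<bar>x n\<bar>" if "n \<in> J" for n
      proof -
        have "int N2 \<le> \<bar>int n - int k\<bar>" using s that by force
        then have "real N2 \<le> \<bar>real k - real n\<bar>" by linarith
        then have "L * real N2 \<le> \<bar>L\<bar> * \<bar>real k - real n\<bar>" using L by (simp add: mult_left_mono)
        then show ?thesis by (simp add: x_def flip: abs_mult right_diff_distrib)
      qed
      show "L2_bounded (\<lambda>z. cmod (\<Sum>n\<in>J. ?y n ((g ^^ k) z))) e"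
      proof (rule L2_bounded_holomorphic)
        show "(\<lambda>z. \<Sum>n\<in>J. ?y n ((g ^^ k) z)) holomorphic_on unit_disc" by (intro holomorphic_on_sum hol)
        show "L2_bounded (\<lambda>z. \<Sum>n\<in>J. 2 * exp (\<bar>x n\<bar> / 4) * cmod (U (of_real (exp (x n)) * (half_plane \<alpha> z - \<beta>)))) (\<Sum>n\<in>J. 2 * exp (\<bar>x n\<bar> / 4) * (K1 * exp (- \<bar>x n\<bar> / 2)))"
          by (intro L2_bounded_sum J L2_bounded_cmult dil) simp
        have "2 * exp (\<bar>x n\<bar> / 4) * (K1 * exp (- \<bar>x n\<bar> / 2)) \<le> 2 * (K1 + 1) * exp (- (L * real N2 / 2) / 4) * exp (- (1 / 8) * \<bar>x n\<bar>)" if n: "n \<in> J" for n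
        proof -
          have "exp (\<bar>x n\<bar> / 4) * exp (- \<bar>x n\<bar> / 2) = exp (- \<bar>x n\<bar> / 4)" by (simp flip: exp_add)
          also have "\<dots> \<le> exp (- (L * real N2 / 2) / 4) * exp (- (1 / 8) * \<bar>x n\<bar>)" using x[OF n] by (simp flip: exp_add)
          finally have le: "exp (\<bar>x n\<bar> / 4) * exp (- \<bar>x n\<bar> / 2) \<le> exp (- (L * real N2 / 2) / 4) * exp (- (1 / 8) * \<bar>x n\<bar>)" .
          have "(2 * K1) * (exp (\<bar>x n\<bar> / 4) * exp (- \<bar>x n\<bar> / 2)) \<le> (2 * (K1 + 1)) * (exp (- (L * real N2 / 2) / 4) * exp (- (1 / 8) * \<bar>x n\<bar>))"
            by (rule mult_mono[OF _ le]) (use K1 in auto)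
          then show ?thesis by (simp only: mult_ac)
        qed
        then have "(\<Sum>n\<in>J. 2 * exp (\<bar>x n\<bar> / 4) * (K1 * exp (- \<bar>x n\<bar> / 2))) \<le> (\<Sum>n\<in>J. 2 * (K1 + 1) * exp (- (L * real N2 / 2) / 4) * exp (- (1 / 8) * \<bar>x n\<bar>))"
          by (rule sum_mono)
        also have "\<dots> = 2 * (K1 + 1) * exp (- (L * real N2 / 2) / 4) * (\<Sum>n\<in>J. exp (- (1 / 8) * \<bar>x n\<bar>))" by (rule sum_distrib_left[symmetric])
        also have "\<dots> \<le> 2 * (K1 + 1) * exp (- (L * real N2 / 2) / 4) * K2"
          unfolding x_def using K1 by (intro mult_left_mono K2(2) J) auto
        also have "\<dots> = 2 * (K1 + 1) * K2 * exp (- (L * real N2 / 2) / 4)" by (simp only: mult_ac)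
        also have "\<dots> \<le> e" by (rule N0[OF N2])
        finally show "(\<Sum>n\<in>J. 2 * exp (\<bar>x n\<bar> / 4) * (K1 * exp (- \<bar>x n\<bar> / 2))) \<le> e" .
        fix z assume z: "z \<in> unit_disc"
        show "cmod (\<Sum>n\<in>J. ?y n ((g ^^ k) z)) \<le> (\<Sum>n\<in>J. 2 * exp (\<bar>x n\<bar> / 4) * cmod (U (of_real (exp (x n)) * (half_plane \<alpha> z - \<beta>))))"
          unfolding eq[OF z] x_def
          by (intro sum_norm_le) (simp only: norm_mult, intro mult_right_mono Qb[OF z] norm_ge_zero)
      qed
    qed
  qed
  then show ?thesis by (simp add: \<beta>_def L_def)
qed

text \<open>For late \<open>n\<close> one majorant, small in quadratic mean, controls all
  multipliers at once, and the dilates are summable pointwise. The finitely many \<open>n\<close>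
  below \<open>N1\<close> only meet late orbit times, when the imaginary shift carries the dilates
  far out to where they decay.\<close>

lemma multiplied_vanishes:
  assumes m: "affine_model g' \<alpha> 1 b'" and b': "Re b' = 0" and \<beta>: "Re \<beta> \<le> 0" and L: "0 < L" and U: "hyperbolic_test U"
    and Q: "\<And>n. Q n holomorphic_on {w. 0 < Re w}" "\<And>n w. 0 < Re w \<Longrightarrow> cmod (Q n w) \<le> 2 * exp (L / 8 * real n)"
    and cross: "\<And>e. 0 < e \<Longrightarrow> \<exists>N. \<forall>m\<in>insert 0 E. \<forall>J. finite J \<longrightarrow> (\<forall>n\<in>J. N \<le> n) \<longrightarrow>
        (\<exists>v. L2_bounded v e \<and> (\<forall>z\<in>unit_disc. 0 \<le> v z \<and> (\<forall>n\<in>J. cmod (Q n (half_plane \<alpha> z + \<i> * of_real (Im b' * real m))) \<le> v z)))"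
  shows "vanishes g' E (multiplied_piece Q \<alpha> \<beta> L U)"
  unfolding vanishes_def
proof (intro allI impI)
  fix e :: real assume e: "0 < e"
  note \<alpha> = affine_modelD(1)[OF m] and g = affine_modelD(5,4)[OF m]
  let ?y = "multiplied_piece Q \<alpha> \<beta> L U"
  have hol: "(\<lambda>z. ?y n ((g' ^^ k) z)) holomorphic_on unit_disc" for n k
    by (intro holomorphic_iterate_compose g holomorphic_multiplied_piece Q U \<alpha> \<beta>)
  define a where "a = Im b'"
  have "b' \<noteq> 0" using m by (simp add: affine_model_def)
  then have a: "a \<noteq> 0" using b' by (simp add: a_def complex_eq_iff)
  define W where "W k z = half_plane \<alpha> z + \<i> * of_real (a * real k)" for k z
  have W: "0 < Re (W k z)" if "z \<in> unit_disc" for k z using Re_half_plane_pos[OF \<alpha> that] by (simp add: W_def)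
  have W\<beta>: "0 < Re (W k z - \<beta>)" if "z \<in> unit_disc" for k z using W[OF that, of k] \<beta> by simp
  have eq: "?y n ((g' ^^ k) z) = Q n (W k z) * U (of_real (exp (- L * real n)) * (W k z - \<beta>))" if "z \<in> unit_disc" for n k z
    unfolding multiplied_piece_def hyperbolic_piece_def parabolic_iterate[OF m b' that] W_def a_def ..
  obtain C where C: "0 \<le> C" "\<And>w. 0 < Re w \<Longrightarrow> cmod (U w) \<le> C * cmod w / (cmod (w + 1))\<^sup>2"
    using U by (auto simp: hyperbolic_test_def)
  obtain K where K: "0 < K" "\<And>(J :: nat set) v. finite J \<Longrightarrow> 0 < Re v \<Longrightarrow> (\<Sum>n\<in>J. cmod (U (of_real (exp (- L * real n)) * v))) \<le> K"
    using hyperbolic_test_sum[OF U L] by blast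
  have "0 < e / (2 * K)" using e K by simp
  from cross[OF this] obtain N1 where N1: "\<forall>k\<in>insert 0 E. \<forall>J. finite J \<longrightarrow> (\<forall>n\<in>J. N1 \<le> n) \<longrightarrow>
        (\<exists>v. L2_bounded v (e / (2 * K)) \<and> (\<forall>z\<in>unit_disc. 0 \<le> v z \<and> (\<forall>n\<in>J. cmod (Q n (W k z)) \<le> v z)))"
    unfolding W_def a_def by (elim exE) assumption
  \<comment> \<open>Chosen so that adding 1 to the dilated argument gives
    \<open>exp (- L * n)\<close> times \<open>half_plane \<alpha> z + p k n\<close>; it tends to
    infinity with \<open>k\<close>.\<close>
  define p where "p k n = \<i> * of_real (a * real k) - \<beta> + of_real (exp (L * real n))" for k and n :: nat
  have p: "1 \<le> Re (p k n)" for k n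
  proof -
    have "1 \<le> exp (L * real n)" using L by simp
    moreover have "Re (p k n) = exp (L * real n) - Re \<beta>" by (simp add: p_def)
    ultimately show ?thesis using \<beta> by linarith
  qed
  have pk: "\<bar>a\<bar> * real k - cmod \<beta> \<le> cmod (p k n)" for k n
  proof -
    have "\<bar>a\<bar> * real k = \<bar>Im (p k n) + Im \<beta>\<bar>" by (simp add: p_def abs_mult)
    also have "\<dots> \<le> cmod (p k n) + cmod \<beta>" using abs_Im_le_cmod[of "p k n"] abs_Im_le_cmod[of \<beta>] by linarith
    finally show ?thesis by simp
  qed
  define X where "X = 2 * exp (L * real N1) * (C * exp (L * real N1))"
  have X: "0 \<le> X" using C by (simp add: X_def)
  \<comment> \<open>From \<open>M0\<close> on each of the at most \<open>N1\<close> early terms is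
    bounded by \<open>e / (2 * N1)\<close>; the summand 1 keeps \<open>p k n\<close> away from
    0.\<close>
  obtain M0 where "(cmod \<beta> + 4 * X * real N1 / e + 1) / \<bar>a\<bar> < real M0" using reals_Archimedean2 by blast
  then have M0: "cmod \<beta> + 4 * X * real N1 / e + 1 \<le> \<bar>a\<bar> * real M0" using a by (simp add: divide_less_eq mult.commute)
  have early: "L2_bounded (\<lambda>z. X * cmod (1 / (half_plane \<alpha> z + p k n))) (e / (2 * real N1))" if k: "M0 \<le> k" and n: "n < N1" for k n
  proof -
    have "\<bar>a\<bar> * real M0 \<le> \<bar>a\<bar> * real k" using k by (intro mult_left_mono) auto
    then have pp: "4 * X * real N1 / e + 1 \<le> cmod (p k n)" using M0 pk[of k n] by linarith
    have nn: "0 \<le> 4 * X * real N1 / e" using X e by simp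
    then have p0: "0 < cmod (p k n)" using pp by linarith
    have "1 / sqrt (Re (p k n)) \<le> 1" using p[of k n] by simp
    then have "X * ((1 + 1 / sqrt (Re (p k n))) / cmod (p k n)) \<le> X * (2 / cmod (p k n))" using X p0 by (intro mult_left_mono divide_right_mono) auto
    also have "\<dots> \<le> e / (2 * real N1)"
    proof -
      have "4 * X * real N1 / e \<le> cmod (p k n)" using pp by linarith
      then have "4 * X * real N1 \<le> e * cmod (p k n)" using e by (simp only: pos_divide_le_eq mult.commute)
      then show ?thesis using p0 n e by (simp add: divide_simps mult_ac)
    qed
    finally have "X * ((1 + 1 / sqrt (Re (p k n))) / cmod (p k n)) \<le> e / (2 * real N1)" .
    moreover have "L2_bounded (\<lambda>z. X * cmod (1 / (half_plane \<alpha> z + p k n))) (X * ((1 + 1 / sqrt (Re (p k n))) / cmod (p k n)))"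
      using p[of k n] X by (intro L2_bounded_cmult L2_bounded_inverse_far \<alpha>) linarith+
    ultimately show ?thesis by (rule L2_bounded_weaken[rotated])
  qed
  have early_le: "cmod (?y n ((g' ^^ k) z)) \<le> X * cmod (1 / (half_plane \<alpha> z + p k n))" if z: "z \<in> unit_disc" and n: "n < N1" for k n z
  proof -
    let ?v = "of_real (exp (- L * real n)) * (W k z - \<beta>)"
    have v: "0 < Re ?v" using W\<beta>[OF z, of k] by simp
    have Ln: "L * real n \<le> L * real N1" "L / 8 * real n \<le> L * real N1" using n L by (auto intro!: mult_mono)
    have "of_real (exp (- L * real n)) * of_real (exp (L * real n)) = (1 :: complex)" by (simp flip: of_real_mult exp_add)
    then have "?v + 1 = of_real (exp (- L * real n)) * (half_plane \<alpha> z + p k n)" by (simp only: p_def W_def ring_distribs) (simp add: algebra_simps)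
    then have "cmod (?v + 1) = exp (- L * real n) * cmod (half_plane \<alpha> z + p k n)" by (simp only: norm_mult norm_of_real abs_exp_cancel)
    then have v1: "1 / cmod (?v + 1) = exp (L * real n) * cmod (1 / (half_plane \<alpha> z + p k n))" by (simp add: norm_inverse exp_minus divide_inverse)
    have "cmod (?y n ((g' ^^ k) z)) = cmod (Q n (W k z)) * cmod (U ?v)" by (simp only: eq[OF z] norm_mult)
    also have "\<dots> \<le> (2 * exp (L / 8 * real n)) * (C * (1 / cmod (?v + 1)))"
      by (intro mult_mono Q(2) W z hyperbolic_test_bounds(1)[OF C(2)[OF v] C(1) v]) auto
    also have "\<dots> = (2 * exp (L / 8 * real n) * (C * exp (L * real n))) * cmod (1 / (half_plane \<alpha> z + p k n))" unfolding v1 by (simp only: mult_ac)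
    also have "\<dots> \<le> X * cmod (1 / (half_plane \<alpha> z + p k n))"
      unfolding X_def using Ln C by (intro mult_right_mono mult_mono mult_left_mono) auto
    finally show ?thesis .
  qed
  show "\<exists>N. \<forall>k\<in>insert 0 E. \<forall>J. finite J \<longrightarrow> J \<subseteq> E \<longrightarrow> (\<forall>n\<in>J. N \<le> max k n) \<longrightarrow>
        L2_bounded (\<lambda>z. cmod (\<Sum>n\<in>J. ?y n ((g' ^^ k) z))) e"
  proof (intro exI[of _ "max N1 M0"] ballI allI impI)
    fix k J assume kE: "k \<in> insert 0 E" and J: "finite J" and s: "\<forall>n\<in>J. max N1 M0 \<le> max k n"
    define J1 J2 where "J1 = {n\<in>J. N1 \<le> n}" and "J2 = {n\<in>J. n < N1}"
    have fin: "finite J1" "finite J2" and J12: "J = J1 \<union> J2" "J1 \<inter> J2 = {}" using J by (auto simp: J1_def J2_def)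
    obtain v where v: "L2_bounded v (e / (2 * K))" "\<And>z. z \<in> unit_disc \<Longrightarrow> 0 \<le> v z" "\<And>z n. z \<in> unit_disc \<Longrightarrow> n \<in> J1 \<Longrightarrow> cmod (Q n (W k z)) \<le> v z"
      using N1[THEN bspec, OF kE, THEN spec, of J1] fin(1) by (auto simp: J1_def)
    show "L2_bounded (\<lambda>z. cmod (\<Sum>n\<in>J. ?y n ((g' ^^ k) z))) e"
    proof (rule L2_bounded_holomorphic)
      show "(\<lambda>z. \<Sum>n\<in>J. ?y n ((g' ^^ k) z)) holomorphic_on unit_disc" by (intro holomorphic_on_sum hol)
      have kM: "M0 \<le> k" "n < N1" if "n \<in> J2" for n using s that by (auto simp: J2_def)
      show "L2_bounded (\<lambda>z. K * v z + (\<Sum>n\<in>J2. X * cmod (1 / (half_plane \<alpha> z + p k n)))) (K * (e / (2 * K)) + (\<Sum>n\<in>J2. e / (2 * real N1)))"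
        using K v(1) kM by (intro L2_bounded_add L2_bounded_cmult L2_bounded_sum fin early) auto
      show "K * (e / (2 * K)) + (\<Sum>n\<in>J2. e / (2 * real N1)) \<le> e"
      proof -
        have "J2 \<subseteq> {..<N1}" by (auto simp: J2_def)
        then have "card J2 \<le> N1" using card_mono[of "{..<N1}" J2] by simp
        then have "real (card J2) * (e / (2 * real N1)) \<le> real N1 * (e / (2 * real N1))" using e by (intro mult_right_mono) auto
        also have "\<dots> \<le> e / 2" using e by simp
        finally have "(\<Sum>n\<in>J2. e / (2 * real N1)) \<le> e / 2" by simp
        moreover have "K * (e / (2 * K)) = e / 2" using K by simp
        ultimately show ?thesis by linarith
      qed
      fix z assume z: "z \<in> unit_disc"
      have "cmod (\<Sum>n\<in>J1. ?y n ((g' ^^ k) z)) \<le> (\<Sum>n\<in>J1. v z * cmod (U (of_real (exp (- L * real n)) * (W k z - \<beta>))))"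
        unfolding eq[OF z] by (intro sum_norm_le) (simp only: norm_mult, intro mult_right_mono v(3) z norm_ge_zero)
      also have "\<dots> = v z * (\<Sum>n\<in>J1. cmod (U (of_real (exp (- L * real n)) * (W k z - \<beta>))))" by (rule sum_distrib_left[symmetric])
      also have "\<dots> \<le> v z * K" by (intro mult_left_mono K(2) fin W\<beta> v(2) z)
      finally have s1: "cmod (\<Sum>n\<in>J1. ?y n ((g' ^^ k) z)) \<le> K * v z" by (simp only: mult.commute)
      have s2: "cmod (\<Sum>n\<in>J2. ?y n ((g' ^^ k) z)) \<le> (\<Sum>n\<in>J2. X * cmod (1 / (half_plane \<alpha> z + p k n)))"
        by (intro sum_norm_le early_le z kM(2))
      have "(\<Sum>n\<in>J. ?y n ((g' ^^ k) z)) = (\<Sum>n\<in>J1. ?y n ((g' ^^ k) z)) + (\<Sum>n\<in>J2. ?y n ((g' ^^ k) z))"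
        unfolding J12(1) by (rule sum.union_disjoint[OF fin J12(2)])
      then show "cmod (\<Sum>n\<in>J. ?y n ((g' ^^ k) z)) \<le> K * v z + (\<Sum>n\<in>J2. X * cmod (1 / (half_plane \<alpha> z + p k n)))"
        using s1 s2 by (simp only: norm_triangle_le add_mono)
    qed
  qed
qed

lemma steers_hyperbolic_parabolic:
  assumes m: "affine_model g \<alpha> \<mu> b" and \<mu>: "1 < \<mu>" and b: "0 < Re b" and m': "affine_model g' \<alpha> 1 b'" and b': "Re b' = 0"
  shows "\<exists>E. rich E \<and> steers g g' E"
proof -
  note \<alpha> = affine_modelD(1)[OF m]
  have a: "Im b' \<noteq> 0" using m' b' by (auto simp: affine_model_def complex_eq_iff)
  have L: "0 < ln \<mu>" "0 < ln \<mu> / 8" using \<mu> by auto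
  have \<beta>: "Re (center \<mu> b) \<le> 0" by (rule Re_center[OF \<mu> affine_modelD(3)[OF m]])
  from multipliers[OF \<alpha> a b L(2)] obtain E Q \<eta> where E: "rich E" and Q: "\<And>n. Q n holomorphic_on {w. 0 < Re w}"
      "\<And>n w. 0 < Re w \<Longrightarrow> cmod (Q n w) \<le> 2 * exp (ln \<mu> / 8 * real n)"
    and Q1: "\<And>m n w. 0 < Re w \<Longrightarrow> n \<le> 2 * m \<Longrightarrow> Re b * real m \<le> Re w \<Longrightarrow> cmod (Q n w - 1) \<le> \<eta> n"
    and \<eta>: "\<And>n. \<eta> n \<le> 1" "\<And>e. 0 < e \<Longrightarrow> \<exists>N. \<forall>n\<ge>N. \<eta> n \<le> (e :: real)"
    and cross: "\<And>e. 0 < e \<Longrightarrow> \<exists>N. \<forall>m\<in>insert 0 E. \<forall>J. finite J \<longrightarrow> (\<forall>n\<in>J. N \<le> n) \<longrightarrow>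
        (\<exists>v. L2_bounded v e \<and> (\<forall>z\<in>unit_disc. 0 \<le> v z \<and> (\<forall>n\<in>J. cmod (Q n (half_plane \<alpha> z + \<i> * of_real (Im b' * real m))) \<le> v z)))"
    by (elim exE conjE) blast
  have "steers g g' E"
    unfolding steers_def
  proof (intro allI impI)
    fix p and e :: real assume e: "0 < e"
    obtain U where U: "hyperbolic_test U" "L2_bounded (\<lambda>z. cmod (poly p z - U (half_plane \<alpha> z - center \<mu> b))) e"
      using hyperbolic_test_dense[OF \<alpha> \<beta> e] by blast
    have "(\<lambda>z. U (half_plane \<alpha> z - center \<mu> b)) holomorphic_on unit_disc"
      using U(1) Re_dilation_pos[OF \<alpha> \<beta>, of _ 0]
      by (intro holomorphic_half_plane_compose[of U] holomorphic_intros holomorphic_half_plane \<alpha>) (auto simp: hyperbolic_test_def)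
    then show "\<exists>u y. u holomorphic_on unit_disc \<and> L2_bounded (\<lambda>z. cmod (poly p z - u z)) e \<and> (\<forall>n. y n holomorphic_on unit_disc) \<and>
       tracks g E u y \<and> vanishes g' E y"
      by (intro exI[of _ "\<lambda>z. U (half_plane \<alpha> z - center \<mu> b)"] exI[of _ "multiplied_piece Q \<alpha> (center \<mu> b) (ln \<mu>) U"] conjI allI U
          holomorphic_multiplied_piece Q \<alpha> \<beta> multiplied_tracks[OF m \<mu> b U(1) Q Q1 \<eta>] multiplied_vanishes[OF m' b' \<beta> L(1) U(1) Q cross])
  qed
  with E show ?thesis by blast
qed

section \<open>The characterization\<close>

text \<open>The hypothesis \<open>ne\<close> makes the translation lengths of two parabolic
  automorphisms with a common attractive fixed point differ; in the remaining cases the conditions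
  themselves separate the maps.\<close>

lemma hypercyclic_pair_affine_models:
  assumes m1: "affine_model g1 \<alpha>1 \<mu>1 b1" and m2: "affine_model g2 \<alpha>2 \<mu>2 b2" and ne: "(\<alpha>1, \<mu>1, b1) \<noteq> (\<alpha>2, \<mu>2, b2)"
  shows "hypercyclic_pair g1 g2 \<longleftrightarrow> (\<mu>1 = 1 \<longrightarrow> Re b1 = 0) \<and> (\<mu>2 = 1 \<longrightarrow> Re b2 = 0) \<and>
     (\<alpha>1 = \<alpha>2 \<longrightarrow> (\<mu>1 = 1 \<and> \<mu>2 = 1 \<or> 1 < \<mu>1 \<and> 1 < \<mu>2 \<and> \<mu>1 \<noteq> \<mu>2 \<or>
        \<mu>1 = 1 \<and> 1 < \<mu>2 \<and> Re b2 \<noteq> 0 \<or> \<mu>2 = 1 \<and> 1 < \<mu>1 \<and> Re b1 \<noteq> 0))" (is "?L \<longleftrightarrow> ?R")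
proof
  note ge = affine_modelD(2)[OF m1] affine_modelD(2)[OF m2] affine_modelD(3)[OF m1] affine_modelD(3)[OF m2]
  assume h: ?L
  have h': "hypercyclic_pair g2 g1" using h by (rule hypercyclic_pair_swap)
  have p1: "Re b1 = 0" if "\<mu>1 = 1"
    using parabolic_nonautomorphism_not_hypercyclic[of g1 \<alpha>1 b1 g2] m1 that h ge(3) by force
  have p2: "Re b2 = 0" if "\<mu>2 = 1"
    using parabolic_nonautomorphism_not_hypercyclic[of g2 \<alpha>2 b2 g1] m2 that h' ge(4) by force
  have "\<mu>1 \<noteq> \<mu>2" if "\<alpha>1 = \<alpha>2" "1 < \<mu>1"
    using equal_multipliers_not_hypercyclic[of g1 \<alpha>1 \<mu>1 b1 g2 b2] m1 m2 that h by auto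
  moreover have "Re b2 \<noteq> 0" if "\<alpha>1 = \<alpha>2" "\<mu>1 = 1" "1 < \<mu>2"
    using parabolic_hyperbolic_automorphism_not_hypercyclic[of g1 \<alpha>1 b1 g2 \<mu>2 b2] m1 m2 that h p1 by auto
  moreover have "Re b1 \<noteq> 0" if "\<alpha>1 = \<alpha>2" "\<mu>2 = 1" "1 < \<mu>1"
    using parabolic_hyperbolic_automorphism_not_hypercyclic[of g2 \<alpha>2 b2 g1 \<mu>1 b1] m1 m2 that h' p2 by auto
  ultimately show ?R using p1 p2 ge(1,2) by (auto simp: order_le_less)
next
  assume R: ?R
  have "\<exists>E. rich E \<and> steers g1 g2 E \<and> steers g2 g1 E"
  proof (cases "\<alpha>1 = \<alpha>2")
    case False
    \<comment> \<open>With distinct attractors no relation between the two speeds is involved, so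
      the simplest blocks serve.\<close>
    have "rich (blocks 2)" by (rule rich_blocks) simp
    then show ?thesis
      using steers_distinct_attractors[OF m1 _ m2 False] steers_distinct_attractors[OF m2 _ m1 False[symmetric]] R by blast
  next
    case True
    have m2': "affine_model g2 \<alpha>1 \<mu>2 b2" using m2 True by simp
    from R True consider "\<mu>1 = 1" "\<mu>2 = 1" "Re b1 = 0" "Re b2 = 0" | "1 < \<mu>1" "1 < \<mu>2" "\<mu>1 \<noteq> \<mu>2" |
       "\<mu>1 = 1" "1 < \<mu>2" "Re b1 = 0" "0 < Re b2" | "\<mu>2 = 1" "1 < \<mu>1" "Re b2 = 0" "0 < Re b1"
      using affine_modelD(3)[OF m1] affine_modelD(3)[OF m2] by fastforce
    then show ?thesis
    proof cases
      case 1
      have n1: "affine_model g1 \<alpha>1 1 b1" and n2: "affine_model g2 \<alpha>1 1 b2" using m1 m2' 1 by auto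
      have "Im b2 \<noteq> Im b1" "Im b2 \<noteq> 0" "Im b1 \<noteq> 0" using ne True 1 n1 n2 by (auto simp: complex_eq_iff affine_model_def)
      from blocks_separate[OF this] obtain H c where H: "2 \<le> H" and c: "0 < c"
        and sep: "\<forall>m\<in>insert 0 (blocks H). \<forall>n\<in>insert 0 (blocks H). c * real (max m n) \<le> \<bar>Im b2 * real m - Im b1 * real n\<bar>" by blast
      have sep': "\<forall>m\<in>insert 0 (blocks H). \<forall>n\<in>insert 0 (blocks H). c * real (max m n) \<le> \<bar>Im b1 * real m - Im b2 * real n\<bar>"
        using sep by (metis abs_minus_commute max.commute)
      show ?thesis
        using rich_blocks[OF H] steers_parabolic_parabolic[OF n1 1(3) n2 1(4) c sep] steers_parabolic_parabolic[OF n2 1(4) n1 1(3) c sep'] by blast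
    next
      case 2
      have "ln \<mu>2 \<noteq> ln \<mu>1" "ln \<mu>2 \<noteq> 0" "ln \<mu>1 \<noteq> 0" using 2 by auto
      from blocks_separate[OF this] obtain H c where H: "2 \<le> H" and c: "0 < c"
        and sep: "\<forall>m\<in>insert 0 (blocks H). \<forall>n\<in>insert 0 (blocks H). c * real (max m n) \<le> \<bar>ln \<mu>2 * real m - ln \<mu>1 * real n\<bar>" by blast
      have sep': "\<forall>m\<in>insert 0 (blocks H). \<forall>n\<in>insert 0 (blocks H). c * real (max m n) \<le> \<bar>ln \<mu>1 * real m - ln \<mu>2 * real n\<bar>"
        using sep by (metis abs_minus_commute max.commute)
      show ?thesis
        using rich_blocks[OF H] steers_hyperbolic_hyperbolic[OF m1 2(1) m2' 2(2) c sep] steers_hyperbolic_hyperbolic[OF m2' 2(2) m1 2(1) c sep'] by blast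
    next
      case 3
      have n1: "affine_model g1 \<alpha>1 1 b1" using m1 3 by simp
      \<comment> \<open>The parabolic map is steered along arbitrary times, so the rich set is the
        one dictated by the hyperbolic map.\<close>
      show ?thesis
        using steers_hyperbolic_parabolic[OF m2' 3(2,4) n1 3(3)] steers_parabolic_hyperbolic[OF n1 3(3) m2' 3(4)] by blast
    next
      case 4
      have n2: "affine_model g2 \<alpha>1 1 b2" using m2' 4 by simp
      show ?thesis
        using steers_hyperbolic_parabolic[OF m1 4(2,4) n2 4(3)] steers_parabolic_hyperbolic[OF n2 4(3) m1 4(4)] by blast
    qed
  qed
  then show ?L
    using hypercyclic_pair_criterion[OF affine_modelD(5,4)[OF m1] affine_modelD(5,4)[OF m2]] by blast
qed

theorem theorem1p2:
  fixes \<phi>1 \<phi>2 :: "complex option \<Rightarrow> complex option" and \<alpha>1 \<alpha>2 :: complex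
  assumes "disc_lft \<phi>1" and "disc_lft \<phi>2"
    and "\<forall>z\<in>unit_disc. \<phi>1 (Some z) \<noteq> Some z"
    and "\<forall>z\<in>unit_disc. \<phi>2 (Some z) \<noteq> Some z"
    and "\<phi>1 \<noteq> \<phi>2"
    and "\<alpha>1 = attractive_fixed_point \<phi>1" and "\<alpha>2 = attractive_fixed_point \<phi>2"
  shows "disjointly_frequently_hypercyclic hardy2_topology
           [composition_operator \<phi>1, composition_operator \<phi>2] \<longleftrightarrow>
         (\<forall>\<phi>\<in>{\<phi>1, \<phi>2}. parabolic \<phi> \<and> disc_automorphism \<phi> \<or> hyperbolic \<phi>) \<and>
         (\<alpha>1 \<noteq> \<alpha>2 \<or>
          \<alpha>1 = \<alpha>2 \<and>
          (hyperbolic \<phi>1 \<and> hyperbolic \<phi>2 \<and>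
             deriv (on_plane \<phi>1) \<alpha>1 \<noteq> deriv (on_plane \<phi>2) \<alpha>1 \<or>
           parabolic \<phi>1 \<and> parabolic \<phi>2 \<or>
           parabolic \<phi>1 \<and> hyperbolic \<phi>2 \<and> \<not> disc_automorphism \<phi>2 \<or>
           parabolic \<phi>2 \<and> hyperbolic \<phi>1 \<and> \<not> disc_automorphism \<phi>1))"
proof -
  obtain \<mu>1 b1 where m1: "affine_model (on_plane \<phi>1) \<alpha>1 \<mu>1 b1" and k1: "parabolic \<phi>1 \<longleftrightarrow> \<mu>1 = 1" "hyperbolic \<phi>1 \<longleftrightarrow> 1 < \<mu>1"
      "disc_automorphism \<phi>1 \<longleftrightarrow> Re b1 = 0" "deriv (on_plane \<phi>1) \<alpha>1 = of_real (1 / \<mu>1)" and f1: "\<phi>1 = affine_moebius \<alpha>1 \<mu>1 b1"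
    using normal_form[OF assms(1,3)] assms(6) by blast
  obtain \<mu>2 b2 where m2: "affine_model (on_plane \<phi>2) \<alpha>2 \<mu>2 b2" and k2: "parabolic \<phi>2 \<longleftrightarrow> \<mu>2 = 1" "hyperbolic \<phi>2 \<longleftrightarrow> 1 < \<mu>2"
      "disc_automorphism \<phi>2 \<longleftrightarrow> Re b2 = 0" "deriv (on_plane \<phi>2) \<alpha>2 = of_real (1 / \<mu>2)" and f2: "\<phi>2 = affine_moebius \<alpha>2 \<mu>2 b2"
    using normal_form[OF assms(2,4)] assms(7) by blast
  \<comment> \<open>\<open>affine_moebius\<close> reconstructs a symbol from its parameters.\<close>
  have "(\<alpha>1, \<mu>1, b1) \<noteq> (\<alpha>2, \<mu>2, b2)" using assms(5) f1 f2 by auto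
  note iff = hypercyclic_pair_affine_models[OF m1 m2 this]
  have d: "deriv (on_plane \<phi>1) \<alpha>1 \<noteq> deriv (on_plane \<phi>2) \<alpha>1 \<longleftrightarrow> \<mu>1 \<noteq> \<mu>2" if "\<alpha>1 = \<alpha>2"
  proof -
    have "deriv (on_plane \<phi>2) \<alpha>1 = of_real (1 / \<mu>2)" using k2(4) that by simp
    then show ?thesis unfolding k1(4) using affine_modelD(2)[OF m1] affine_modelD(2)[OF m2] by (simp only: of_real_eq_iff) auto
  qed
  show ?thesis
    unfolding disjointly_frequently_hypercyclic_iff[OF affine_modelD(5,4)[OF m1] affine_modelD(5,4)[OF m2]] iff
    using affine_modelD(2)[OF m1] affine_modelD(2)[OF m2] d k1(1-3) k2(1-3) by (auto simp: order_le_less)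
qed

end
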